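(* Let $m\geq 2$, $n\geq1$ be integers, let $0<p<\infty$ and $0<p_1,\dots,p_m\leq\infty$ satisfy $1/p=1/p_1+\dots+1/p_m$, and suppose $0<s<mn$. (1) For any $0<r<mn/s$ and $0<q\leq\infty$, there exists a function $\sigma$ on $\mathbb{R}^{mn}$ with $$\sup_{k\in\mathbb{Z}}\big\Vert \sigma(2^k\,\cdot\,)\widehat{\Psi^{(m)}}\big\Vert_{L^{r,q}_s(\mathbb{R}^{mn})}<\infty$$ such that $T_\sigma$ is not bounded from $L^{p_1}(\mathbb{R}^n)\times\cdots\times L^{p_m}(\mathbb{R}^n)$ to $L^p(\mathbb{R}^n)$. (2) For any $q>1$, there exists a function $\sigma$ on $\mathbb{R}^{mn}$ with $$\sup_{k\in\mathbb{Z}}\big\Vert \sigma(2^k\,\cdot\,)\widehat{\Psi^{(m)}}\big\Vert_{L^{mn/s,q}_s(\mathbb{R}^{mn})}<\infty$$ such that $T_\sigma$ is not bounded from $L^{p_1}(\mathbb{R}^n)\times\cdots\times L^{p_m}(\mathbb{R}^n)$ to $L^p(\mathbb{R}^n)$.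
   Context: Fourier transform: $\widehat{f}(\xi)=\int f(x)e^{-2\pi i\langle x,\xi\rangle}dx$, $f^{\vee}(\xi)=\widehat f(-\xi)$. For a bounded function $\sigma$ on $\mathbb{R}^{mn}$, $T_{\sigma}(f_1,\dots,f_m)(x)=\int_{\mathbb{R}^{mn}}\sigma(\xi_1,\dots,\xi_m)\prod_{j=1}^m\widehat{f_j}(\xi_j)\,e^{2\pi i\langle x,\xi_1+\dots+\xi_m\rangle}\,d\xi_1\cdots d\xi_m$ for $f_j\in\mathscr{S}(\mathbb{R}^n)$. $\Psi^{(m)}$ is a fixed Schwartz function on $\mathbb{R}^{mn}$ with $\widehat{\Psi^{(m)}}$ supported in $\{1/2\leq|\vec\xi|\leq 2\}$ and $\sum_{k\in\mathbb{Z}}\widehat{\Psi^{(m)}}(\vec\xi/2^k)=1$ for $\vec\xi\neq0$. For $0<p,q\le\infty$, $\Vert f\Vert_{L^{p,q}}=\big(\int_0^\infty (t^{1/p}f^*(t))^q\,dt/t\big)^{1/q}$ ($\sup_t t^{1/p}f^*(t)$ if $q=\infty$), $f^*$ the decreasing rearrangement. For $s>0$, $\Vert f\Vert_{L^{p,q}_s}=\Vert (I-\Delta)^{s/2}f\Vert_{L^{p,q}}$ with $(I-\Delta)^{s/2}f=((1+4\pi^2|\cdot|^2)^{s/2}\widehat f)^{\vee}$. *)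

theory Defs
  imports "HOL-Analysis.Analysis"
begin

definition fourier :: "('a::euclidean_space \<Rightarrow> complex) \<Rightarrow> 'a \<Rightarrow> complex" where
  "fourier f \<xi> = (\<integral>x. f x * cis (- 2 * pi * (x \<bullet> \<xi>)) \<partial>lborel)"

definition inv_fourier :: "('a::euclidean_space \<Rightarrow> complex) \<Rightarrow> 'a \<Rightarrow> complex" where
  "inv_fourier f \<xi> = fourier f (- \<xi>)"

fun iter_dderiv :: "'a::euclidean_space list \<Rightarrow> ('a \<Rightarrow> complex) \<Rightarrow> 'a \<Rightarrow> complex" where
  "iter_dderiv [] f = f"
| "iter_dderiv (v # vs) f = (\<lambda>x. frechet_derivative (iter_dderiv vs f) (at x) v)"

definition schwartz :: "('a::euclidean_space \<Rightarrow> complex) \<Rightarrow> bool" where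
  "schwartz f \<longleftrightarrow>
     (\<forall>vs. set vs \<subseteq> Basis \<longrightarrow>
        (\<forall>x. iter_dderiv vs f differentiable (at x)) \<and>
        (\<forall>N::nat. \<exists>B. \<forall>x. (1 + norm x) ^ N * norm (iter_dderiv vs f x) \<le> B))"

text \<open>Real power on ennreal (for positive exponents): infinity stays infinity.\<close>
definition epowr :: "ennreal \<Rightarrow> real \<Rightarrow> ennreal" where
  "epowr x a = (if x = top then top else ennreal (enn2real x powr a))"

definition rearr :: "('a::euclidean_space \<Rightarrow> complex) \<Rightarrow> real \<Rightarrow> ennreal" where
  "rearr f t = Inf {ennreal l | l. l \<ge> 0 \<and>
                     emeasure lborel {x. norm (f x) > l} \<le> ennreal t}"

definition lorentz_norm :: "real \<Rightarrow> ennreal \<Rightarrow> ('a::euclidean_space \<Rightarrow> complex) \<Rightarrow> ennreal" where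
  "lorentz_norm p q f =
     (if q = top then (SUP t\<in>{0<..}. ennreal (t powr (1 / p)) * rearr f t)
      else epowr (set_nn_integral lborel {0<..}
                    (\<lambda>t. epowr (ennreal (t powr (1 / p)) * rearr f t) (enn2real q)
                          * ennreal (1 / t)))
                 (1 / enn2real q))"

definition lp_norm :: "ennreal \<Rightarrow> ('a::euclidean_space \<Rightarrow> complex) \<Rightarrow> ennreal" where
  "lp_norm p f =
     (if p = top then Inf {C. AE x in lborel. ennreal (norm (f x)) \<le> C}
      else epowr (\<integral>\<^sup>+ x. ennreal (norm (f x) powr enn2real p) \<partial>lborel) (1 / enn2real p))"

text \<open>Bessel potential (I - Delta)^(s/2) applied to a Schwartz function.\<close>
definition bessel_schwartz :: "real \<Rightarrow> ('a::euclidean_space \<Rightarrow> complex) \<Rightarrow> 'a \<Rightarrow> complex" where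
  "bessel_schwartz s \<phi> =
     inv_fourier (\<lambda>\<xi>. complex_of_real ((1 + 4 * pi\<^sup>2 * (norm \<xi>)\<^sup>2) powr (s / 2)) * fourier \<phi> \<xi>)"

text \<open>h is (a representative of) the tempered distribution (I - Delta)^(s/2) g,
  i.e. h is a measurable function with <h, phi> = <g, (I - Delta)^(s/2) phi>
  for all Schwartz phi.\<close>
definition bessel_rep :: "real \<Rightarrow> ('a::euclidean_space \<Rightarrow> complex) \<Rightarrow> ('a \<Rightarrow> complex) \<Rightarrow> bool" where
  "bessel_rep s g h \<longleftrightarrow>
     h \<in> borel_measurable lborel \<and>
     (\<forall>\<phi>. schwartz \<phi> \<longrightarrow>
        integrable lborel (\<lambda>x. h x * \<phi> x) \<and>
        (\<integral>x. h x * \<phi> x \<partial>lborel) = (\<integral>x. g x * bessel_schwartz s \<phi> x \<partial>lborel))"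

text \<open>Sobolev-Lorentz norm ||g||_{L^{r,q}_s} = ||(I - Delta)^(s/2) g||_{L^{r,q}}
  (infinity if (I - Delta)^(s/2) g is not a function).\<close>
definition sobolev_lorentz_norm ::
  "real \<Rightarrow> real \<Rightarrow> ennreal \<Rightarrow> ('a::euclidean_space \<Rightarrow> complex) \<Rightarrow> ennreal" where
  "sobolev_lorentz_norm s r q g = Inf {lorentz_norm r q h | h. bessel_rep s g h}"

text \<open>The m-linear multiplier operator T_sigma; R^(mn) is modelled as
  real^'n^'m, the j-th block of xi being xi $ j.\<close>
definition mult_op ::
  "((real^'n)^'m \<Rightarrow> complex) \<Rightarrow> ('m::finite \<Rightarrow> real^'n \<Rightarrow> complex) \<Rightarrow> real^'n \<Rightarrow> complex" where
  "mult_op \<sigma> f x =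
     (\<integral>\<xi>. \<sigma> \<xi> * (\<Prod>j\<in>UNIV. fourier (f j) (\<xi> $ j))
            * cis (2 * pi * (x \<bullet> (\<Sum>j\<in>UNIV. \<xi> $ j))) \<partial>lborel)"

definition mult_bounded ::
  "((real^'n)^'m \<Rightarrow> complex) \<Rightarrow> ('m::finite \<Rightarrow> ennreal) \<Rightarrow> ennreal \<Rightarrow> bool" where
  "mult_bounded \<sigma> ps p \<longleftrightarrow>
     (\<exists>C::real. C \<ge> 0 \<and>
        (\<forall>f :: 'm \<Rightarrow> real^'n \<Rightarrow> complex. (\<forall>j. schwartz (f j)) \<longrightarrow>
           lp_norm p (mult_op \<sigma> f) \<le> ennreal C * (\<Prod>j\<in>UNIV. lp_norm (ps j) (f j))))"

end

theory Submission
  imports Defs "HOL-Probability.Characteristic_Functions"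
begin

text \<open>
  The multiplier is built from tiny bumps that prescribe its values at isolated points of the
  annulus near the unit sphere. In dimension $d = mn$ put $B_J(x) = J^{-1} \sum_{j \le J} \eta(2^j x)$.
  Then $B_J(0) = 1$, while $(I - \Delta)^{s/2} B_J$ is bounded by $J^{-1} |x|^{-s}$, cut off at height
  $2^{Js}/J$. So its Lorentz norm is of order $J^{1/q - 1}$ in $L^{d/s,q}$ and of order $J^{-1}$
  in $L^{r,q}$ with $r < d/s$, and tends to $0$ in both cases of the theorem. Hence arbitrary values
  $c_i$ with $|c_i| \le 1$ can be prescribed at a sequence of isolated points at no cost.

  For the lower bound let $K = 2^k$, let $\rho_j$, $\rho'_l$ be the Rudin-Shapiro coefficients of length
  $2K$ and $K$, and let $\tau$ be one of the two Rudin-Shapiro coefficient sequences of length $K$.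
  Prescribe the value $\rho_j \rho'_l \tau_{j+l-K}$ at the point with frequencies $j$ and $l$ in two of
  the $m$ blocks if $K \le j + l < 2K$, and $0$ otherwise. Applied to the two Rudin-Shapiro polynomials,
  which are bounded by a multiple of $K^{1/2}$ each, and flat functions in the other slots, the operator
  produces $K$ times the polynomial with coefficients $\tau$. At every point one of the two choices
  of $\tau$ gives modulus at least $K^{3/2}$. Multiplying by $e^{-\pi \epsilon^2 |x|^2}$ and
  letting $\epsilon \to 0$ turns this into functions in Lebesgue spaces, the powers of $\epsilon$ cancel
  by the Hoelder relation, and the operator norm is at least a multiple of $K^{1/2}$.
\<close>

section \<open>Lebesgue integrals on Euclidean spaces and Gaussians\<close>

text \<open>The threshold \<open>q > 1\<close> comes from counting: after averaging, about J dyadic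
  scales each carry size 1/J in the critical norm, so its q-th power is of order J * J^(-q).
  Positions, separations and radii are fixed before J is chosen, so the i-th bump can be charged a
  budget 2^(-i-1) however small its support must be. One symbol has to defeat every constant C,
  hence the patterns for all k and for both choices of tau are placed in it as separate clusters of
  points. A single polynomial with coefficients of modulus one may be small on a large set, and for
  small p a lower bound in mean square says little; the squares of a Rudin-Shapiro pair add up to
  the constant 2K, so no x is bad for both. The restriction K <= j + l < 2K gives every output
  frequency the same multiplicity K. The inputs enter only through sup bounds against a Gaussian, so
  all exponents in (0, infinity] are handled alike. Beyond its bound 1, the symbol enters only
  through its values and its continuity at the chosen points, because the transform of a wide
  Gaussian wave is a narrow kernel of mass one.\<close>

lemma nn_integral_powr_0:
  assumes "a > 0" "\<tau> \<ge> 0"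
  shows "(\<integral>\<^sup>+t. ennreal (t powr (a - 1)) * indicator {0<..\<tau>} t \<partial>lborel) = ennreal (\<tau> powr a / a)"
proof -
  have "(\<integral>\<^sup>+t. ennreal (t powr (a - 1)) * indicator {0<..\<tau>} t \<partial>lborel)
      = (\<integral>\<^sup>+t. ennreal (t powr (a - 1)) * indicator {0..\<tau>} t \<partial>lborel)"
    by (rule nn_integral_cong) (auto simp: indicator_def)
  also have "\<dots> = ennreal (\<tau> powr (a - 1 + 1) / (a - 1 + 1))"
    using assms by (intro nn_integral_has_integral_lebesgue' has_integral_powr_from_0) auto
  finally show ?thesis by simp
qed

lemma nn_integral_powr_inf:
  assumes "a > 0" "\<tau> > 0"
  shows "(\<integral>\<^sup>+t. ennreal (t powr (- a - 1)) * indicator {\<tau><..} t \<partial>lborel) = ennreal (\<tau> powr (- a) / a)"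
proof -
  have "(\<integral>\<^sup>+t. ennreal (t powr (- a - 1)) * indicator {\<tau><..} t \<partial>lborel)
     = (\<integral>\<^sup>+t. ennreal (t powr (- a - 1)) * indicator {\<tau>..} t \<partial>lborel)"
    by (rule nn_integral_cong_AE, rule AE_mp[OF AE_lborel_singleton[of \<tau>]])
       (auto simp: indicator_def)
  also have "\<dots> = ennreal (- (\<tau> powr (- a - 1 + 1)) / (- a - 1 + 1))"
    using assms by (intro nn_integral_has_integral_lebesgue' has_integral_powr_to_inf) auto
  finally show ?thesis by simp
qed

lemma nn_integral_inverse:
  assumes "\<tau> > 0" "\<tau> \<le> \<tau>'"
  shows "(\<integral>\<^sup>+t. ennreal (1 / t) * indicator {\<tau>..\<tau>'} t \<partial>lborel) = ennreal (ln \<tau>' - ln \<tau>)"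
  using assms
  by (intro nn_integral_FTC_Icc) (auto intro!: derivative_eq_intros simp: has_real_derivative_iff_has_vector_derivative[symmetric])

lemma integrable_lborel_prod:
  fixes f :: "'a::euclidean_space \<Rightarrow> real \<Rightarrow> complex"
  assumes "\<And>b. b \<in> Basis \<Longrightarrow> integrable lborel (f b)"
  shows "integrable lborel (\<lambda>x::'a. \<Prod>b\<in>Basis. f b (x \<bullet> b))"
proof -
  interpret product_sigma_finite "\<lambda>b::'a. lborel :: real measure"
    by standard
  have [measurable]: "\<And>b. b \<in> Basis \<Longrightarrow> f b \<in> borel_measurable borel"
    using assms by auto
  have "integrable (\<Pi>\<^sub>M b\<in>(Basis::'a set). lborel) (\<lambda>x. \<Prod>b\<in>Basis. f b (x b))"
    using assms by (intro product_integrable_prod) auto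
  then have "integrable (\<Pi>\<^sub>M b\<in>(Basis::'a set). lborel)
      (\<lambda>x. \<Prod>b\<in>Basis. f b ((\<Sum>c\<in>Basis. x c *\<^sub>R c) \<bullet> b))"
    by (simp add: inner_sum_left inner_Basis if_distrib cong: if_cong)
  then show ?thesis
    by (subst lborel_eq) (simp add: integrable_distr_eq)
qed

lemma integral_lborel_prod:
  fixes f :: "'a::euclidean_space \<Rightarrow> real \<Rightarrow> complex"
  assumes "\<And>b. b \<in> Basis \<Longrightarrow> integrable lborel (f b)"
  shows "(\<integral>x. (\<Prod>b\<in>Basis. f b ((x::'a) \<bullet> b)) \<partial>lborel) = (\<Prod>b\<in>Basis. integral\<^sup>L lborel (f b))"
proof -
  interpret product_sigma_finite "\<lambda>b::'a. lborel :: real measure"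
    by standard
  have [measurable]: "\<And>b. b \<in> Basis \<Longrightarrow> f b \<in> borel_measurable borel"
    using assms by auto
  have "(\<integral>x. (\<Prod>b\<in>Basis. f b (x \<bullet> b)) \<partial>lborel)
     = (\<integral>x. (\<Prod>b\<in>Basis. f b ((\<Sum>c\<in>Basis. x c *\<^sub>R c) \<bullet> b)) \<partial>(\<Pi>\<^sub>M b\<in>(Basis::'a set). lborel))"
    by (subst lborel_eq) (simp add: integral_distr)
  also have "\<dots> = (\<integral>x. (\<Prod>b\<in>Basis. f b (x b)) \<partial>(\<Pi>\<^sub>M b\<in>(Basis::'a set). lborel))"
    by (simp add: inner_sum_left inner_Basis if_distrib cong: if_cong)
  also have "\<dots> = (\<Prod>b\<in>Basis. integral\<^sup>L lborel (f b))"
    using assms by (intro product_integral_prod) auto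
  finally show ?thesis .
qed

lemma nn_integral_lborel_scale:
  fixes f :: "'a::euclidean_space \<Rightarrow> ennreal"
  assumes [measurable]: "f \<in> borel_measurable borel" and c: "c > 0"
  shows "(\<integral>\<^sup>+x. f (t + c *\<^sub>R x) \<partial>lborel) = ennreal (c powr - real DIM('a)) * (\<integral>\<^sup>+x. f x \<partial>lborel)"
proof -
  have "(\<integral>\<^sup>+x. f x \<partial>lborel) = ennreal (c ^ DIM('a)) * (\<integral>\<^sup>+x. f (t + c *\<^sub>R x) \<partial>lborel)"
    using c by (subst lborel_affine[of c t])
       (simp_all add: nn_integral_density nn_integral_distr nn_integral_cmult)
  moreover have "ennreal (c powr - real DIM('a)) * ennreal (c ^ DIM('a)) = 1"
    using c by (simp add: ennreal_mult[symmetric] powr_minus powr_realpow)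
  ultimately show ?thesis
    by (simp add: mult.assoc[symmetric])
qed

lemma lborel_integral_scale:
  fixes f :: "'a::euclidean_space \<Rightarrow> complex"
  assumes [measurable]: "f \<in> borel_measurable borel" and c: "c > 0"
  shows "(\<integral>x. f (t + c *\<^sub>R x) \<partial>lborel) = of_real (c powr - real DIM('a)) * (\<integral>x. f x \<partial>lborel)"
proof -
  have "(\<integral>x. f x \<partial>lborel) = of_real (c ^ DIM('a)) * (\<integral>x. f (t + c *\<^sub>R x) \<partial>lborel)"
    using c by (subst lborel_affine[of c t])
       (simp_all add: integral_density integral_distr scaleR_conv_of_real)
  moreover have "complex_of_real (c powr - real DIM('a)) * of_real (c ^ DIM('a)) = 1"
    using c by (simp add: of_real_mult[symmetric] powr_minus powr_realpow del: of_real_power of_real_mult)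
  ultimately show ?thesis
    by (simp add: mult.assoc[symmetric])
qed

lemma lborel_integral_translation:
  fixes f :: "'a::euclidean_space \<Rightarrow> complex"
  assumes [measurable]: "f \<in> borel_measurable borel"
  shows "(\<integral>x. f (t + x) \<partial>lborel) = (\<integral>x. f x \<partial>lborel)"
  using lborel_integral_scale[of f 1 t] by simp

lemma nn_integral_lborel_translation:
  fixes f :: "'a::euclidean_space \<Rightarrow> ennreal"
  assumes [measurable]: "f \<in> borel_measurable borel"
  shows "(\<integral>\<^sup>+x. f (t + x) \<partial>lborel) = (\<integral>\<^sup>+x. f x \<partial>lborel)"
  using nn_integral_lborel_scale[of f 1 t] by simp

lemma nn_integral_lborel_reflect:
  fixes f :: "'a::euclidean_space \<Rightarrow> ennreal"
  assumes [measurable]: "f \<in> borel_measurable borel"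
  shows "(\<integral>\<^sup>+x. f (t - x) \<partial>lborel) = (\<integral>\<^sup>+x. f x \<partial>lborel)"
  by (subst (2) lborel_affine[of "-1" t]) (simp_all add: nn_integral_density nn_integral_distr)

text \<open>After rescaling by \<open>c = sqrt (2 * u)\<close> the Gaussian becomes a standard
  normal density, so the formula is the known characteristic function of the normal
  distribution.\<close>

lemma gaussian_fourier_1d:
  fixes u z :: real
  assumes "u > 0"
  shows "integrable lborel (\<lambda>x::real. exp (- u * x\<^sup>2) * cis (2 * pi * z * x))"
    and "(\<integral>x. exp (- u * x\<^sup>2) * cis (2 * pi * z * x) \<partial>lborel)
      = complex_of_real (sqrt (pi / u) * exp (- pi\<^sup>2 * z\<^sup>2 / u))"
proof -
  define c where "c = sqrt (2 * u)"
  define t where "t = 2 * pi * z / c"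
  have c: "c > 0" "c\<^sup>2 = 2 * u" using assms by (auto simp: c_def)
  define F where "F = (\<lambda>y::real. std_normal_density y *\<^sub>R iexp (t * y))"
  have Fint: "integrable lborel F"
  proof -
    interpret prob_space std_normal_distribution by (simp add: prob_space_normal_density)
    have "integrable std_normal_distribution (\<lambda>y. iexp (t * y))"
      by (rule integrable_iexp) auto
    then show ?thesis unfolding F_def
      by (subst (asm) integrable_density) (auto simp: normal_density_nonneg)
  qed
  have "complex_of_real (exp (- (t^2) / 2)) = char std_normal_distribution t"
    by (simp add: char_std_normal_distribution)
  also have "\<dots> = (\<integral>y. F y \<partial>lborel)"
    unfolding char_def F_def by (subst integral_density) (auto simp: normal_density_nonneg)
  finally have FI: "(\<integral>y. F y \<partial>lborel) = complex_of_real (exp (- (t^2) / 2))" ..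
  have FG: "complex_of_real (sqrt (2 * pi)) * F (0 + c *\<^sub>R x) = exp (- u * x\<^sup>2) * cis (2 * pi * z * x)" for x
  proof -
    have 1: "sqrt (2 * pi) * std_normal_density (c * x) = exp (- u * x\<^sup>2)"
      using c by (simp add: std_normal_density_def power_mult_distrib)
    have 2: "iexp (t * (c * x)) = cis (2 * pi * z * x)"
      using c by (simp add: t_def cis_conv_exp field_simps)
    have "complex_of_real (sqrt (2 * pi)) * F (0 + c *\<^sub>R x)
       = complex_of_real (sqrt (2 * pi) * std_normal_density (c * x)) * iexp (t * (c * x))"
      by (simp add: F_def scaleR_conv_of_real)
    then show ?thesis unfolding 1 2 .
  qed
  have [measurable]: "F \<in> borel_measurable borel" using Fint by auto
  have "integrable lborel (\<lambda>x. F (0 + c *\<^sub>R x))"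
    using lborel_integrable_real_affine[OF Fint, of c 0] c by simp
  from integrable_mult_right[OF this, of "complex_of_real (sqrt (2 * pi))"]
  show "integrable lborel (\<lambda>x::real. exp (- u * x\<^sup>2) * cis (2 * pi * z * x))"
    unfolding FG .
  have "(\<integral>x. exp (- u * x\<^sup>2) * cis (2 * pi * z * x) \<partial>lborel)
     = complex_of_real (sqrt (2 * pi)) * (\<integral>x. F (0 + c *\<^sub>R x) \<partial>lborel)"
    unfolding FG[symmetric] by simp
  also have "\<dots> = complex_of_real (sqrt (2 * pi) * (c powr - 1) * exp (- (t^2) / 2))"
    using lborel_integral_scale[of F c 0] c FI by simp
  also have "sqrt (2 * pi) * (c powr - 1) = sqrt (pi / u)"
    using assms by (simp add: powr_minus c_def real_sqrt_divide real_sqrt_mult field_simps)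
  also have "- (t^2) / 2 = - pi\<^sup>2 * z\<^sup>2 / u"
    using c assms by (simp add: t_def power_divide power_mult_distrib)
  finally show "(\<integral>x. exp (- u * x\<^sup>2) * cis (2 * pi * z * x) \<partial>lborel)
      = complex_of_real (sqrt (pi / u) * exp (- pi\<^sup>2 * z\<^sup>2 / u))" .
qed

lemma cis_sum: "finite A \<Longrightarrow> cis (\<Sum>i\<in>A. f i) = (\<Prod>i\<in>A. cis (f i))"
  by (induction A rule: finite_induct) (auto simp: cis_mult[symmetric])

lemma norm_sq_Basis: "(norm (x::'a::euclidean_space))\<^sup>2 = (\<Sum>b\<in>Basis. (x \<bullet> b)\<^sup>2)"
  by (subst power2_norm_eq_inner, subst euclidean_inner) (simp add: power2_eq_square)

lemma gaussian_fourier: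
  fixes z :: "'a::euclidean_space"
  assumes "u > 0"
  shows "integrable lborel (\<lambda>x::'a. exp (- u * (norm x)\<^sup>2) * cis (2 * pi * (z \<bullet> x)))"
    and "(\<integral>x. exp (- u * (norm x)\<^sup>2) * cis (2 * pi * (z \<bullet> x)) \<partial>lborel)
      = complex_of_real ((pi / u) powr (DIM('a) / 2) * exp (- pi\<^sup>2 * (norm z)\<^sup>2 / u))"
proof -
  have eq: "exp (- u * (norm x)\<^sup>2) * cis (2 * pi * (z \<bullet> x))
    = (\<Prod>b\<in>Basis. exp (- u * (x \<bullet> b)\<^sup>2) * cis (2 * pi * (z \<bullet> b) * (x \<bullet> b)))" for x :: 'a
  proof -
    have "complex_of_real (exp (- u * (norm x)\<^sup>2)) = of_real (\<Prod>b\<in>Basis. exp (- u * (x \<bullet> b)\<^sup>2))"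
      by (subst exp_sum[symmetric]) (auto simp: norm_sq_Basis sum_distrib_left)
    moreover have "cis (2 * pi * (z \<bullet> x)) = (\<Prod>b\<in>Basis. cis (2 * pi * (z \<bullet> b) * (x \<bullet> b)))"
      by (subst cis_sum[symmetric]) (auto simp: euclidean_inner[of z x] sum_distrib_left mult_ac)
    ultimately show ?thesis by (simp add: prod.distrib)
  qed
  show "integrable lborel (\<lambda>x::'a. exp (- u * (norm x)\<^sup>2) * cis (2 * pi * (z \<bullet> x)))"
    unfolding eq by (rule integrable_lborel_prod) (rule gaussian_fourier_1d[OF assms])
  have "(\<integral>x. exp (- u * (norm x)\<^sup>2) * cis (2 * pi * (z \<bullet> x)) \<partial>lborel)
     = (\<Prod>b\<in>(Basis::'a set). complex_of_real (sqrt (pi / u) * exp (- pi\<^sup>2 * (z \<bullet> b)\<^sup>2 / u)))"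
    unfolding eq
    by (subst integral_lborel_prod[of "\<lambda>b x. exp (- u * x\<^sup>2) * cis (2 * pi * (z \<bullet> b) * x)"])
       (use gaussian_fourier_1d[OF assms] in auto)
  also have "\<dots> = complex_of_real (sqrt (pi / u) ^ DIM('a) * exp (- pi\<^sup>2 * (norm z)\<^sup>2 / u))"
    by (simp add: prod.distrib norm_sq_Basis exp_sum sum_distrib_left sum_divide_distrib sum_negf
        flip: of_real_prod exp_sum)
  also have "sqrt (pi / u) ^ DIM('a) = (pi / u) powr (DIM('a) / 2)"
    using assms by (simp add: powr_half_sqrt[symmetric] powr_powr flip: powr_realpow)
  finally show "(\<integral>x. exp (- u * (norm x)\<^sup>2) * cis (2 * pi * (z \<bullet> x)) \<partial>lborel)
      = complex_of_real ((pi / u) powr (DIM('a) / 2) * exp (- pi\<^sup>2 * (norm z)\<^sup>2 / u))" .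
qed

lemma integrable_gaussian:
  assumes "u > 0"
  shows "integrable lborel (\<lambda>x::'a::euclidean_space. exp (- u * (norm x)\<^sup>2))"
    and "(\<integral>x. exp (- u * (norm (x::'a))\<^sup>2) \<partial>lborel) = (pi / u) powr (DIM('a) / 2)"
proof -
  have "integrable lborel (\<lambda>x::'a. complex_of_real (exp (- u * (norm x)\<^sup>2)))"
    using gaussian_fourier(1)[OF assms, of "0::'a"] by simp
  then show 1: "integrable lborel (\<lambda>x::'a. exp (- u * (norm x)\<^sup>2))"
    by (simp only: complex_of_real_integrable_eq)
  have "complex_of_real (\<integral>x. exp (- u * (norm (x::'a))\<^sup>2) \<partial>lborel) = complex_of_real ((pi / u) powr (DIM('a) / 2))"
    using gaussian_fourier(2)[OF assms, of "0::'a"] by (simp flip: integral_complex_of_real)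
  then show "(\<integral>x. exp (- u * (norm (x::'a))\<^sup>2) \<partial>lborel) = (pi / u) powr (DIM('a) / 2)"
    using of_real_eq_iff by blast
qed

section \<open>Bump functions with integrable weighted Fourier transform\<close>

lemma nn_integral_even:
  fixes f :: "real \<Rightarrow> ennreal"
  assumes [measurable]: "f \<in> borel_measurable borel"
  shows "(\<integral>\<^sup>+z. f \<bar>z\<bar> \<partial>lborel) = 2 * (\<integral>\<^sup>+z. f z * indicator {0<..} z \<partial>lborel)"
proof -
  have "(\<integral>\<^sup>+z. f \<bar>z\<bar> \<partial>lborel)
      = (\<integral>\<^sup>+z. f z * indicator {0<..} z + f (0 - z) * indicator {0<..} (0 - z) \<partial>lborel)"
    by (rule nn_integral_cong_AE, rule AE_mp[OF AE_lborel_singleton[of 0]])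
       (auto simp: indicator_def abs_if)
  also have "\<dots> = (\<integral>\<^sup>+z. f z * indicator {0<..} z \<partial>lborel) + (\<integral>\<^sup>+z. f (0 - z) * indicator {0<..} (0 - z) \<partial>lborel)"
    by (rule nn_integral_add) measurable
  also have "(\<integral>\<^sup>+z. f (0 - z) * indicator {0<..} (0 - z) \<partial>lborel) = (\<integral>\<^sup>+z. f z * indicator {0<..} z \<partial>lborel)"
    by (rule nn_integral_lborel_reflect) measurable
  finally show ?thesis by (simp add: mult_2)
qed

lemma nn_integral_min_powr_finite:
  assumes "\<alpha> < 1" "1 < \<beta>"
  shows "(\<integral>\<^sup>+z. ennreal (min (\<bar>z\<bar> powr - \<alpha>) (\<bar>z\<bar> powr - \<beta>)) \<partial>(lborel :: real measure)) < \<infinity>"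
proof -
  let ?f = "\<lambda>z. ennreal (min (z powr - \<alpha>) (z powr - \<beta>))"
  have "(\<integral>\<^sup>+z. ?f z * indicator {0<..} z \<partial>lborel)
     \<le> (\<integral>\<^sup>+z. ennreal (z powr (1 - \<alpha> - 1)) * indicator {0<..1} z
           + ennreal (z powr (- (\<beta> - 1) - 1)) * indicator {1<..} z \<partial>lborel)"
    by (rule nn_integral_mono) (auto simp: indicator_def intro!: ennreal_leI)
  also have "\<dots> = ennreal (1 powr (1 - \<alpha>) / (1 - \<alpha>)) + ennreal (1 powr - (\<beta> - 1) / (\<beta> - 1))"
    using assms by (subst nn_integral_add) (simp_all only: nn_integral_powr_0 nn_integral_powr_inf, auto)
  also have "\<dots> < \<infinity>" by simp
  finally have "(\<integral>\<^sup>+z. ?f z * indicator {0<..} z \<partial>lborel) < \<infinity>" .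
  moreover have "(\<integral>\<^sup>+z. ?f \<bar>z\<bar> \<partial>lborel) = 2 * (\<integral>\<^sup>+z. ?f z * indicator {0<..} z \<partial>lborel)"
    by (rule nn_integral_even) measurable
  ultimately show ?thesis by (simp add: ennreal_mult_less_top)
qed

text \<open>A radially decreasing function of the form $\psi(|x|)^d$ is at most the product of the
  $\psi(|x_i|)$, which reduces integrability to one dimension.\<close>

lemma nn_integral_min_norm_powr_finite:
  fixes s M :: real
  assumes "0 \<le> s" "s < DIM('a::euclidean_space)" "DIM('a) < M"
  shows "(\<integral>\<^sup>+x. ennreal (min (norm x powr - s) (norm x powr - M)) \<partial>(lborel :: 'a measure)) < \<infinity>"
proof -
  define d where "d = real DIM('a)"
  define \<psi> where "\<psi> = (\<lambda>z::real. min (\<bar>z\<bar> powr - (s / d)) (\<bar>z\<bar> powr - (M / d)))"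
  \<comment> \<open>In HOL \<open>0 powr a = 0\<close>, so \<open>\<psi>\<close> vanishes at 0,
    where the radial majorant should be infinite; \<open>\<psi>'\<close> restores that value and
    differs from \<open>\<psi>\<close> only on a null set.\<close>
  define \<psi>' where "\<psi>' = (\<lambda>z. if z = 0 then top else ennreal (\<psi> z))"
  have d: "d > 0" "DIM('a) = d" by (auto simp: d_def)
  have [measurable]: "\<psi> \<in> borel_measurable borel" "\<psi>' \<in> borel_measurable borel"
    unfolding \<psi>_def \<psi>'_def by measurable
  have le: "ennreal (min (norm x powr - s) (norm x powr - M)) \<le> (\<Prod>b\<in>Basis. \<psi>' (x \<bullet> b))" for x :: 'a
  proof -
    have "min (norm x powr - s) (norm x powr - M) \<le> (\<Prod>b\<in>(Basis::'a set). \<psi> (norm x))"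
    proof (cases "x = 0")
      case False
      have "(norm x powr - (r / d)) ^ DIM('a) = norm x powr - r" for r
        using d False by (simp add: powr_realpow[symmetric] powr_powr)
      then show ?thesis by (auto simp: \<psi>_def min_def)
    qed (simp add: \<psi>_def)
    then have "ennreal (min (norm x powr - s) (norm x powr - M)) \<le> ennreal (\<Prod>b\<in>(Basis::'a set). \<psi> (norm x))"
      by (rule ennreal_leI)
    also have "\<dots> = (\<Prod>b\<in>(Basis::'a set). ennreal (\<psi> (norm x)))"
      by (intro prod_ennreal[symmetric]) (auto simp: \<psi>_def)
    also have "\<dots> \<le> (\<Prod>b\<in>Basis. \<psi>' (x \<bullet> b))"
    proof (rule prod_mono_ennreal)
      fix b :: 'a assume b: "b \<in> Basis"
      have "\<psi> (norm x) \<le> \<psi> (x \<bullet> b)" if "x \<bullet> b \<noteq> 0"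
        unfolding \<psi>_def using that assms d Basis_le_norm[OF b, of x]
        by (intro min.mono powr_mono2') auto
      then show "ennreal (\<psi> (norm x)) \<le> \<psi>' (x \<bullet> b)"
        by (auto simp: \<psi>'_def intro: ennreal_leI)
    qed
    finally show ?thesis .
  qed
  have fin: "(\<integral>\<^sup>+z. \<psi>' z \<partial>lborel) < \<infinity>"
  proof -
    have "(\<integral>\<^sup>+z. \<psi>' z \<partial>lborel) = (\<integral>\<^sup>+z. ennreal (\<psi> z) \<partial>lborel)"
      by (rule nn_integral_cong_AE, rule AE_mp[OF AE_lborel_singleton[of 0]]) (auto simp: \<psi>'_def)
    also have "\<dots> < \<infinity>" unfolding \<psi>_def using assms d
      by (intro nn_integral_min_powr_finite) (auto simp: field_simps)
    finally show ?thesis .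
  qed
  have "(\<integral>\<^sup>+x. ennreal (min (norm x powr - s) (norm x powr - M)) \<partial>(lborel :: 'a measure))
     \<le> (\<integral>\<^sup>+x. (\<Prod>b\<in>Basis. \<psi>' ((x::'a) \<bullet> b)) \<partial>lborel)"
    by (rule nn_integral_mono) (rule le)
  also have "\<dots> = (\<Prod>b\<in>(Basis::'a set). \<integral>\<^sup>+z. \<psi>' z \<partial>lborel)"
    by (rule nn_integral_lborel_prod) auto
  also have "\<dots> < \<infinity>"
    using fin by (simp add: power_less_top_ennreal)
  finally show ?thesis .
qed

lemma integrable_decay:
  fixes f :: "'a::euclidean_space \<Rightarrow> complex" and M :: real
  assumes [measurable]: "f \<in> borel_measurable borel"
    and M: "DIM('a) < M"
    and f: "\<And>x. x \<noteq> 0 \<Longrightarrow> norm (f x) \<le> C * min 1 (norm x powr - M)"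
  shows "integrable lborel f"
proof (rule integrableI_bounded)
  have C: "C \<ge> 0"
  proof -
    obtain i :: 'a where i: "i \<in> Basis" using nonempty_Basis by blast
    then have "norm (f i) \<le> C" using f[of i] nonzero_Basis[OF i] by auto
    then show ?thesis by (rule order_trans[OF norm_ge_zero])
  qed
  have "(\<integral>\<^sup>+x. ennreal (norm (f x)) \<partial>lborel)
     \<le> (\<integral>\<^sup>+x. ennreal C * ennreal (min (norm (x::'a) powr - 0) (norm x powr - M)) \<partial>lborel)"
    by (rule nn_integral_mono_AE, rule AE_mp[OF AE_lborel_singleton[of 0]])
       (use f in \<open>auto simp: ennreal_mult'[symmetric] C intro!: ennreal_leI\<close>)
  also have "\<dots> = ennreal C * (\<integral>\<^sup>+x. ennreal (min (norm (x::'a) powr - 0) (norm x powr - M)) \<partial>lborel)"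
    by (rule nn_integral_cmult) measurable
  also have "\<dots> < \<infinity>"
    using nn_integral_min_norm_powr_finite[of 0 M, where 'a='a] M by (simp add: ennreal_mult_less_top)
  finally show "(\<integral>\<^sup>+x. ennreal (norm (f x)) \<partial>lborel) < \<infinity>" .
qed simp

text \<open>The Fourier symbol of I - Delta in the normalisation of \<open>fourier\<close>;
  \<open>lam \<xi> powr (s / 2)\<close> is the weight in \<open>bessel_schwartz\<close>.\<close>

definition lam :: "'a::euclidean_space \<Rightarrow> real" where
  "lam x = 1 + 4 * pi\<^sup>2 * (norm x)\<^sup>2"

lemma lam_ge_1: "lam x \<ge> 1" and lam_pos: "lam x > 0"
  by (auto simp: lam_def intro: add_pos_nonneg)

lemma borel_measurable_lam [measurable]: "lam \<in> borel_measurable borel"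
  unfolding lam_def by measurable

text \<open>A Peetre-type inequality: the weight is submultiplicative up to a factor 2, so a
  weighted L^1 norm of a convolution is controlled by the weighted L^1 norms of its factors.\<close>

lemma lam_add: "lam (x + y) \<le> 2 * lam x * lam y"
proof -
  have "(norm (x + y))\<^sup>2 \<le> (norm x + norm y)\<^sup>2"
    by (rule power_mono) (auto simp: norm_triangle_ineq)
  also have "\<dots> \<le> 2 * (norm x)\<^sup>2 + 2 * (norm y)\<^sup>2"
    using zero_le_power2[of "norm x - norm y"] by (simp add: power2_eq_square algebra_simps)
  finally have "4 * pi\<^sup>2 * (norm (x + y))\<^sup>2 \<le> 4 * pi\<^sup>2 * (2 * (norm x)\<^sup>2 + 2 * (norm y)\<^sup>2)"
    by (rule mult_left_mono) auto
  moreover have "0 \<le> (4 * pi\<^sup>2 * (norm x)\<^sup>2) * (4 * pi\<^sup>2 * (norm y)\<^sup>2)" by simp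
  moreover have "2 * lam x * lam y = 2 + 4 * pi\<^sup>2 * (2 * (norm x)\<^sup>2 + 2 * (norm y)\<^sup>2)
      + 2 * ((4 * pi\<^sup>2 * (norm x)\<^sup>2) * (4 * pi\<^sup>2 * (norm y)\<^sup>2))"
    unfolding lam_def by algebra
  ultimately show ?thesis unfolding lam_def[of "x + y"]
    by linarith
qed

lemma one_plus_sum_le_prod:
  fixes a :: "'i \<Rightarrow> real"
  assumes "finite A" "\<And>i. i \<in> A \<Longrightarrow> a i \<ge> 0"
  shows "1 + (\<Sum>i\<in>A. a i) \<le> (\<Prod>i\<in>A. 1 + a i)"
  using assms
proof (induction A rule: finite_induct)
  case (insert i A)
  have "1 + (a i + (\<Sum>i\<in>A. a i)) \<le> (1 + a i) * (1 + (\<Sum>i\<in>A. a i))"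
    using insert.prems by (simp add: algebra_simps sum_nonneg)
  also have "\<dots> \<le> (1 + a i) * (\<Prod>i\<in>A. 1 + a i)"
    using insert by (intro mult_left_mono) auto
  finally show ?case using insert by simp
qed simp

text \<open>Domination by a product over the coordinates reduces weighted integrals of tensor
  products to dimension one.\<close>

lemma lam_le_prod: "lam (x::'a::euclidean_space) \<le> (\<Prod>b\<in>Basis. lam (x \<bullet> b))"
  using one_plus_sum_le_prod[of "Basis::'a set" "\<lambda>b. 4 * pi\<^sup>2 * (x \<bullet> b)\<^sup>2"]
  by (simp add: lam_def norm_sq_Basis sum_distrib_left)

text \<open>Repeated integration by parts on [-1, 1]. The factor (1 - x^2)^N kills the boundary
  terms, and differentiating it leaves (1 - x^2)^(N-1) times another polynomial; hence the induction
  over N for all \<open>p\<close> at once.\<close>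

lemma poly_fourier_decay:
  fixes p :: "real poly"
  shows "\<exists>C. \<forall>\<xi>. \<bar>\<xi>\<bar> ^ N * norm (\<integral>x. indicator {-1..1} x *\<^sub>R
      (of_real (poly ([:1,0,-1:] ^ N * p) x) * cis (2 * pi * \<xi> * x)) \<partial>lborel) \<le> C"
proof (induction N arbitrary: p)
  case 0
  have "norm (\<integral>x. indicator {-1..1} x *\<^sub>R (complex_of_real (poly p x) * cis (2 * pi * \<xi> * x)) \<partial>lborel)
      \<le> (\<integral>x. norm (indicator {-1..1} x *\<^sub>R (complex_of_real (poly p x) * cis (2 * pi * \<xi> * x))) \<partial>lborel)" for \<xi>
    by (rule integral_norm_bound)
  then show ?case by (simp add: norm_mult) blast
next
  case (Suc N)
  define q where "q = [:1,0,-1:] ^ Suc N * p"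
  \<comment> \<open>\<open>[:1,0,-1:]\<close> is the polynomial 1 - x^2; \<open>r\<close> is what
    remains of the derivative of \<open>q\<close> once N factors 1 - x^2 are split off.\<close>
  define r where "r = smult (real (Suc N)) [:0,-2:] * p + [:1,0,-1:] * pderiv p"
  have q': "pderiv q = [:1,0,-1:] ^ N * r"
    unfolding q_def r_def by (simp add: pderiv_mult pderiv_power_Suc pderiv_pCons algebra_simps del: power_Suc mult_smult_left mult_pCons_left)
       (simp add: algebra_simps flip: smult_add_left)
  obtain C where C: "\<And>\<xi>. \<bar>\<xi>\<bar> ^ N * norm (\<integral>x. indicator {-1..1} x *\<^sub>R
      (of_real (poly (pderiv q) x) * cis (2 * pi * \<xi> * x)) \<partial>lborel) \<le> C"
    using Suc[of r] unfolding q' by blast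
  have "\<bar>\<xi>\<bar> ^ Suc N * norm (\<integral>x. indicator {-1..1} x *\<^sub>R
      (of_real (poly q x) * cis (2 * pi * \<xi> * x)) \<partial>lborel) \<le> C" for \<xi>
  proof -
    define A where "A = (\<integral>x. indicator {-1..1::real} x *\<^sub>R (of_real (poly q x) * cis (2 * pi * \<xi> * x)) \<partial>lborel)"
    define B where "B = (\<integral>x. indicator {-1..1::real} x *\<^sub>R (of_real (poly (pderiv q) x) * cis (2 * pi * \<xi> * x)) \<partial>lborel)"
    let ?F = "\<lambda>x. of_real (poly q x) * cis (2 * pi * \<xi> * x)"
    let ?f = "\<lambda>x. of_real (poly (pderiv q) x) * cis (2 * pi * \<xi> * x)
            + (of_real (poly q x) * cis (2 * pi * \<xi> * x)) * (\<i> * of_real (2 * pi * \<xi>))"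
    have "(\<integral>x. indicator {-1..1::real} x *\<^sub>R ?f x \<partial>lborel) = ?F 1 - ?F (- 1)"
    proof (rule integral_FTC_Icc)
      fix x :: real
      have "((\<lambda>x. of_real (poly q x)) has_vector_derivative complex_of_real (poly (pderiv q) x)) (at x within {-1..1})"
        by (rule has_vector_derivative_of_real) (auto intro: DERIV_subset poly_DERIV)
      moreover have "((\<lambda>x. cis (2 * pi * \<xi> * x)) has_vector_derivative
          cis (2 * pi * \<xi> * x) * (\<i> * of_real (2 * pi * \<xi>))) (at x within {-1..1})"
      proof -
        have "((\<lambda>x. cis (2 * pi * \<xi> * x)) has_vector_derivative
          (2 * pi * \<xi>) *\<^sub>R (\<i> * cis (2 * pi * \<xi> * x))) (at x within {-1..1})"
          by (rule vector_diff_chain_within[where f="\<lambda>x. 2 * pi * \<xi> * x" and g=cis, unfolded o_def])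
             (auto intro!: derivative_eq_intros has_vector_derivative_at_within simp: has_vector_derivative_def has_derivative_cis)
        then show ?thesis by (simp add: scaleR_conv_of_real mult_ac)
      qed
      ultimately show "(?F has_vector_derivative ?f x) (at x within {-1..1})"
        by (auto intro!: derivative_eq_intros simp: algebra_simps)
    qed (auto intro!: continuous_intros)
    also have "?F 1 - ?F (- 1) = 0" by (simp add: q_def)
    also have "(\<integral>x. indicator {-1..1::real} x *\<^sub>R ?f x \<partial>lborel) = B + A * (\<i> * of_real (2 * pi * \<xi>))"
    proof -
      have i1: "integrable lborel (\<lambda>x. indicator {-1..1::real} x *\<^sub>R (complex_of_real (poly (pderiv q) x) * cis (2 * pi * \<xi> * x)))"
        and i2: "integrable lborel (\<lambda>x. indicator {-1..1::real} x *\<^sub>R (complex_of_real (poly q x) * cis (2 * pi * \<xi> * x)))"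
        by (intro borel_integrable_compact continuous_intros; simp)+
      show ?thesis
        using Bochner_Integration.integral_add[OF i1 integrable_mult_left[OF i2, of "\<i> * of_real (2 * pi * \<xi>)"]]
        by (simp add: A_def B_def scaleR_add_right flip: integral_mult_left_zero)
    qed
    finally have "norm B = norm (A * (\<i> * of_real (2 * pi * \<xi>)))"
      by (metis add_eq_0_iff norm_minus_cancel)
    then have "norm B = norm A * (2 * pi * \<bar>\<xi>\<bar>)"
      by (simp add: norm_mult abs_mult)
    then have "\<bar>\<xi>\<bar> * norm A \<le> norm B"
      using pi_ge_two mult_right_mono[of 1 "2 * pi" "\<bar>\<xi>\<bar> * norm A"] by (simp add: algebra_simps)
    then have "\<bar>\<xi>\<bar> ^ N * (\<bar>\<xi>\<bar> * norm A) \<le> \<bar>\<xi>\<bar> ^ N * norm B"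
      by (rule mult_left_mono) simp
    also have "\<dots> \<le> C" using C[of \<xi>] by (simp add: B_def)
    finally show ?thesis by (simp add: A_def mult_ac)
  qed
  then show ?case unfolding q_def by blast
qed

text \<open>A bump of finite smoothness that is polynomial on its support, so integration by parts
  stays among polynomials. Its transform decays to order N, and N can be taken large in terms of
  s.\<close>

definition bump1 :: "nat \<Rightarrow> real \<Rightarrow> real" where
  "bump1 N x = (max 0 (1 - x\<^sup>2)) ^ N"

lemma continuous_on_bump1: "continuous_on A (bump1 N)"
  unfolding bump1_def by (intro continuous_intros)

lemma borel_measurable_bump1 [measurable]: "bump1 N \<in> borel_measurable borel"
  by (intro borel_measurable_continuous_onI continuous_on_bump1)

lemma bump1_0 [simp]: "bump1 N 0 = 1"
  by (simp add: bump1_def)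

lemma bump1_nonneg: "0 \<le> bump1 N x" and bump1_le_1: "bump1 N x \<le> 1"
  by (auto simp: bump1_def intro!: power_le_one)

lemma bump1_eq_0: "N > 0 \<Longrightarrow> \<bar>x\<bar> \<ge> 1 \<Longrightarrow> bump1 N x = 0"
proof -
  assume "N > 0" "\<bar>x\<bar> \<ge> 1"
  then have "1 \<le> x\<^sup>2" by (metis one_le_power power2_abs)
  with \<open>N > 0\<close> show ?thesis by (simp add: bump1_def)
qed

lemma bump1_eq: "N > 0 \<Longrightarrow> bump1 N x = indicator {-1..1} x * poly ([:1,0,-1:] ^ N) x"
proof (cases "\<bar>x\<bar> \<le> 1")
  case True
  then have "x\<^sup>2 \<le> 1" by (metis abs_square_le_1)
  with True show ?thesis by (auto simp: bump1_def indicator_def power2_eq_square)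
qed (auto simp: bump1_eq_0 indicator_def)

lemma integrable_bump1: "N > 0 \<Longrightarrow> integrable lborel (\<lambda>x. of_real (bump1 N x) * cis (2 * pi * \<xi> * x))"
proof -
  assume N: "N > 0"
  have "integrable lborel (\<lambda>x. indicator {-1..1::real} x *\<^sub>R (of_real (poly ([:1,0,-1:] ^ N) x) * cis (2 * pi * \<xi> * x)))"
    by (intro borel_integrable_compact continuous_intros) auto
  then show ?thesis by (simp add: bump1_eq[OF N] scaleR_conv_of_real mult_ac)
qed

lemma bump1_fourier_decay:
  assumes N: "N > 0"
  shows "\<exists>C. \<forall>\<xi>. norm (\<integral>x. of_real (bump1 N x) * cis (2 * pi * \<xi> * x) \<partial>lborel) \<le> C
    \<and> \<bar>\<xi>\<bar> ^ N * norm (\<integral>x. of_real (bump1 N x) * cis (2 * pi * \<xi> * x) \<partial>lborel) \<le> C"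
proof -
  have eq: "(\<integral>x. of_real (bump1 N x) * cis (2 * pi * \<xi> * x) \<partial>lborel)
      = (\<integral>x. indicator {-1..1} x *\<^sub>R (of_real (poly ([:1,0,-1:] ^ N * 1) x) * cis (2 * pi * \<xi> * x)) \<partial>lborel)" for \<xi>
    by (simp add: bump1_eq[OF N] scaleR_conv_of_real mult_ac)
  obtain C where C: "\<And>\<xi>. \<bar>\<xi>\<bar> ^ N * norm (\<integral>x. of_real (bump1 N x) * cis (2 * pi * \<xi> * x) \<partial>lborel) \<le> C"
    unfolding eq using poly_fourier_decay[of N 1] by blast
  define C' where "C' = (\<integral>x. norm (complex_of_real (bump1 N x)) \<partial>lborel)"
  have C': "norm (\<integral>x. of_real (bump1 N x) * cis (2 * pi * \<xi> * x) \<partial>lborel) \<le> C'" for \<xi>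
    using integral_norm_bound[of lborel "\<lambda>x. of_real (bump1 N x) * cis (2 * pi * \<xi> * x)"]
    by (simp add: C'_def norm_mult)
  show ?thesis
    by (intro exI[of _ "max C C'"] allI conjI max.coboundedI1 max.coboundedI2 C C')
qed

definition bumpd :: "nat \<Rightarrow> 'a::euclidean_space \<Rightarrow> real" where
  "bumpd N x = (\<Prod>b\<in>Basis. bump1 N (x \<bullet> b))"

lemma borel_measurable_bumpd [measurable]: "bumpd N \<in> borel_measurable borel"
  unfolding bumpd_def by measurable

lemma continuous_on_bumpd: "continuous_on A (bumpd N)"
  unfolding bumpd_def by (intro continuous_intros continuous_on_compose2[OF continuous_on_bump1]) auto

lemma bumpd_0 [simp]: "bumpd N 0 = 1"
  by (simp add: bumpd_def)

lemma bumpd_nonneg: "0 \<le> bumpd N x" and bumpd_le_1: "bumpd N x \<le> 1"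
  by (auto simp: bumpd_def bump1_nonneg bump1_le_1 intro!: prod_nonneg prod_le_1)

text \<open>The support lies in the cube [-1, 1]^d, which the comparison with the l^1 norm puts into
  the ball of radius d.\<close>

lemma bumpd_eq_0:
  assumes "N > 0" "norm (x::'a::euclidean_space) > DIM('a)"
  shows "bumpd N x = 0"
proof (rule ccontr)
  assume "bumpd N x \<noteq> 0"
  then have "\<bar>x \<bullet> b\<bar> \<le> 1" if "b \<in> Basis" for b
    using that bump1_eq_0[OF assms(1), of "x \<bullet> b"] by (force simp: bumpd_def)
  then have "(\<Sum>b\<in>Basis. \<bar>x \<bullet> b\<bar>) \<le> (\<Sum>b\<in>(Basis::'a set). 1)"
    by (intro sum_mono)
  with norm_le_l1[of x] assms(2) show False by simp
qed

text \<open>With N >= s + 2 the decay |z|^(-s-2) absorbs the growth |z|^s of the weight and leaves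
  |z|^(-2), integrable at infinity.\<close>

lemma bump1_fourier_weighted:
  assumes s: "s \<ge> 0" and N: "real N \<ge> s + 2"
  shows "(\<integral>\<^sup>+z. ennreal (lam z powr (s / 2) * norm (\<integral>x. of_real (bump1 N x) * cis (2 * pi * z * x) \<partial>lborel)) \<partial>(lborel::real measure)) < \<infinity>"
proof -
  define F where "F = (\<lambda>z. norm (\<integral>x. of_real (bump1 N x) * cis (2 * pi * z * x) \<partial>lborel))"
  have N0: "N > 0" using s N by (cases N) auto
  obtain C where C: "\<And>z. F z \<le> C" "\<And>z. \<bar>z\<bar> ^ N * F z \<le> C"
    using bump1_fourier_decay[OF N0] unfolding F_def by blast
  have F0: "F z \<ge> 0" for z by (simp add: F_def)
  have C0: "C \<ge> 0" using F0 C(1) by (rule order_trans)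
  define K where "K = (1 + 4 * pi\<^sup>2) powr (s / 2) * C"
  have K: "K \<ge> 0" using C0 by (simp add: K_def)
  have le: "lam z powr (s / 2) * F z \<le> K * min (\<bar>z\<bar> powr - 0) (\<bar>z\<bar> powr - 2)" if "z \<noteq> 0" for z :: real
  proof (cases "\<bar>z\<bar> \<le> 1")
    case True
    then have "z\<^sup>2 \<le> 1" by (metis abs_square_le_1)
    then have "lam z \<le> 1 + 4 * pi\<^sup>2" by (simp add: lam_def)
    then have "lam z powr (s / 2) * F z \<le> K"
      unfolding K_def using lam_pos[of z] s C(1)[of z] F0
      by (intro mult_mono powr_mono2) auto
    moreover have "1 \<le> \<bar>z\<bar> powr - 2"
      using True that powr_mono2'[of "-2" "\<bar>z\<bar>" 1] by auto
    ultimately show ?thesis using that by (simp add: min_def)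
  next
    case False
    then have z: "\<bar>z\<bar> > 1" by simp
    then have "1 \<le> z\<^sup>2" by (metis one_le_power power2_abs less_imp_le)
    then have "lam z \<le> (1 + 4 * pi\<^sup>2) * \<bar>z\<bar> powr 2"
      using z by (simp add: lam_def algebra_simps)
    then have "lam z powr (s / 2) \<le> ((1 + 4 * pi\<^sup>2) * \<bar>z\<bar> powr 2) powr (s / 2)"
      using lam_pos[of z] s by (intro powr_mono2) auto
    also have "\<dots> = (1 + 4 * pi\<^sup>2) powr (s / 2) * \<bar>z\<bar> powr s"
      by (simp add: powr_mult powr_powr del: powr_numeral)
    finally have 1: "lam z powr (s / 2) \<le> (1 + 4 * pi\<^sup>2) powr (s / 2) * \<bar>z\<bar> powr s" .
    have "F z \<le> C * \<bar>z\<bar> powr - real N"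
      using C(2)[of z] z by (simp add: powr_minus powr_realpow field_simps)
    also have "\<dots> \<le> C * \<bar>z\<bar> powr - (s + 2)"
      using z N C0 by (intro mult_left_mono powr_mono) auto
    finally have "lam z powr (s / 2) * F z \<le> ((1 + 4 * pi\<^sup>2) powr (s / 2) * \<bar>z\<bar> powr s) * (C * \<bar>z\<bar> powr - (s + 2))"
      using 1 F0 by (intro mult_mono) auto
    also have "\<dots> = K * \<bar>z\<bar> powr - 2"
      using z by (simp add: K_def powr_add[symmetric] mult_ac)
    also have "\<bar>z\<bar> powr - 2 = min (\<bar>z\<bar> powr - 0) (\<bar>z\<bar> powr - 2)"
      using z powr_mono[of "-2" 0 "\<bar>z\<bar>"] by (auto simp: min_def)
    finally show ?thesis .
  qed
  have "(\<integral>\<^sup>+z. ennreal (lam z powr (s / 2) * F z) \<partial>(lborel::real measure))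
     \<le> (\<integral>\<^sup>+z. ennreal K * ennreal (min (\<bar>z\<bar> powr - 0) (\<bar>z\<bar> powr - 2)) \<partial>lborel)"
    by (rule nn_integral_mono_AE, rule AE_mp[OF AE_lborel_singleton[of 0]])
       (use le K in \<open>auto simp: ennreal_mult'[symmetric] intro!: ennreal_leI\<close>)
  also have "\<dots> = ennreal K * (\<integral>\<^sup>+z. ennreal (min (\<bar>z\<bar> powr - 0) (\<bar>z\<bar> powr - 2)) \<partial>(lborel::real measure))"
    by (rule nn_integral_cmult) measurable
  also have "\<dots> < \<infinity>"
    using nn_integral_min_powr_finite[of 0 2] by (simp add: ennreal_mult_less_top)
  finally show ?thesis by (simp add: F_def)
qed

lemma bumpd_fourier:
  fixes z :: "'a::euclidean_space"
  assumes N: "N > 0"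
  shows "integrable lborel (\<lambda>x::'a. of_real (bumpd N x) * cis (2 * pi * (x \<bullet> z)))"
    and "(\<integral>x. of_real (bumpd N x) * cis (2 * pi * (x \<bullet> z)) \<partial>lborel)
      = (\<Prod>b\<in>Basis. \<integral>x. of_real (bump1 N x) * cis (2 * pi * (z \<bullet> b) * x) \<partial>lborel)"
proof -
  have eq: "of_real (bumpd N x) * cis (2 * pi * (x \<bullet> z))
    = (\<Prod>b\<in>Basis. of_real (bump1 N (x \<bullet> b)) * cis (2 * pi * (z \<bullet> b) * (x \<bullet> b)))" for x :: 'a
  proof -
    have "cis (2 * pi * (x \<bullet> z)) = (\<Prod>b\<in>Basis. cis (2 * pi * (z \<bullet> b) * (x \<bullet> b)))"
      by (subst cis_sum[symmetric]) (auto simp: euclidean_inner[of x z] sum_distrib_left mult_ac)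
    then show ?thesis by (simp add: prod.distrib bumpd_def)
  qed
  show "integrable lborel (\<lambda>x::'a. of_real (bumpd N x) * cis (2 * pi * (x \<bullet> z)))"
    unfolding eq by (rule integrable_lborel_prod) (rule integrable_bump1[OF N])
  show "(\<integral>x. of_real (bumpd N x) * cis (2 * pi * (x \<bullet> z)) \<partial>lborel)
      = (\<Prod>b\<in>Basis. \<integral>x. of_real (bump1 N x) * cis (2 * pi * (z \<bullet> b) * x) \<partial>lborel)"
    unfolding eq
    by (subst integral_lborel_prod[of "\<lambda>b x. of_real (bump1 N x) * cis (2 * pi * (z \<bullet> b) * x)"])
       (auto intro: integrable_bump1[OF N])
qed

lemma borel_measurable_fourier_integral [measurable]:
  fixes f :: "'a::euclidean_space \<Rightarrow> complex"
  assumes [measurable]: "f \<in> borel_measurable borel"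
  shows "(\<lambda>z. \<integral>x. f x * cis (2 * pi * (x \<bullet> z)) \<partial>lborel) \<in> borel_measurable borel"
    and "(\<lambda>z. \<integral>x. f x * cis (- 2 * pi * (x \<bullet> z)) \<partial>lborel) \<in> borel_measurable borel"
proof -
  have c: "cis \<in> borel_measurable borel"
    by (intro borel_measurable_continuous_onI continuous_intros)
  note [measurable] = measurable_compose[OF _ c]
  show "(\<lambda>z. \<integral>x. f x * cis (2 * pi * (x \<bullet> z)) \<partial>lborel) \<in> borel_measurable borel"
    and "(\<lambda>z. \<integral>x. f x * cis (- 2 * pi * (x \<bullet> z)) \<partial>lborel) \<in> borel_measurable borel"
    by measurable
qed

lemma borel_measurable_fourier [measurable]:
  "f \<in> borel_measurable borel \<Longrightarrow> fourier f \<in> borel_measurable borel"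
  unfolding fourier_def[abs_def] by (rule borel_measurable_fourier_integral)

text \<open>The transform of the tensor bump factors over the coordinates and the weight is bounded
  by a product (\<open>lam_le_prod\<close>), so the integral is at most a power of the
  one-dimensional one.\<close>

lemma bumpd_fourier_weighted:
  assumes s: "s \<ge> 0" and N: "real N \<ge> s + 2"
  shows "(\<integral>\<^sup>+z. ennreal (lam z powr (s / 2) * norm (\<integral>x. of_real (bumpd N x) * cis (2 * pi * (x \<bullet> z)) \<partial>lborel)) \<partial>(lborel::'a::euclidean_space measure)) < \<infinity>"
proof -
  have N0: "N > 0" using s N by (cases N) auto
  define F where "F = (\<lambda>z::real. norm (\<integral>x. of_real (bump1 N x) * cis (2 * pi * z * x) \<partial>lborel))"
  have [measurable]: "F \<in> borel_measurable borel"
    using borel_measurable_fourier_integral(1)[of "\<lambda>x::real. of_real (bump1 N x)"]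
    unfolding F_def by (simp add: mult_ac)
  have "(\<integral>\<^sup>+z. ennreal (lam z powr (s / 2) * norm (\<integral>x. of_real (bumpd N x) * cis (2 * pi * (x \<bullet> z)) \<partial>lborel)) \<partial>(lborel::'a measure))
    \<le> (\<integral>\<^sup>+z. (\<Prod>b\<in>Basis. ennreal (lam ((z::'a) \<bullet> b) powr (s / 2) * F (z \<bullet> b))) \<partial>lborel)"
  proof (rule nn_integral_mono)
    fix z :: 'a
    have "norm (\<integral>x. of_real (bumpd N x) * cis (2 * pi * (x \<bullet> z)) \<partial>lborel) = (\<Prod>b\<in>Basis. F (z \<bullet> b))"
      by (simp add: bumpd_fourier(2)[OF N0] F_def prod_norm[symmetric])
    moreover have "lam z powr (s / 2) \<le> (\<Prod>b\<in>Basis. lam (z \<bullet> b)) powr (s / 2)"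
      using lam_le_prod[of z] lam_pos[of z] s by (intro powr_mono2) auto
    moreover have "(\<Prod>b\<in>Basis. lam (z \<bullet> b)) powr (s / 2) = (\<Prod>b\<in>Basis. lam (z \<bullet> b) powr (s / 2))"
      by (rule prod_powr_distrib)
    ultimately have "lam z powr (s / 2) * norm (\<integral>x. of_real (bumpd N x) * cis (2 * pi * (x \<bullet> z)) \<partial>lborel)
       \<le> (\<Prod>b\<in>Basis. lam (z \<bullet> b) powr (s / 2)) * (\<Prod>b\<in>Basis. F (z \<bullet> b))"
      by (auto intro!: mult_mono prod_nonneg simp: F_def)
    also have "\<dots> = (\<Prod>b\<in>Basis. lam (z \<bullet> b) powr (s / 2) * F (z \<bullet> b))"
      by (simp add: prod.distrib)
    finally show "ennreal (lam z powr (s / 2) * norm (\<integral>x. of_real (bumpd N x) * cis (2 * pi * (x \<bullet> z)) \<partial>lborel))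
       \<le> (\<Prod>b\<in>Basis. ennreal (lam (z \<bullet> b) powr (s / 2) * F (z \<bullet> b)))"
      by (subst prod_ennreal) (auto intro!: ennreal_leI simp: F_def)
  qed
  also have "\<dots> = (\<Prod>b\<in>(Basis::'a set). \<integral>\<^sup>+z. ennreal (lam z powr (s / 2) * F z) \<partial>lborel)"
    by (rule nn_integral_lborel_prod) auto
  also have "\<dots> < \<infinity>"
    using bump1_fourier_weighted[OF s N] by (simp add: power_less_top_ennreal F_def)
  finally show ?thesis .
qed

section \<open>Schwartz functions and the decay of their Fourier transforms\<close>

lemma iter_dderiv_append: "iter_dderiv (vs @ ws) f = iter_dderiv vs (iter_dderiv ws f)"
  by (induction vs) auto

lemma schwartz_iter_dderiv:
  assumes "schwartz f" "set ws \<subseteq> Basis"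
  shows "schwartz (iter_dderiv ws f)"
  using assms unfolding schwartz_def by (auto simp flip: iter_dderiv_append)

lemma schwartz_differentiable: "schwartz f \<Longrightarrow> f differentiable (at x)"
  unfolding schwartz_def by (metis empty_set empty_subsetI iter_dderiv.simps(1))

lemma schwartz_continuous: "schwartz f \<Longrightarrow> continuous_on A f"
  by (meson schwartz_differentiable continuous_at_imp_continuous_on differentiable_imp_continuous_within)

lemma schwartz_measurable: "schwartz f \<Longrightarrow> f \<in> borel_measurable borel"
  by (intro borel_measurable_continuous_onI schwartz_continuous)

lemma schwartz_decay: "schwartz f \<Longrightarrow> \<exists>B. \<forall>x. (1 + norm x) ^ N * norm (f x) \<le> B"
  unfolding schwartz_def by (metis empty_set empty_subsetI iter_dderiv.simps(1))

text \<open>Formulated for decay alone, so that it applies both to Schwartz functions and to their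
  Fourier transforms.\<close>

lemma rapid_decay_integrable:
  fixes f :: "'a::euclidean_space \<Rightarrow> complex"
  assumes [measurable]: "f \<in> borel_measurable borel"
    and f: "\<And>N. \<exists>B. \<forall>x. (1 + norm x) ^ N * norm (f x) \<le> B"
    and a: "a \<ge> 0"
  shows "integrable lborel (\<lambda>x. of_real (lam x powr a) * f x)"
proof -
  \<comment> \<open>The weight grows like (1 + |x|)^(2a); this N leaves at least d + 1 powers,
    enough for integrability.\<close>
  define N where "N = nat \<lceil>2 * a\<rceil> + DIM('a) + 1"
  obtain B where B: "\<And>x. (1 + norm x) ^ N * norm (f x) \<le> B" using f by blast
  define C where "C = (1 + 4 * pi\<^sup>2) powr a * B"
  have B0: "B \<ge> 0" using order_trans[OF norm_ge_zero[of "f 0"]] B[of 0] by simp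
  show ?thesis
  proof (rule integrable_decay[of _ "DIM('a) + 1" C])
    fix x :: 'a assume x: "x \<noteq> 0"
    define r where "r = 1 + norm x"
    have r: "r \<ge> 1" by (simp add: r_def)
    have "(norm x)\<^sup>2 \<le> r\<^sup>2" "1 \<le> r\<^sup>2" using r by (auto simp: r_def intro!: power_mono)
    then have "lam x \<le> (1 + 4 * pi\<^sup>2) * r powr 2"
      using r by (simp add: lam_def distrib_right add_mono)
    then have "lam x powr a \<le> ((1 + 4 * pi\<^sup>2) * r powr 2) powr a"
      using lam_pos[of x] a by (intro powr_mono2) auto
    also have "\<dots> = (1 + 4 * pi\<^sup>2) powr a * r powr (2 * a)"
      by (simp add: powr_mult powr_powr)
    also have "\<dots> \<le> (1 + 4 * pi\<^sup>2) powr a * r powr (real N - DIM('a) - 1)"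
      using r unfolding N_def by (intro mult_left_mono powr_mono) (auto, linarith)
    finally have 1: "lam x powr a \<le> (1 + 4 * pi\<^sup>2) powr a * r powr (real N - DIM('a) - 1)" .
    have "norm (f x) \<le> B * r powr - real N"
      using B[of x] r by (simp add: r_def[symmetric] powr_minus powr_realpow field_simps)
    then have "lam x powr a * norm (f x) \<le> ((1 + 4 * pi\<^sup>2) powr a * r powr (real N - DIM('a) - 1)) * (B * r powr - real N)"
      using 1 by (intro mult_mono) auto
    also have "\<dots> = C * (r powr (real N - DIM('a) - 1) * r powr - real N)"
      by (simp add: C_def)
    also have "r powr (real N - DIM('a) - 1) * r powr - real N = r powr - real (DIM('a) + 1)"
    proof -
      have e: "real N - DIM('a) - 1 + - real N = - real (DIM('a) + 1)" by simp
      show ?thesis by (simp only: powr_add[symmetric] e)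
    qed
    also have "C * r powr - real (DIM('a) + 1) \<le> C * min 1 (norm x powr - real (DIM('a) + 1))"
    proof -
      have "r powr - real (DIM('a) + 1) \<le> norm x powr - real (DIM('a) + 1)"
        using x by (intro powr_mono2') (auto simp: r_def)
      moreover have "r powr - real (DIM('a) + 1) \<le> r powr 0"
        using r by (intro powr_mono) auto
      ultimately show ?thesis using B0 r by (intro mult_left_mono) (auto simp: C_def)
    qed
    finally show "norm (of_real (lam x powr a) * f x) \<le> C * min 1 (norm x powr - real (DIM('a) + 1))"
      by (simp add: norm_mult)
  qed auto
qed

lemma schwartz_integrable_weighted:
  "schwartz f \<Longrightarrow> a \<ge> 0 \<Longrightarrow> integrable lborel (\<lambda>x. of_real (lam x powr a) * f x)"
  by (rule rapid_decay_integrable) (auto simp: schwartz_measurable schwartz_decay)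

lemma schwartz_integrable: "schwartz f \<Longrightarrow> integrable lborel f"
  using schwartz_integrable_weighted[of f 0] by (simp add: less_imp_neq[OF lam_pos, symmetric])

lemma norm_fourier_le: "norm (fourier f \<xi>) \<le> (\<integral>x. norm (f x) \<partial>lborel)"
  using integral_norm_bound[of lborel "\<lambda>x. f x * cis (- 2 * pi * (x \<bullet> \<xi>))"]
  by (simp add: fourier_def norm_mult)

text \<open>By translation invariance, $\int F(x + e) - F(x) \, dx = 0$; by the fundamental theorem and
  Fubini, the same integral equals $\int \partial_e F$.\<close>

lemma integral_directional_derivative_eq_0:
  fixes F G :: "'a::euclidean_space \<Rightarrow> complex"
  assumes F: "integrable lborel F" and G: "integrable lborel G" "continuous_on UNIV G"
    and der: "\<And>x t. ((\<lambda>t. F (x + t *\<^sub>R e)) has_vector_derivative G (x + t *\<^sub>R e)) (at t)"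
  shows "(\<integral>x. G x \<partial>lborel) = 0"
proof -
  have [measurable]: "F \<in> borel_measurable borel" "G \<in> borel_measurable borel"
    using F G by auto
  have G_shift: "integrable lborel (\<lambda>x. G (x + t *\<^sub>R e))"
    "(\<integral>x. G (x + t *\<^sub>R e) \<partial>lborel) = (\<integral>x. G x \<partial>lborel)"
    "(\<integral>\<^sup>+x. ennreal (norm (G (x + t *\<^sub>R e))) \<partial>lborel) = (\<integral>\<^sup>+x. ennreal (norm (G x)) \<partial>lborel)" for t
  proof -
    show *: "(\<integral>\<^sup>+x. ennreal (norm (G (x + t *\<^sub>R e))) \<partial>lborel) = (\<integral>\<^sup>+x. ennreal (norm (G x)) \<partial>lborel)"
      using nn_integral_lborel_translation[of "\<lambda>x. ennreal (norm (G x))" "t *\<^sub>R e"] by (simp add: add.commute)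
    show "integrable lborel (\<lambda>x. G (x + t *\<^sub>R e))"
      using G(1) unfolding integrable_iff_bounded * by simp
    show "(\<integral>x. G (x + t *\<^sub>R e) \<partial>lborel) = (\<integral>x. G x \<partial>lborel)"
      using lborel_integral_translation[of G "t *\<^sub>R e"] by (simp add: add.commute)
  qed
  have ftc: "(\<integral>t. indicator {0..1::real} t *\<^sub>R G (x + t *\<^sub>R e) \<partial>lborel) = F (e + x) - F x" for x
  proof -
    have "(\<integral>t. indicator {0..1::real} t *\<^sub>R G (x + t *\<^sub>R e) \<partial>lborel) = F (x + 1 *\<^sub>R e) - F (x + 0 *\<^sub>R e)"
      by (rule integral_FTC_Icc)
         (auto intro!: has_vector_derivative_at_within der continuous_intros
            continuous_on_compose2[OF G(2)])
    then show ?thesis by (simp add: add.commute)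
  qed
  have "integrable (lborel \<Otimes>\<^sub>M lborel) (\<lambda>(t::real, x). indicator {0..1} t *\<^sub>R G (x + t *\<^sub>R e))"
  proof (rule lborel_pair.Fubini_integrable)
    have A: "(\<integral>x. norm (indicator {0..1} t *\<^sub>R G (x + t *\<^sub>R e)) \<partial>lborel) = indicator {0..1} t * (\<integral>x. norm (G x) \<partial>lborel)" for t :: real
      using G_shift(3)[of t] by (simp add: integral_eq_nn_integral)
    show "integrable lborel (\<lambda>t::real. \<integral>x. norm (case (t, x) of (t, x) \<Rightarrow> indicator {0..1} t *\<^sub>R G (x + t *\<^sub>R e)) \<partial>lborel)"
      unfolding prod.case A by simp
  qed (auto simp: G_shift)
  then have "(\<integral>x. (\<integral>t. indicator {0..1::real} t *\<^sub>R G (x + t *\<^sub>R e) \<partial>lborel) \<partial>lborel)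
      = (\<integral>t. (\<integral>x. indicator {0..1::real} t *\<^sub>R G (x + t *\<^sub>R e) \<partial>lborel) \<partial>lborel)"
    by (rule lborel_pair.Fubini_integral)
  also have "\<dots> = (\<integral>x. G x \<partial>lborel)"
    by (simp add: G_shift)
  finally have "(\<integral>x. G x \<partial>lborel) = (\<integral>x. F (e + x) - F x \<partial>lborel)"
    unfolding ftc ..
  also have "\<dots> = 0"
  proof -
    have "integrable lborel (\<lambda>x. F (e + x))"
      using F nn_integral_lborel_translation[of "\<lambda>x. ennreal (norm (F x))" e] unfolding integrable_iff_bounded by simp
    then show ?thesis using F by (simp add: lborel_integral_translation)
  qed
  finally show ?thesis .
qed

text \<open>The product of f with the character has directional derivative \<open>G\<close>, whose
  integral vanishes; this is integration by parts with no boundary to discuss.\<close>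

lemma fourier_dderiv:
  fixes f :: "'a::euclidean_space \<Rightarrow> complex"
  assumes f: "schwartz f" and e: "e \<in> Basis"
  shows "fourier (iter_dderiv [e] f) \<xi> = 2 * pi * \<i> * (\<xi> \<bullet> e) * fourier f \<xi>"
proof -
  define f' where "f' = iter_dderiv [e] f"
  have f': "schwartz f'" unfolding f'_def using e by (intro schwartz_iter_dderiv[OF f]) auto
  define c where "c = (\<lambda>x::'a. cis (- 2 * pi * (x \<bullet> \<xi>)))"
  define G where "G = (\<lambda>x. f' x * c x - 2 * pi * \<i> * (\<xi> \<bullet> e) * (f x * c x))"
  have c: "continuous_on UNIV c" unfolding c_def by (intro continuous_intros)
  have nc: "norm (c x) = 1" for x by (simp add: c_def)
  have [measurable]: "c \<in> borel_measurable borel" by (rule borel_measurable_continuous_onI[OF c])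
  have int: "integrable lborel (\<lambda>x. g x * c x)" if "schwartz g" for g
    by (rule Bochner_Integration.integrable_bound[OF schwartz_integrable[OF that]])
       (use schwartz_measurable[OF that] nc in \<open>auto simp: norm_mult\<close>)
  have "(\<integral>x. G x \<partial>lborel) = 0"
  proof (rule integral_directional_derivative_eq_0)
    show "integrable lborel (\<lambda>x. f x * c x)" by (rule int[OF f])
    show "integrable lborel G" unfolding G_def
      by (intro Bochner_Integration.integrable_diff integrable_mult_right int f f')
    show "continuous_on UNIV G" unfolding G_def
      by (intro continuous_intros schwartz_continuous f f' c)
    fix x t
    have "(f has_derivative frechet_derivative f (at (x + t *\<^sub>R e))) (at (x + t *\<^sub>R e))"
      using schwartz_differentiable[OF f] frechet_derivative_works by blast
    moreover have "((\<lambda>t. x + t *\<^sub>R e) has_vector_derivative e) (at t)"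
      by (auto intro!: derivative_eq_intros)
    ultimately have 1: "((\<lambda>t. f (x + t *\<^sub>R e)) has_vector_derivative f' (x + t *\<^sub>R e)) (at t)"
      using vector_derivative_diff_chain_within[of "\<lambda>t. x + t *\<^sub>R e" e t UNIV f "frechet_derivative f (at (x + t *\<^sub>R e))"]
      by (auto simp: o_def f'_def has_derivative_at_withinI)
    have "((\<lambda>t. - 2 * pi * ((x + t *\<^sub>R e) \<bullet> \<xi>)) has_vector_derivative - 2 * pi * (e \<bullet> \<xi>)) (at t)"
      by (auto intro!: derivative_eq_intros simp: inner_add_left has_real_derivative_iff_has_vector_derivative[symmetric])
    moreover have "(cis has_vector_derivative \<i> * cis \<theta>) (at \<theta>)" for \<theta>
      by (auto intro!: derivative_eq_intros simp: has_vector_derivative_def)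
    ultimately have "(cis \<circ> (\<lambda>t. - 2 * pi * ((x + t *\<^sub>R e) \<bullet> \<xi>)) has_vector_derivative
        (- 2 * pi * (e \<bullet> \<xi>)) *\<^sub>R (\<i> * cis (- 2 * pi * ((x + t *\<^sub>R e) \<bullet> \<xi>)))) (at t)"
      by (rule vector_diff_chain_at)
    then
    have 2: "((\<lambda>t. c (x + t *\<^sub>R e)) has_vector_derivative (- 2 * pi * (e \<bullet> \<xi>)) *\<^sub>R (\<i> * c (x + t *\<^sub>R e))) (at t)"
      by (simp add: o_def c_def)
    show "((\<lambda>t. f (x + t *\<^sub>R e) * c (x + t *\<^sub>R e)) has_vector_derivative G (x + t *\<^sub>R e)) (at t)"
      using has_vector_derivative_mult[OF 1 2] 
      by (rule has_vector_derivative_eq_rhs) (simp add: G_def scaleR_conv_of_real inner_commute algebra_simps)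
  qed
  also have "(\<integral>x. G x \<partial>lborel) = (\<integral>x. f' x * c x \<partial>lborel) - 2 * pi * \<i> * (\<xi> \<bullet> e) * (\<integral>x. f x * c x \<partial>lborel)"
    unfolding G_def by (subst Bochner_Integration.integral_diff) (auto intro!: int f f')
  finally show ?thesis
    by (simp add: fourier_def f'_def c_def)
qed

text \<open>Each power of the coordinate costs one derivative: the induction passes from
  \<open>f\<close> to its derivative along \<open>e\<close>, and the factor 2 pi >= 1 is
  dropped.\<close>

lemma schwartz_fourier_decay_coord:
  assumes "schwartz f" "e \<in> Basis"
  shows "\<exists>C. \<forall>\<xi>. \<bar>\<xi> \<bullet> e\<bar> ^ N * norm (fourier f \<xi>) \<le> C"
  using assms
proof (induction N arbitrary: f)
  case 0
  then show ?case using norm_fourier_le[of f] by auto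
next
  case (Suc N)
  then obtain C where C: "\<And>\<xi>. \<bar>\<xi> \<bullet> e\<bar> ^ N * norm (fourier (iter_dderiv [e] f) \<xi>) \<le> C"
    using schwartz_iter_dderiv[of f "[e]"] by force
  have "\<bar>\<xi> \<bullet> e\<bar> ^ Suc N * norm (fourier f \<xi>) \<le> C" for \<xi>
  proof -
    have eq: "norm (fourier (iter_dderiv [e] f) \<xi>) = 2 * pi * (\<bar>\<xi> \<bullet> e\<bar> * norm (fourier f \<xi>))"
      unfolding fourier_dderiv[OF Suc.prems] by (simp add: norm_mult)
    have "\<bar>\<xi> \<bullet> e\<bar> * norm (fourier f \<xi>) \<le> norm (fourier (iter_dderiv [e] f) \<xi>)"
      unfolding eq using mult_right_mono[of 1 "2 * pi" "\<bar>\<xi> \<bullet> e\<bar> * norm (fourier f \<xi>)"] pi_ge_two by simp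
    then have "\<bar>\<xi> \<bullet> e\<bar> ^ N * (\<bar>\<xi> \<bullet> e\<bar> * norm (fourier f \<xi>)) \<le> \<bar>\<xi> \<bullet> e\<bar> ^ N * norm (fourier (iter_dderiv [e] f) \<xi>)"
      by (rule mult_left_mono) simp
    with C[of \<xi>] show ?thesis by (simp add: mult_ac)
  qed
  then show ?case by blast
qed

lemma schwartz_fourier_decay:
  fixes f :: "'a::euclidean_space \<Rightarrow> complex"
  assumes f: "schwartz f"
  shows "\<exists>B. \<forall>\<xi>. (1 + norm \<xi>) ^ N * norm (fourier f \<xi>) \<le> B"
proof -
  obtain C where C: "\<And>e \<xi>. e \<in> Basis \<Longrightarrow> \<bar>\<xi> \<bullet> e\<bar> ^ N * norm (fourier f \<xi>) \<le> C e"
  proof -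
    have "\<forall>e. \<exists>C. e \<in> Basis \<longrightarrow> (\<forall>\<xi>. \<bar>\<xi> \<bullet> e\<bar> ^ N * norm (fourier f \<xi>) \<le> C)"
      using schwartz_fourier_decay_coord[OF f] by blast
    then have "\<exists>C. \<forall>e. e \<in> Basis \<longrightarrow> (\<forall>\<xi>. \<bar>\<xi> \<bullet> e\<bar> ^ N * norm (fourier f \<xi>) \<le> C e)"
      by (rule choice)
    then show ?thesis using that by blast
  qed
  define L where "L = (\<integral>x. norm (f x) \<partial>lborel)"
  define D where "D = (\<Sum>e\<in>Basis. \<bar>C e\<bar>)"
  have "(1 + norm \<xi>) ^ N * norm (fourier f \<xi>) \<le> 2 ^ N * L + (2 * DIM('a)) ^ N * D" for \<xi>
  proof (cases "norm \<xi> \<le> 1")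
    case True
    have "(1 + norm \<xi>) ^ N * norm (fourier f \<xi>) \<le> 2 ^ N * L"
      using True norm_fourier_le[of f \<xi>] by (intro mult_mono power_mono) (auto simp: L_def)
    moreover have "0 \<le> (2 * DIM('a)) ^ N * D" by (auto simp: D_def intro: sum_nonneg)
    ultimately show ?thesis by linarith
  next
    case False
    \<comment> \<open>If every coordinate of \<xi> were smaller than |\<xi>| / d, its l^1 norm would
      be smaller than |\<xi>|. So one coordinate carries the decay.\<close>
    have "\<exists>e\<in>Basis. norm \<xi> \<le> DIM('a) * \<bar>\<xi> \<bullet> e\<bar>"
    proof (rule ccontr)
      assume "\<not> ?thesis"
      then have "(\<Sum>e\<in>(Basis::'a set). DIM('a) * \<bar>\<xi> \<bullet> e\<bar>) < (\<Sum>e\<in>(Basis::'a set). norm \<xi>)"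
        by (intro sum_strict_mono) auto
      then have "DIM('a) * (\<Sum>e\<in>(Basis::'a set). \<bar>\<xi> \<bullet> e\<bar>) < DIM('a) * norm \<xi>"
        by (simp add: sum_distrib_left)
      then have "(\<Sum>e\<in>(Basis::'a set). \<bar>\<xi> \<bullet> e\<bar>) < norm \<xi>" by simp
      with norm_le_l1[of \<xi>] show False by simp
    qed
    then obtain e where e: "e \<in> Basis" "norm \<xi> \<le> DIM('a) * \<bar>\<xi> \<bullet> e\<bar>" by blast
    have "(1 + norm \<xi>) ^ N \<le> (2 * norm \<xi>) ^ N"
      using False by (intro power_mono) auto
    also have "\<dots> \<le> (2 * (DIM('a) * \<bar>\<xi> \<bullet> e\<bar>)) ^ N"
      using e by (intro power_mono mult_left_mono) auto
    also have "\<dots> = (2 * DIM('a)) ^ N * \<bar>\<xi> \<bullet> e\<bar> ^ N" by (simp add: power_mult_distrib)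
    finally have "(1 + norm \<xi>) ^ N * norm (fourier f \<xi>) \<le> ((2 * DIM('a)) ^ N * \<bar>\<xi> \<bullet> e\<bar> ^ N) * norm (fourier f \<xi>)"
      by (rule mult_right_mono) simp
    also have "\<dots> = (2 * DIM('a)) ^ N * (\<bar>\<xi> \<bullet> e\<bar> ^ N * norm (fourier f \<xi>))" by simp
    also have "\<dots> \<le> (2 * DIM('a)) ^ N * D"
    proof (rule mult_left_mono)
      have "\<bar>\<xi> \<bullet> e\<bar> ^ N * norm (fourier f \<xi>) \<le> \<bar>C e\<bar>" using C[OF e(1), of \<xi>] by simp
      also have "\<dots> \<le> D" unfolding D_def using e by (intro member_le_sum) auto
      finally show "\<bar>\<xi> \<bullet> e\<bar> ^ N * norm (fourier f \<xi>) \<le> D" .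
    qed simp
    finally show ?thesis by (auto simp: L_def intro: add_increasing)
  qed
  then show ?thesis by blast
qed

lemma schwartz_fourier_integrable_weighted:
  assumes "schwartz f" "a \<ge> 0"
  shows "integrable lborel (\<lambda>\<xi>. of_real (lam \<xi> powr a) * fourier f \<xi>)"
  using assms by (intro rapid_decay_integrable schwartz_fourier_decay borel_measurable_fourier schwartz_measurable)

section \<open>Bessel potentials of compactly supported functions\<close>

lemma borel_measurable_cis [measurable (raw)]:
  "f \<in> borel_measurable M \<Longrightarrow> (\<lambda>x. cis (f x)) \<in> borel_measurable M"
  by (rule measurable_compose[of f M borel cis])
     (auto intro!: borel_measurable_continuous_onI continuous_intros)

text \<open>Fubini for the kernel cis (c x . \<xi>). The free constant \<open>c\<close> covers both
  the transform and its inverse.\<close>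

lemma fourier_multiplication_formula:
  fixes f V :: "'a::euclidean_space \<Rightarrow> complex"
  assumes f: "integrable lborel f" and V: "integrable lborel V"
  shows "(\<integral>x. f x * (\<integral>\<xi>. V \<xi> * cis (c * (x \<bullet> \<xi>)) \<partial>lborel) \<partial>lborel)
    = (\<integral>\<xi>. V \<xi> * (\<integral>x. f x * cis (c * (x \<bullet> \<xi>)) \<partial>lborel) \<partial>lborel)"
proof -
  have [measurable]: "f \<in> borel_measurable borel" "V \<in> borel_measurable borel"
    using f V by auto
  have int_cis: "integrable lborel (\<lambda>\<xi>. V \<xi> * cis (c * (x \<bullet> \<xi>)))" for x
    by (rule Bochner_Integration.integrable_bound[OF V]) (auto simp: norm_mult)
  have "integrable (lborel \<Otimes>\<^sub>M lborel) (\<lambda>(x, \<xi>). f x * (V \<xi> * cis (c * (x \<bullet> \<xi>))))"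
  proof (rule lborel_pair.Fubini_integrable)
    show "integrable lborel (\<lambda>x. \<integral>\<xi>. norm (case (x, \<xi>) of (x, \<xi>) \<Rightarrow> f x * (V \<xi> * cis (c * (x \<bullet> \<xi>)))) \<partial>lborel)"
      using f by (simp add: norm_mult)
  qed (auto intro!: integrable_mult_right int_cis)
  from lborel_pair.Fubini_integral[OF this]
  have "(\<integral>x. (\<integral>\<xi>. f x * (V \<xi> * cis (c * (x \<bullet> \<xi>))) \<partial>lborel) \<partial>lborel)
    = (\<integral>\<xi>. (\<integral>x. V \<xi> * (f x * cis (c * (x \<bullet> \<xi>))) \<partial>lborel) \<partial>lborel)"
    by (simp add: mult_ac)
  then show ?thesis by simp
qed

lemma inv_fourier_eq: "inv_fourier f \<xi> = (\<integral>x. f x * cis (2 * pi * (x \<bullet> \<xi>)) \<partial>lborel)"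
  by (simp add: inv_fourier_def fourier_def)

lemma borel_measurable_inv_fourier [measurable]:
  "f \<in> borel_measurable borel \<Longrightarrow> inv_fourier f \<in> borel_measurable borel"
  unfolding inv_fourier_eq[abs_def] by (rule borel_measurable_fourier_integral)

text \<open>The Bessel potential with the transform and its inverse in the opposite order to
  \<open>bessel_schwartz\<close>; the two then become dual under the multiplication formula.\<close>

definition bessel_fun :: "real \<Rightarrow> ('a::euclidean_space \<Rightarrow> complex) \<Rightarrow> 'a \<Rightarrow> complex" where
  "bessel_fun s g = fourier (\<lambda>\<xi>. of_real (lam \<xi> powr (s / 2)) * inv_fourier g \<xi>)"

text \<open>Two applications of the multiplication formula: the outer transform moves to \<phi>, the
  weight changes hands, and the inverse transform moves from \<open>g\<close> to the weighted
  transform of \<phi>. Integrability of the weighted transform makes the potential a bounded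
  function.\<close>

lemma bessel_rep_bessel_fun:
  fixes g :: "'a::euclidean_space \<Rightarrow> complex"
  assumes s: "s \<ge> 0" and g: "integrable lborel g"
    and W: "integrable lborel (\<lambda>\<xi>. of_real (lam \<xi> powr (s / 2)) * inv_fourier g \<xi>)"
  shows "bessel_rep s g (bessel_fun s g)"
  unfolding bessel_rep_def
proof (intro conjI allI impI)
  define V where "V = (\<lambda>\<xi>. of_real (lam \<xi> powr (s / 2)) * inv_fourier g \<xi>)"
  have V: "integrable lborel V" using W by (simp add: V_def)
  have [measurable]: "g \<in> borel_measurable borel" "V \<in> borel_measurable borel" using g V by auto
  have h: "bessel_fun s g = fourier V" by (simp add: bessel_fun_def V_def)
  show meas: "bessel_fun s g \<in> borel_measurable lborel"
    unfolding h by simp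
  fix \<phi> :: "'a \<Rightarrow> complex" assume \<phi>: "schwartz \<phi>"
  note \<phi>i = schwartz_integrable[OF \<phi>]
  have [measurable]: "\<phi> \<in> borel_measurable borel" using \<phi>i by auto
  define U where "U = (\<lambda>\<xi>. of_real (lam \<xi> powr (s / 2)) * fourier \<phi> \<xi>)"
  have U: "integrable lborel U"
    unfolding U_def using s by (intro schwartz_fourier_integrable_weighted \<phi>) auto
  show "integrable lborel (\<lambda>x. bessel_fun s g x * \<phi> x)"
  proof (rule Bochner_Integration.integrable_bound)
    show "integrable lborel (\<lambda>x. of_real (\<integral>x. norm (V x) \<partial>lborel) * \<phi> x)"
      using \<phi>i by simp
    show "AE x in lborel. norm (bessel_fun s g x * \<phi> x) \<le> norm (of_real (\<integral>x. norm (V x) \<partial>lborel) * \<phi> x)"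
      unfolding h using norm_fourier_le[of V] by (auto simp: norm_mult intro!: AE_I2 mult_right_mono order_trans[OF _ abs_ge_self])
  qed (use meas in simp)
  have "(\<integral>x. bessel_fun s g x * \<phi> x \<partial>lborel) = (\<integral>x. \<phi> x * (\<integral>\<xi>. V \<xi> * cis (- 2 * pi * (x \<bullet> \<xi>)) \<partial>lborel) \<partial>lborel)"
    by (simp add: h fourier_def inner_commute mult.commute)
  also have "\<dots> = (\<integral>\<xi>. V \<xi> * (\<integral>x. \<phi> x * cis (- 2 * pi * (x \<bullet> \<xi>)) \<partial>lborel) \<partial>lborel)"
    by (rule fourier_multiplication_formula[OF \<phi>i V])
  also have "\<dots> = (\<integral>\<xi>. U \<xi> * (\<integral>x. g x * cis (2 * pi * (x \<bullet> \<xi>)) \<partial>lborel) \<partial>lborel)"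
    by (simp add: V_def U_def fourier_def inv_fourier_eq mult_ac)
  also have "\<dots> = (\<integral>x. g x * (\<integral>\<xi>. U \<xi> * cis (2 * pi * (x \<bullet> \<xi>)) \<partial>lborel) \<partial>lborel)"
    by (rule fourier_multiplication_formula[OF g U, symmetric])
  also have "\<dots> = (\<integral>x. g x * bessel_schwartz s \<phi> x \<partial>lborel)"
    unfolding bessel_schwartz_def inv_fourier_eq U_def lam_def by (simp add: inner_commute)
  finally show "(\<integral>x. bessel_fun s g x * \<phi> x \<partial>lborel) = (\<integral>x. g x * bessel_schwartz s \<phi> x \<partial>lborel)" .
qed

lemma bessel_schwartz_bounded:
  assumes "schwartz \<phi>" "s \<ge> 0"
  shows "\<exists>B. \<forall>x. norm (bessel_schwartz s \<phi> x) \<le> B" and "bessel_schwartz s \<phi> \<in> borel_measurable borel"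
proof -
  show "\<exists>B. \<forall>x. norm (bessel_schwartz s \<phi> x) \<le> B"
    unfolding bessel_schwartz_def inv_fourier_def using norm_fourier_le by blast
  have [measurable]: "\<phi> \<in> borel_measurable borel" by (rule schwartz_measurable[OF assms(1)])
  show "bessel_schwartz s \<phi> \<in> borel_measurable borel"
    unfolding bessel_schwartz_def by measurable
qed

section \<open>Heat operators and the decay of Bessel potentials off the support\<close>

lemma exp_minus_le_powr:
  assumes "m \<ge> 0"
  obtains C :: real where "C > 0" "\<And>y. y > 0 \<Longrightarrow> exp (- y) \<le> C * y powr - m"
proof
  define N where "N = nat \<lceil>m\<rceil>"
  show "fact N > (0::real)" by simp
  fix y :: real assume y: "y > 0"
  have "y powr m \<le> fact N * exp y"
  proof (cases "y \<le> 1")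
    case True
    then have "y powr m \<le> 1" using y assms by (simp add: powr_le1)
    also have "1 \<le> fact N * exp y" using y mult_mono[of 1 "fact N :: real" 1 "exp y"] by (simp add: fact_ge_1)
    finally show ?thesis .
  next
    case False
    then have "y powr m \<le> y powr real N" using assms by (intro powr_mono) (auto simp: N_def)
    also have "\<dots> = y ^ N" using y by (simp add: powr_realpow)
    also have "\<dots> \<le> fact N * exp y"
    proof -
      have "(\<Sum>n\<in>{N}. y ^ n /\<^sub>R fact n) \<le> (\<Sum>n. y ^ n /\<^sub>R fact n)"
        using y by (intro sum_le_suminf summable_exp_generic) auto
      then show ?thesis by (simp add: exp_def field_simps)
    qed
    finally show ?thesis .
  qed
  then show "exp (- y) \<le> fact N * y powr - m"
    using y by (simp add: exp_minus powr_minus field_simps)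
qed

text \<open>Split at the parabolic time t = D^2: before it the Gaussian factor beats the singular
  power and leaves the constant \<open>L * D powr (- 2 * \<alpha> - 2)\<close> on an interval of
  length D^2; after it the Gaussian is dropped.\<close>

lemma nn_integral_heat_bound:
  assumes \<alpha>: "\<alpha> > 0" and c: "c > 0"
  obtains C where "C \<ge> 0"
    "\<And>D. D > 0 \<Longrightarrow> (\<integral>\<^sup>+t. ennreal (t powr (- \<alpha> - 1) * exp (- c * D\<^sup>2 / t)) * indicator {0<..} t \<partial>lborel)
        \<le> ennreal (C * D powr (- 2 * \<alpha>))"
proof -
  obtain K where K: "K > 0" "\<And>y. y > 0 \<Longrightarrow> exp (- y) \<le> K * y powr - (\<alpha> + 1)"
    using exp_minus_le_powr[of "\<alpha> + 1"] \<alpha> by auto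
  define L where "L = K * c powr - (\<alpha> + 1)"
  have L: "L > 0" using K c by (simp add: L_def)
  show ?thesis
  proof (rule that[of "L + 1 / \<alpha>"])
    show "0 \<le> L + 1 / \<alpha>" using L \<alpha> by simp
    fix D :: real assume D: "D > 0"
    have 1: "t powr (- \<alpha> - 1) * exp (- c * D\<^sup>2 / t) \<le> L * D powr (- 2 * \<alpha> - 2)" if "t > 0" for t
    proof -
      have "exp (- c * D\<^sup>2 / t) \<le> K * (c * D\<^sup>2 / t) powr - (\<alpha> + 1)"
        using K(2)[of "c * D\<^sup>2 / t"] c D that by simp
      also have "(c * D\<^sup>2 / t) powr - (\<alpha> + 1) = c powr - (\<alpha> + 1) * D powr (- 2 * \<alpha> - 2) * t powr (\<alpha> + 1)"
      proof -
        have "(D\<^sup>2) powr - (\<alpha> + 1) = (D powr 2) powr - (\<alpha> + 1)" using D by simp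
        also have "\<dots> = D powr (2 * - (\<alpha> + 1))" by (rule powr_powr)
        also have "2 * - (\<alpha> + 1) = - 2 * \<alpha> - 2" by simp
        finally have "(D\<^sup>2) powr - (\<alpha> + 1) = D powr (- 2 * \<alpha> - 2)" .
        moreover have "(1 / t) powr - (\<alpha> + 1) = t powr (\<alpha> + 1)"
          using that powr_minus[of "1 / t" "\<alpha> + 1"] powr_divide[of 1 t "\<alpha> + 1"] by simp
        moreover have "(c * D\<^sup>2 / t) powr - (\<alpha> + 1) = c powr - (\<alpha> + 1) * (D\<^sup>2) powr - (\<alpha> + 1) * (1 / t) powr - (\<alpha> + 1)"
          using c D that powr_mult[of "c * D\<^sup>2" "1 / t" "- (\<alpha> + 1)"] powr_mult[of c "D\<^sup>2" "- (\<alpha> + 1)"] by simp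
        ultimately show ?thesis by simp
      qed
      finally have "t powr (- \<alpha> - 1) * exp (- c * D\<^sup>2 / t)
         \<le> t powr (- \<alpha> - 1) * (K * (c powr - (\<alpha> + 1) * D powr (- 2 * \<alpha> - 2) * t powr (\<alpha> + 1)))"
        by (intro mult_left_mono) auto
      also have "\<dots> = L * D powr (- 2 * \<alpha> - 2) * (t powr (- \<alpha> - 1) * t powr (\<alpha> + 1))"
        by (simp add: L_def)
      also have "t powr (- \<alpha> - 1) * t powr (\<alpha> + 1) = 1"
        using that by (simp flip: powr_add)
      finally show ?thesis by simp
    qed
    have 2: "t powr (- \<alpha> - 1) * exp (- c * D\<^sup>2 / t) \<le> t powr (- \<alpha> - 1)" if "t > 0" for t
      using that c by (intro mult_left_le) auto
    have "(\<integral>\<^sup>+t. ennreal (t powr (- \<alpha> - 1) * exp (- c * D\<^sup>2 / t)) * indicator {0<..} t \<partial>lborel)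
      \<le> (\<integral>\<^sup>+t. ennreal (L * D powr (- 2 * \<alpha> - 2)) * indicator {0<..D\<^sup>2} t
           + ennreal (t powr (- \<alpha> - 1)) * indicator {D\<^sup>2<..} t \<partial>lborel)"
      by (rule nn_integral_mono) (use 1 2 in \<open>auto simp: indicator_def intro!: ennreal_leI\<close>)
    also have "\<dots> = ennreal (L * D powr (- 2 * \<alpha> - 2)) * ennreal (D\<^sup>2) + ennreal ((D\<^sup>2) powr (- \<alpha>) / \<alpha>)"
      using D \<alpha> by (subst nn_integral_add) (auto simp: nn_integral_cmult nn_integral_powr_inf)
    also have "\<dots> = ennreal ((L + 1 / \<alpha>) * D powr (- 2 * \<alpha>))"
    proof -
      have "D powr (- 2 * \<alpha> - 2) * D\<^sup>2 = D powr (- 2 * \<alpha>)"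
        using D by (simp flip: powr_numeral powr_add)
      moreover have "(D\<^sup>2) powr (- \<alpha>) = D powr (- 2 * \<alpha>)"
        using D by (simp add: powr_powr flip: powr_numeral)
      ultimately show ?thesis using L \<alpha>
        by (simp add: ennreal_mult[symmetric] ennreal_plus[symmetric] algebra_simps del: ennreal_plus)
    qed
    finally show "(\<integral>\<^sup>+t. ennreal (t powr (- \<alpha> - 1) * exp (- c * D\<^sup>2 / t)) * indicator {0<..} t \<partial>lborel)
        \<le> ennreal ((L + 1 / \<alpha>) * D powr (- 2 * \<alpha>))" .
  qed
qed

text \<open>With $\lambda = 1 + 4\pi^2|\xi|^2$, expanding the $k$-th power turns the Bessel operator into a
  superposition of heat operators, whose kernels decay away from the diagonal.\<close>

lemma fractional_power_representation:
  fixes a :: real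
  assumes a: "0 < a" "a < real k"
  obtains c where "c > 0"
    "\<And>l. l > 0 \<Longrightarrow> (\<integral>\<^sup>+t. ennreal ((1 - exp (- t * l)) ^ k * t powr (- a - 1)) * indicator {0<..} t \<partial>lborel)
       = ennreal (c * l powr a)"
proof -
  define f where "f = (\<lambda>t::real. ennreal ((1 - exp (- t)) ^ k * t powr (- a - 1)) * indicator {0<..} t)"
  have [measurable]: "f \<in> borel_measurable borel" unfolding f_def by measurable
  \<comment> \<open>Near 0 the difference factor is at most t^k with k > a, at infinity it is at
    most 1; both ends converge.\<close>
  have "(\<integral>\<^sup>+t. f t \<partial>lborel) \<le> (\<integral>\<^sup>+t. ennreal (t powr ((real k - a) - 1)) * indicator {0<..1} t
           + ennreal (t powr (- a - 1)) * indicator {1<..} t \<partial>lborel)"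
  proof (rule nn_integral_mono)
    fix t :: real
    have "(1 - exp (- t)) ^ k * t powr (- a - 1) \<le> t powr (real k - a - 1)" if t: "t > 0"
    proof -
      have "1 - exp (- t) \<le> t" using exp_ge_add_one_self[of "-t"] by simp
      then have "(1 - exp (- t)) ^ k \<le> t ^ k" using t by (intro power_mono) auto
      then have "(1 - exp (- t)) ^ k * t powr (- a - 1) \<le> t powr real k * t powr (- a - 1)"
        using t by (intro mult_right_mono) (auto simp: powr_realpow)
      also have "\<dots> = t powr (real k + (- a - 1))" by (rule powr_add[symmetric])
      also have "real k + (- a - 1) = real k - a - 1" by simp
      finally show ?thesis .
    qed
    moreover have "(1 - exp (- t)) ^ k * t powr (- a - 1) \<le> t powr (- a - 1)" if t: "t > 0"
      using t by (intro mult_left_le_one_le power_le_one) auto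
    ultimately show "f t \<le> ennreal (t powr ((real k - a) - 1)) * indicator {0<..1} t
           + ennreal (t powr (- a - 1)) * indicator {1<..} t"
      by (auto simp: f_def indicator_def intro!: ennreal_leI)
  qed
  also have "\<dots> = ennreal (1 / (real k - a)) + ennreal (1 / a)"
    using a nn_integral_powr_0[of "real k - a" 1] nn_integral_powr_inf[of a 1]
    by (subst nn_integral_add) auto
  also have "\<dots> < \<infinity>" by simp
  finally have fin: "(\<integral>\<^sup>+t. f t \<partial>lborel) < \<infinity>" .
  have pos: "(\<integral>\<^sup>+t. f t \<partial>lborel) \<noteq> 0"
  proof
    assume "(\<integral>\<^sup>+t. f t \<partial>lborel) = 0"
    then have "AE t in lborel. f t = 0" by (subst (asm) nn_integral_0_iff_AE) auto
    then have "AE t in lborel. t \<notin> {0<..<1::real}"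
      by (rule AE_mp) (auto simp: f_def intro!: AE_I2 split: if_splits)
    then have "emeasure lborel {0<..<1::real} = 0"
      by (subst (asm) AE_iff_measurable[where N="{0<..<1}"]) auto
    then show False by simp
  qed
  obtain c where c: "(\<integral>\<^sup>+t. f t \<partial>lborel) = ennreal c" "c \<ge> 0"
    using fin by (cases "\<integral>\<^sup>+t. f t \<partial>lborel") auto
  show ?thesis
  proof (rule that[of c])
    show "c > 0" using pos c by (cases "c = 0") auto
    fix l :: real assume l: "l > 0"
    \<comment> \<open>Passing to the variable l * t produces l^(a+1) and the Jacobian 1 / l, so the
      integral is a constant times l^a.\<close>
    have eq: "ennreal ((1 - exp (- t * l)) ^ k * t powr (- a - 1)) * indicator {0<..} t
      = ennreal (l powr (a + 1)) * f (0 + l *\<^sub>R t)" for t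
    proof (cases "t > 0")
      case True
      have "l powr (a + 1) * (l * t) powr (- a - 1) = (l powr (a + 1) * l powr (- a - 1)) * t powr (- a - 1)"
        using l True by (simp add: powr_mult)
      also have "l powr (a + 1) * l powr (- a - 1) = 1"
        using l powr_add[of l "a + 1" "- a - 1"] by simp
      finally have "(1 - exp (- t * l)) ^ k * t powr (- a - 1)
        = (1 - exp (- (l * t))) ^ k * (l powr (a + 1) * (l * t) powr (- a - 1))"
        by (simp add: mult.commute)
      then have "(1 - exp (- t * l)) ^ k * t powr (- a - 1)
        = l powr (a + 1) * ((1 - exp (- (l * t))) ^ k * (l * t) powr (- a - 1))"
        by (simp only: mult.left_commute)
      then show ?thesis using True l by (simp add: f_def ennreal_mult')
    qed (use l in \<open>auto simp: f_def indicator_def zero_less_mult_iff\<close>)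
    have "(\<integral>\<^sup>+t. ennreal ((1 - exp (- t * l)) ^ k * t powr (- a - 1)) * indicator {0<..} t \<partial>lborel)
        = ennreal (l powr (a + 1)) * (\<integral>\<^sup>+t. f (0 + l *\<^sub>R t) \<partial>lborel)"
      unfolding eq by (rule nn_integral_cmult) measurable
    also have "\<dots> = ennreal (l powr (a + 1)) * (ennreal (l powr - 1) * ennreal c)"
      using nn_integral_lborel_scale[of f l 0] l c by simp
    also have "\<dots> = ennreal (c * l powr a)"
      using c l by (simp add: ennreal_mult[symmetric] powr_add powr_minus field_simps)
    finally show "(\<integral>\<^sup>+t. ennreal ((1 - exp (- t * l)) ^ k * t powr (- a - 1)) * indicator {0<..} t \<partial>lborel)
       = ennreal (c * l powr a)" .
  qed
qed

lemma lam_nonneg [simp]: "0 \<le> lam x"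
  using lam_pos[of x] by simp

text \<open>The operator exp (- u (I - Delta)) applied to \<open>g\<close>, with the transforms
  ordered as in \<open>bessel_fun\<close>. At \<open>u = 0\<close> it is the Fourier inversion
  integral of \<open>g\<close>.\<close>

definition heat :: "('a::euclidean_space \<Rightarrow> complex) \<Rightarrow> real \<Rightarrow> 'a \<Rightarrow> complex" where
  "heat g u x = (\<integral>\<xi>. inv_fourier g \<xi> * of_real (exp (- u * lam \<xi>)) * cis (- 2 * pi * (x \<bullet> \<xi>)) \<partial>lborel)"

text \<open>The multiplication formula moves the inverse transform from \<open>g\<close> to a
  modulated Gaussian, whose transform is explicit: the heat kernel centred at x. The factor exp (-
  u) comes from the summand 1 of \<open>lam\<close>.\<close>

lemma heat_kernel_representation:
  fixes g :: "'a::euclidean_space \<Rightarrow> complex"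
  assumes g: "integrable lborel g" and u: "u > 0"
  shows "heat g u x = of_real (exp (- u)) *
     (\<integral>y. g y * of_real ((1 / (4 * pi * u)) powr (DIM('a) / 2) * exp (- (norm (y - x))\<^sup>2 / (4 * u))) \<partial>lborel)"
proof -
  define V where "V = (\<lambda>\<xi>::'a. of_real (exp (- (4 * pi\<^sup>2 * u) * (norm \<xi>)\<^sup>2)) * cis (- 2 * pi * (x \<bullet> \<xi>)))"
  have u': "4 * pi\<^sup>2 * u > 0" using u by simp
  have eV: "V \<xi> * cis (2 * pi * (y \<bullet> \<xi>))
      = of_real (exp (- (4 * pi\<^sup>2 * u) * (norm \<xi>)\<^sup>2)) * cis (2 * pi * ((y - x) \<bullet> \<xi>))" for y \<xi>
    by (simp add: V_def cis_mult inner_diff_left algebra_simps)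
  have V: "integrable lborel V"
    using gaussian_fourier(1)[OF u', of "- x"] by (simp add: V_def)
  have "heat g u x = (\<integral>\<xi>. of_real (exp (- u)) * (V \<xi> * (\<integral>y. g y * cis (2 * pi * (y \<bullet> \<xi>)) \<partial>lborel)) \<partial>lborel)"
  proof -
    have e: "complex_of_real (exp (- u * lam \<xi>))
      = of_real (exp (- u)) * of_real (exp (- (4 * pi\<^sup>2 * u) * (norm \<xi>)\<^sup>2))" for \<xi> :: 'a
      by (simp only: of_real_mult[symmetric] exp_add[symmetric] lam_def) (simp add: algebra_simps)
    show ?thesis
      unfolding heat_def inv_fourier_eq V_def e by (simp only: mult_ac)
  qed
  also have "\<dots> = of_real (exp (- u)) * (\<integral>\<xi>. V \<xi> * (\<integral>y. g y * cis (2 * pi * (y \<bullet> \<xi>)) \<partial>lborel) \<partial>lborel)"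
    by (rule integral_mult_right_zero)
  also have "(\<integral>\<xi>. V \<xi> * (\<integral>y. g y * cis (2 * pi * (y \<bullet> \<xi>)) \<partial>lborel) \<partial>lborel)
     = (\<integral>y. g y * (\<integral>\<xi>. V \<xi> * cis (2 * pi * (y \<bullet> \<xi>)) \<partial>lborel) \<partial>lborel)"
    by (rule fourier_multiplication_formula[OF g V, symmetric])
  also have "\<dots> = (\<integral>y. g y * of_real ((1 / (4 * pi * u)) powr (DIM('a) / 2) * exp (- (norm (y - x))\<^sup>2 / (4 * u))) \<partial>lborel)"
  proof -
    have e1: "pi / (4 * pi\<^sup>2 * u) = 1 / (4 * pi * u)" by (simp add: power2_eq_square)
    have e2: "- pi\<^sup>2 * r / (4 * pi\<^sup>2 * u) = - r / (4 * u)" for r by (simp add: power2_eq_square)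
    have "(\<integral>\<xi>. V \<xi> * cis (2 * pi * (y \<bullet> \<xi>)) \<partial>lborel)
      = of_real ((1 / (4 * pi * u)) powr (DIM('a) / 2) * exp (- (norm (y - x))\<^sup>2 / (4 * u)))" for y
      using gaussian_fourier(2)[OF u', of "y - x"] unfolding eV e1 e2 .
    then show ?thesis by simp
  qed
  finally show ?thesis .
qed

text \<open>Off the support of g only the tail of the heat kernel contributes, and the value at time
  zero is the limit of these tails; no inversion theorem is needed.\<close>

lemma heat_off_support:
  fixes g :: "'a::euclidean_space \<Rightarrow> complex"
  assumes g: "integrable lborel g" and u: "u > 0" and D: "D > 0"
    and supp: "\<And>y. g y \<noteq> 0 \<Longrightarrow> norm (y - x) \<ge> D / 2"
  shows "norm (heat g u x) \<le> exp (- u) * u powr - (DIM('a) / 2) * exp (- D\<^sup>2 / (16 * u)) * (\<integral>y. norm (g y) \<partial>lborel)"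
proof -
  define K where "K = u powr - (DIM('a) / 2) * exp (- D\<^sup>2 / (16 * u))"
  have Kle: "norm (g y * of_real ((1 / (4 * pi * u)) powr (DIM('a) / 2) * exp (- (norm (y - x))\<^sup>2 / (4 * u)))) \<le> K * norm (g y)" for y
  proof (cases "g y = 0")
    case False
    \<comment> \<open>The constant 16 that recurs below is explained by (D / 2)^2 / (4 u) = D^2 /
      (16 u).\<close>
    then have "(D / 2)\<^sup>2 \<le> (norm (y - x))\<^sup>2" using D supp by (intro power_mono) auto
    then have "exp (- (norm (y - x))\<^sup>2 / (4 * u)) \<le> exp (- D\<^sup>2 / (16 * u))"
      using u by (simp add: field_simps power2_eq_square)
    moreover have "(1 / (4 * pi * u)) powr (DIM('a) / 2) \<le> (1 / u) powr (DIM('a) / 2)"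
    proof (rule powr_mono2)
      have "1 \<le> 4 * pi" using pi_ge_two by simp
      then show "1 / (4 * pi * u) \<le> 1 / u" using u by (simp add: field_simps)
    qed (use u in auto)
    then have "(1 / (4 * pi * u)) powr (DIM('a) / 2) \<le> u powr - (DIM('a) / 2)"
      using u by (simp add: powr_minus powr_divide inverse_eq_divide)
    ultimately have "(1 / (4 * pi * u)) powr (DIM('a) / 2) * exp (- (norm (y - x))\<^sup>2 / (4 * u)) \<le> K"
      unfolding K_def by (intro mult_mono) auto
    then have "norm (g y) * ((1 / (4 * pi * u)) powr (DIM('a) / 2) * exp (- (norm (y - x))\<^sup>2 / (4 * u))) \<le> norm (g y) * K"
      by (rule mult_left_mono) simp
    then show ?thesis by (simp add: norm_mult mult_ac)
  qed simp
  have "norm (heat g u x) = exp (- u) * norm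
     (\<integral>y. g y * of_real ((1 / (4 * pi * u)) powr (DIM('a) / 2) * exp (- (norm (y - x))\<^sup>2 / (4 * u))) \<partial>lborel)"
    unfolding heat_kernel_representation[OF g u] norm_mult by simp
  also have "\<dots> \<le> exp (- u) * (\<integral>y. K * norm (g y) \<partial>lborel)"
  proof -
    have iK: "integrable lborel (\<lambda>y. K * norm (g y))" using g by simp
    have [measurable]: "g \<in> borel_measurable borel" using g by auto
    have "integrable lborel (\<lambda>y. g y * of_real ((1 / (4 * pi * u)) powr (DIM('a) / 2) * exp (- (norm (y - x))\<^sup>2 / (4 * u))))"
      by (rule Bochner_Integration.integrable_bound[OF iK])
         (measurable, rule AE_I2, rule order_trans[OF Kle], simp only: real_norm_def abs_ge_self)
    from Bochner_Integration.integral_norm_bound_integral[OF this iK Kle] show ?thesis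
      by (intro mult_left_mono) auto
  qed
  finally show ?thesis by (simp add: K_def mult_ac)
qed

lemma bessel_weight_integrable:
  fixes g :: "'a::euclidean_space \<Rightarrow> complex"
  assumes s: "s \<ge> 0" and [measurable]: "g \<in> borel_measurable borel"
    and W: "integrable lborel (\<lambda>\<xi>. of_real (lam \<xi> powr (s / 2)) * inv_fourier g \<xi>)"
  shows "integrable lborel (inv_fourier g)"
proof (rule Bochner_Integration.integrable_bound[OF W])
  have "1 \<le> lam \<xi> powr (s / 2)" for \<xi> :: 'a
    using s lam_ge_1[of \<xi>] by (intro ge_one_powr_ge_zero) auto
  from mult_right_mono[OF this norm_ge_zero]
  show "AE \<xi> in lborel. norm (inv_fourier g \<xi>) \<le> norm (of_real (lam \<xi> powr (s / 2)) * inv_fourier g \<xi>)"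
    by (intro AE_I2) (simp add: norm_mult)
qed measurable

text \<open>Pointwise inversion away from the support. It disposes of the j = 0 term in the binomial
  expansion of (1 - exp (- t lam))^k, for which there is no kernel.\<close>

lemma heat_0_off_support:
  fixes g :: "'a::euclidean_space \<Rightarrow> complex"
  assumes g: "integrable lborel g" and W: "integrable lborel (inv_fourier g)" and D: "D > 0"
    and supp: "\<And>y. g y \<noteq> 0 \<Longrightarrow> norm (y - x) \<ge> D / 2"
  shows "heat g 0 x = 0"
proof -
  define u where "u = (\<lambda>n. 1 / real (Suc n))"
  have u: "u n > 0" for n by (simp add: u_def)
  have ulim: "u \<longlonglongrightarrow> 0" unfolding u_def by (rule LIMSEQ_Suc) (rule lim_1_over_n)
  have [measurable]: "inv_fourier g \<in> borel_measurable borel" using W by auto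
  have "(\<lambda>n. heat g (u n) x) \<longlonglongrightarrow> heat g 0 x"
    unfolding heat_def
  proof (rule integral_dominated_convergence[where w="\<lambda>\<xi>. norm (inv_fourier g \<xi>)"])
    show "AE \<xi> in lborel. (\<lambda>n. inv_fourier g \<xi> * of_real (exp (- u n * lam \<xi>)) * cis (- 2 * pi * (x \<bullet> \<xi>)))
        \<longlonglongrightarrow> inv_fourier g \<xi> * of_real (exp (- 0 * lam \<xi>)) * cis (- 2 * pi * (x \<bullet> \<xi>))"
      by (intro AE_I2 tendsto_intros ulim)
    show "AE \<xi> in lborel. norm (inv_fourier g \<xi> * of_real (exp (- u n * lam \<xi>)) * cis (- 2 * pi * (x \<bullet> \<xi>))) \<le> norm (inv_fourier g \<xi>)" for n
      using u[of n] lam_nonneg by (intro AE_I2) (auto simp: norm_mult intro!: mult_left_le mult_nonneg_nonneg)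
  qed (use W in auto)
  moreover have "(\<lambda>n. heat g (u n) x) \<longlonglongrightarrow> 0"
  proof -
    define a where "a = real DIM('a) / 2"
    define L where "L = (\<integral>y. norm (g y) \<partial>lborel)"
    have L: "L \<ge> 0" by (simp add: L_def)
    \<comment> \<open>The exponent \<open>a + 1\<close> beats the prefactor u^(-a) by one power, so
      the heat values are at most a constant times u.\<close>
    obtain K where K: "K > 0" "\<And>y. y > 0 \<Longrightarrow> exp (- y) \<le> K * y powr - (a + 1)"
      using exp_minus_le_powr[of "a + 1"] by (auto simp: a_def)
    define B where "B = K * (D\<^sup>2 / 16) powr - (a + 1) * L"
    have "norm (heat g (u n) x) \<le> B * u n" for n
    proof -
      have "norm (heat g (u n) x) \<le> exp (- u n) * u n powr - a * exp (- D\<^sup>2 / (16 * u n)) * L"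
        unfolding a_def L_def by (rule heat_off_support[OF g u D supp])
      also have "\<dots> \<le> 1 * u n powr - a * (K * (D\<^sup>2 / 16 / u n) powr - (a + 1)) * L"
        using K(2)[of "D\<^sup>2 / 16 / u n"] u[of n] D L
        by (intro mult_mono mult_right_mono) (auto simp: field_simps)
      also have "(D\<^sup>2 / 16 / u n) powr - (a + 1) = (D\<^sup>2 / 16) powr - (a + 1) * u n powr (a + 1)"
      proof -
        have *: "(q / v) powr - (a + 1) = q powr - (a + 1) * v powr (a + 1)" if "q > 0" "v > 0" for q v :: real
        proof -
          have "(1 / v) powr - (a + 1) = v powr (a + 1)"
            using that powr_minus[of "1 / v" "a + 1"] powr_divide[of 1 v "a + 1"] by simp
          then show ?thesis
            using that powr_mult[of q "1 / v" "- (a + 1)"] by simp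
        qed
        show ?thesis by (rule *) (use D u[of n] in auto)
      qed
      also have "1 * u n powr - a * (K * ((D\<^sup>2 / 16) powr - (a + 1) * u n powr (a + 1))) * L
         = B * (u n powr - a * u n powr (a + 1))"
        by (simp add: B_def)
      also have "u n powr - a * u n powr (a + 1) = u n"
        using u[of n] by (simp flip: powr_add)
      finally show ?thesis .
    qed
    then have "\<forall>\<^sub>F n in sequentially. norm (heat g (u n) x) \<le> B * u n" by simp
    then show ?thesis using tendsto_mult_right_zero[OF ulim] by (rule Lim_null_comparison)
  qed
  ultimately show ?thesis by (rule LIMSEQ_unique)
qed

text \<open>By the binomial theorem (1 - exp (- t lam))^k is a signed sum of heat operators at times
  j t with j <= k. For j >= 1 the singular prefactor is worst at time t and the Gaussian at time k
  t, whence 16 k; the binomial coefficients sum to 2^k.\<close>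

lemma heat_difference_off_support:
  fixes g :: "'a::euclidean_space \<Rightarrow> complex"
  assumes g: "integrable lborel g" and W: "integrable lborel (inv_fourier g)" and D: "D > 0"
    and supp: "\<And>y. g y \<noteq> 0 \<Longrightarrow> norm (y - x) \<ge> D / 2" and t: "t > 0" and k: "k > 0"
  shows "norm (\<integral>\<xi>. inv_fourier g \<xi> * of_real ((1 - exp (- t * lam \<xi>)) ^ k) * cis (- 2 * pi * (x \<bullet> \<xi>)) \<partial>lborel)
    \<le> 2 ^ k * (exp (- t) * t powr - (DIM('a) / 2) * exp (- (1 / (16 * real k)) * D\<^sup>2 / t) * (\<integral>y. norm (g y) \<partial>lborel))"
proof -
  define B where "B = exp (- t) * t powr - (DIM('a) / 2) * exp (- (1 / (16 * real k)) * D\<^sup>2 / t) * (\<integral>y. norm (g y) \<partial>lborel)"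
  have B: "B \<ge> 0" by (simp add: B_def)
  have [measurable]: "inv_fourier g \<in> borel_measurable borel" using W by auto
  have int: "integrable lborel (\<lambda>\<xi>. inv_fourier g \<xi> * of_real (exp (- u * lam \<xi>)) * cis (- 2 * pi * (x \<bullet> \<xi>)))" if "u \<ge> 0" for u
    by (rule Bochner_Integration.integrable_bound[OF W])
       (use that in \<open>auto simp: norm_mult intro!: AE_I2 mult_left_le mult_nonneg_nonneg\<close>)
  have expand: "(1 - exp (- t * l)) ^ k = (\<Sum>j\<le>k. real (k choose j) * (-1) ^ j * exp (- (real j * t) * l))" for l :: real
  proof -
    have "(1 - exp (- t * l)) ^ k = (\<Sum>j\<le>k. real (k choose j) * (- exp (- t * l)) ^ j * 1 ^ (k - j))"
      using binomial_ring[of "- exp (- t * l)" 1 k] by simp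
    also have "\<dots> = (\<Sum>j\<le>k. real (k choose j) * (-1) ^ j * exp (- (real j * t) * l))"
      by (intro sum.cong refl) (simp add: power_minus[of "exp _"] exp_of_nat_mult[symmetric] mult_ac)
    finally show ?thesis .
  qed
  have "(\<integral>\<xi>. inv_fourier g \<xi> * of_real ((1 - exp (- t * lam \<xi>)) ^ k) * cis (- 2 * pi * (x \<bullet> \<xi>)) \<partial>lborel)
    = (\<integral>\<xi>. (\<Sum>j\<le>k. of_real (real (k choose j) * (-1) ^ j) *
         (inv_fourier g \<xi> * of_real (exp (- (real j * t) * lam \<xi>)) * cis (- 2 * pi * (x \<bullet> \<xi>)))) \<partial>lborel)"
    unfolding expand by (simp add: sum_distrib_left sum_distrib_right mult_ac)
  also have "\<dots> = (\<Sum>j\<le>k. of_real (real (k choose j) * (-1) ^ j) * heat g (real j * t) x)"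
    unfolding heat_def
    by (subst Bochner_Integration.integral_sum) (use int t in \<open>auto intro!: integrable_mult_right simp del: of_real_mult\<close>)
  finally have "norm (\<integral>\<xi>. inv_fourier g \<xi> * of_real ((1 - exp (- t * lam \<xi>)) ^ k) * cis (- 2 * pi * (x \<bullet> \<xi>)) \<partial>lborel)
     \<le> (\<Sum>j\<le>k. norm (of_real (real (k choose j) * (-1) ^ j) * heat g (real j * t) x))"
    by (simp add: norm_sum del: of_real_mult)
  also have "\<dots> \<le> (\<Sum>j\<le>k. real (k choose j) * B)"
  proof (rule sum_mono)
    fix j assume j: "j \<in> {..k}"
    have "norm (heat g (real j * t) x) \<le> B"
    proof (cases "j = 0")
      case True
      then show ?thesis using heat_0_off_support[OF g W D supp] B by simp
    next
      case False
      then have jt: "real j * t > 0" "t \<le> real j * t" using t by auto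
      have "norm (heat g (real j * t) x) \<le> exp (- (real j * t)) * (real j * t) powr - (DIM('a) / 2)
          * exp (- D\<^sup>2 / (16 * (real j * t))) * (\<integral>y. norm (g y) \<partial>lborel)"
        by (rule heat_off_support[OF g jt(1) D supp])
      also have "\<dots> \<le> B"
        unfolding B_def
      proof (intro mult_right_mono mult_mono)
        show "(real j * t) powr - (DIM('a) / 2) \<le> t powr - (DIM('a) / 2)"
          using jt t by (intro powr_mono2') auto
        have "D\<^sup>2 / (16 * (real k * t)) \<le> D\<^sup>2 / (16 * (real j * t))"
          using j jt t D by (intro divide_left_mono mult_left_mono mult_right_mono mult_pos_pos) (auto simp: k)
        then show "exp (- D\<^sup>2 / (16 * (real j * t))) \<le> exp (- (1 / (16 * real k)) * D\<^sup>2 / t)"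
          by simp
      qed (use jt in auto)
      finally show ?thesis .
    qed
    then show "norm (of_real (real (k choose j) * (-1) ^ j) * heat g (real j * t) x) \<le> real (k choose j) * B"
      by (simp add: norm_mult norm_power mult_left_mono)
  qed
  also have "\<dots> = 2 ^ k * B"
    using choose_row_sum[of k] by (simp add: sum_distrib_right[symmetric] flip: of_nat_sum of_nat_power)
  finally show ?thesis by (simp add: B_def)
qed

text \<open>\<open>fractional_power_representation\<close> with a = s / 2 is inserted under the
  Fourier integral. Integrating the absolute value over t first returns c times the modulus of the
  weighted transform, integrable by assumption, which justifies Fubini.\<close>

lemma bessel_fun_superposition:
  fixes g :: "'a::euclidean_space \<Rightarrow> complex"
  assumes s: "0 < s" "s / 2 < real k"
  obtains c where "c > 0"
    "\<And>(g :: 'a \<Rightarrow> complex) x. g \<in> borel_measurable borel \<Longrightarrow>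
       integrable lborel (\<lambda>\<xi>. of_real (lam \<xi> powr (s / 2)) * inv_fourier g \<xi>) \<Longrightarrow>
       ennreal (c * norm (bessel_fun s g x)) \<le>
         (\<integral>\<^sup>+t. ennreal (t powr (- (s / 2) - 1) *
            norm (\<integral>\<xi>. inv_fourier g \<xi> * of_real ((1 - exp (- t * lam \<xi>)) ^ k) * cis (- 2 * pi * (x \<bullet> \<xi>)) \<partial>lborel))
            * indicator {0<..} t \<partial>lborel)"
proof -
  obtain c where c: "c > 0" "\<And>l. l > 0 \<Longrightarrow> (\<integral>\<^sup>+t. ennreal ((1 - exp (- t * l)) ^ k * t powr (- (s / 2) - 1)) * indicator {0<..} t \<partial>lborel)
       = ennreal (c * l powr (s / 2))"
    using fractional_power_representation[of "s / 2" k] s by auto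
  define m where "m = (\<lambda>t l. indicator {0<..} t * ((1 - exp (- t * l)) ^ k * t powr (- (s / 2) - 1)) :: real)"
  have m_nonneg: "m t l \<ge> 0" if "l > 0" for t l
    using that by (auto simp: m_def indicator_def intro!: mult_nonneg_nonneg zero_le_power)
  have [measurable]: "(\<lambda>t. m t l) \<in> borel_measurable borel" for l
    unfolding m_def by measurable
  have mI: "(\<integral>\<^sup>+t. ennreal (m t l) \<partial>lborel) = ennreal (c * l powr (s / 2))" if "l > 0" for l
    unfolding c(2)[OF that, symmetric] m_def
    by (intro nn_integral_cong) (auto simp: indicator_def)
  have m_int: "integrable lborel (\<lambda>t. m t l)" "(\<integral>t. m t l \<partial>lborel) = c * l powr (s / 2)" if "l > 0" for l
  proof -
    show "integrable lborel (\<lambda>t. m t l)"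
      using mI[OF that] m_nonneg[OF that] by (intro integrableI_nonneg) (auto simp: top.not_eq_extremum)
    show "(\<integral>t. m t l \<partial>lborel) = c * l powr (s / 2)"
      using mI[OF that] m_nonneg[OF that] c by (simp add: integral_eq_nn_integral)
  qed
  show ?thesis
  proof (rule that[OF c(1)])
    fix g :: "'a \<Rightarrow> complex" and x :: 'a
    assume [measurable]: "g \<in> borel_measurable borel"
      and W: "integrable lborel (\<lambda>\<xi>. of_real (lam \<xi> powr (s / 2)) * inv_fourier g \<xi>)"
    define F where "F = (\<lambda>\<xi> t. inv_fourier g \<xi> * cis (- 2 * pi * (x \<bullet> \<xi>)) * of_real (m t (lam \<xi>)))"
    define A where "A = (\<lambda>t. \<integral>\<xi>. inv_fourier g \<xi> * of_real ((1 - exp (- t * lam \<xi>)) ^ k) * cis (- 2 * pi * (x \<bullet> \<xi>)) \<partial>lborel)"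
    have [measurable]: "(\<lambda>(\<xi>, t). F \<xi> t) \<in> borel_measurable (lborel \<Otimes>\<^sub>M lborel)"
      unfolding F_def m_def by measurable
    have normF: "(\<integral>t. norm (F \<xi> t) \<partial>lborel) = c * (lam \<xi> powr (s / 2) * norm (inv_fourier g \<xi>))" for \<xi>
      using m_nonneg[OF lam_pos, of _ \<xi>] m_int(2)[OF lam_pos, of \<xi>] by (simp add: F_def norm_mult)
    have "integrable (lborel \<Otimes>\<^sub>M lborel) (\<lambda>(\<xi>, t). F \<xi> t)"
    proof (rule lborel_pair.Fubini_integrable)
      show "integrable lborel (\<lambda>\<xi>. \<integral>t. norm (case (\<xi>, t) of (\<xi>, t) \<Rightarrow> F \<xi> t) \<partial>lborel)"
        using integrable_norm[OF W] unfolding prod.case normF by (simp add: norm_mult)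
      show "AE \<xi> in lborel. integrable lborel (\<lambda>t. case (\<xi>, t) of (\<xi>, t) \<Rightarrow> F \<xi> t)"
        unfolding prod.case F_def using m_int(1)[OF lam_pos]
        by (intro AE_I2 integrable_mult_right integrable_of_real) auto
    qed measurable
    note int = this
    have Fub: "(\<integral>\<xi>. (\<integral>t. F \<xi> t \<partial>lborel) \<partial>lborel) = (\<integral>t. (\<integral>\<xi>. F \<xi> t \<partial>lborel) \<partial>lborel)"
      using lborel_pair.Fubini_integral[OF int] by simp
    have intt: "integrable lborel (\<lambda>t. \<integral>\<xi>. F \<xi> t \<partial>lborel)"
      using lborel_pair.integrable_snd[OF int] .
    have "(\<integral>\<xi>. (\<integral>t. F \<xi> t \<partial>lborel) \<partial>lborel) = of_real c * bessel_fun s g x"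
    proof -
      have "(\<integral>t. F \<xi> t \<partial>lborel)
        = of_real c * (of_real (lam \<xi> powr (s / 2)) * inv_fourier g \<xi> * cis (- 2 * pi * (\<xi> \<bullet> x)))" for \<xi>
        unfolding F_def using m_int(2)[OF lam_pos, of \<xi>]
        by (subst integral_mult_right_zero) (simp add: inner_commute[of x])
      then show ?thesis unfolding bessel_fun_def fourier_def by simp
    qed
    then have "ennreal (c * norm (bessel_fun s g x)) = ennreal (norm (\<integral>t. (\<integral>\<xi>. F \<xi> t \<partial>lborel) \<partial>lborel))"
      using c(1) Fub by (simp add: norm_mult)
    also have "\<dots> \<le> (\<integral>\<^sup>+t. ennreal (norm (\<integral>\<xi>. F \<xi> t \<partial>lborel)) \<partial>lborel)"
      by (rule integral_norm_bound_ennreal[OF intt])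
    also have "\<dots> = (\<integral>\<^sup>+t. ennreal (t powr (- (s / 2) - 1) * norm (A t)) * indicator {0<..} t \<partial>lborel)"
    proof (rule nn_integral_cong)
      fix t :: real
      have "(\<integral>\<xi>. F \<xi> t \<partial>lborel) = of_real (t powr (- (s / 2) - 1)) * A t" if "t > 0"
        unfolding A_def F_def m_def using that
        by (simp add: mult_ac flip: integral_mult_right_zero)
      moreover have "(\<integral>\<xi>. F \<xi> t \<partial>lborel) = 0" if "\<not> t > 0"
        unfolding F_def m_def using that by simp
      ultimately show "ennreal (norm (\<integral>\<xi>. F \<xi> t \<partial>lborel)) = ennreal (t powr (- (s / 2) - 1) * norm (A t)) * indicator {0<..} t"
        by (auto simp: norm_mult indicator_def)
    qed
    finally show "ennreal (c * norm (bessel_fun s g x)) \<le>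
         (\<integral>\<^sup>+t. ennreal (t powr (- (s / 2) - 1) *
            norm (\<integral>\<xi>. inv_fourier g \<xi> * of_real ((1 - exp (- t * lam \<xi>)) ^ k) * cis (- 2 * pi * (x \<bullet> \<xi>)) \<partial>lborel))
            * indicator {0<..} t \<partial>lborel)"
      by (simp add: A_def)
  qed
qed

text \<open>The heat representation yields decay in the distance to the support. Its factor exp (-
  t), due to the summand I of I - Delta, can be traded for any negative power of t, so every rate M
  >= d + s is available.\<close>

lemma bessel_fun_off_support:
  assumes s: "0 < s" and M: "real DIM('a::euclidean_space) + s \<le> M"
  obtains C where "C \<ge> 0"
    "\<And>(g :: 'a \<Rightarrow> complex) x D. integrable lborel g \<Longrightarrow>
       integrable lborel (\<lambda>\<xi>. of_real (lam \<xi> powr (s / 2)) * inv_fourier g \<xi>) \<Longrightarrow> D > 0 \<Longrightarrow>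
       (\<And>y. g y \<noteq> 0 \<Longrightarrow> norm (y - x) \<ge> D / 2) \<Longrightarrow>
       norm (bessel_fun s g x) \<le> C * (\<integral>y. norm (g y) \<partial>lborel) * D powr - M"
proof -
  define k where "k = nat \<lceil>s / 2\<rceil> + 1"
  have k: "s / 2 < real k" "k > 0" by (auto simp: k_def) linarith+
  obtain c where c: "c > 0"
    "\<And>(g :: 'a \<Rightarrow> complex) x. g \<in> borel_measurable borel \<Longrightarrow>
       integrable lborel (\<lambda>\<xi>. of_real (lam \<xi> powr (s / 2)) * inv_fourier g \<xi>) \<Longrightarrow>
       ennreal (c * norm (bessel_fun s g x)) \<le>
         (\<integral>\<^sup>+t. ennreal (t powr (- (s / 2) - 1) *
            norm (\<integral>\<xi>. inv_fourier g \<xi> * of_real ((1 - exp (- t * lam \<xi>)) ^ k) * cis (- 2 * pi * (x \<bullet> \<xi>)) \<partial>lborel))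
            * indicator {0<..} t \<partial>lborel)"
    using bessel_fun_superposition[OF s k(1), where 'a='a] by blast
  \<comment> \<open>Chosen so that s / 2 + d / 2 + \<beta> = M / 2: trading exp (- t) for
    t^(-\<beta>) turns the total power of t into t^(-M/2-1).\<close>
  define \<beta> where "\<beta> = (M - DIM('a) - s) / 2"
  have \<beta>: "\<beta> \<ge> 0" using M by (simp add: \<beta>_def)
  obtain K where K: "K > 0" "\<And>y. y > 0 \<Longrightarrow> exp (- y) \<le> K * y powr - \<beta>"
    using exp_minus_le_powr[OF \<beta>] by auto
  have Mpos: "M / 2 > 0" using s M by (intro divide_pos_pos) (auto intro: less_le_trans[OF _ M] add_nonneg_pos)
  define c' where "c' = 1 / (16 * real k)"
  have c': "c' > 0" using k by (simp add: c'_def)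
  obtain L where L: "L \<ge> 0" "\<And>D. D > 0 \<Longrightarrow> (\<integral>\<^sup>+t. ennreal (t powr (- (M / 2) - 1) * exp (- c' * D\<^sup>2 / t)) * indicator {0<..} t \<partial>lborel)
        \<le> ennreal (L * D powr (- 2 * (M / 2)))"
    using nn_integral_heat_bound[OF Mpos c'] by blast
  show ?thesis
  proof (rule that[of "2 ^ k * K * L / c"])
    show "0 \<le> 2 ^ k * K * L / c" using K L c by simp
    fix g :: "'a \<Rightarrow> complex" and x :: 'a and D :: real
    assume g: "integrable lborel g" 
      and W: "integrable lborel (\<lambda>\<xi>. of_real (lam \<xi> powr (s / 2)) * inv_fourier g \<xi>)"
      and D: "D > 0" and supp: "\<And>y. g y \<noteq> 0 \<Longrightarrow> norm (y - x) \<ge> D / 2"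
    define G where "G = (\<integral>y. norm (g y) \<partial>lborel)"
    have G: "G \<ge> 0" by (simp add: G_def)
    have gm: "g \<in> borel_measurable borel" using g by auto
    have Wi: "integrable lborel (inv_fourier g)"
      using bessel_weight_integrable[OF _ gm W] s by simp
    have "ennreal (c * norm (bessel_fun s g x)) \<le>
         (\<integral>\<^sup>+t. ennreal (t powr (- (s / 2) - 1) *
            norm (\<integral>\<xi>. inv_fourier g \<xi> * of_real ((1 - exp (- t * lam \<xi>)) ^ k) * cis (- 2 * pi * (x \<bullet> \<xi>)) \<partial>lborel))
            * indicator {0<..} t \<partial>lborel)"
      by (rule c(2)[OF gm W])
    also have "\<dots> \<le> (\<integral>\<^sup>+t. ennreal (2 ^ k * K * G) * (ennreal (t powr (- (M / 2) - 1) * exp (- c' * D\<^sup>2 / t)) * indicator {0<..} t) \<partial>lborel)"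
    proof (rule nn_integral_mono)
      fix t :: real
      have "t powr (- (s / 2) - 1) *
            norm (\<integral>\<xi>. inv_fourier g \<xi> * of_real ((1 - exp (- t * lam \<xi>)) ^ k) * cis (- 2 * pi * (x \<bullet> \<xi>)) \<partial>lborel)
         \<le> 2 ^ k * K * G * (t powr (- (M / 2) - 1) * exp (- c' * D\<^sup>2 / t))" if t: "t > 0"
      proof -
        have "norm (\<integral>\<xi>. inv_fourier g \<xi> * of_real ((1 - exp (- t * lam \<xi>)) ^ k) * cis (- 2 * pi * (x \<bullet> \<xi>)) \<partial>lborel)
           \<le> 2 ^ k * (exp (- t) * t powr - (DIM('a) / 2) * exp (- c' * D\<^sup>2 / t) * G)"
          unfolding c'_def G_def by (rule heat_difference_off_support[OF g Wi D supp t k(2)])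
        also have "\<dots> \<le> 2 ^ k * ((K * t powr - \<beta>) * t powr - (DIM('a) / 2) * exp (- c' * D\<^sup>2 / t) * G)"
          using K(2)[OF t] G by (intro mult_left_mono mult_right_mono) auto
        finally have "t powr (- (s / 2) - 1) *
            norm (\<integral>\<xi>. inv_fourier g \<xi> * of_real ((1 - exp (- t * lam \<xi>)) ^ k) * cis (- 2 * pi * (x \<bullet> \<xi>)) \<partial>lborel)
            \<le> t powr (- (s / 2) - 1) * (2 ^ k * ((K * t powr - \<beta>) * t powr - (DIM('a) / 2) * exp (- c' * D\<^sup>2 / t) * G))"
          by (rule mult_left_mono) simp
        also have "\<dots> = 2 ^ k * K * G * ((t powr (- (s / 2) - 1) * (t powr - \<beta> * t powr - (DIM('a) / 2))) * exp (- c' * D\<^sup>2 / t))"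
          by (simp only: mult_ac)
        also have "t powr (- (s / 2) - 1) * (t powr - \<beta> * t powr - (DIM('a) / 2)) = t powr (- (M / 2) - 1)"
        proof -
          have e: "- (s / 2) - 1 + (- \<beta> + - (DIM('a) / 2)) = - (M / 2) - 1"
            by (simp add: \<beta>_def field_simps)
          show ?thesis by (simp only: powr_add[symmetric] e)
        qed
        finally show ?thesis .
      qed
      then show "ennreal (t powr (- (s / 2) - 1) *
            norm (\<integral>\<xi>. inv_fourier g \<xi> * of_real ((1 - exp (- t * lam \<xi>)) ^ k) * cis (- 2 * pi * (x \<bullet> \<xi>)) \<partial>lborel))
            * indicator {0<..} t
          \<le> ennreal (2 ^ k * K * G) * (ennreal (t powr (- (M / 2) - 1) * exp (- c' * D\<^sup>2 / t)) * indicator {0<..} t)"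
        using K G by (auto simp: indicator_def ennreal_mult'[symmetric] intro!: ennreal_leI)
    qed
    also have "\<dots> = ennreal (2 ^ k * K * G) * (\<integral>\<^sup>+t. ennreal (t powr (- (M / 2) - 1) * exp (- c' * D\<^sup>2 / t)) * indicator {0<..} t \<partial>lborel)"
      by (rule nn_integral_cmult) measurable
    also have "\<dots> \<le> ennreal (2 ^ k * K * G) * ennreal (L * D powr (- 2 * (M / 2)))"
      by (intro mult_left_mono L(2) D) simp
    also have "\<dots> = ennreal (2 ^ k * K * G * (L * D powr - M))"
      using K G by (simp add: ennreal_mult'[symmetric])
    finally have "c * norm (bessel_fun s g x) \<le> 2 ^ k * K * G * (L * D powr - M)"
      using K G L by (subst (asm) ennreal_le_iff) auto
    then show "norm (bessel_fun s g x) \<le> 2 ^ k * K * L / c * (\<integral>y. norm (g y) \<partial>lborel) * D powr - M"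
      using c(1) by (simp add: G_def[symmetric] field_simps)
  qed
qed

section \<open>Averaged bumps\<close>

lemma lam_powr_add:
  assumes "a \<ge> 0"
  shows "lam (x + y) powr a \<le> 2 powr a * (lam x powr a * lam y powr a)"
proof -
  have "lam (x + y) powr a \<le> (2 * lam x * lam y) powr a"
    using assms lam_add by (intro powr_mono2) auto
  then show ?thesis by (simp add: powr_mult)
qed

lemma lam_powr_scale:
  assumes "0 < \<rho>" "\<rho> \<le> 1" "s \<ge> 0"
  shows "lam x powr (s / 2) \<le> \<rho> powr - s * lam (\<rho> *\<^sub>R x) powr (s / 2)"
proof -
  have "\<rho>\<^sup>2 * lam x \<le> lam (\<rho> *\<^sub>R x)"
    using assms power_le_one[of \<rho> 2] by (simp add: lam_def power_mult_distrib algebra_simps)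
  then have "(\<rho>\<^sup>2 * lam x) powr (s / 2) \<le> lam (\<rho> *\<^sub>R x) powr (s / 2)"
    using assms by (intro powr_mono2) auto
  moreover have "(\<rho>\<^sup>2 * lam x) powr (s / 2) = \<rho> powr s * lam x powr (s / 2)"
  proof -
    have "(\<rho>\<^sup>2) powr (s / 2) = (\<rho> powr 2) powr (s / 2)" using assms by simp
    also have "\<dots> = \<rho> powr s" by (subst powr_powr) simp
    finally show ?thesis by (simp add: powr_mult)
  qed
  ultimately have "\<rho> powr - s * (\<rho> powr s * lam x powr (s / 2)) \<le> \<rho> powr - s * lam (\<rho> *\<^sub>R x) powr (s / 2)"
    by (intro mult_left_mono) auto
  moreover have "\<rho> powr - s * \<rho> powr s = 1" using assms by (simp flip: powr_add)
  ultimately show ?thesis by (simp flip: mult.assoc)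
qed

definition sbump :: "nat \<Rightarrow> real \<Rightarrow> 'a::euclidean_space \<Rightarrow> 'a \<Rightarrow> real" where
  "sbump N \<rho> a x = bumpd N ((x - a) /\<^sub>R \<rho>)"

lemma borel_measurable_sbump [measurable]: "sbump N \<rho> a \<in> borel_measurable borel"
  unfolding sbump_def by measurable

lemma continuous_on_sbump: "continuous_on A (sbump N \<rho> a)"
  unfolding sbump_def by (intro continuous_on_compose2[OF continuous_on_bumpd[of UNIV]] continuous_intros) auto

lemma sbump_center [simp]: "sbump N \<rho> a a = 1"
  by (simp add: sbump_def)

lemma sbump_nonneg [simp]: "0 \<le> sbump N \<rho> a x" and sbump_le_1 [simp]: "sbump N \<rho> a x \<le> 1"
  by (simp_all add: sbump_def bumpd_nonneg bumpd_le_1)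

lemma sbump_support:
  fixes a :: "'a::euclidean_space" and \<rho> :: real
  assumes "N > 0" "\<rho> > 0" "sbump N \<rho> a x \<noteq> 0"
  shows "norm (x - a) \<le> DIM('a) * \<rho>"
proof (rule ccontr)
  assume "\<not> ?thesis"
  then have "norm (x - a) / \<rho> > DIM('a)" using assms by (simp add: field_simps)
  then have "norm ((x - a) /\<^sub>R \<rho>) > DIM('a)" using assms by (simp add: divide_inverse mult.commute)
  with assms bumpd_eq_0[of N "(x - a) /\<^sub>R \<rho>"] show False by (simp add: sbump_def)
qed

lemma sbump_integrable:
  fixes a :: "'a::euclidean_space"
  assumes "N > 0" "\<rho> > 0"
  shows "integrable lborel (\<lambda>x. complex_of_real (sbump N \<rho> a x) * cis (c * (x \<bullet> \<xi>)))"
    and "(\<integral>\<^sup>+x. ennreal (sbump N \<rho> a x) \<partial>lborel) = ennreal (\<rho> powr DIM('a)) * (\<integral>\<^sup>+x. ennreal (bumpd N (x::'a)) \<partial>lborel)"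
proof -
  have "(\<integral>\<^sup>+x. ennreal (bumpd N ((x - a) /\<^sub>R \<rho>)) \<partial>lborel)
     = ennreal ((1 / \<rho>) powr - real DIM('a)) * (\<integral>\<^sup>+x. ennreal (bumpd N (x::'a)) \<partial>lborel)"
    using nn_integral_lborel_scale[of "\<lambda>x. ennreal (bumpd N x)" "1 / \<rho>" "- a /\<^sub>R \<rho>"] assms
    by (simp add: algebra_simps divide_inverse)
  then show eq: "(\<integral>\<^sup>+x. ennreal (sbump N \<rho> a x) \<partial>lborel) = ennreal (\<rho> powr DIM('a)) * (\<integral>\<^sup>+x. ennreal (bumpd N (x::'a)) \<partial>lborel)"
    using assms by (simp add: sbump_def powr_divide powr_minus_divide)
  have "integrable lborel (\<lambda>x::'a. complex_of_real (bumpd N x))"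
    using bumpd_fourier(1)[OF assms(1), of "0::'a"] by simp
  then have "(\<integral>\<^sup>+x. ennreal (bumpd N (x::'a)) \<partial>lborel) < \<infinity>"
    by (simp add: integrable_iff_bounded bumpd_nonneg)
  then show "integrable lborel (\<lambda>x. complex_of_real (sbump N \<rho> a x) * cis (c * (x \<bullet> \<xi>)))"
    by (intro integrableI_bounded) (auto simp: norm_mult eq ennreal_mult_less_top)
qed

lemma sbump_fourier:
  fixes a \<zeta> :: "'a::euclidean_space"
  assumes "\<rho> > 0"
  shows "norm (\<integral>x. of_real (sbump N \<rho> a x) * cis (2 * pi * (x \<bullet> \<zeta>)) \<partial>lborel)
    = \<rho> powr DIM('a) * norm (\<integral>x. of_real (bumpd N x) * cis (2 * pi * (x \<bullet> (\<rho> *\<^sub>R \<zeta>))) \<partial>lborel)"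
proof -
  define F where "F = (\<lambda>x. of_real (sbump N \<rho> a x) * cis (2 * pi * (x \<bullet> \<zeta>)))"
  have [measurable]: "F \<in> borel_measurable borel" unfolding F_def by measurable
  have F: "F (a + \<rho> *\<^sub>R x) = cis (2 * pi * (a \<bullet> \<zeta>)) * (of_real (bumpd N x) * cis (2 * pi * (x \<bullet> (\<rho> *\<^sub>R \<zeta>))))" for x
    using assms by (simp add: F_def sbump_def inner_add_left distrib_left cis_mult mult_ac)
  have "norm (\<integral>x. F (a + \<rho> *\<^sub>R x) \<partial>lborel) = \<rho> powr - real DIM('a) * norm (\<integral>x. F x \<partial>lborel)"
    by (subst lborel_integral_scale) (use assms in \<open>auto simp: norm_mult\<close>)
  moreover have "norm (\<integral>x. F (a + \<rho> *\<^sub>R x) \<partial>lborel)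
     = norm (\<integral>x. of_real (bumpd N x) * cis (2 * pi * (x \<bullet> (\<rho> *\<^sub>R \<zeta>))) \<partial>lborel)"
    unfolding F by (subst integral_mult_right_zero) (simp add: norm_mult)
  ultimately have "norm (\<integral>x. F x \<partial>lborel) = \<rho> powr DIM('a) *
      norm (\<integral>x. of_real (bumpd N x) * cis (2 * pi * (x \<bullet> (\<rho> *\<^sub>R \<zeta>))) \<partial>lborel)"
    using assms by (simp add: powr_minus field_simps)
  then show ?thesis unfolding F_def .
qed

text \<open>The inverse transform of the product is the convolution of \<Psi> with the inverse
  transform of the bump, and the weight is submultiplicative, so the weighted L^1 norm splits.
  Moving the centre only changes a phase, so the constant does not depend on it.\<close>

lemma bump_times_fourier_weighted:
  fixes \<Psi> :: "'a::euclidean_space \<Rightarrow> complex"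
  assumes \<Psi>: "schwartz \<Psi>" and s: "s \<ge> 0" and N: "real N \<ge> s + 2"
  obtains C where "C \<ge> 0"
    "\<And>\<rho> a. 0 < \<rho> \<Longrightarrow> \<rho> \<le> 1 \<Longrightarrow>
      (\<integral>\<^sup>+\<xi>. ennreal (lam \<xi> powr (s / 2) * norm (inv_fourier (\<lambda>x. of_real (sbump N \<rho> a x) * fourier \<Psi> x) \<xi>)) \<partial>lborel)
       \<le> ennreal (C * \<rho> powr - s)"
proof -
  have N0: "N > 0" using s N by (cases N) auto
  have \<Psi>i: "integrable lborel \<Psi>" by (rule schwartz_integrable[OF \<Psi>])
  have [measurable]: "\<Psi> \<in> borel_measurable borel" using \<Psi>i by auto
  define B1 where "B1 = (\<lambda>z::'a. norm (\<integral>x. of_real (bumpd N x) * cis (2 * pi * (x \<bullet> z)) \<partial>lborel))"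
  have [measurable]: "B1 \<in> borel_measurable borel"
    unfolding B1_def by measurable
  have "(\<integral>\<^sup>+z. ennreal (lam z powr (s / 2) * B1 z) \<partial>lborel) < \<infinity>"
    unfolding B1_def by (rule bumpd_fourier_weighted[OF s N])
  then obtain Q where Q: "(\<integral>\<^sup>+z. ennreal (lam z powr (s / 2) * B1 z) \<partial>lborel) = ennreal Q" "Q \<ge> 0"
    by (cases "\<integral>\<^sup>+z. ennreal (lam z powr (s / 2) * B1 z) \<partial>lborel") auto
  have "(\<integral>\<^sup>+y. ennreal (lam y powr (s / 2) * norm (\<Psi> y)) \<partial>lborel) < \<infinity>"
    using schwartz_integrable_weighted[OF \<Psi>, of "s / 2"] s
    by (simp add: integrable_iff_bounded norm_mult)
  then obtain P where P: "(\<integral>\<^sup>+y. ennreal (lam y powr (s / 2) * norm (\<Psi> y)) \<partial>lborel) = ennreal P" "P \<ge> 0"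
    by (cases "\<integral>\<^sup>+y. ennreal (lam y powr (s / 2) * norm (\<Psi> y)) \<partial>lborel") auto
  show ?thesis
  proof (rule that[of "2 powr (s / 2) * P * Q"])
    show "0 \<le> 2 powr (s / 2) * P * Q" using P Q by simp
    fix \<rho> :: real and a :: 'a assume \<rho>: "0 < \<rho>" "\<rho> \<le> 1"
    define B where "B = (\<lambda>z::'a. \<integral>x. of_real (sbump N \<rho> a x) * cis (2 * pi * (x \<bullet> z)) \<partial>lborel)"
    define g where "g = (\<lambda>x. of_real (sbump N \<rho> a x) * fourier \<Psi> x)"
    have [measurable]: "B \<in> borel_measurable borel" unfolding B_def by measurable
    have repr: "inv_fourier g \<xi> = (\<integral>y. \<Psi> y * B (\<xi> - y) \<partial>lborel)" for \<xi>
    proof -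
      have "inv_fourier g \<xi> = (\<integral>x. (of_real (sbump N \<rho> a x) * cis (2 * pi * (x \<bullet> \<xi>))) *
              (\<integral>y. \<Psi> y * cis ((- 2 * pi) * (x \<bullet> y)) \<partial>lborel) \<partial>lborel)"
        by (simp add: inv_fourier_eq g_def fourier_def inner_commute mult_ac)
      also have "\<dots> = (\<integral>y. \<Psi> y * (\<integral>x. (of_real (sbump N \<rho> a x) * cis (2 * pi * (x \<bullet> \<xi>))) *
              cis ((- 2 * pi) * (x \<bullet> y)) \<partial>lborel) \<partial>lborel)"
        by (rule fourier_multiplication_formula[OF sbump_integrable(1)[OF N0 \<rho>(1)] \<Psi>i])
      also have "\<dots> = (\<integral>y. \<Psi> y * B (\<xi> - y) \<partial>lborel)"
        unfolding B_def by (simp add: cis_mult inner_diff_right algebra_simps)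
      finally show ?thesis .
    qed
    have norm_le: "ennreal (norm (inv_fourier g \<xi>)) \<le> (\<integral>\<^sup>+y. ennreal (norm (\<Psi> y) * norm (B (\<xi> - y))) \<partial>lborel)" for \<xi>
    proof (cases "integrable lborel (\<lambda>y. \<Psi> y * B (\<xi> - y))")
      case True
      then show ?thesis unfolding repr using integral_norm_bound_ennreal[OF True] by (simp add: norm_mult)
    next
      case False
      \<comment> \<open>Without integrability the Bochner integral is 0 by convention and the bound
        is trivial.\<close>
      then show ?thesis unfolding repr by (simp add: not_integrable_integral_eq)
    qed
    have "(\<integral>\<^sup>+\<xi>. ennreal (lam \<xi> powr (s / 2) * norm (inv_fourier g \<xi>)) \<partial>lborel)
       \<le> (\<integral>\<^sup>+\<xi>. (\<integral>\<^sup>+y. ennreal (2 powr (s / 2)) * (ennreal (lam y powr (s / 2) * norm (\<Psi> y)) *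
              ennreal (lam (\<xi> - y) powr (s / 2) * norm (B (\<xi> - y)))) \<partial>lborel) \<partial>lborel)"
    proof (rule nn_integral_mono)
      fix \<xi> :: 'a
      have "ennreal (lam \<xi> powr (s / 2) * norm (inv_fourier g \<xi>))
         \<le> ennreal (lam \<xi> powr (s / 2)) * (\<integral>\<^sup>+y. ennreal (norm (\<Psi> y) * norm (B (\<xi> - y))) \<partial>lborel)"
        by (subst ennreal_mult') (auto intro!: mult_left_mono norm_le)
      also have "\<dots> = (\<integral>\<^sup>+y. ennreal (lam \<xi> powr (s / 2)) * ennreal (norm (\<Psi> y) * norm (B (\<xi> - y))) \<partial>lborel)"
        by (rule nn_integral_cmult[symmetric]) measurable
      also have "\<dots> \<le> (\<integral>\<^sup>+y. ennreal (2 powr (s / 2)) * (ennreal (lam y powr (s / 2) * norm (\<Psi> y)) *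
              ennreal (lam (\<xi> - y) powr (s / 2) * norm (B (\<xi> - y)))) \<partial>lborel)"
      proof (rule nn_integral_mono)
        fix y :: 'a
        have "lam \<xi> powr (s / 2) * (norm (\<Psi> y) * norm (B (\<xi> - y)))
           \<le> (2 powr (s / 2) * (lam y powr (s / 2) * lam (\<xi> - y) powr (s / 2))) * (norm (\<Psi> y) * norm (B (\<xi> - y)))"
          using lam_powr_add[of "s / 2" y "\<xi> - y"] s by (intro mult_right_mono) auto
        then show "ennreal (lam \<xi> powr (s / 2)) * ennreal (norm (\<Psi> y) * norm (B (\<xi> - y)))
           \<le> ennreal (2 powr (s / 2)) * (ennreal (lam y powr (s / 2) * norm (\<Psi> y)) *
              ennreal (lam (\<xi> - y) powr (s / 2) * norm (B (\<xi> - y))))"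
          by (simp add: ennreal_mult'[symmetric] mult_ac)
      qed
      finally show "ennreal (lam \<xi> powr (s / 2) * norm (inv_fourier g \<xi>)) \<le> (\<integral>\<^sup>+y. ennreal (2 powr (s / 2)) * (ennreal (lam y powr (s / 2) * norm (\<Psi> y)) *
              ennreal (lam (\<xi> - y) powr (s / 2) * norm (B (\<xi> - y)))) \<partial>lborel)" .
    qed
    also have "\<dots> = (\<integral>\<^sup>+y. (\<integral>\<^sup>+\<xi>. ennreal (2 powr (s / 2)) * (ennreal (lam y powr (s / 2) * norm (\<Psi> y)) *
              ennreal (lam (\<xi> - y) powr (s / 2) * norm (B (\<xi> - y)))) \<partial>lborel) \<partial>lborel)"
      by (rule lborel_pair.Fubini') measurable
    also have "\<dots> = (\<integral>\<^sup>+y. ennreal (2 powr (s / 2)) * (ennreal (lam y powr (s / 2) * norm (\<Psi> y)) *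
              (\<integral>\<^sup>+\<xi>. ennreal (lam (\<xi> - y) powr (s / 2) * norm (B (\<xi> - y))) \<partial>lborel)) \<partial>lborel)"
      by (intro nn_integral_cong) (simp add: nn_integral_cmult)
    also have "\<dots> = (\<integral>\<^sup>+y. ennreal (2 powr (s / 2)) * (ennreal (lam y powr (s / 2) * norm (\<Psi> y)) *
              (\<integral>\<^sup>+\<xi>. ennreal (lam \<xi> powr (s / 2) * norm (B \<xi>)) \<partial>lborel)) \<partial>lborel)"
      using nn_integral_lborel_translation[of "\<lambda>\<xi>. ennreal (lam \<xi> powr (s / 2) * norm (B \<xi>))" "- y" for y]
      by simp
    also have "\<dots> = ennreal (2 powr (s / 2)) * (ennreal P * (\<integral>\<^sup>+\<xi>. ennreal (lam \<xi> powr (s / 2) * norm (B \<xi>)) \<partial>lborel))"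
      by (simp add: nn_integral_cmult nn_integral_multc P)
    \<comment> \<open>The amplitude of the transformed bump contributes \<rho>^d, the weight
      \<rho>^(-s) and the change of variables \<rho>^(-d); only \<rho>^(-s) survives.\<close>
    also have "(\<integral>\<^sup>+\<xi>. ennreal (lam \<xi> powr (s / 2) * norm (B \<xi>)) \<partial>lborel) \<le>
       (\<integral>\<^sup>+\<xi>. ennreal (\<rho> powr (DIM('a) - s)) * ennreal (lam (0 + \<rho> *\<^sub>R \<xi>) powr (s / 2) * B1 (0 + \<rho> *\<^sub>R \<xi>)) \<partial>lborel)"
    proof (rule nn_integral_mono)
      fix \<xi> :: 'a
      have "lam \<xi> powr (s / 2) * norm (B \<xi>) \<le> (\<rho> powr - s * lam (\<rho> *\<^sub>R \<xi>) powr (s / 2)) * norm (B \<xi>)"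
        using lam_powr_scale[OF \<rho> s] by (rule mult_right_mono) simp
      also have "\<dots> = (\<rho> powr - s * \<rho> powr DIM('a)) * (lam (\<rho> *\<^sub>R \<xi>) powr (s / 2) * B1 (\<rho> *\<^sub>R \<xi>))"
        unfolding B_def B1_def sbump_fourier[OF \<rho>(1)] by simp
      also have "\<rho> powr - s * \<rho> powr DIM('a) = \<rho> powr (DIM('a) - s)"
        by (simp flip: powr_add)
      finally show "ennreal (lam \<xi> powr (s / 2) * norm (B \<xi>)) \<le> ennreal (\<rho> powr (DIM('a) - s)) * ennreal (lam (0 + \<rho> *\<^sub>R \<xi>) powr (s / 2) * B1 (0 + \<rho> *\<^sub>R \<xi>))"
        by (simp add: ennreal_mult'[symmetric] ennreal_leI)
    qed
    also have "\<dots> = ennreal (\<rho> powr (DIM('a) - s)) * (ennreal (\<rho> powr - real DIM('a)) * ennreal Q)"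
      using nn_integral_lborel_scale[of "\<lambda>\<xi>. ennreal (lam \<xi> powr (s / 2) * B1 \<xi>)" \<rho> 0] \<rho>
      by (subst nn_integral_cmult) (simp_all add: Q)
    also have "\<dots> = ennreal (\<rho> powr - s * Q)"
      using Q by (simp add: ennreal_mult'[symmetric] mult.assoc[symmetric] flip: powr_add)
    also have "ennreal (2 powr (s / 2)) * (ennreal P * ennreal (\<rho> powr - s * Q)) = ennreal (2 powr (s / 2) * P * Q * \<rho> powr - s)"
      using P Q by (simp add: ennreal_mult'[symmetric] mult_ac)
    finally show "(\<integral>\<^sup>+\<xi>. ennreal (lam \<xi> powr (s / 2) * norm (inv_fourier (\<lambda>x. of_real (sbump N \<rho> a x) * fourier \<Psi> x) \<xi>)) \<partial>lborel)
       \<le> ennreal (2 powr (s / 2) * P * Q * \<rho> powr - s)"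
      by (simp add: g_def mult_left_mono)
  qed
qed

text \<open>The uniform bound on the potential is the weighted L^1 norm of the transform; the decay
  comes from \<open>bessel_fun_off_support\<close>, with the mass of the bump as the factor
  \<rho>^d. Close to the support that lemma says nothing, but there the uniform bound is the
  stronger one, so both estimates hold for all x different from a.\<close>

lemma bump_times_fourier_bounds:
  fixes \<Psi> :: "'a::euclidean_space \<Rightarrow> complex"
  assumes \<Psi>: "schwartz \<Psi>" and s: "s > 0" and N: "real N \<ge> s + 2" and M: "real DIM('a) + s \<le> M"
  obtains C where "C > 0"
    "\<And>\<rho> a. 0 < \<rho> \<Longrightarrow> \<rho> \<le> 1 \<Longrightarrow>
      (let g = (\<lambda>x. of_real (sbump N \<rho> a x) * fourier \<Psi> x); h = bessel_fun s g in
       integrable lborel g \<and> bessel_rep s g h \<and>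
       (\<integral>\<^sup>+x. ennreal (norm (g x)) \<partial>lborel) \<le> ennreal (C * \<rho> powr DIM('a)) \<and>
       (\<forall>x. norm (h x) \<le> C * \<rho> powr - s) \<and>
       (\<forall>x. x \<noteq> a \<longrightarrow> norm (h x) \<le> C * (\<rho> powr DIM('a) * norm (x - a) powr - M)))"
proof -
  have N0: "N > 0" using s N by (cases N) auto
  obtain C1 where C1: "C1 \<ge> 0" "\<And>\<rho> a. 0 < \<rho> \<Longrightarrow> \<rho> \<le> 1 \<Longrightarrow>
      (\<integral>\<^sup>+\<xi>. ennreal (lam \<xi> powr (s / 2) * norm (inv_fourier (\<lambda>x. of_real (sbump N \<rho> a x) * fourier \<Psi> x) \<xi>)) \<partial>lborel)
       \<le> ennreal (C1 * \<rho> powr - s)"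
    using bump_times_fourier_weighted[OF \<Psi> _ N] s by auto
  obtain C2 where C2: "C2 \<ge> 0"
    "\<And>(g :: 'a \<Rightarrow> complex) x D. integrable lborel g \<Longrightarrow>
       integrable lborel (\<lambda>\<xi>. of_real (lam \<xi> powr (s / 2)) * inv_fourier g \<xi>) \<Longrightarrow> D > 0 \<Longrightarrow>
       (\<And>y. g y \<noteq> 0 \<Longrightarrow> norm (y - x) \<ge> D / 2) \<Longrightarrow>
       norm (bessel_fun s g x) \<le> C2 * (\<integral>y. norm (g y) \<partial>lborel) * D powr - M"
    using bessel_fun_off_support[OF s M] by blast
  define L where "L = (\<integral>x. norm (\<Psi> x) \<partial>lborel)"
  have L: "L \<ge> 0" by (simp add: L_def)
  have "(\<integral>\<^sup>+x. ennreal (bumpd N (x::'a)) \<partial>lborel) < \<infinity>"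
    using bumpd_fourier(1)[OF N0, of "0::'a"] by (simp add: integrable_iff_bounded bumpd_nonneg)
  then obtain V where V: "(\<integral>\<^sup>+x. ennreal (bumpd N (x::'a)) \<partial>lborel) = ennreal V" "V \<ge> 0"
    by (cases "\<integral>\<^sup>+x. ennreal (bumpd N (x::'a)) \<partial>lborel") auto
  have \<Psi>m[measurable]: "\<Psi> \<in> borel_measurable borel" by (rule schwartz_measurable[OF \<Psi>])
  define C where "C = 1 + L * V + C1 + C2 * (L * V) + C1 * (2 * DIM('a)) powr M"
  have CC: "L * V \<le> C" "C1 \<le> C" "C2 * (L * V) \<le> C" "C1 * (2 * DIM('a)) powr M \<le> C" "C > 0"
    using L V C1 C2 by (auto simp: C_def intro!: add_nonneg_nonneg add_pos_nonneg)
  show ?thesis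
  proof (rule that[OF CC(5)], unfold Let_def, intro conjI)
    fix \<rho> :: real and a :: 'a assume \<rho>: "0 < \<rho>" "\<rho> \<le> 1"
    define g where "g = (\<lambda>x. of_real (sbump N \<rho> a x) * fourier \<Psi> x)"
    define h where "h = bessel_fun s g"
    have [measurable]: "g \<in> borel_measurable borel" unfolding g_def by measurable
    have "(\<integral>\<^sup>+x. ennreal (norm (g x)) \<partial>lborel) \<le> (\<integral>\<^sup>+x. ennreal L * ennreal (sbump N \<rho> a x) \<partial>lborel)"
    proof (rule nn_integral_mono)
      fix x
      have "norm (g x) \<le> L * sbump N \<rho> a x"
        using mult_left_mono[OF norm_fourier_le[of \<Psi> x] sbump_nonneg[of N \<rho> a x]]
        by (simp add: g_def L_def norm_mult mult.commute)
      then show "ennreal (norm (g x)) \<le> ennreal L * ennreal (sbump N \<rho> a x)"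
        using L by (simp add: ennreal_mult'[symmetric] ennreal_leI)
    qed
    also have "\<dots> = ennreal (L * V * \<rho> powr DIM('a))"
      using L V \<rho>
      by (subst nn_integral_cmult) (simp_all add: sbump_integrable(2)[OF N0 \<rho>(1)] ennreal_mult'[symmetric] mult_ac)
    finally have g1: "(\<integral>\<^sup>+x. ennreal (norm (g x)) \<partial>lborel) \<le> ennreal (L * V * \<rho> powr DIM('a))" .
    have gi: "integrable lborel g"
      using g1 by (intro integrableI_bounded) (auto simp: le_less_trans)
    have g1r: "(\<integral>x. norm (g x) \<partial>lborel) \<le> L * V * \<rho> powr DIM('a)"
      using g1 L V by (subst integral_eq_nn_integral) (auto intro: enn2real_leI)
    have W1: "(\<integral>\<^sup>+\<xi>. ennreal (lam \<xi> powr (s / 2) * norm (inv_fourier g \<xi>)) \<partial>lborel) \<le> ennreal (C1 * \<rho> powr - s)"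
      unfolding g_def by (rule C1(2)[OF \<rho>])
    have W: "integrable lborel (\<lambda>\<xi>. of_real (lam \<xi> powr (s / 2)) * inv_fourier g \<xi>)"
      using W1 by (intro integrableI_bounded) (auto simp: norm_mult le_less_trans)
    have near: "norm (h x) \<le> C1 * \<rho> powr - s" for x
    proof -
      have "norm (h x) \<le> (\<integral>\<xi>. norm (of_real (lam \<xi> powr (s / 2)) * inv_fourier g \<xi>) \<partial>lborel)"
        unfolding h_def bessel_fun_def by (rule norm_fourier_le)
      also have "\<dots> \<le> C1 * \<rho> powr - s"
        using W1 C1(1) by (subst integral_eq_nn_integral) (auto simp: norm_mult intro: enn2real_leI)
      finally show ?thesis .
    qed
    show "integrable lborel (\<lambda>x. of_real (sbump N \<rho> a x) * fourier \<Psi> x)"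
      using gi by (simp add: g_def)
    show "bessel_rep s (\<lambda>x. of_real (sbump N \<rho> a x) * fourier \<Psi> x)
        (bessel_fun s (\<lambda>x. of_real (sbump N \<rho> a x) * fourier \<Psi> x))"
      using bessel_rep_bessel_fun[OF _ gi W] s by (simp add: g_def)
    show "(\<integral>\<^sup>+x. ennreal (norm (of_real (sbump N \<rho> a x) * fourier \<Psi> x)) \<partial>lborel) \<le> ennreal (C * \<rho> powr DIM('a))"
      using order_trans[OF g1 ennreal_leI[OF mult_right_mono[OF CC(1)]]] unfolding g_def by simp
    show "\<forall>x. norm (bessel_fun s (\<lambda>x. of_real (sbump N \<rho> a x) * fourier \<Psi> x) x) \<le> C * \<rho> powr - s"
      using order_trans[OF near mult_right_mono[OF CC(2)]] unfolding h_def g_def by simp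
    have far: "norm (h x) \<le> C * (\<rho> powr DIM('a) * norm (x - a) powr - M)" if x: "x \<noteq> a" for x
    \<comment> \<open>Beyond twice the support radius, the distance from x to the support is at
      least |x - a| / 2, so D = |x - a| is admissible.\<close>
    proof (cases "norm (x - a) \<ge> 2 * (DIM('a) * \<rho>)")
      case True
      have "norm (h x) \<le> C2 * (\<integral>y. norm (g y) \<partial>lborel) * norm (x - a) powr - M"
        unfolding h_def
      proof (rule C2(2)[OF gi W])
        fix y assume "g y \<noteq> 0"
        then have "sbump N \<rho> a y \<noteq> 0" by (auto simp: g_def)
        then have "norm (y - a) \<le> DIM('a) * \<rho>" by (rule sbump_support[OF N0 \<rho>(1)])
        moreover have "norm (x - a) \<le> norm (y - a) + norm (y - x)"
          using norm_triangle_ineq4[of "y - a" "y - x"] by simp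
        ultimately show "norm (x - a) / 2 \<le> norm (y - x)" using True by linarith
      qed (use x in auto)
      also have "\<dots> \<le> C2 * (L * V * \<rho> powr DIM('a)) * norm (x - a) powr - M"
        using g1r C2(1) by (intro mult_right_mono mult_left_mono) auto
      also have "\<dots> = C2 * (L * V) * (\<rho> powr DIM('a) * norm (x - a) powr - M)" by simp
      also have "\<dots> \<le> C * (\<rho> powr DIM('a) * norm (x - a) powr - M)"
        using CC(3) by (rule mult_right_mono) simp
      finally show ?thesis .
    next
      \<comment> \<open>Here \<rho> > |x - a| / (2d), and \<rho>^(-s) = \<rho>^d \<rho>^(-d-s) <=
        \<rho>^d \<rho>^(-M) because \<rho> <= 1 and M >= d + s.\<close>
      case False
      define q where "q = 2 * real DIM('a)"
      have q: "q > 0" by (simp add: q_def)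
      have z: "norm (x - a) > 0" using x by simp
      have "norm (h x) \<le> C1 * \<rho> powr - s" by (rule near)
      also have "\<rho> powr - s = \<rho> powr DIM('a) * \<rho> powr - (DIM('a) + s)"
        by (simp flip: powr_add)
      also have "\<rho> powr - (DIM('a) + s) \<le> \<rho> powr - M"
        using \<rho> M by (intro powr_mono') auto
      also have "\<rho> powr - M \<le> (norm (x - a) / q) powr - M"
        using False q z \<rho> s M by (intro powr_mono2') (auto simp: q_def field_simps)
      also have "(norm (x - a) / q) powr - M = q powr M * norm (x - a) powr - M"
        using q z powr_minus[of "norm (x - a) / q" M] powr_minus[of "norm (x - a)" M]
        by (simp add: powr_divide field_simps)
      also have "C1 * (\<rho> powr DIM('a) * (q powr M * norm (x - a) powr - M)) = C1 * q powr M * (\<rho> powr DIM('a) * norm (x - a) powr - M)"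
        by simp
      also have "\<dots> \<le> C * (\<rho> powr DIM('a) * norm (x - a) powr - M)"
        using CC(4) unfolding q_def by (intro mult_right_mono) auto
      finally show ?thesis using C1(1) by (simp add: mult_left_mono)
    qed
    then show "\<forall>x. x \<noteq> a \<longrightarrow> norm (bessel_fun s (\<lambda>x. of_real (sbump N \<rho> a x) * fourier \<Psi> x) x)
        \<le> C * (\<rho> powr DIM('a) * norm (x - a) powr - M)"
      unfolding h_def g_def by blast
  qed
qed

lemma bessel_rep_sum:
  fixes g h :: "'i \<Rightarrow> 'a::euclidean_space \<Rightarrow> complex"
  assumes "finite A" "s \<ge> 0" and rep: "\<And>i. i \<in> A \<Longrightarrow> bessel_rep s (g i) (h i)"
    and g: "\<And>i. i \<in> A \<Longrightarrow> integrable lborel (g i)"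
  shows "bessel_rep s (\<lambda>x. \<Sum>i\<in>A. c i * g i x) (\<lambda>x. \<Sum>i\<in>A. c i * h i x)"
  unfolding bessel_rep_def
proof (intro conjI allI impI)
  have [measurable]: "h i \<in> borel_measurable borel" if "i \<in> A" for i
    using rep[OF that] by (simp add: bessel_rep_def)
  show "(\<lambda>x. \<Sum>i\<in>A. c i * h i x) \<in> borel_measurable lborel" by simp
  fix \<phi> :: "'a \<Rightarrow> complex" assume \<phi>: "schwartz \<phi>"
  have h: "integrable lborel (\<lambda>x. h i x * \<phi> x)" "(\<integral>x. h i x * \<phi> x \<partial>lborel) = (\<integral>x. g i x * bessel_schwartz s \<phi> x \<partial>lborel)"
    if "i \<in> A" for i using rep[OF that] \<phi> by (auto simp: bessel_rep_def)
  obtain B where B: "\<And>x. norm (bessel_schwartz s \<phi> x) \<le> B"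
    using bessel_schwartz_bounded(1)[OF \<phi> assms(2)] by blast
  have [measurable]: "bessel_schwartz s \<phi> \<in> borel_measurable borel"
    by (rule bessel_schwartz_bounded(2)[OF \<phi> assms(2)])
  have gB: "integrable lborel (\<lambda>x. g i x * bessel_schwartz s \<phi> x)" if "i \<in> A" for i
  proof (rule Bochner_Integration.integrable_bound)
    show "integrable lborel (\<lambda>x. of_real B * g i x)" using g[OF that] by simp
    show "AE x in lborel. norm (g i x * bessel_schwartz s \<phi> x) \<le> norm (of_real B * g i x)"
      using order_trans[OF B abs_ge_self]
      by (intro AE_I2) (auto simp: norm_mult mult.commute[of _ "norm (bessel_schwartz s \<phi> _)"] intro!: mult_right_mono)
  qed (use g[OF that] in measurable)
  have e: "(\<Sum>i\<in>A. c i * f i x) * y = (\<Sum>i\<in>A. c i * (f i x * y))" for f :: "'i \<Rightarrow> 'a \<Rightarrow> complex" and x y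
    by (simp add: sum_distrib_right mult.assoc)
  show "integrable lborel (\<lambda>x. (\<Sum>i\<in>A. c i * h i x) * \<phi> x)"
    unfolding e by (intro Bochner_Integration.integrable_sum integrable_mult_right h)
  have "(\<integral>x. (\<Sum>i\<in>A. c i * h i x) * \<phi> x \<partial>lborel) = (\<Sum>i\<in>A. c i * (\<integral>x. h i x * \<phi> x \<partial>lborel))"
    unfolding e by (subst Bochner_Integration.integral_sum) (auto intro!: integrable_mult_right h)
  also have "\<dots> = (\<Sum>i\<in>A. c i * (\<integral>x. g i x * bessel_schwartz s \<phi> x \<partial>lborel))"
    by (intro sum.cong refl) (simp add: h)
  also have "\<dots> = (\<integral>x. (\<Sum>i\<in>A. c i * g i x) * bessel_schwartz s \<phi> x \<partial>lborel)"
    unfolding e by (subst Bochner_Integration.integral_sum) (auto intro!: integrable_mult_right gB)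
  finally show "(\<integral>x. (\<Sum>i\<in>A. c i * h i x) * \<phi> x \<partial>lborel) = (\<integral>x. (\<Sum>i\<in>A. c i * g i x) * bessel_schwartz s \<phi> x \<partial>lborel)" .
qed

text \<open>The terms decay geometrically in both directions from the index where x / 2^j passes 1,
  so the sum is bounded independently of x and J. Later x is the ratio of \<rho> to the distance
  from the centre.\<close>

lemma dyadic_sum_bound:
  assumes s: "s > 0" and d: "d \<ge> (1::real)" and x: "x > 0"
  shows "(\<Sum>j=1..J. min ((x / 2 ^ j) powr - s) ((x / 2 ^ j) powr d)) \<le> 1 / (1 - 2 powr - s) + 3"
proof -
  define K where "K = 1 / (1 - 2 powr - s)"
  have "2 powr - s < 1" using s powr_less_mono[of "- s" 0 2] by simp
  then have "1 - 2 powr - s > 0" "1 - 2 powr - s \<noteq> 0" by auto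
  then have K: "K > 0" "K * 2 powr - s + 1 = K" by (simp_all add: K_def divide_simps)
  define y where "y = (\<lambda>j. x / 2 ^ j)"
  have y: "y j > 0" "y (Suc j) = y j / 2" for j using x by (auto simp: y_def)
  \<comment> \<open>The strengthened claim for the induction. Above 1 the constant K reproduces
    itself by \<open>K * 2 powr - s + 1 = K\<close>; crossing 1 costs one term of size at most 1;
    below 1 the budget 2 (1 - y) grows by \<open>y J\<close> when y is halved, which pays for the
    new term, at most \<open>y (Suc J)\<close>.\<close>
  have "(\<Sum>j=1..J. min (y j powr - s) (y j powr d)) \<le> (if y J \<ge> 1 then K * y J powr - s else K + 1 + 2 * (1 - y J))"
  proof (induction J)
    case 0
    then show ?case using K y(1)[of 0] by auto
  next
    case (Suc J)
    let ?S = "\<Sum>j=1..J. min (y j powr - s) (y j powr d)"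
    consider "y (Suc J) \<ge> 1" | "y J \<ge> 1" "y (Suc J) < 1" | "y J < 1" by linarith
    then show ?case
    proof cases
      case 1
      then have "y J \<ge> 1" using y(2)[of J] by linarith
      then have "?S \<le> K * y J powr - s" using Suc by simp
      also have "y J powr - s = y (Suc J) powr - s * 2 powr - s"
        using y[of J] y(1)[of "Suc J"] powr_mult[of "y (Suc J)" 2 "- s"] by simp
      finally have "?S + y (Suc J) powr - s \<le> (K * 2 powr - s + 1) * y (Suc J) powr - s"
        by (simp add: algebra_simps)
      then show ?thesis unfolding K(2) using 1 by simp
    next
      case 2
      then have "?S \<le> K * y J powr - s" using Suc by simp
      also have "\<dots> \<le> K" using K 2 s powr_mono2'[of "-s" 1 "y J"] by simp
      finally have "?S \<le> K" .
      moreover have "min (y (Suc J) powr - s) (y (Suc J) powr d) \<le> 1"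
        using 2 y(1)[of "Suc J"] d by (intro min.coboundedI2) (simp add: powr_le1)
      ultimately show ?thesis using 2 by simp
    next
      case 3
      then have "?S \<le> K + 1 + 2 * (1 - y J)" using Suc by simp
      moreover have "min (y (Suc J) powr - s) (y (Suc J) powr d) \<le> y (Suc J)"
        using 3 y[of J] y(1)[of "Suc J"] d powr_mono'[of 1 d "y (Suc J)"] by (intro min.coboundedI2) simp
      moreover have lt: "\<not> y (Suc J) \<ge> 1" using 3 y(1)[of J] y(2)[of J] by linarith
      ultimately have "?S + min (y (Suc J) powr - s) (y (Suc J) powr d) \<le> K + 1 + 2 * (1 - y (Suc J))"
      proof -
        have "u + m \<le> K + 1 + 2 * (1 - y (Suc J))" if "u \<le> K + 1 + 2 * (1 - y J)" "m \<le> y (Suc J)" for u m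
          using that y(2)[of J] y(1)[of J] by (simp add: field_simps)
        then show ?thesis using \<open>?S \<le> K + 1 + 2 * (1 - y J)\<close>
          \<open>min (y (Suc J) powr - s) (y (Suc J) powr d) \<le> y (Suc J)\<close> by blast
      qed
      moreover have "(\<Sum>j=1..Suc J. min (y j powr - s) (y j powr d)) = ?S + min (y (Suc J) powr - s) (y (Suc J) powr d)"
        by simp
      ultimately show ?thesis using lt by presburger
    qed
  qed
  also have "\<dots> \<le> K + 3"
  proof -
    have "y J powr - s \<le> 1" if "y J \<ge> 1" using that s powr_mono2'[of "-s" 1 "y J"] by simp
    then have "K * y J powr - s \<le> K * 1" if "y J \<ge> 1" using that K(1) by (intro mult_left_mono) auto
    moreover have "K + 1 + 2 * (1 - y J) \<le> K + 3" using y(1)[of J] by simp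
    ultimately show ?thesis using K(1) by (cases "1 \<le> y J") (simp_all add: add_increasing2)
  qed
  finally show ?thesis by (simp add: K_def y_def)
qed

lemma geometric_sum_bound:
  fixes s :: real
  assumes "s > 0"
  shows "(\<Sum>j=1..J. (2 ^ j) powr s) \<le> 1 / (1 - 2 powr - s) * (2 ^ J) powr s"
proof -
  define K where "K = 1 / (1 - 2 powr - s)"
  have "2 powr - s < 1" using assms powr_less_mono[of "- s" 0 2] by simp
  then have "1 - 2 powr - s > 0" "1 - 2 powr - s \<noteq> 0" by auto
  then have K: "K > 0" "K * 2 powr - s + 1 = K" by (simp_all add: K_def divide_simps)
  have "(\<Sum>j=1..J. (2 ^ j) powr s) \<le> K * (2 ^ J) powr s"
  proof (induction J)
    case (Suc J)
    have e: "(2 ^ J) powr s = (2 ^ Suc J) powr s * 2 powr - s"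
      using powr_mult[of "2 ^ J" 2 s] by (simp add: powr_minus field_simps)
    have "(\<Sum>j=1..Suc J. (2 ^ j) powr s) \<le> (K * 2 powr - s + 1) * (2 ^ Suc J) powr s"
      using Suc by (simp add: e algebra_simps)
    then show ?case unfolding K(2) .
  qed (use K in simp)
  then show ?thesis by (simp add: K_def)
qed

lemma half_powers_sum: "(\<Sum>j=1..J. 1 / 2 ^ j) \<le> (1::real)"
proof -
  have "(\<Sum>j=1..J. 1 / 2 ^ j) = 1 - 1 / (2::real) ^ J"
    by (induction J) (auto simp: field_simps)
  then show ?thesis by simp
qed

definition avg_bump :: "nat \<Rightarrow> nat \<Rightarrow> real \<Rightarrow> 'a::euclidean_space \<Rightarrow> 'a \<Rightarrow> real" where
  "avg_bump N J \<rho> a x = (\<Sum>j=1..J. sbump N (\<rho> / 2 ^ j) a x) / J"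

lemma borel_measurable_avg_bump [measurable]: "avg_bump N J \<rho> a \<in> borel_measurable borel"
  unfolding avg_bump_def by measurable

lemma continuous_on_avg_bump: "continuous_on A (avg_bump N J \<rho> a)"
proof -
  have "continuous_on A (\<lambda>x. (\<Sum>j=1..J. sbump N (\<rho> / 2 ^ j) a x) * (1 / J))"
    by (intro continuous_on_mult continuous_on_sum continuous_on_sbump continuous_on_const)
  then show ?thesis by (simp add: avg_bump_def[abs_def])
qed

lemma avg_bump_center [simp]: "J > 0 \<Longrightarrow> avg_bump N J \<rho> a a = 1"
  by (simp add: avg_bump_def)

lemma avg_bump_nonneg [simp]: "0 \<le> avg_bump N J \<rho> a x"
  by (simp add: avg_bump_def sum_nonneg)

lemma avg_bump_le_1 [simp]: "avg_bump N J \<rho> a x \<le> 1"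
proof -
  have "(\<Sum>j=1..J. sbump N (\<rho> / 2 ^ j) a x) \<le> (\<Sum>j=1..J. 1)"
    by (intro sum_mono) simp
  then show ?thesis by (cases "J = 0") (simp_all add: avg_bump_def)
qed

lemma avg_bump_support:
  fixes a :: "'a::euclidean_space" and \<rho> :: real
  assumes "N > 0" "\<rho> > 0" "avg_bump N J \<rho> a x \<noteq> 0"
  shows "norm (x - a) \<le> DIM('a) * \<rho>"
proof -
  obtain j where "sbump N (\<rho> / 2 ^ j) a x \<noteq> 0"
  proof (rule ccontr)
    assume "\<not> thesis"
    with that have "\<And>j. sbump N (\<rho> / 2 ^ j) a x = 0" by blast
    with assms(3) show False by (simp add: avg_bump_def)
  qed
  then have "norm (x - a) \<le> DIM('a) * (\<rho> / 2 ^ j)"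
    using sbump_support[of N "\<rho> / 2 ^ j" a x] assms by simp
  also have "\<dots> \<le> DIM('a) * \<rho>"
    using assms by (intro mult_left_mono) (auto simp: field_simps)
  finally show ?thesis .
qed

lemma sbump_scale: "\<kappa> > 0 \<Longrightarrow> sbump N \<rho> a (\<kappa> *\<^sub>R x) = sbump N (\<rho> / \<kappa>) (a /\<^sub>R \<kappa>) x"
  by (simp add: sbump_def divide_inverse scaleR_diff_right mult.assoc)

text \<open>Dilation stays within the family of averaged bumps, so \<sigma>(2^k x) can be estimated
  like \<sigma>, with rescaled points and radii.\<close>

lemma avg_bump_scale: "\<kappa> > 0 \<Longrightarrow> avg_bump N J \<rho> a (\<kappa> *\<^sub>R x) = avg_bump N J (\<rho> / \<kappa>) (a /\<^sub>R \<kappa>) x"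
  by (simp add: avg_bump_def sbump_scale mult.commute)

text \<open>The factor 1 / J of the average survives as a gain because at each distance from a
  essentially one of the J scales matters. The height (2^J / \<rho>)^s is that of the smallest
  scale, and the two outer entries of the minimum make the potential integrable, as s < d <
  M.\<close>

lemma avg_bump_bounds:
  fixes \<Psi> :: "'a::euclidean_space \<Rightarrow> complex" and s M :: real
  assumes \<Psi>: "schwartz \<Psi>" and s: "s > 0" "s < DIM('a)" and N: "real N \<ge> s + 2" and M: "real DIM('a) + s \<le> M"
  obtains C where "C > 0"
    "\<And>\<rho> a J. 0 < \<rho> \<Longrightarrow> \<rho> \<le> 1 \<Longrightarrow> J \<ge> 1 \<Longrightarrow>
      (\<exists>h. let g = (\<lambda>x. of_real (avg_bump N J \<rho> a x) * fourier \<Psi> x) in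
       integrable lborel g \<and> bessel_rep s g h \<and>
       (\<integral>\<^sup>+x. ennreal (norm (g x)) \<partial>lborel) \<le> ennreal (C / J) \<and>
       (\<integral>\<^sup>+x. ennreal (norm (h x)) \<partial>lborel) \<le> ennreal (C / J) \<and>
       (\<forall>x. x \<noteq> a \<longrightarrow> norm (h x) \<le> C / J * min (norm (x - a) powr - s) (min ((2 ^ J / \<rho>) powr s) (norm (x - a) powr - M))))"
proof -
  define d where "d = real DIM('a)"
  have d: "d \<ge> 1" "real DIM('a) = d" by (simp_all add: d_def Suc_leI)
  obtain C0 where C0: "C0 > 0"
    "\<And>\<rho> a. 0 < \<rho> \<Longrightarrow> \<rho> \<le> 1 \<Longrightarrow>
      (let g = (\<lambda>x. of_real (sbump N \<rho> a x) * fourier \<Psi> x); h = bessel_fun s g in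
       integrable lborel g \<and> bessel_rep s g h \<and>
       (\<integral>\<^sup>+x. ennreal (norm (g x)) \<partial>lborel) \<le> ennreal (C0 * \<rho> powr DIM('a)) \<and>
       (\<forall>x. norm (h x) \<le> C0 * \<rho> powr - s) \<and>
       (\<forall>x. x \<noteq> a \<longrightarrow> norm (h x) \<le> C0 * (\<rho> powr DIM('a) * norm (x - a) powr - M)))"
    using bump_times_fourier_bounds[OF \<Psi> s(1) N M] by blast
  \<comment> \<open>The single-bump estimate is needed a second time with the exact rate d + s: only
    then is each bound equal to |x - a|^(-s) times a function of the ratio of scale to distance, as
    \<open>dyadic_sum_bound\<close> requires.\<close>
  obtain C1 where C1: "C1 > 0"
    "\<And>\<rho> a. 0 < \<rho> \<Longrightarrow> \<rho> \<le> 1 \<Longrightarrow>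
      (let g = (\<lambda>x. of_real (sbump N \<rho> a x) * fourier \<Psi> x); h = bessel_fun s g in
       integrable lborel g \<and> bessel_rep s g h \<and>
       (\<integral>\<^sup>+x. ennreal (norm (g x)) \<partial>lborel) \<le> ennreal (C1 * \<rho> powr DIM('a)) \<and>
       (\<forall>x. norm (h x) \<le> C1 * \<rho> powr - s) \<and>
       (\<forall>x. x \<noteq> a \<longrightarrow> norm (h x) \<le> C1 * (\<rho> powr DIM('a) * norm (x - a) powr - (DIM('a) + s))))"
    using bump_times_fourier_bounds[OF \<Psi> s(1) N order_refl] by blast
  define A where "A = max C0 C1"
  define K where "K = 1 / (1 - 2 powr - s) + 3"
  have "2 powr - s < 1" using s powr_less_mono[of "- s" 0 2] by simp
  then have K: "K \<ge> 1" "1 / (1 - 2 powr - s) \<le> K" by (auto simp: K_def)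
  have A: "A > 0" "C0 \<le> A" "C1 \<le> A" using C0 by (auto simp: A_def)
  define I where "I = (\<integral>\<^sup>+x. ennreal (min (norm x powr - s) (norm x powr - M)) \<partial>(lborel :: 'a measure))"
  have "I < \<infinity>" unfolding I_def using s M by (intro nn_integral_min_norm_powr_finite) auto
  then obtain Ir where Ir: "I = ennreal Ir" "Ir \<ge> 0" by (cases I) auto
  define C where "C = A * K * (1 + Ir)"
  have C: "C > 0" "A \<le> C" "A * K \<le> C" "A * K * Ir \<le> C"
  proof -
    show "C > 0" using A K Ir by (simp add: C_def)
    have "A * 1 \<le> A * K" using A K by (intro mult_left_mono) auto
    moreover have "A * K * 1 \<le> A * K * (1 + Ir)" "A * K * Ir \<le> A * K * (1 + Ir)"
      using A K Ir by (intro mult_left_mono; simp)+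
    ultimately show "A \<le> C" "A * K \<le> C" "A * K * Ir \<le> C" by (auto simp: C_def)
  qed
  show ?thesis
  proof (rule that[OF C(1)])
    fix \<rho> :: real and a :: 'a and J :: nat
    assume \<rho>: "0 < \<rho>" "\<rho> \<le> 1" and J: "J \<ge> 1"
    define \<rho>j where "\<rho>j = (\<lambda>j::nat. \<rho> / 2 ^ j)"
    have \<rho>j: "0 < \<rho>j j" "\<rho>j j \<le> 1" "\<rho>j j \<le> 1 / 2 ^ j" for j
    proof -
      show "0 < \<rho>j j" "\<rho>j j \<le> 1 / 2 ^ j" using \<rho> by (auto simp: \<rho>j_def field_simps)
      have "\<rho> \<le> 2 ^ j" using \<rho>(2) one_le_power[of "2::real" j] by linarith
      then show "\<rho>j j \<le> 1" by (simp add: \<rho>j_def field_simps)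
    qed
    define gj where "gj = (\<lambda>j x. of_real (sbump N (\<rho>j j) a x) * fourier \<Psi> x)"
    define hj where "hj = (\<lambda>j. bessel_fun s (gj j))"
    have C0j: "integrable lborel (gj j) \<and> bessel_rep s (gj j) (hj j) \<and>
       (\<integral>\<^sup>+x. ennreal (norm (gj j x)) \<partial>lborel) \<le> ennreal (C0 * \<rho>j j powr DIM('a)) \<and>
       (\<forall>x. norm (hj j x) \<le> C0 * \<rho>j j powr - s) \<and>
       (\<forall>x. x \<noteq> a \<longrightarrow> norm (hj j x) \<le> C0 * (\<rho>j j powr DIM('a) * norm (x - a) powr - M))" for j
      using C0(2)[OF \<rho>j(1,2), of j a] unfolding Let_def gj_def hj_def .
    have C1j: "integrable lborel (gj j) \<and> bessel_rep s (gj j) (hj j) \<and>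
       (\<integral>\<^sup>+x. ennreal (norm (gj j x)) \<partial>lborel) \<le> ennreal (C1 * \<rho>j j powr DIM('a)) \<and>
       (\<forall>x. norm (hj j x) \<le> C1 * \<rho>j j powr - s) \<and>
       (\<forall>x. x \<noteq> a \<longrightarrow> norm (hj j x) \<le> C1 * (\<rho>j j powr DIM('a) * norm (x - a) powr - (DIM('a) + s)))" for j
      using C1(2)[OF \<rho>j(1,2), of j a] unfolding Let_def gj_def hj_def .
    have gj: "integrable lborel (gj j)" "bessel_rep s (gj j) (hj j)"
       "(\<integral>\<^sup>+x. ennreal (norm (gj j x)) \<partial>lborel) \<le> ennreal (A * \<rho>j j)" for j
    proof -
      note * = C0j[of j]
      show "integrable lborel (gj j)" "bessel_rep s (gj j) (hj j)" using * by auto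
      have "\<rho>j j powr DIM('a) \<le> \<rho>j j"
        using powr_mono'[of 1 d "\<rho>j j"] d \<rho>j[of j] by simp
      then have "C0 * \<rho>j j powr DIM('a) \<le> A * \<rho>j j"
        using A C0(1) by (intro mult_mono) auto
      then show "(\<integral>\<^sup>+x. ennreal (norm (gj j x)) \<partial>lborel) \<le> ennreal (A * \<rho>j j)"
        using * by (meson ennreal_leI order_trans)
    qed
    have hj_near: "norm (hj j x) \<le> A * \<rho>j j powr - s" for j x
    proof -
      have "norm (hj j x) \<le> C0 * \<rho>j j powr - s"
        using C0j[of j] by blast
      also have "\<dots> \<le> A * \<rho>j j powr - s" using A by (intro mult_right_mono) auto
      finally show ?thesis .
    qed
    have hj_far: "norm (hj j x) \<le> A * (\<rho>j j powr d * norm (x - a) powr - M)" if "x \<noteq> a" for j x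
    proof -
      have "norm (hj j x) \<le> C0 * (\<rho>j j powr d * norm (x - a) powr - M)"
        using C0j[of j] that d by simp
      also have "\<dots> \<le> A * (\<rho>j j powr d * norm (x - a) powr - M)" using A by (intro mult_right_mono) auto
      finally show ?thesis .
    qed
    have hj_mid: "norm (hj j x) \<le> A * (\<rho>j j powr d * norm (x - a) powr - (d + s))" if "x \<noteq> a" for j x
    proof -
      have "norm (hj j x) \<le> C1 * (\<rho>j j powr d * norm (x - a) powr - (d + s))"
        using C1j[of j] that d by simp
      also have "\<dots> \<le> A * (\<rho>j j powr d * norm (x - a) powr - (d + s))" using A by (intro mult_right_mono) auto
      finally show ?thesis .
    qed
    define g where "g = (\<lambda>x. of_real (avg_bump N J \<rho> a x) * fourier \<Psi> x)"
    define h where "h = (\<lambda>x. \<Sum>j=1..J. of_real (1 / J) * hj j x)"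
    have g_eq: "g = (\<lambda>x. \<Sum>j=1..J. of_real (1 / J) * gj j x)"
      unfolding g_def gj_def avg_bump_def \<rho>j_def
      by (rule ext) (simp add: sum_distrib_right sum_divide_distrib)
    have rep: "bessel_rep s g h"
      unfolding g_eq h_def using s by (intro bessel_rep_sum gj) auto
    have gi: "integrable lborel g"
      unfolding g_eq by (intro Bochner_Integration.integrable_sum integrable_mult_right gj)
    have "(\<integral>\<^sup>+x. ennreal (norm (g x)) \<partial>lborel) \<le> (\<integral>\<^sup>+x. (\<Sum>j=1..J. ennreal (1 / J) * ennreal (norm (gj j x))) \<partial>lborel)"
    proof (rule nn_integral_mono)
      fix x
      have "norm (g x) \<le> (\<Sum>j=1..J. 1 / J * norm (gj j x))"
        unfolding g_eq by (rule order_trans[OF norm_sum]) (simp add: norm_mult norm_divide)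
      then have "ennreal (norm (g x)) \<le> ennreal (\<Sum>j=1..J. 1 / J * norm (gj j x))" by (rule ennreal_leI)
      also have "\<dots> = (\<Sum>j=1..J. ennreal (1 / J) * ennreal (norm (gj j x)))"
        by (subst sum_ennreal[symmetric]) (auto simp: ennreal_mult'[symmetric] intro!: sum.cong)
      finally show "ennreal (norm (g x)) \<le> (\<Sum>j=1..J. ennreal (1 / J) * ennreal (norm (gj j x)))" .
    qed
    also have "\<dots> = (\<Sum>j=1..J. ennreal (1 / J) * (\<integral>\<^sup>+x. ennreal (norm (gj j x)) \<partial>lborel))"
      using gj(1) by (subst nn_integral_sum) (auto intro!: sum.cong nn_integral_cmult)
    also have "\<dots> \<le> (\<Sum>j=1..J. ennreal (1 / J) * ennreal (A * (1 / 2 ^ j)))"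
      using A \<rho>j(3) by (intro sum_mono mult_left_mono order_trans[OF gj(3)] ennreal_leI) auto
    also have "\<dots> = ennreal (A / J * (\<Sum>j=1..J. 1 / 2 ^ j))"
      using A by (subst sum_distrib_left, subst sum_ennreal[symmetric]) (auto simp: ennreal_mult'[symmetric] intro!: sum.cong)
    also have "\<dots> \<le> ennreal (C / J)"
    proof (rule ennreal_leI)
      have "A / J * (\<Sum>j=1..J. 1 / 2 ^ j) \<le> A / J * 1"
        using A half_powers_sum[of J] by (intro mult_left_mono) auto
      also have "\<dots> \<le> C / J" using C by (simp add: divide_right_mono)
      finally show "A / J * (\<Sum>j=1..J. 1 / 2 ^ j) \<le> C / J" .
    qed
    finally have g1: "(\<integral>\<^sup>+x. ennreal (norm (g x)) \<partial>lborel) \<le> ennreal (C / J)" .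
    have h_le: "norm (h x) \<le> A * B / J" if "\<And>j. norm (hj j x) \<le> A * b j" "(\<Sum>j=1..J. b j) \<le> B" for x b B
    proof -
      have "norm (h x) \<le> (\<Sum>j=1..J. 1 / J * (A * b j))"
        unfolding h_def by (rule order_trans[OF norm_sum], rule sum_mono)
          (use that(1) in \<open>auto simp: norm_mult norm_divide intro!: divide_right_mono\<close>)
      also have "\<dots> = A / J * (\<Sum>j=1..J. b j)" by (simp add: sum_distrib_left)
      also have "\<dots> \<le> A / J * B" using that(2) A by (intro mult_left_mono) auto
      finally show ?thesis by simp
    qed
    have hb: "norm (h x) \<le> A * K / J * min (norm (x - a) powr - s) (min ((2 ^ J / \<rho>) powr s) (norm (x - a) powr - M))"
      if x: "x \<noteq> a" for x
    proof -
      define z where "z = norm (x - a)"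
      have z: "z > 0" using x by (simp add: z_def)
      have "norm (h x) \<le> A * (K * z powr - s) / J"
      proof (rule h_le)
        fix j
        have "\<rho>j j powr - s = z powr - s * (\<rho>j j / z) powr - s"
          using z \<rho>j[of j] powr_mult[of z "\<rho>j j / z" "- s"] by simp
        moreover have "\<rho>j j powr d * z powr - (d + s) = z powr - s * (\<rho>j j / z) powr d"
        proof -
          have "- (d + s) = - s + - d" by simp
          then have "z powr - (d + s) = z powr - s * z powr - d" by (simp only: powr_add)
          moreover have "(\<rho>j j / z) powr d = \<rho>j j powr d * z powr - d"
            using z \<rho>j[of j] by (simp add: powr_divide powr_minus_divide)
          ultimately show ?thesis by simp
        qed
        ultimately have "norm (hj j x) \<le> A * (z powr - s * (\<rho>j j / z) powr - s)"
           "norm (hj j x) \<le> A * (z powr - s * (\<rho>j j / z) powr d)"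
          using hj_near[of j x] hj_mid[OF x, of j] by (simp_all add: z_def)
        then show "norm (hj j x) \<le> A * (z powr - s * min ((\<rho> / z / 2 ^ j) powr - s) ((\<rho> / z / 2 ^ j) powr d))"
          by (simp add: min_def \<rho>j_def mult.commute)
      next
        have "(\<Sum>j=1..J. z powr - s * min ((\<rho> / z / 2 ^ j) powr - s) ((\<rho> / z / 2 ^ j) powr d)) \<le> z powr - s * K"
          unfolding sum_distrib_left[symmetric] K_def using dyadic_sum_bound[OF s(1) d(1), of "\<rho> / z" J] \<rho> z
          by (intro mult_left_mono) auto
        then show "(\<Sum>j=1..J. z powr - s * min ((\<rho> / z / 2 ^ j) powr - s) ((\<rho> / z / 2 ^ j) powr d)) \<le> K * z powr - s"
          by (simp add: mult.commute)
      qed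
      moreover have "norm (h x) \<le> A * (K * (2 ^ J / \<rho>) powr s) / J"
      proof (rule h_le)
        fix j
        have "\<rho>j j powr - s = \<rho> powr - s * (2 ^ j) powr s"
          using \<rho> by (simp add: \<rho>j_def powr_divide powr_minus_divide)
        then show "norm (hj j x) \<le> A * (\<rho> powr - s * (2 ^ j) powr s)"
          using hj_near[of j x] by simp
      next
        have "(\<Sum>j=1..J. \<rho> powr - s * (2 ^ j) powr s) \<le> \<rho> powr - s * (1 / (1 - 2 powr - s) * (2 ^ J) powr s)"
          unfolding sum_distrib_left[symmetric] using geometric_sum_bound[OF s(1), of J] by (rule mult_left_mono) simp
        also have "\<dots> \<le> \<rho> powr - s * (K * (2 ^ J) powr s)"
          using K by (intro mult_left_mono mult_right_mono) auto
        also have "\<dots> = K * (2 ^ J / \<rho>) powr s"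
          using \<rho> by (simp add: powr_divide powr_minus_divide)
        finally show "(\<Sum>j=1..J. \<rho> powr - s * (2 ^ j) powr s) \<le> K * (2 ^ J / \<rho>) powr s" .
      qed
      moreover have "norm (h x) \<le> A * (K * z powr - M) / J"
      proof (rule h_le)
        fix j
        have "\<rho>j j powr d \<le> \<rho>j j"
          using powr_mono'[of 1 d "\<rho>j j"] d \<rho>j[of j] by simp
        also have "\<dots> \<le> 1 / 2 ^ j" by (rule \<rho>j)
        finally have "A * (\<rho>j j powr d * norm (x - a) powr - M) \<le> A * (1 / 2 ^ j * z powr - M)"
          using A unfolding z_def by (intro mult_left_mono mult_right_mono) auto
        with hj_far[OF x, of j] show "norm (hj j x) \<le> A * (1 / 2 ^ j * z powr - M)" by linarith
      next
        have "(\<Sum>j=1..J. 1 / 2 ^ j * z powr - M) \<le> 1 * z powr - M"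
          unfolding sum_distrib_right[symmetric] using half_powers_sum[of J] by (rule mult_right_mono) simp
        also have "\<dots> \<le> K * z powr - M" using K by (intro mult_right_mono) auto
        finally show "(\<Sum>j=1..J. 1 / 2 ^ j * z powr - M) \<le> K * z powr - M" .
      qed
      ultimately show ?thesis by (simp add: min_def z_def)
    qed
    have hm: "h \<in> borel_measurable borel" using rep by (simp add: bessel_rep_def)
    have "(\<integral>\<^sup>+x. ennreal (norm (h x)) \<partial>lborel)
        \<le> (\<integral>\<^sup>+x. ennreal (A * K / J) * ennreal (min (norm (- a + x) powr - s) (norm (- a + x) powr - M)) \<partial>lborel)"
    proof (rule nn_integral_mono_AE, rule AE_mp[OF AE_lborel_singleton[of a]], rule AE_I2, rule impI)
      fix x assume x: "x \<noteq> a"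
      have "norm (h x) \<le> A * K / J * min (norm (x - a) powr - s) (min ((2 ^ J / \<rho>) powr s) (norm (x - a) powr - M))"
        by (rule hb[OF x])
      also have "\<dots> \<le> A * K / J * min (norm (x - a) powr - s) (norm (x - a) powr - M)"
        using A K by (intro mult_left_mono) auto
      finally show "ennreal (norm (h x)) \<le> ennreal (A * K / J) * ennreal (min (norm (- a + x) powr - s) (norm (- a + x) powr - M))"
        using A K by (subst ennreal_mult'[symmetric]) (auto intro!: ennreal_leI)
    qed
    also have "\<dots> = ennreal (A * K / J) * I"
      using nn_integral_lborel_translation[of "\<lambda>x. ennreal (min (norm x powr - s) (norm x powr - M))" "- a"]
      by (subst nn_integral_cmult) (simp_all add: I_def)
    also have "\<dots> \<le> ennreal (C / J)"
      using A K C(4) Ir by (simp add: ennreal_mult'[symmetric] divide_right_mono ennreal_leI)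
    finally have h1: "(\<integral>\<^sup>+x. ennreal (norm (h x)) \<partial>lborel) \<le> ennreal (C / J)" .
    have hb': "norm (h x) \<le> C / J * min (norm (x - a) powr - s) (min ((2 ^ J / \<rho>) powr s) (norm (x - a) powr - M))"
      if x: "x \<noteq> a" for x
      using C(3) by (intro order_trans[OF hb[OF x]] mult_right_mono divide_right_mono) auto
    show "\<exists>h. let g = (\<lambda>x. of_real (avg_bump N J \<rho> a x) * fourier \<Psi> x) in
       integrable lborel g \<and> bessel_rep s g h \<and>
       (\<integral>\<^sup>+x. ennreal (norm (g x)) \<partial>lborel) \<le> ennreal (C / J) \<and>
       (\<integral>\<^sup>+x. ennreal (norm (h x)) \<partial>lborel) \<le> ennreal (C / J) \<and>
       (\<forall>x. x \<noteq> a \<longrightarrow> norm (h x) \<le> C / J * min (norm (x - a) powr - s) (min ((2 ^ J / \<rho>) powr s) (norm (x - a) powr - M)))"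
      unfolding Let_def g_def[symmetric]
      using gi rep g1 h1 hb' by blast
  qed
qed

section \<open>Lorentz norms of countable sums\<close>

lemma epowr_mono: "x \<le> y \<Longrightarrow> a > 0 \<Longrightarrow> epowr x a \<le> epowr y a"
  by (cases x; cases y) (auto simp: epowr_def top_unique intro!: ennreal_leI powr_mono2)

lemma epowr_ennreal: "x \<ge> 0 \<Longrightarrow> epowr (ennreal x) a = ennreal (x powr a)"
  by (simp add: epowr_def)

lemma epowr_less_top: "x < top \<Longrightarrow> epowr x a < top"
  by (simp add: epowr_def)

lemma suminf_half_powers: "(\<Sum>i. ennreal ((1 / 2) ^ Suc i)) = 1"
proof -
  have "(\<Sum>i. ennreal ((1 / 2) ^ Suc i)) = ennreal 1"
    by (rule suminf_ennreal_eq[OF _ power_half_series]) simp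
  then show ?thesis by (simp only: ennreal_1)
qed

text \<open>A substitute for the triangle inequality, valid for all q > 0: each term on the right is
  at most the total S, so a_i <= S^(1/q) 2^(-i-1), and these bounds are summable.\<close>

lemma epowr_suminf_le:
  fixes a :: "nat \<Rightarrow> real"
  assumes a: "\<And>i. a i \<ge> 0" and q: "q > 0"
  shows "epowr (\<Sum>i. ennreal (a i)) q \<le> (\<Sum>i. ennreal ((2 ^ Suc i * a i) powr q))"
proof (cases "(\<Sum>i. ennreal ((2 ^ Suc i * a i) powr q))")
  case (real S)
  have "ennreal (a i) \<le> ennreal (S powr (1 / q)) * ennreal ((1 / 2) ^ Suc i)" for i
  proof -
    have "(\<Sum>j\<in>{i}. ennreal ((2 ^ Suc j * a j) powr q)) \<le> (\<Sum>j. ennreal ((2 ^ Suc j * a j) powr q))"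
      by (intro sum_le_suminf summableI) auto
    then have "(2 ^ Suc i * a i) powr q \<le> S" using real by simp
    then have "((2 ^ Suc i * a i) powr q) powr (1 / q) \<le> S powr (1 / q)"
      using q by (intro powr_mono2) auto
    then have "2 ^ Suc i * a i \<le> S powr (1 / q)"
      using q a[of i] by (simp add: powr_powr)
    then have "a i \<le> S powr (1 / q) * (1 / 2) ^ Suc i"
      by (simp add: power_divide field_simps)
    then show ?thesis by (simp add: ennreal_mult'[symmetric] ennreal_leI)
  qed
  then have "(\<Sum>i. ennreal (a i)) \<le> (\<Sum>i. ennreal (S powr (1 / q)) * ennreal ((1 / 2) ^ Suc i))"
    by (intro suminf_le summableI)
  also have "\<dots> = ennreal (S powr (1 / q))"
    by (subst ennreal_suminf_cmult) (simp add: suminf_half_powers del: power_Suc)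
  finally have "epowr (\<Sum>i. ennreal (a i)) q \<le> epowr (ennreal (S powr (1 / q))) q"
    using q by (rule epowr_mono)
  also have "\<dots> = ennreal S"
    using q real by (simp add: epowr_ennreal powr_powr)
  finally show ?thesis using real by simp
qed simp

section \<open>Rearrangements and Lorentz energies of peaked profiles\<close>

text \<open>The potential of an averaged bump in the variable t = measure of a ball: with a = s / d
  and b = M / d it is the singularity t^(-a), truncated at height R and with tail t^(-b).\<close>

definition lorentz_kernel :: "real \<Rightarrow> real \<Rightarrow> real \<Rightarrow> real \<Rightarrow> real" where
  "lorentz_kernel a b R t = min (t powr - a) (min R (t powr - b))"

lemma borel_measurable_lorentz_kernel [measurable]: "lorentz_kernel a b R \<in> borel_measurable borel"
  unfolding lorentz_kernel_def by measurable

text \<open>Splitting the measure t into the pieces $2^{-i-1} t$ bounds the decreasing rearrangement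
  of a sum of infinitely many functions peaked at different points.\<close>

lemma rearr_countable_sum:
  fixes h :: "'a::euclidean_space \<Rightarrow> complex" and s M :: real
  defines "d \<equiv> real DIM('a)"
  assumes s: "s > 0" "s \<le> M" and \<epsilon>: "\<And>i. \<epsilon> i \<ge> 0" and R: "\<And>i. R i \<ge> 0"
    and h: "\<And>x. ennreal (norm (h x)) \<le> (\<Sum>i. ennreal (norm (H i x)))"
    and H: "\<And>i x. x \<noteq> b i \<Longrightarrow> norm (H i x) \<le> \<epsilon> i * min (norm (x - b i) powr - s) (min (R i) (norm (x - b i) powr - M))"
    and t: "t > 0"
  shows "rearr h t \<le> (\<Sum>i. ennreal ((max 1 (unit_ball_vol d) * 2 ^ Suc i) powr (M / d) * \<epsilon> i * lorentz_kernel (s / d) (M / d) (R i) t))"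
proof -
  define V where "V = max 1 (unit_ball_vol d)"
  \<comment> \<open>The constant V absorbs the volume of the unit ball, so that the ball of radius
    \<open>z i\<close> has measure at most t 2^(-i-1).\<close>
  define \<theta> where "\<theta> = (\<lambda>i::nat. 1 / (V * 2 ^ Suc i))"
  define z where "z = (\<lambda>i. (\<theta> i * t) powr (1 / d))"
  define a where "a = (\<lambda>i. (V * 2 ^ Suc i) powr (M / d) * \<epsilon> i * lorentz_kernel (s / d) (M / d) (R i) t)"
  have d: "d > 0" by (simp add: d_def)
  have V: "V \<ge> 1" "V > 0" by (auto simp: V_def)
  have \<theta>: "\<theta> i > 0" "\<theta> i \<le> 1" for i
  proof -
    show "\<theta> i > 0" using V by (simp add: \<theta>_def)
    have "1 * 1 \<le> V * 2 ^ Suc i" using V by (intro mult_mono one_le_power) auto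
    then show "\<theta> i \<le> 1" using V by (simp add: \<theta>_def)
  qed
  have z: "z i > 0" for i using \<theta>[of i] t by (simp add: z_def)
  have a0: "a i \<ge> 0" for i using \<epsilon>[of i] R[of i] by (auto simp: a_def lorentz_kernel_def)
  have kernel_le: "\<epsilon> i * min (z i powr - s) (min (R i) (z i powr - M)) \<le> a i" for i
  proof -
    \<comment> \<open>The cost of shrinking t to \<open>\<theta> i * t\<close>. Since
      \<open>\<theta> i \<le> 1\<close>, the largest exponent M / d dominates for all three entries
      of the minimum.\<close>
    define \<Lambda> where "\<Lambda> = \<theta> i powr - (M / d)"
    have zp: "z i powr - e = \<theta> i powr - (e / d) * t powr - (e / d)" for e
      using \<theta>[of i] t d by (simp add: z_def powr_powr powr_mult)
    have "\<Lambda> \<ge> \<theta> i powr 0" unfolding \<Lambda>_def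
      using \<theta>[of i] s d by (intro powr_mono') auto
    then have "\<Lambda> \<ge> 1" using \<theta>(1)[of i] by simp
    then have 2: "R i \<le> \<Lambda> * R i" using R[of i] mult_right_mono[of 1 \<Lambda> "R i"] by simp
    have "\<theta> i powr - (s / d) \<le> \<Lambda>"
      unfolding \<Lambda>_def using \<theta>[of i] s d by (intro powr_mono') (auto simp: divide_right_mono)
    then have 1: "z i powr - s \<le> \<Lambda> * t powr - (s / d)"
      unfolding zp by (rule mult_right_mono) simp
    have 3: "z i powr - M = \<Lambda> * t powr - (M / d)" by (simp add: zp \<Lambda>_def)
    have "\<Lambda> \<ge> 0" by (simp add: \<Lambda>_def)
    then have "min (z i powr - s) (min (R i) (z i powr - M)) \<le> \<Lambda> * lorentz_kernel (s / d) (M / d) (R i) t"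
      using 1 2 3 unfolding lorentz_kernel_def by (auto simp: min_def)
    moreover have "\<Lambda> = (V * 2 ^ Suc i) powr (M / d)"
      using V by (simp add: \<Lambda>_def \<theta>_def powr_divide powr_minus_divide)
    ultimately show ?thesis
      using mult_left_mono[OF _ \<epsilon>[of i]] unfolding a_def by (metis mult.assoc mult.commute)
  qed
  show ?thesis
  proof (cases "(\<Sum>i. ennreal (a i))")
    case (real l)
    have "emeasure lborel {x. norm (h x) > l} \<le> emeasure lborel (\<Union>i. cball (b i) (z i))"
    proof (rule emeasure_mono)
      show "{x. norm (h x) > l} \<subseteq> (\<Union>i. cball (b i) (z i))"
      proof (rule subsetI, rule ccontr)
        fix x assume x: "x \<in> {x. norm (h x) > l}" "x \<notin> (\<Union>i. cball (b i) (z i))"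
        have "norm (H i x) \<le> a i" for i
        proof -
          have xi: "norm (x - b i) > z i" using x(2) by (auto simp: dist_norm norm_minus_commute not_le)
          then have "x \<noteq> b i" using z[of i] by auto
          then have "norm (H i x) \<le> \<epsilon> i * min (norm (x - b i) powr - s) (min (R i) (norm (x - b i) powr - M))"
            by (rule H)
          also have "\<dots> \<le> \<epsilon> i * min (z i powr - s) (min (R i) (z i powr - M))"
            using xi z[of i] s \<epsilon>[of i] by (intro mult_left_mono min.mono powr_mono2') auto
          also have "\<dots> \<le> a i" by (rule kernel_le)
          finally show ?thesis .
        qed
        then have "(\<Sum>i. ennreal (norm (H i x))) \<le> (\<Sum>i. ennreal (a i))"
          by (intro suminf_le summableI ennreal_leI)
        with h[of x] have "ennreal (norm (h x)) \<le> ennreal l" using real by (metis order_trans)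
        with x(1) real show False by (simp add: ennreal_le_iff)
      qed
    qed auto
    also have "\<dots> \<le> (\<Sum>i. emeasure lborel (cball (b i) (z i)))"
      by (rule emeasure_subadditive_countably) auto
    also have "\<dots> \<le> (\<Sum>i. ennreal t * ennreal ((1 / 2) ^ Suc i))"
    proof (intro suminf_le summableI)
      fix i
      have "z i ^ DIM('a) = \<theta> i * t"
        using \<theta>[of i] t d by (simp add: z_def d_def[symmetric] powr_powr flip: powr_realpow)
      then have "emeasure lborel (cball (b i) (z i)) = ennreal (unit_ball_vol d * (\<theta> i * t))"
        using z[of i] by (simp add: emeasure_cball d_def)
      also have "\<dots> \<le> ennreal (V * (\<theta> i * t))"
        using \<theta>[of i] t by (intro ennreal_leI mult_right_mono) (auto simp: V_def)
      also have "V * (\<theta> i * t) = t * (1 / 2) ^ Suc i"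
        using V by (simp add: \<theta>_def power_divide)
      finally show "emeasure lborel (cball (b i) (z i)) \<le> ennreal t * ennreal ((1 / 2) ^ Suc i)"
        using t by (simp add: ennreal_mult'[symmetric])
    qed
    also have "\<dots> = ennreal t"
      by (subst ennreal_suminf_cmult) (simp add: suminf_half_powers del: power_Suc)
    finally have "rearr h t \<le> ennreal l"
      unfolding rearr_def using real by (intro Inf_lower) auto
    then show ?thesis using real by (simp add: a_def V_def)
  qed (simp add: a_def V_def)
qed

text \<open>The q-th power of the L^{1/e,q} quasinorm of the profile, with e standing for 1 /
  r.\<close>

definition lorentz_energy :: "real \<Rightarrow> real \<Rightarrow> real \<Rightarrow> real \<Rightarrow> real \<Rightarrow> ennreal" where
  "lorentz_energy e a b q R =
    (\<integral>\<^sup>+t. ennreal ((t powr e * lorentz_kernel a b R t) powr q * (1 / t)) * indicator {0<..} t \<partial>lborel)"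

text \<open>For q = infinity each profile contributes only a constant: since s / d <= 1 / r <= M /
  d, the product of t^(1/r) with the profile never exceeds 1.\<close>

lemma lorentz_norm_countable_sum_top:
  fixes h :: "'a::euclidean_space \<Rightarrow> complex" and s M :: real
  defines "d \<equiv> real DIM('a)"
  assumes s: "s > 0" "s \<le> M" and \<epsilon>: "\<And>i. \<epsilon> i \<ge> 0" and R: "\<And>i. R i \<ge> 0"
    and h: "\<And>x. ennreal (norm (h x)) \<le> (\<Sum>i. ennreal (norm (H i x)))"
    and H: "\<And>i x. x \<noteq> b i \<Longrightarrow> norm (H i x) \<le> \<epsilon> i * min (norm (x - b i) powr - s) (min (R i) (norm (x - b i) powr - M))"
    and r: "s / d \<le> 1 / r" "1 / r \<le> M / d"
    and fin: "(\<Sum>i. ennreal ((max 1 (unit_ball_vol d) * 2 ^ Suc i) powr (M / d) * \<epsilon> i)) < top"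
  shows "lorentz_norm r top h < top"
proof -
  let ?\<Lambda> = "\<lambda>i. (max 1 (unit_ball_vol d) * 2 ^ Suc i) powr (M / d) * \<epsilon> i"
  have "ennreal (t powr (1 / r)) * rearr h t \<le> (\<Sum>i. ennreal (?\<Lambda> i))" if t: "t > 0" for t
  proof -
    have k1: "t powr (1 / r) * lorentz_kernel (s / d) (M / d) (R i) t \<le> 1" for i
    proof (cases "t \<le> 1")
      case True
      have "t powr (1 / r) * lorentz_kernel (s / d) (M / d) (R i) t \<le> t powr (1 / r) * t powr - (s / d)"
        by (intro mult_left_mono) (auto simp: lorentz_kernel_def)
      also have "\<dots> = t powr (1 / r - s / d)" by (simp flip: powr_add)
      also have "\<dots> \<le> 1" using True t r by (intro powr_le1) auto
      finally show ?thesis .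
    next
      case False
      have "t powr (1 / r) * lorentz_kernel (s / d) (M / d) (R i) t \<le> t powr (1 / r) * t powr - (M / d)"
        by (intro mult_left_mono) (auto simp: lorentz_kernel_def)
      also have "\<dots> = t powr (1 / r - M / d)" by (simp flip: powr_add)
      also have "\<dots> \<le> t powr 0" using False r by (intro powr_mono) auto
      finally show ?thesis using t by simp
    qed
    have "ennreal (t powr (1 / r)) * rearr h t
       \<le> ennreal (t powr (1 / r)) * (\<Sum>i. ennreal (?\<Lambda> i * lorentz_kernel (s / d) (M / d) (R i) t))"
      unfolding d_def by (intro mult_left_mono rearr_countable_sum[OF s \<epsilon> R h H t]) auto
    also have "\<dots> = (\<Sum>i. ennreal (t powr (1 / r)) * ennreal (?\<Lambda> i * lorentz_kernel (s / d) (M / d) (R i) t))"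
      by (rule ennreal_suminf_cmult[symmetric])
    also have "\<dots> \<le> (\<Sum>i. ennreal (?\<Lambda> i))"
    proof (intro suminf_le summableI)
      fix i
      have "?\<Lambda> i * (t powr (1 / r) * lorentz_kernel (s / d) (M / d) (R i) t) \<le> ?\<Lambda> i * 1"
        using \<epsilon>[of i] by (intro mult_left_mono k1) auto
      then show "ennreal (t powr (1 / r)) * ennreal (?\<Lambda> i * lorentz_kernel (s / d) (M / d) (R i) t) \<le> ennreal (?\<Lambda> i)"
        by (subst ennreal_mult'[symmetric]) (auto intro!: ennreal_leI simp: mult_ac)
    qed
    finally show ?thesis .
  qed
  then have "lorentz_norm r top h \<le> (\<Sum>i. ennreal (?\<Lambda> i))"
    by (auto simp: lorentz_norm_def intro!: SUP_least)
  also have "\<dots> < top" by (rule fin)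
  finally show ?thesis .
qed

text \<open>The rearrangement bound turns the norm into a q-th power of a countable sum,
  \<open>epowr_suminf_le\<close> distributes the power at the price of factors 2^(i+1), and
  integration over t leaves one energy per bump.\<close>

lemma lorentz_norm_countable_sum:
  fixes h :: "'a::euclidean_space \<Rightarrow> complex" and s M :: real
  defines "d \<equiv> real DIM('a)"
  assumes s: "s > 0" "s \<le> M" and \<epsilon>: "\<And>i. \<epsilon> i \<ge> 0" and R: "\<And>i. R i \<ge> 0"
    and h: "\<And>x. ennreal (norm (h x)) \<le> (\<Sum>i. ennreal (norm (H i x)))"
    and H: "\<And>i x. x \<noteq> b i \<Longrightarrow> norm (H i x) \<le> \<epsilon> i * min (norm (x - b i) powr - s) (min (R i) (norm (x - b i) powr - M))"
    and q: "q > 0"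
    and fin: "(\<Sum>i. ennreal ((2 ^ Suc i * ((max 1 (unit_ball_vol d) * 2 ^ Suc i) powr (M / d) * \<epsilon> i)) powr q)
        * lorentz_energy (1 / r) (s / d) (M / d) q (R i)) < top"
  shows "lorentz_norm r (ennreal q) h < top"
proof -
  let ?\<Lambda> = "\<lambda>i. (max 1 (unit_ball_vol d) * 2 ^ Suc i) powr (M / d) * \<epsilon> i"
  let ?k = "\<lambda>i t. lorentz_kernel (s / d) (M / d) (R i) t"
  have k0: "?k i t \<ge> 0" for i t using R[of i] by (simp add: lorentz_kernel_def)
  have \<Lambda>0: "?\<Lambda> i \<ge> 0" for i using \<epsilon>[of i] by simp
  have "(\<integral>\<^sup>+t. epowr (ennreal (t powr (1 / r)) * rearr h t) q * ennreal (1 / t) * indicator {0<..} t \<partial>lborel)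
     \<le> (\<integral>\<^sup>+t. (\<Sum>i. ennreal ((2 ^ Suc i * ?\<Lambda> i) powr q) * (ennreal ((t powr (1 / r) * ?k i t) powr q * (1 / t)) * indicator {0<..} t)) \<partial>lborel)"
  proof (rule nn_integral_mono)
    fix t :: real
    show "epowr (ennreal (t powr (1 / r)) * rearr h t) q * ennreal (1 / t) * indicator {0<..} t
      \<le> (\<Sum>i. ennreal ((2 ^ Suc i * ?\<Lambda> i) powr q) * (ennreal ((t powr (1 / r) * ?k i t) powr q * (1 / t)) * indicator {0<..} t))"
    proof (cases "t > 0")
      case True
      have "ennreal (t powr (1 / r)) * rearr h t \<le> ennreal (t powr (1 / r)) * (\<Sum>i. ennreal (?\<Lambda> i * ?k i t))"
        unfolding d_def by (intro mult_left_mono rearr_countable_sum[OF s \<epsilon> R h H True]) auto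
      also have "\<dots> = (\<Sum>i. ennreal (?\<Lambda> i * (t powr (1 / r) * ?k i t)))"
        by (subst ennreal_suminf_cmult[symmetric]) (simp add: ennreal_mult'[symmetric] mult_ac)
      finally have "epowr (ennreal (t powr (1 / r)) * rearr h t) q \<le> epowr (\<Sum>i. ennreal (?\<Lambda> i * (t powr (1 / r) * ?k i t))) q"
        using q by (rule epowr_mono)
      also have "\<dots> \<le> (\<Sum>i. ennreal ((2 ^ Suc i * (?\<Lambda> i * (t powr (1 / r) * ?k i t))) powr q))"
        by (intro epowr_suminf_le mult_nonneg_nonneg[OF \<Lambda>0 mult_nonneg_nonneg[OF powr_ge_zero k0]] q)
      finally have "epowr (ennreal (t powr (1 / r)) * rearr h t) q * ennreal (1 / t)
         \<le> (\<Sum>i. ennreal ((2 ^ Suc i * (?\<Lambda> i * (t powr (1 / r) * ?k i t))) powr q)) * ennreal (1 / t)"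
        by (rule mult_right_mono) simp
      also have "\<dots> = (\<Sum>i. ennreal ((2 ^ Suc i * (?\<Lambda> i * (t powr (1 / r) * ?k i t))) powr q) * ennreal (1 / t))"
        by (rule ennreal_suminf_multc[symmetric])
      also have "\<dots> = (\<Sum>i. ennreal ((2 ^ Suc i * ?\<Lambda> i) powr q) * (ennreal ((t powr (1 / r) * ?k i t) powr q * (1 / t)) * indicator {0<..} t))"
      proof (rule suminf_cong)
        fix i
        have aux: "ennreal (A * B) * ennreal c = ennreal A * (ennreal (B * c) * indicator {0<..} t)"
          if "A \<ge> 0" "B \<ge> 0" "c \<ge> 0" for A B c :: real
          using that True by (simp add: ennreal_mult mult.assoc)
        have "(2 ^ Suc i * (?\<Lambda> i * (t powr (1 / r) * ?k i t))) powr q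
          = (2 ^ Suc i * ?\<Lambda> i) powr q * (t powr (1 / r) * ?k i t) powr q"
          by (subst powr_mult[symmetric]) (simp only: mult.assoc)
        then show "ennreal ((2 ^ Suc i * (?\<Lambda> i * (t powr (1 / r) * ?k i t))) powr q) * ennreal (1 / t)
          = ennreal ((2 ^ Suc i * ?\<Lambda> i) powr q) * (ennreal ((t powr (1 / r) * ?k i t) powr q * (1 / t)) * indicator {0<..} t)"
          using True by (simp only:) (rule aux, auto)
      qed
      finally show ?thesis using True by simp
    qed simp
  qed
  also have "\<dots> = (\<Sum>i. ennreal ((2 ^ Suc i * ?\<Lambda> i) powr q) * lorentz_energy (1 / r) (s / d) (M / d) q (R i))"
    unfolding lorentz_energy_def by (subst nn_integral_suminf) (auto simp: nn_integral_cmult)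
  also have "\<dots> < top" by (rule fin)
  finally show ?thesis
    using q by (simp add: lorentz_norm_def epowr_less_top)
qed

lemma powr_mult_divide:
  fixes t :: real
  assumes "t > 0"
  shows "(t powr e * t powr - c) powr q * (1 / t) = t powr ((e - c) * q - 1)"
proof -
  have "t powr e * t powr - c = t powr (e - c)"
    using powr_add[of t e "- c"] by simp
  then have "(t powr e * t powr - c) powr q = t powr ((e - c) * q)" by (simp only: powr_powr)
  moreover have "t powr ((e - c) * q - 1) = t powr ((e - c) * q) * (1 / t)"
    using assms by (simp add: powr_diff)
  ultimately show ?thesis by (simp only:)
qed

text \<open>Strictly between the two exponents both ends of the t-integral converge, so the bound
  does not see the truncation height R.\<close>

lemma lorentz_energy_subcritical:
  assumes e: "a < e" "e < b" and q: "q > 0"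
  obtains K where "K \<ge> 0" "\<And>R. R \<ge> 0 \<Longrightarrow> lorentz_energy e a b q R \<le> ennreal K"
proof (rule that[of "1 / ((e - a) * q) + 1 / ((b - e) * q)"])
  show "0 \<le> 1 / ((e - a) * q) + 1 / ((b - e) * q)" using e q by simp
  fix R :: real assume R: "R \<ge> 0"
  note p = powr_mult_divide[of _ e _ q]
  have k0: "lorentz_kernel a b R t \<ge> 0" for t using R by (simp add: lorentz_kernel_def)
  have mono: "(t powr e * lorentz_kernel a b R t) powr q * (1 / t) \<le> (t powr e * t powr - c) powr q * (1 / t)"
    if "t > 0" "c = a \<or> c = b" for t c
    using that k0[of t] q by (intro mult_right_mono powr_mono2 mult_left_mono mult_nonneg_nonneg) (auto simp: lorentz_kernel_def)
  have "lorentz_energy e a b q R \<le> (\<integral>\<^sup>+t. ennreal (t powr ((e - a) * q - 1)) * indicator {0<..1} t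
     + ennreal (t powr (- ((b - e) * q) - 1)) * indicator {1<..} t \<partial>lborel)"
    unfolding lorentz_energy_def
  proof (rule nn_integral_mono)
    fix t :: real
    have "(t powr e * lorentz_kernel a b R t) powr q * (1 / t) \<le> t powr ((e - a) * q - 1)"
      "(t powr e * lorentz_kernel a b R t) powr q * (1 / t) \<le> t powr (- ((b - e) * q) - 1)" if "t > 0"
      using mono[OF that, of a] mono[OF that, of b] p[OF that, of a] p[OF that, of b]
      by (auto simp: algebra_simps)
    then show "ennreal ((t powr e * lorentz_kernel a b R t) powr q * (1 / t)) * indicator {0<..} t
       \<le> ennreal (t powr ((e - a) * q - 1)) * indicator {0<..1} t + ennreal (t powr (- ((b - e) * q) - 1)) * indicator {1<..} t"
      by (auto simp: indicator_def intro!: ennreal_leI)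
  qed
  also have "\<dots> = ennreal (1 powr ((e - a) * q) / ((e - a) * q)) + ennreal (1 powr - ((b - e) * q) / ((b - e) * q))"
    using e q by (subst nn_integral_add) (simp_all only: nn_integral_powr_0 nn_integral_powr_inf mult_pos_pos diff_gt_0_iff_gt, auto)
  also have "\<dots> = ennreal (1 / ((e - a) * q) + 1 / ((b - e) * q))"
    using e q by (simp add: ennreal_plus[symmetric] del: ennreal_plus)
  finally show "lorentz_energy e a b q R \<le> ennreal (1 / ((e - a) * q) + 1 / ((b - e) * q))" .
qed

text \<open>At the critical exponent the integrand is 1 / t wherever the profile is t^(-a);
  truncation stops this range at \<open>R powr - (1 / a)\<close>, hence growth only like ln
  R.\<close>

lemma lorentz_energy_critical:
  assumes a: "0 < a" "a < b" and q: "q > 0"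
  obtains K where "K \<ge> 0" "\<And>R. R \<ge> 1 \<Longrightarrow> lorentz_energy a a b q R \<le> ennreal (K * (1 + ln R))"
proof (rule that[of "1 / (a * q) + 1 / ((b - a) * q) + 1 / a"])
  show "0 \<le> 1 / (a * q) + 1 / ((b - a) * q) + 1 / a" using a q by simp
  fix R :: real assume R: "R \<ge> 1"
  \<comment> \<open>The point where t^(-a) reaches the height R.\<close>
  define \<tau> where "\<tau> = R powr - (1 / a)"
  have \<tau>: "\<tau> > 0" "\<tau> \<le> 1" "ln \<tau> = - ln R / a" "\<tau> powr (a * q) = R powr - q"
    using R a powr_mono[of "- (1 / a)" 0 R] by (auto simp: \<tau>_def ln_powr powr_powr)
  have k0: "lorentz_kernel a b R t \<ge> 0" for t using R by (simp add: lorentz_kernel_def)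
  have gen: "(t powr a * lorentz_kernel a b R t) powr q * (1 / t) \<le> (t powr a * u) powr q * (1 / t)"
    if "t > 0" "lorentz_kernel a b R t \<le> u" for t u
    using that k0[of t] q by (intro mult_right_mono powr_mono2 mult_left_mono mult_nonneg_nonneg) auto
  have "lorentz_energy a a b q R \<le> (\<integral>\<^sup>+t. (ennreal (R powr q) * (ennreal (t powr (a * q - 1)) * indicator {0<..\<tau>} t)
     + ennreal (1 / t) * indicator {\<tau>..1} t) + ennreal (t powr (- ((b - a) * q) - 1)) * indicator {1<..} t \<partial>lborel)"
    unfolding lorentz_energy_def
  proof (rule nn_integral_mono)
    fix t :: real
    let ?l = "(t powr a * lorentz_kernel a b R t) powr q * (1 / t)"
    have 1: "?l \<le> R powr q * t powr (a * q - 1)" if t: "t > 0"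
    proof -
      have "?l \<le> (t powr a * R) powr q * (1 / t)" by (rule gen[OF t]) (auto simp: lorentz_kernel_def)
      also have "\<dots> = R powr q * t powr (a * q - 1)"
        using t R by (simp add: powr_mult powr_powr powr_diff)
      finally show ?thesis .
    qed
    have 2: "?l \<le> 1 / t" if t: "t > 0"
    proof -
      have "?l \<le> (t powr a * t powr - a) powr q * (1 / t)" by (rule gen[OF t]) (auto simp: lorentz_kernel_def)
      also have "\<dots> = 1 / t" using t by (simp flip: powr_add)
      finally show ?thesis .
    qed
    have 3: "?l \<le> t powr (- ((b - a) * q) - 1)" if t: "t > 0"
    proof -
      have "?l \<le> (t powr a * t powr - b) powr q * (1 / t)" by (rule gen[OF t]) (auto simp: lorentz_kernel_def)
      also have "\<dots> = t powr ((a - b) * q - 1)" by (rule powr_mult_divide[OF t])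
      also have "(a - b) * q - 1 = - ((b - a) * q) - 1" by (simp add: algebra_simps)
      finally show ?thesis .
    qed
    show "ennreal ?l * indicator {0<..} t
       \<le> (ennreal (R powr q) * (ennreal (t powr (a * q - 1)) * indicator {0<..\<tau>} t)
     + ennreal (1 / t) * indicator {\<tau>..1} t) + ennreal (t powr (- ((b - a) * q) - 1)) * indicator {1<..} t"
    proof -
      consider "t \<le> 0" | "0 < t" "t < \<tau>" | "\<tau> \<le> t" "t \<le> 1" | "t > 1" by linarith
      then show ?thesis
      proof cases
        case 2
        then show ?thesis using 1 \<tau> by (simp add: indicator_def ennreal_mult'[symmetric] ennreal_leI)
      next
        case 3
        then have "ennreal ?l \<le> ennreal (1 / t)" using 2 \<tau> by (intro ennreal_leI) auto
        then show ?thesis using 3 \<tau> by (auto simp: indicator_def intro: order_trans add_increasing)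
      next
        case 4
        then show ?thesis using 3 \<tau> by (auto simp: indicator_def intro!: ennreal_leI)
      qed simp
    qed
  qed
  also have "\<dots> = ennreal (R powr q) * ennreal (\<tau> powr (a * q) / (a * q)) + ennreal (ln 1 - ln \<tau>) + ennreal (1 powr - ((b - a) * q) / ((b - a) * q))"
    using a q \<tau> by (subst nn_integral_add, measurable, subst nn_integral_add, measurable, subst nn_integral_cmult, measurable)
       (simp_all only: nn_integral_powr_0 nn_integral_powr_inf nn_integral_inverse mult_pos_pos diff_gt_0_iff_gt less_imp_le zero_less_one)
  also have "\<dots> = ennreal (1 / (a * q) + ln R / a + 1 / ((b - a) * q))"
    using a q \<tau> R by (simp add: ennreal_mult'[symmetric] ennreal_plus[symmetric] powr_minus del: ennreal_plus)
  also have "\<dots> \<le> ennreal ((1 / (a * q) + 1 / ((b - a) * q) + 1 / a) * (1 + ln R))"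
  proof (rule ennreal_leI)
    have "0 \<le> (1 / (a * q) + 1 / ((b - a) * q)) * ln R" "0 \<le> 1 / a"
      using a q R by (auto intro!: mult_nonneg_nonneg add_nonneg_nonneg)
    then show "1 / (a * q) + ln R / a + 1 / ((b - a) * q) \<le> (1 / (a * q) + 1 / ((b - a) * q) + 1 / a) * (1 + ln R)"
      by (simp add: distrib_left distrib_right)
  qed
  finally show "lorentz_energy a a b q R \<le> ennreal ((1 / (a * q) + 1 / ((b - a) * q) + 1 / a) * (1 + ln R))" .
qed

text \<open>In the critical case R is of order 2^(Js), so the energy is linear in J, and against
  J^(-q) this tends to 0 because q > 1. In the subcritical case the energy is bounded and J^(-q)
  alone suffices.\<close>

lemma lorentz_energy_small:
  assumes q: "q > 0" and s: "s > 0" and a: "0 < a" and e: "e < b" "a < e \<or> a = e \<and> 1 < q"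
    and \<lambda>: "l \<ge> 0" and \<rho>: "0 < \<rho>" "\<rho> \<le> 1" and \<delta>: "\<delta> > 0"
  shows "\<forall>\<^sub>F J in sequentially. ennreal ((l / real J) powr q) * lorentz_energy e a b q ((2 ^ J / \<rho>) powr s) \<le> ennreal \<delta>"
proof -
  have lim: "(\<lambda>J. real J powr - c) \<longlonglongrightarrow> 0" if "c > 0" for c
    using that by (intro tendsto_neg_powr filterlim_real_sequentially) auto
  have split: "(l / real J) powr q = l powr q * real J powr - q" for J
    using \<lambda> by (simp add: powr_divide powr_minus_divide)
  have R: "(2 ^ J / \<rho>) powr s \<ge> 1" for J
  proof -
    have "\<rho> \<le> 2 ^ J" using \<rho>(2) one_le_power[of "2::real" J] by linarith
    then have "1 \<le> 2 ^ J / \<rho>" using \<rho> by simp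
    then show ?thesis using s by (intro ge_one_powr_ge_zero) auto
  qed
  have fin: ?thesis if f: "\<And>J. J \<ge> 1 \<Longrightarrow> lorentz_energy e a b q ((2 ^ J / \<rho>) powr s) \<le> ennreal (f J)"
    "(\<lambda>J. l powr q * (real J powr - q * f J)) \<longlonglongrightarrow> 0" for f
  proof -
    have "\<forall>\<^sub>F J in sequentially. l powr q * (real J powr - q * f J) < \<delta>"
      using order_tendstoD(2)[OF f(2) \<delta>] .
    then show ?thesis using eventually_ge_at_top[of 1]
    proof eventually_elim
      case (elim J)
      have "ennreal ((l / real J) powr q) * lorentz_energy e a b q ((2 ^ J / \<rho>) powr s) \<le> ennreal ((l / real J) powr q) * ennreal (f J)"
        by (intro mult_left_mono f elim) simp
      also have "\<dots> = ennreal (l powr q * (real J powr - q * f J))"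
        by (simp add: ennreal_mult'[symmetric] split mult.assoc)
      also have "\<dots> \<le> ennreal \<delta>" using elim by (intro ennreal_leI) simp
      finally show ?case .
    qed
  qed
  show ?thesis
  proof (cases "a < e")
    case True
    obtain K where K: "\<And>R. R \<ge> 0 \<Longrightarrow> lorentz_energy e a b q R \<le> ennreal K"
      using lorentz_energy_subcritical[OF True e(1) q] by blast
    show ?thesis
    proof (rule fin[of "\<lambda>_. K"])
      show "(\<lambda>J. l powr q * (real J powr - q * K)) \<longlonglongrightarrow> 0"
        using tendsto_mult_right_zero[OF tendsto_mult_left_zero[OF lim[OF q]]] .
    qed (use K in auto)
  next
    case False
    then have e': "e = a" "1 < q" using e by auto
    obtain K where K: "K \<ge> 0" "\<And>R. R \<ge> 1 \<Longrightarrow> lorentz_energy a a b q R \<le> ennreal (K * (1 + ln R))"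
      using lorentz_energy_critical[OF a _ q, of b] e e' by auto
    define f where "f = (\<lambda>J. K * (1 + s * (real J * ln 2 - ln \<rho>)))"
    show ?thesis
    proof (rule fin[of f])
      fix J
      have eq: "ln ((2 ^ J / \<rho>) powr s) = s * (real J * ln 2 - ln \<rho>)"
        using \<rho> by (simp add: ln_powr ln_div ln_realpow)
      show "lorentz_energy e a b q ((2 ^ J / \<rho>) powr s) \<le> ennreal (f J)"
        using K(2)[OF R[of J]] unfolding eq e'(1) f_def .
    next
      have "(\<lambda>J. l powr q * (K * ((1 - s * ln \<rho>) * real J powr - q + s * ln 2 * real J powr - (q - 1)))) \<longlonglongrightarrow> l powr q * (K * ((1 - s * ln \<rho>) * 0 + s * ln 2 * 0))"
        using e' q by (intro tendsto_intros lim) auto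
      then have "(\<lambda>J. l powr q * (K * ((1 - s * ln \<rho>) * real J powr - q + s * ln 2 * real J powr - (q - 1)))) \<longlonglongrightarrow> 0"
        by (simp only: mult_zero_right add_0_left)
      moreover have "\<forall>\<^sub>F J in sequentially. l powr q * (K * ((1 - s * ln \<rho>) * real J powr - q + s * ln 2 * real J powr - (q - 1)))
        = l powr q * (real J powr - q * f J)"
        using eventually_ge_at_top[of 1]
      proof eventually_elim
        case (elim J)
        have "- (q - 1) = - q + 1" by simp
        then have "real J powr - (q - 1) = real J powr - q * real J"
          using elim by (simp only: powr_add) simp
        then show ?case by (simp add: f_def algebra_simps)
      qed
      ultimately show "(\<lambda>J. l powr q * (real J powr - q * f J)) \<longlonglongrightarrow> 0"
        by (rule Lim_transform_eventually)
    qed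
  qed
qed

text \<open>The L^1 bounds 2^(-i-1) allow both sides of \<open>bessel_rep\<close> to be integrated
  term by term against the bounded functions \<phi> and \<open>bessel_schwartz s \<phi>\<close>.
  They give convergence of the series of potentials almost everywhere.\<close>

lemma bessel_rep_countable_sum:
  fixes g H :: "nat \<Rightarrow> 'a::euclidean_space \<Rightarrow> complex"
  assumes s: "s \<ge> 0" and rep: "\<And>i. bessel_rep s (g i) (H i)"
    and g: "\<And>i. (\<integral>\<^sup>+x. ennreal (norm (g i x)) \<partial>lborel) \<le> ennreal ((1 / 2) ^ Suc i)"
    and gm: "\<And>i. g i \<in> borel_measurable borel"
    and H: "\<And>i. (\<integral>\<^sup>+x. ennreal (norm (H i x)) \<partial>lborel) \<le> ennreal ((1 / 2) ^ Suc i)"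
    and c: "\<And>i. norm (c i) \<le> 1" and G: "\<And>x. (\<lambda>i. c i * g i x) sums G x"
  obtains h where "bessel_rep s G h" "\<And>x. ennreal (norm (h x)) \<le> (\<Sum>i. ennreal (norm (H i x)))"
proof -
  have [measurable]: "\<And>i. H i \<in> borel_measurable borel" using rep by (simp add: bessel_rep_def)
  note [measurable] = gm
  have half: "summable (\<lambda>i. (1 / 2 :: real) ^ Suc i)"
    using power_half_series by (rule sums_summable)
  define S where "S = (\<lambda>x. \<Sum>i. ennreal (norm (c i * H i x)))"
  \<comment> \<open>The value 0 where the series fails to converge absolutely makes the bound on
    \<open>h\<close> hold at every point, as the rearrangement estimate requires.\<close>
  define h where "h = (\<lambda>x. if S x < top then (\<Sum>i. c i * H i x) else 0)"
  have [measurable]: "S \<in> borel_measurable borel" unfolding S_def by measurable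
  have [measurable]: "h \<in> borel_measurable borel" unfolding h_def by measurable
  have summ: "summable (\<lambda>i. norm (c i * H i x))" if "S x < top" for x
    using that unfolding S_def by (intro summable_suminf_not_top) auto
  have L1: "integrable lborel (f i)" "(\<integral>x. norm (f i x) \<partial>lborel) \<le> (1 / 2) ^ Suc i"
    if "\<And>i. (\<integral>\<^sup>+x. ennreal (norm (f i x)) \<partial>lborel) \<le> ennreal ((1 / 2) ^ Suc i)" "\<And>i. f i \<in> borel_measurable borel"
    for f :: "nat \<Rightarrow> 'a \<Rightarrow> complex" and i
  proof -
    show "integrable lborel (f i)"
      using that[of i] by (intro integrableI_bounded) (auto intro: le_less_trans)
    show "(\<integral>x. norm (f i x) \<partial>lborel) \<le> (1 / 2) ^ Suc i"
      using that(1)[of i] that(2)[of i] by (subst integral_eq_nn_integral) (auto intro: enn2real_leI simp del: power_Suc)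
  qed
  have AES: "AE x in lborel. (\<Sum>i. ennreal (norm (f i x))) < top"
    if f: "\<And>i. (\<integral>\<^sup>+x. ennreal (norm (f i x)) \<partial>lborel) \<le> ennreal ((1 / 2) ^ Suc i)" and [measurable]: "\<And>i. f i \<in> borel_measurable borel"
    for f :: "nat \<Rightarrow> 'a \<Rightarrow> complex"
  proof -
    have "(\<integral>\<^sup>+x. (\<Sum>i. ennreal (norm (f i x))) \<partial>lborel) = (\<Sum>i. \<integral>\<^sup>+x. ennreal (norm (f i x)) \<partial>lborel)"
      by (rule nn_integral_suminf) measurable
    also have "\<dots> \<le> (\<Sum>i. ennreal ((1 / 2) ^ Suc i))"
      by (intro suminf_le summableI f)
    also have "\<dots> < top" by (simp only: suminf_half_powers) simp
    finally have "AE x in lborel. (\<Sum>i. ennreal (norm (f i x))) \<noteq> \<infinity>"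
      by (intro nn_integral_noteq_infinite) auto
    then show ?thesis by (rule AE_mp) (auto simp: top.not_eq_extremum)
  qed
  have cf: "(\<integral>\<^sup>+x. ennreal (norm (c i * f i x)) \<partial>lborel) \<le> ennreal ((1 / 2) ^ Suc i)"
    if "(\<integral>\<^sup>+x. ennreal (norm (f i x)) \<partial>lborel) \<le> ennreal ((1 / 2) ^ Suc i)" for f :: "nat \<Rightarrow> 'a \<Rightarrow> complex" and i
  proof (rule order_trans[OF _ that], rule nn_integral_mono)
    fix x show "ennreal (norm (c i * f i x)) \<le> ennreal (norm (f i x))"
      using c[of i] by (simp add: norm_mult mult_left_le_one_le ennreal_leI)
  qed
  \<comment> \<open>One statement for both sides of the duality: the potentials \<open>H\<close>
    tested with \<phi>, and the functions \<open>g\<close> tested with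
    \<open>bessel_schwartz s \<phi>\<close>.\<close>
  have key: "integrable lborel (\<lambda>x. F x * \<phi> x) \<and> (\<lambda>i. c i * (\<integral>x. f i x * \<phi> x \<partial>lborel)) sums (\<integral>x. F x * \<phi> x \<partial>lborel)"
    if f: "\<And>i. (\<integral>\<^sup>+x. ennreal (norm (f i x)) \<partial>lborel) \<le> ennreal ((1 / 2) ^ Suc i)" and fm[measurable]: "\<And>i. f i \<in> borel_measurable borel"
     and F: "AE x in lborel. F x = (\<Sum>i. c i * f i x)" and [measurable]: "F \<in> borel_measurable borel"
     and \<phi>: "\<And>x. norm (\<phi> x) \<le> B" and [measurable]: "\<phi> \<in> borel_measurable borel"
    for f :: "nat \<Rightarrow> 'a \<Rightarrow> complex" and F \<phi> B
  proof -
    have B: "B \<ge> 0" using \<phi>[of 0] norm_ge_zero order_trans by blast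
    have cff: "(\<integral>\<^sup>+x. ennreal (norm (c i * f i x)) \<partial>lborel) \<le> ennreal ((1 / 2) ^ Suc i)" for i
      by (rule cf[OF f])
    define u where "u = (\<lambda>i x. c i * f i x * \<phi> x)"
    have cfi: "integrable lborel (\<lambda>x. c i * f i x)" "(\<integral>x. norm (c i * f i x) \<partial>lborel) \<le> (1 / 2) ^ Suc i" for i
      using L1[of "\<lambda>i x. c i * f i x" i, OF cff] by auto
    have ule: "norm (u i x) \<le> B * norm (c i * f i x)" for i x
      using mult_left_mono[OF \<phi>[of x] norm_ge_zero[of "c i * f i x"]] by (simp add: u_def norm_mult mult_ac)
    have ui: "integrable lborel (u i)" for i
      by (rule Bochner_Integration.integrable_bound[OF integrable_mult_right[OF integrable_norm[OF cfi(1)[of i]], of B]])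
         (use ule B in \<open>auto simp: u_def norm_mult intro!: AE_I2\<close>)
    have us: "AE x in lborel. summable (\<lambda>i. norm (u i x))"
    proof (rule AE_mp[OF AES[of "\<lambda>i x. c i * f i x", OF cff]])
      show "AE x in lborel. (\<Sum>i. ennreal (norm (c i * f i x))) < top \<longrightarrow> summable (\<lambda>i. norm (u i x))"
      proof (rule AE_I2, rule impI)
        fix x assume "(\<Sum>i. ennreal (norm (c i * f i x))) < top"
        then have "summable (\<lambda>i. norm (c i * f i x))"
          by (intro summable_suminf_not_top) auto
        then have "summable (\<lambda>i. B * norm (c i * f i x))" by (rule summable_mult)
        then show "summable (\<lambda>i. norm (u i x))" by (rule summable_comparison_test'[of _ 0]) (simp add: ule)
      qed
    qed measurable
    have us': "summable (\<lambda>i. \<integral>x. norm (u i x) \<partial>lborel)"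
    proof (rule summable_comparison_test'[of "\<lambda>i. B * (1 / 2) ^ Suc i" 0])
      show "summable (\<lambda>i. B * (1 / 2) ^ Suc i)" using half by (rule summable_mult)
      fix i
      have "(\<integral>x. norm (u i x) \<partial>lborel) \<le> (\<integral>x. B * norm (c i * f i x) \<partial>lborel)"
        by (intro integral_mono integrable_norm ui integrable_mult_right cfi ule)
      also have "\<dots> = B * (\<integral>x. norm (c i * f i x) \<partial>lborel)" by simp
      also have "\<dots> \<le> B * (1 / 2) ^ Suc i" by (rule mult_left_mono[OF cfi(2) B])
      finally show "norm (\<integral>x. norm (u i x) \<partial>lborel) \<le> B * (1 / 2) ^ Suc i" by simp
    qed
    have eq: "AE x in lborel. (\<Sum>i. u i x) = F x * \<phi> x"
    proof (rule AE_mp[OF F], rule AE_mp[OF AES[of "\<lambda>i x. c i * f i x", OF cff]])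
      show "AE x in lborel. (\<Sum>i. ennreal (norm (c i * f i x))) < top \<longrightarrow> F x = (\<Sum>i. c i * f i x) \<longrightarrow> (\<Sum>i. u i x) = F x * \<phi> x"
      proof (rule AE_I2, intro impI)
        fix x assume "(\<Sum>i. ennreal (norm (c i * f i x))) < top" and Fx: "F x = (\<Sum>i. c i * f i x)"
        then have "summable (\<lambda>i. norm (c i * f i x))"
          by (intro summable_suminf_not_top) auto
        then have "summable (\<lambda>i. c i * f i x)" by (rule summable_norm_cancel)
        then show "(\<Sum>i. u i x) = F x * \<phi> x" unfolding u_def Fx by (rule suminf_mult2[symmetric])
      qed
    qed measurable
    have "integrable lborel (\<lambda>x. \<Sum>i. u i x)" by (rule integrable_suminf[OF ui us us'])
    moreover have um: "(\<lambda>x. \<Sum>i. u i x) \<in> borel_measurable lborel" unfolding u_def by measurable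
    ultimately have int: "integrable lborel (\<lambda>x. F x * \<phi> x)"
      using eq by (subst integrable_cong_AE[symmetric, of "\<lambda>x. \<Sum>i. u i x"]) auto
    have "(\<lambda>i. \<integral>x. u i x \<partial>lborel) sums (\<integral>x. (\<Sum>i. u i x) \<partial>lborel)"
      by (rule sums_integral[OF ui us us'])
    also have "(\<integral>x. (\<Sum>i. u i x) \<partial>lborel) = (\<integral>x. F x * \<phi> x \<partial>lborel)"
      using eq um by (intro integral_cong_AE) auto
    finally show ?thesis using int by (simp add: u_def mult.assoc)
  qed
  have "bessel_rep s G h" unfolding bessel_rep_def
  proof (intro conjI allI impI)
    show "h \<in> borel_measurable lborel" by simp
    fix \<phi> :: "'a \<Rightarrow> complex" assume \<phi>: "schwartz \<phi>"
    have [measurable]: "\<phi> \<in> borel_measurable borel" by (rule schwartz_measurable[OF \<phi>])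
    obtain B where B: "\<And>x. norm (\<phi> x) \<le> B"
      using schwartz_decay[OF \<phi>, of 0] by auto
    obtain B' where B': "\<And>x. norm (bessel_schwartz s \<phi> x) \<le> B'"
      using bessel_schwartz_bounded(1)[OF \<phi> s] by blast
    have [measurable]: "bessel_schwartz s \<phi> \<in> borel_measurable borel"
      by (rule bessel_schwartz_bounded(2)[OF \<phi> s])
    have "G = (\<lambda>x. \<Sum>i. c i * g i x)" using G by (auto simp: sums_iff)
    then have [measurable]: "G \<in> borel_measurable borel" by simp
    have cH: "(\<integral>\<^sup>+x. ennreal (norm (c i * H i x)) \<partial>lborel) \<le> ennreal ((1 / 2) ^ Suc i)" for i
      by (rule cf[OF H])
    have hAE: "AE x in lborel. h x = (\<Sum>i. c i * H i x)"
      using AES[of "\<lambda>i x. c i * H i x", OF cH] by (rule AE_mp) (auto simp: h_def S_def)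
    have GAE: "AE x in lborel. G x = (\<Sum>i. c i * g i x)" using G by (auto simp: sums_iff)
    have 1: "integrable lborel (\<lambda>x. h x * \<phi> x) \<and> (\<lambda>i. c i * (\<integral>x. H i x * \<phi> x \<partial>lborel)) sums (\<integral>x. h x * \<phi> x \<partial>lborel)"
      by (rule key[OF H _ hAE _ B]) measurable
    have 2: "integrable lborel (\<lambda>x. G x * bessel_schwartz s \<phi> x) \<and>
       (\<lambda>i. c i * (\<integral>x. g i x * bessel_schwartz s \<phi> x \<partial>lborel)) sums (\<integral>x. G x * bessel_schwartz s \<phi> x \<partial>lborel)"
      by (rule key[OF g _ GAE _ B']) measurable
    have 3: "(\<integral>x. H i x * \<phi> x \<partial>lborel) = (\<integral>x. g i x * bessel_schwartz s \<phi> x \<partial>lborel)" for i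
      using rep[of i] \<phi> by (auto simp: bessel_rep_def)
    show "integrable lborel (\<lambda>x. h x * \<phi> x)" using 1 by blast
    show "(\<integral>x. h x * \<phi> x \<partial>lborel) = (\<integral>x. G x * bessel_schwartz s \<phi> x \<partial>lborel)"
      using 1 2 unfolding 3 by (blast intro: sums_unique2)
  qed
  moreover have "ennreal (norm (h x)) \<le> (\<Sum>i. ennreal (norm (H i x)))" for x
  proof (cases "S x < top")
    case True
    have "ennreal (norm (h x)) \<le> ennreal (\<Sum>i. norm (c i * H i x))"
      using True summable_norm[OF summ[OF True]] by (auto simp: h_def intro: ennreal_leI)
    also have "\<dots> = S x" unfolding S_def using summ[OF True] by (intro suminf_ennreal2[symmetric]) auto
    also have "\<dots> \<le> (\<Sum>i. ennreal (norm (H i x)))"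
      unfolding S_def using c by (intro suminf_le summableI ennreal_leI) (auto simp: norm_mult mult_left_le_one_le)
    finally show ?thesis .
  qed (simp add: h_def)
  ultimately show ?thesis by (rule that)
qed

lemma sobolev_lorentz_norm_zero:
  assumes "q > 0"
  shows "sobolev_lorentz_norm s r q (\<lambda>x::'a::euclidean_space. 0) = 0"
proof -
  have "rearr (\<lambda>x::'a. 0) t \<le> ennreal 0" for t
    unfolding rearr_def by (rule Inf_lower) auto
  then have "rearr (\<lambda>x::'a. 0) t = 0" for t by simp
  then have "lorentz_norm r q (\<lambda>x::'a. 0) = 0"
    by (auto simp: lorentz_norm_def epowr_def image_constant_conv)
  moreover have "bessel_rep s (\<lambda>x::'a. 0) (\<lambda>x. 0)" by (simp add: bessel_rep_def)
  ultimately have "sobolev_lorentz_norm s r q (\<lambda>x::'a. 0) \<le> 0"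
    unfolding sobolev_lorentz_norm_def by (intro Inf_lower) (auto intro!: exI[of _ "\<lambda>x. 0"])
  then show ?thesis by simp
qed

section \<open>Multipliers with prescribed values at isolated points\<close>

text \<open>Disjoint supports around the points let \<sigma> take the prescribed values; the number
  of scales in each bump is chosen last, so large that the contributions are dominated by the series
  of 2^(-i-1).\<close>

lemma multiplier_construction:
  fixes \<Psi> :: "'a::euclidean_space \<Rightarrow> complex" and s r :: real and q :: ennreal
    and a :: "nat \<Rightarrow> 'a" and c :: "nat \<Rightarrow> complex" and \<delta> :: "nat \<Rightarrow> real"
  assumes \<Psi>: "schwartz \<Psi>"
    and supp: "\<And>\<xi>. fourier \<Psi> \<xi> \<noteq> 0 \<Longrightarrow> 1/2 \<le> norm \<xi> \<and> norm \<xi> \<le> 2"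
    and s: "0 < s" "s < DIM('a)" and r: "0 < r" and q: "0 < q"
    and rq: "r < DIM('a) / s \<or> r = DIM('a) / s \<and> 1 < q"
    and c: "\<And>i. norm (c i) \<le> 1"
    and a: "\<And>i. 7/8 \<le> norm (a i)" "\<And>i. norm (a i) \<le> 9/8"
    and \<delta>: "\<And>i. \<delta> i > 0" and sep: "\<And>i j. i \<noteq> j \<Longrightarrow> norm (a i - a j) \<ge> \<delta> i"
  obtains \<sigma> where "\<sigma> \<in> borel_measurable borel" "\<And>x. norm (\<sigma> x) \<le> 1"
    "\<And>i. \<sigma> (a i) = c i" "\<And>i. isCont \<sigma> (a i)"
    "(SUP k::int. sobolev_lorentz_norm s r q (\<lambda>\<xi>. \<sigma> (2 powr real_of_int k *\<^sub>R \<xi>) * fourier \<Psi> \<xi>)) < top"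
proof -
  define d where "d = real DIM('a)"
  have d: "d \<ge> 1" "real DIM('a) = d" by (simp_all add: d_def Suc_leI)
  define N where "N = nat \<lceil>s + 2\<rceil>"
  \<comment> \<open>The extra d / r ensures M / d > 1 / r, the decay that the Lorentz integrals need
    at infinity.\<close>
  define M where "M = d + s + d / r"
  have N: "real N \<ge> s + 2" unfolding N_def by linarith
  have N0: "N > 0" using N s by (cases N) auto
  have M: "real DIM('a) + s \<le> M" using d r by (simp add: M_def)
  have sM: "s \<le> M" using M d by linarith
  have "0 < d * r + r * s" using d r s by (intro add_pos_pos mult_pos_pos) auto
  then have rM: "1 / r < M / d" using d r s by (simp add: M_def field_simps)
  have sr: "s / d < 1 / r \<or> s / d = 1 / r \<and> 1 < q" "s / d \<le> 1 / r"
    using rq s r d by (auto simp: field_simps)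
  obtain C where C: "C > 0"
    "\<And>\<rho> a J. 0 < \<rho> \<Longrightarrow> \<rho> \<le> 1 \<Longrightarrow> J \<ge> 1 \<Longrightarrow>
      (\<exists>h. let g = (\<lambda>x. of_real (avg_bump N J \<rho> a x) * fourier \<Psi> x) in
       integrable lborel g \<and> bessel_rep s g h \<and>
       (\<integral>\<^sup>+x. ennreal (norm (g x)) \<partial>lborel) \<le> ennreal (C / J) \<and>
       (\<integral>\<^sup>+x. ennreal (norm (h x)) \<partial>lborel) \<le> ennreal (C / J) \<and>
       (\<forall>x. x \<noteq> a \<longrightarrow> norm (h x) \<le> C / J * min (norm (x - a) powr - s) (min ((2 ^ J / \<rho>) powr s) (norm (x - a) powr - M))))"
    using avg_bump_bounds[OF \<Psi> s N M] by blast
  \<comment> \<open>A support radius \<open>d * \<rho> i\<close> of at most 1/16 keeps \<sigma> near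
    the unit sphere; a radius of at most \<open>\<delta> i / 3\<close> keeps supports disjoint, as
    two radii then add up to less than the larger separation. Also
    \<open>\<rho> i \<le> 1 / 2\<close>, so the rescaled radius for the dilation by 1/2 stays at
    most 1.\<close>
  define \<rho> where "\<rho> = (\<lambda>i. min (1 / (16 * d)) (\<delta> i / (3 * d)))"
  have \<rho>: "\<rho> i > 0" "\<rho> i \<le> 1 / 2" "d * \<rho> i \<le> 1 / 16" "d * \<rho> i \<le> \<delta> i / 3" for i
  proof -
    show "\<rho> i > 0" using d \<delta>[of i] by (simp add: \<rho>_def)
    have "\<rho> i \<le> 1 / (16 * d)" "\<rho> i \<le> \<delta> i / (3 * d)" by (simp_all add: \<rho>_def)
    then show 1: "d * \<rho> i \<le> 1 / 16" "d * \<rho> i \<le> \<delta> i / 3" using d by (simp_all add: field_simps)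
    have "1 * \<rho> i \<le> d * \<rho> i" using d \<open>\<rho> i > 0\<close> by (intro mult_right_mono) auto
    with 1 show "\<rho> i \<le> 1 / 2" by simp
  qed
  define \<Lambda> where "\<Lambda> = (\<lambda>i. (max 1 (unit_ball_vol d) * 2 ^ Suc i) powr (M / d))"
  have \<Lambda>: "\<Lambda> i \<ge> 0" for i by (simp add: \<Lambda>_def)
  \<comment> \<open>The requirements on J at the i-th point: the L^1 bounds for
    \<open>bessel_rep_countable_sum\<close>, the coefficient bound for q = infinity, and for finite
    q the energy bound under each of the three dilations that meet the annulus.\<close>
  define good where "good = (\<lambda>i J. J \<ge> 1 \<and> C / real J \<le> (1 / 2) ^ Suc i \<and> \<Lambda> i * (C / real J) \<le> (1 / 2) ^ Suc i \<and>
      (q < top \<longrightarrow> (\<forall>\<kappa>\<in>{1/2, 1, 2}. ennreal ((2 ^ Suc i * (\<Lambda> i * (C / real J))) powr enn2real q)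
         * lorentz_energy (1 / r) (s / d) (M / d) (enn2real q) ((2 ^ J / (\<rho> i / \<kappa>)) powr s) \<le> ennreal ((1 / 2) ^ Suc i))))"
  have "\<exists>J. good i J" for i
  proof -
    have lim: "(\<lambda>J. l * (C / real J)) \<longlonglongrightarrow> 0" for l
      using tendsto_mult_right_zero[OF lim_const_over_n[of C], of l] by simp
    have e1: "\<forall>\<^sub>F J in sequentially. l * (C / real J) \<le> (1 / 2) ^ Suc i" for l
    proof -
      have "\<forall>\<^sub>F J in sequentially. l * (C / real J) < (1 / 2) ^ Suc i"
        by (rule order_tendstoD(2)[OF lim]) simp
      then show ?thesis by eventually_elim simp
    qed
    have e2: "\<forall>\<^sub>F J in sequentially. q < top \<longrightarrow> ennreal ((2 ^ Suc i * (\<Lambda> i * (C / real J))) powr enn2real q)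
         * lorentz_energy (1 / r) (s / d) (M / d) (enn2real q) ((2 ^ J / (\<rho> i / \<kappa>)) powr s) \<le> ennreal ((1 / 2) ^ Suc i)"
      if \<kappa>: "\<kappa> \<in> {1/2, 1, 2}" for \<kappa> :: real
    proof (cases "q < top")
      case True
      have q': "enn2real q > 0" "1 < q \<longrightarrow> 1 < enn2real q"
        using q True by (cases q; simp add: ennreal_less_iff flip: ennreal_1)+
      have \<rho>\<kappa>: "0 < \<rho> i / \<kappa>" "\<rho> i / \<kappa> \<le> 1" using \<rho>(1,2)[of i] \<kappa> by auto
      have "\<forall>\<^sub>F J in sequentially. ennreal ((2 ^ Suc i * \<Lambda> i * C / real J) powr enn2real q)
         * lorentz_energy (1 / r) (s / d) (M / d) (enn2real q) ((2 ^ J / (\<rho> i / \<kappa>)) powr s) \<le> ennreal ((1 / 2) ^ Suc i)"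
        using s d r rM sr q' \<Lambda>[of i] C(1) by (intro lorentz_energy_small \<rho>\<kappa>) auto
      then show ?thesis by (simp add: mult.assoc)
    qed simp
    have e3: "\<forall>\<^sub>F J in sequentially. \<forall>\<kappa>\<in>{1/2, 1, 2}. q < top \<longrightarrow> ennreal ((2 ^ Suc i * (\<Lambda> i * (C / real J))) powr enn2real q)
         * lorentz_energy (1 / r) (s / d) (M / d) (enn2real q) ((2 ^ J / (\<rho> i / \<kappa>)) powr s) \<le> ennreal ((1 / 2) ^ Suc i)"
      by (rule eventually_ball_finite) (simp, blast intro: e2)
    have "\<forall>\<^sub>F J in sequentially. good i J"
      using eventually_ge_at_top[of 1] e1[of 1] e1[of "\<Lambda> i"] e3
    proof eventually_elim
      case (elim J)
      then show ?case unfolding good_def mult_1 by blast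
    qed
    then show ?thesis by (rule eventually_happens'[OF sequentially_bot])
  qed
  then obtain J where J: "\<And>i. good i (J i)" by metis
  have J1: "J i \<ge> 1" "C / real (J i) \<le> (1 / 2) ^ Suc i" "\<Lambda> i * (C / real (J i)) \<le> (1 / 2) ^ Suc i" for i
    using J[of i] by (auto simp: good_def)
  define B where "B = (\<lambda>i x. of_real (avg_bump N (J i) (\<rho> i) (a i) x) :: complex)"
  have Bm[measurable]: "B i \<in> borel_measurable borel" for i unfolding B_def by measurable
  have Bsupp: "norm (x - a i) \<le> d * \<rho> i" if "B i x \<noteq> 0" for i x
    using avg_bump_support[OF N0 \<rho>(1)] that unfolding B_def d_def by auto
  have disj: "B j x = 0" if "B i x \<noteq> 0" "i \<noteq> j" for i j x
  proof (rule ccontr)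
    assume "B j x \<noteq> 0"
    then have "norm (a i - a j) \<le> d * \<rho> i + d * \<rho> j"
      using Bsupp[OF that(1)] Bsupp[of j x] norm_triangle_ineq4[of "x - a j" "x - a i"] by simp
    also have "\<dots> \<le> \<delta> i / 3 + \<delta> j / 3" using \<rho>(4)[of i] \<rho>(4)[of j] by linarith
    finally show False
      using sep[OF that(2)] sep[OF that(2)[symmetric]] \<delta>[of i] \<delta>[of j] by (simp add: norm_minus_commute)
  qed
  define \<sigma> where "\<sigma> = (\<lambda>x. \<Sum>i. c i * B i x)"
  have single: "(\<lambda>i. c i * B i x) sums (c i * B i x)" if "\<And>j. j \<noteq> i \<Longrightarrow> B j x = 0" for i x
    using sums_finite[of "{i}" "\<lambda>i. c i * B i x"] that by auto
  have \<sigma>_eq: "\<sigma> x = c i * B i x" if "\<And>j. j \<noteq> i \<Longrightarrow> B j x = 0" for i x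
    unfolding \<sigma>_def using sums_unique[OF single[OF that]] by simp
  \<comment> \<open>By disjointness at most one summand is nonzero at x, so the series reduces to a
    single term.\<close>
  have ex: "\<exists>i. \<forall>j. j \<noteq> i \<longrightarrow> B j x = 0" for x using disj[of _ x] by blast
  have sums: "(\<lambda>i. c i * B i x) sums \<sigma> x" for x
  proof -
    obtain i where i: "\<And>j. j \<noteq> i \<Longrightarrow> B j x = 0" using ex by blast
    show ?thesis using single[OF i] \<sigma>_eq[OF i] by simp
  qed
  have Ble: "norm (B i x) \<le> 1" for i x by (simp add: B_def)
  have \<sigma>1: "norm (\<sigma> x) \<le> 1" for x
  proof -
    obtain i where i: "\<And>j. j \<noteq> i \<Longrightarrow> B j x = 0" using ex by blast
    have "\<sigma> x = c i * B i x" by (rule \<sigma>_eq) (rule i)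
    then have "norm (\<sigma> x) = norm (c i) * norm (B i x)" by (simp only: norm_mult)
    also have "\<dots> \<le> 1" using c[of i] Ble[of i x] by (simp add: mult_le_one)
    finally show ?thesis .
  qed
  have \<sigma>m: "\<sigma> \<in> borel_measurable borel" unfolding \<sigma>_def by measurable
  have near: "\<sigma> x = c i * B i x" if x: "x \<in> ball (a i) (\<delta> i / 3)" for i x
  proof (rule \<sigma>_eq, rule ccontr)
    fix j assume j: "j \<noteq> i" "B j x \<noteq> 0"
    have "norm (x - a j) \<le> \<delta> j / 3" using Bsupp[OF j(2)] \<rho>(4)[of j] by linarith
    moreover have "norm (x - a i) < \<delta> i / 3" using x by (simp add: dist_norm norm_minus_commute)
    moreover have "norm (a i - a j) \<le> norm (x - a j) + norm (x - a i)"
      using norm_triangle_ineq4[of "x - a j" "x - a i"] by simp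
    ultimately show False using sep[OF j(1)] sep[OF j(1)[symmetric]] \<delta>[of i] \<delta>[of j]
      by (simp add: norm_minus_commute)
  qed
  have \<sigma>a: "\<sigma> (a i) = c i" for i
    using near[of "a i" i] \<delta>[of i] J1(1)[of i] by (simp add: B_def)
  have \<sigma>c: "isCont \<sigma> (a i)" for i
  proof -
    have "continuous_on (ball (a i) (\<delta> i / 3)) (\<lambda>x. c i * B i x)"
      unfolding B_def by (intro continuous_intros continuous_on_avg_bump)
    then have "continuous_on (ball (a i) (\<delta> i / 3)) \<sigma>"
      using continuous_on_cong[of "ball (a i) (\<delta> i / 3)" "ball (a i) (\<delta> i / 3)" \<sigma> "\<lambda>x. c i * B i x"] near
      by blast
    then show ?thesis
      using \<delta>[of i] by (simp add: continuous_on_eq_continuous_at)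
  qed
  have fin: "sobolev_lorentz_norm s r q (\<lambda>\<xi>. \<sigma> (\<kappa> *\<^sub>R \<xi>) * fourier \<Psi> \<xi>) < top" if \<kappa>: "\<kappa> \<in> {1/2, 1, 2}" for \<kappa> :: real
  proof -
    have \<kappa>0: "\<kappa> > 0" using \<kappa> by auto
    have \<rho>\<kappa>: "0 < \<rho> i / \<kappa>" "\<rho> i / \<kappa> \<le> 1" for i using \<rho>(1,2)[of i] \<kappa> by auto
    define g where "g = (\<lambda>i x. of_real (avg_bump N (J i) (\<rho> i / \<kappa>) (a i /\<^sub>R \<kappa>) x) * fourier \<Psi> x)"
    define R where "R = (\<lambda>i. (2 ^ J i / (\<rho> i / \<kappa>)) powr s)"
    have "\<forall>i. \<exists>h. integrable lborel (g i) \<and> bessel_rep s (g i) h \<and>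
       (\<integral>\<^sup>+x. ennreal (norm (g i x)) \<partial>lborel) \<le> ennreal (C / J i) \<and>
       (\<integral>\<^sup>+x. ennreal (norm (h x)) \<partial>lborel) \<le> ennreal (C / J i) \<and>
       (\<forall>x. x \<noteq> a i /\<^sub>R \<kappa> \<longrightarrow> norm (h x) \<le> C / J i * min (norm (x - a i /\<^sub>R \<kappa>) powr - s) (min (R i) (norm (x - a i /\<^sub>R \<kappa>) powr - M)))"
      using C(2)[OF \<rho>\<kappa> J1(1)] unfolding g_def R_def Let_def by blast
    then obtain H where H: "\<And>i. integrable lborel (g i)" "\<And>i. bessel_rep s (g i) (H i)"
       "\<And>i. (\<integral>\<^sup>+x. ennreal (norm (g i x)) \<partial>lborel) \<le> ennreal (C / J i)"
       "\<And>i. (\<integral>\<^sup>+x. ennreal (norm (H i x)) \<partial>lborel) \<le> ennreal (C / J i)"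
       "\<And>i x. x \<noteq> a i /\<^sub>R \<kappa> \<Longrightarrow> norm (H i x) \<le> C / J i * min (norm (x - a i /\<^sub>R \<kappa>) powr - s) (min (R i) (norm (x - a i /\<^sub>R \<kappa>) powr - M))"
      by metis
    have gB: "g i x = B i (\<kappa> *\<^sub>R x) * fourier \<Psi> x" for i x
      by (simp add: g_def B_def avg_bump_scale[OF \<kappa>0])
    have Gs: "(\<lambda>i. c i * g i x) sums (\<sigma> (\<kappa> *\<^sub>R x) * fourier \<Psi> x)" for x
      unfolding gB mult.assoc[symmetric] by (rule sums_mult2[OF sums])
    have s0: "s \<ge> 0" using s by simp
    have g1: "(\<integral>\<^sup>+x. ennreal (norm (g i x)) \<partial>lborel) \<le> ennreal ((1 / 2) ^ Suc i)" for i
      using order_trans[OF H(3) ennreal_leI[OF J1(2)]] .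
    have H1: "(\<integral>\<^sup>+x. ennreal (norm (H i x)) \<partial>lborel) \<le> ennreal ((1 / 2) ^ Suc i)" for i
      using order_trans[OF H(4) ennreal_leI[OF J1(2)]] .
    have gm: "g i \<in> borel_measurable borel" for i using H(1)[of i] by auto
    obtain h where h: "bessel_rep s (\<lambda>x. \<sigma> (\<kappa> *\<^sub>R x) * fourier \<Psi> x) h" "\<And>x. ennreal (norm (h x)) \<le> (\<Sum>i. ennreal (norm (H i x)))"
      using bessel_rep_countable_sum[OF s0 H(2) g1 gm H1 c Gs] by blast
    have \<epsilon>: "C / real (J i) \<ge> 0" for i using C by simp
    have R0: "R i \<ge> 0" for i by (simp add: R_def)
    have "lorentz_norm r q h < top"
    proof (cases "q = top")
      case True
      have "(\<Sum>i. ennreal (\<Lambda> i * (C / real (J i)))) \<le> (\<Sum>i. ennreal ((1 / 2) ^ Suc i))"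
        by (intro suminf_le summableI ennreal_leI J1)
      also have "\<dots> < top" by (simp only: suminf_half_powers) simp
      finally show ?thesis unfolding True
        using lorentz_norm_countable_sum_top[OF s(1) sM \<epsilon> R0 h(2) H(5)] sr(2) rM by (simp add: d_def \<Lambda>_def)
    next
      case False
      then have qt: "q < top" by (simp add: top.not_eq_extremum)
      then have q': "enn2real q > 0" "ennreal (enn2real q) = q" using q by (auto simp: enn2real_positive_iff)
      have "(\<Sum>i. ennreal ((2 ^ Suc i * (\<Lambda> i * (C / real (J i)))) powr enn2real q)
         * lorentz_energy (1 / r) (s / d) (M / d) (enn2real q) (R i)) \<le> (\<Sum>i. ennreal ((1 / 2) ^ Suc i))"
        using J qt \<kappa> unfolding good_def R_def by (intro suminf_le summableI) blast
      also have "\<dots> < top" by (simp only: suminf_half_powers) simp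
      finally have "lorentz_norm r (ennreal (enn2real q)) h < top"
        using lorentz_norm_countable_sum[where b="\<lambda>i. a i /\<^sub>R \<kappa>" and \<epsilon>="\<lambda>i. C / real (J i)" and R=R and H=H and r=r,
          OF s(1) sM \<epsilon> R0 h(2) H(5) q'(1)]
        unfolding d_def \<Lambda>_def by blast
      then show ?thesis unfolding q' .
    qed
    moreover have "sobolev_lorentz_norm s r q (\<lambda>\<xi>. \<sigma> (\<kappa> *\<^sub>R \<xi>) * fourier \<Psi> \<xi>) \<le> lorentz_norm r q h"
      unfolding sobolev_lorentz_norm_def using h(1) by (intro Inf_lower) blast
    ultimately show ?thesis by (rule le_less_trans[rotated])
  qed
  define Z where "Z = (\<lambda>k::int. sobolev_lorentz_norm s r q (\<lambda>\<xi>. \<sigma> (2 powr real_of_int k *\<^sub>R \<xi>) * fourier \<Psi> \<xi>))"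
  \<comment> \<open>\<sigma> lives in 13/16 <= |x| <= 19/16 and the transform of \<Psi> in 1/2 <=
    |\<xi>| <= 2, so only k = -1, 0, 1 contribute to the supremum.\<close>
  have Z0: "Z k = 0" if k: "k \<notin> {-1, 0, 1}" for k
  proof -
    have "\<sigma> (2 powr real_of_int k *\<^sub>R \<xi>) * fourier \<Psi> \<xi> = 0" for \<xi>
    proof (rule ccontr)
      assume nz: "\<sigma> (2 powr real_of_int k *\<^sub>R \<xi>) * fourier \<Psi> \<xi> \<noteq> 0"
      then have \<xi>: "1/2 \<le> norm \<xi>" "norm \<xi> \<le> 2" using supp[of \<xi>] by auto
      define x where "x = 2 powr real_of_int k *\<^sub>R \<xi>"
      obtain i where i: "\<And>j. j \<noteq> i \<Longrightarrow> B j x = 0" using ex by blast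
      have "\<sigma> x \<noteq> 0" using nz by (simp add: x_def)
      with \<sigma>_eq[OF i] have "B i x \<noteq> 0" by auto
      then have "norm (x - a i) \<le> 1 / 16" using Bsupp[of i x] \<rho>(3)[of i] by linarith
      then have "13 / 16 \<le> norm x" "norm x \<le> 19 / 16"
        using a[of i] norm_triangle_ineq2[of "a i" x] norm_triangle_ineq2[of x "a i"] by (auto simp: norm_minus_commute)
      then have n: "13 / 16 \<le> 2 powr real_of_int k * norm \<xi>" "2 powr real_of_int k * norm \<xi> \<le> 19 / 16"
        by (simp_all add: x_def)
      consider "k \<le> -2" | "k \<ge> 2" using k by force
      then show False
      proof cases
        case 1
        then have "2 powr real_of_int k \<le> 2 powr -2" by (intro powr_mono) auto
        then have "2 powr real_of_int k * norm \<xi> \<le> 1/4 * 2" using \<xi> by (intro mult_mono) (auto simp: powr_minus_divide)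
        with n show False by simp
      next
        case 2
        then have "2 powr 2 \<le> 2 powr real_of_int k" by (intro powr_mono) auto
        then have "4 * (1/2) \<le> 2 powr real_of_int k * norm \<xi>" using \<xi> by (intro mult_mono) auto
        with n show False by simp
      qed
    qed
    then have "(\<lambda>\<xi>. \<sigma> (2 powr real_of_int k *\<^sub>R \<xi>) * fourier \<Psi> \<xi>) = (\<lambda>\<xi>. 0)" by (rule ext)
    then show ?thesis unfolding Z_def by (simp only: sobolev_lorentz_norm_zero[OF q])
  qed
  have "2 powr real_of_int (-1) = 1/2" "2 powr real_of_int 0 = 1" "2 powr real_of_int 1 = 2"
    by (simp_all add: powr_minus_divide)
  then have Zf: "Z (-1) < top" "Z 0 < top" "Z 1 < top"
    unfolding Z_def using fin[of "1/2"] fin[of 1] fin[of 2] by simp_all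
  have "Z k \<le> Z (-1) + Z 0 + Z 1" for k
    using Z0[of k] by (cases "k \<in> {-1, 0, 1}") (auto intro: add_increasing add_increasing2)
  then have "(SUP k. Z k) \<le> Z (-1) + Z 0 + Z 1" by (intro SUP_least)
  also have "\<dots> < top" using Zf by simp
  finally have "(SUP k. Z k) < top" .
  then show ?thesis using that[OF \<sigma>m \<sigma>1 \<sigma>a \<sigma>c] unfolding Z_def by blast
qed

section \<open>Rudin-Shapiro polynomials and Gaussian test functions\<close>

lemma sum_lessThan_add:
  fixes f :: "nat \<Rightarrow> 'b::comm_monoid_add"
  shows "(\<Sum>l<m + n. f l) = (\<Sum>l<m. f l) + (\<Sum>l<n. f (m + l))"
  by (induction n) (simp_all add: add.assoc)

lemma cis_add_mult: "cis ((p + q) * \<theta>) = cis (p * \<theta>) * cis (q * \<theta>)"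
  by (simp add: distrib_right cis_mult)

text \<open>The classical recursion replaces (P, Q) by (P + zQ, P - zQ) with z = cis (2^k \<theta>).
  By the parallelogram law the sum of squares doubles at each step.\<close>

lemma rudin_shapiro:
  obtains r r' :: "nat \<Rightarrow> real" where "\<And>l. \<bar>r l\<bar> \<le> 1" "\<And>l. \<bar>r' l\<bar> \<le> 1" "\<And>l. l < 2 ^ k \<Longrightarrow> r l * r l = 1"
    "\<And>\<theta>. (norm (\<Sum>l<2 ^ k. of_real (r l) * cis (real l * \<theta>)))\<^sup>2
        + (norm (\<Sum>l<2 ^ k. of_real (r' l) * cis (real l * \<theta>)))\<^sup>2 = 2 * 2 ^ k"
proof -
  have "\<exists>r r' :: nat \<Rightarrow> real. (\<forall>l. \<bar>r l\<bar> \<le> 1) \<and> (\<forall>l. \<bar>r' l\<bar> \<le> 1) \<and>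
    (\<forall>l<2 ^ k. r l * r l = 1) \<and> (\<forall>l<2 ^ k. r' l * r' l = 1) \<and>
    (\<forall>\<theta>. (norm (\<Sum>l<2 ^ k. of_real (r l) * cis (real l * \<theta>)))\<^sup>2
        + (norm (\<Sum>l<2 ^ k. of_real (r' l) * cis (real l * \<theta>)))\<^sup>2 = 2 * 2 ^ k)"
  proof (induction k)
    case 0
    show ?case by (rule exI[of _ "\<lambda>_. 1"], rule exI[of _ "\<lambda>_. 1"]) simp
  next
    case (Suc k)
    then obtain r r' :: "nat \<Rightarrow> real" where r: "\<And>l. \<bar>r l\<bar> \<le> 1" "\<And>l. \<bar>r' l\<bar> \<le> 1"
      "\<And>l. l < 2 ^ k \<Longrightarrow> r l * r l = 1" "\<And>l. l < 2 ^ k \<Longrightarrow> r' l * r' l = 1"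
      "\<And>\<theta>. (norm (\<Sum>l<2 ^ k. of_real (r l) * cis (real l * \<theta>)))\<^sup>2
        + (norm (\<Sum>l<2 ^ k. of_real (r' l) * cis (real l * \<theta>)))\<^sup>2 = 2 * 2 ^ k"
      by blast
    define R where "R = (\<lambda>c l. if l < 2 ^ k then r l else c * r' (l - 2 ^ k))"
    have RS: "(\<Sum>l<2 ^ Suc k. of_real (R c l) * cis (real l * \<theta>))
       = (\<Sum>l<2 ^ k. of_real (r l) * cis (real l * \<theta>)) + of_real c * cis (2 ^ k * \<theta>) * (\<Sum>l<2 ^ k. of_real (r' l) * cis (real l * \<theta>))"
      for c \<theta>
    proof -
      have "(\<Sum>l<2 ^ Suc k. of_real (R c l) * cis (real l * \<theta>)) = (\<Sum>l<2 ^ k + 2 ^ k. of_real (R c l) * cis (real l * \<theta>))"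
        by (simp add: mult_2)
      also have "\<dots> = (\<Sum>l<2 ^ k. of_real (R c l) * cis (real l * \<theta>)) + (\<Sum>l<2 ^ k. of_real (R c (2 ^ k + l)) * cis (real (2 ^ k + l) * \<theta>))"
        by (rule sum_lessThan_add)
      also have "(\<Sum>l<2 ^ k. of_real (R c (2 ^ k + l)) * cis (real (2 ^ k + l) * \<theta>))
         = of_real c * cis (2 ^ k * \<theta>) * (\<Sum>l<2 ^ k. of_real (r' l) * cis (real l * \<theta>))"
        unfolding sum_distrib_left by (intro sum.cong refl) (simp add: R_def cis_add_mult mult.left_commute mult.assoc)
      finally show ?thesis by (simp add: R_def)
    qed
    have par: "(norm (x + y))\<^sup>2 + (norm (x - y))\<^sup>2 = 2 * ((norm x)\<^sup>2 + (norm y)\<^sup>2)" for x y :: complex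
      by (simp add: power2_norm_eq_inner inner_add_left inner_add_right inner_diff_left inner_diff_right)
    show ?case
    proof (rule exI[of _ "R 1"], rule exI[of _ "R (-1)"], intro conjI allI impI)
      fix \<theta> :: real
      let ?P = "\<Sum>l<2 ^ k. of_real (r l) * cis (real l * \<theta>)"
      let ?Q = "\<Sum>l<2 ^ k. of_real (r' l) * cis (real l * \<theta>)"
      have "(norm (?P + cis (2 ^ k * \<theta>) * ?Q))\<^sup>2 + (norm (?P - cis (2 ^ k * \<theta>) * ?Q))\<^sup>2 = 2 * (2 * 2 ^ k)"
        unfolding par using r(5)[of \<theta>] by (simp add: norm_mult)
      then show "(norm (\<Sum>l<2 ^ Suc k. of_real (R 1 l) * cis (real l * \<theta>)))\<^sup>2
        + (norm (\<Sum>l<2 ^ Suc k. of_real (R (-1) l) * cis (real l * \<theta>)))\<^sup>2 = 2 * 2 ^ Suc k"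
        unfolding RS by simp
    next
      fix l :: nat assume "l < 2 ^ Suc k"
      then have "l < 2 ^ k \<or> l - 2 ^ k < 2 ^ k" by auto
      then show "R 1 l * R 1 l = 1" "R (- 1) l * R (- 1) l = 1" using r by (auto simp: R_def)
    qed (use r in \<open>auto simp: R_def abs_mult\<close>)
  qed
  then show ?thesis using that by blast
qed

text \<open>For fixed l the admissible j are exactly j = K + u - l with u < K. They all lie below
  2K, which is why one factor has length 2K. The signs cancel in pairs, and each of the K values of
  l contributes the same polynomial.\<close>

lemma rudin_shapiro_convolution:
  fixes \<rho> \<sigma> \<tau> :: "nat \<Rightarrow> real" and K :: nat
  assumes "\<And>j. j < 2 * K \<Longrightarrow> \<rho> j * \<rho> j = 1" "\<And>l. l < K \<Longrightarrow> \<sigma> l * \<sigma> l = 1"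
  shows "(\<Sum>j<2 * K. \<Sum>l<K. of_real (\<rho> j * \<sigma> l * (if K \<le> j + l \<and> j + l < 2 * K then \<rho> j * \<sigma> l * \<tau> (j + l - K) else 0))
            * cis (real (j + l) * \<theta>))
     = of_nat K * cis (real K * \<theta>) * (\<Sum>u<K. of_real (\<tau> u) * cis (real u * \<theta>))"
proof -
  have "(\<Sum>j<2 * K. \<Sum>l<K. of_real (\<rho> j * \<sigma> l * (if K \<le> j + l \<and> j + l < 2 * K then \<rho> j * \<sigma> l * \<tau> (j + l - K) else 0)) * cis (real (j + l) * \<theta>))
     = (\<Sum>l<K. \<Sum>j<2 * K. of_real (\<rho> j * \<sigma> l * (if K \<le> j + l \<and> j + l < 2 * K then \<rho> j * \<sigma> l * \<tau> (j + l - K) else 0)) * cis (real (j + l) * \<theta>))"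
    by (rule sum.swap)
  also have "\<dots> = (\<Sum>l<K. cis (real K * \<theta>) * (\<Sum>u<K. of_real (\<tau> u) * cis (real u * \<theta>)))"
  proof (rule sum.cong[OF refl])
    fix l assume "l \<in> {..<K}"
    then have l: "l < K" by simp
    have "(\<Sum>j<2 * K. of_real (\<rho> j * \<sigma> l * (if K \<le> j + l \<and> j + l < 2 * K then \<rho> j * \<sigma> l * \<tau> (j + l - K) else 0)) * cis (real (j + l) * \<theta>))
      = (\<Sum>j\<in>{j. j < 2 * K \<and> K \<le> j + l \<and> j + l < 2 * K}. of_real (\<tau> (j + l - K)) * cis (real (j + l) * \<theta>))"
    proof (rule sum.mono_neutral_cong_right)
      fix j assume j: "j \<in> {j. j < 2 * K \<and> K \<le> j + l \<and> j + l < 2 * K}"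
      have "\<rho> j * \<sigma> l * (\<rho> j * \<sigma> l * \<tau> (j + l - K)) = (\<rho> j * \<rho> j) * (\<sigma> l * \<sigma> l) * \<tau> (j + l - K)"
        by (simp only: mult_ac)
      also have "\<dots> = \<tau> (j + l - K)" using assms j l by simp
      finally have "\<rho> j * \<sigma> l * (\<rho> j * \<sigma> l * \<tau> (j + l - K)) = \<tau> (j + l - K)" .
      with j show "of_real (\<rho> j * \<sigma> l * (if K \<le> j + l \<and> j + l < 2 * K then \<rho> j * \<sigma> l * \<tau> (j + l - K) else 0)) * cis (real (j + l) * \<theta>)
         = of_real (\<tau> (j + l - K)) * cis (real (j + l) * \<theta>)"
        by (simp del: of_real_mult)
    qed auto
    also have "\<dots> = (\<Sum>u<K. of_real (\<tau> u) * cis (real (K + u) * \<theta>))"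
      by (rule sum.reindex_bij_witness[of _ "\<lambda>u. K + u - l" "\<lambda>j. j + l - K"]) (use l in auto)
    also have "\<dots> = cis (real K * \<theta>) * (\<Sum>u<K. of_real (\<tau> u) * cis (real u * \<theta>))"
      unfolding sum_distrib_left by (intro sum.cong refl) (simp add: cis_add_mult mult.left_commute mult.assoc)
    finally show "(\<Sum>j<2 * K. of_real (\<rho> j * \<sigma> l * (if K \<le> j + l \<and> j + l < 2 * K then \<rho> j * \<sigma> l * \<tau> (j + l - K) else 0)) * cis (real (j + l) * \<theta>))
      = cis (real K * \<theta>) * (\<Sum>u<K. of_real (\<tau> u) * cis (real u * \<theta>))" .
  qed
  finally show ?thesis by (simp add: mult.assoc)
qed

section \<open>Gaussian wave packets\<close>

text \<open>A class that contains the modulated Gaussians and is closed under everything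
  differentiation produces; the Schwartz bounds then follow by rule induction instead of explicit
  derivatives.\<close>

inductive_set gauss_fun :: "real \<Rightarrow> ('a::euclidean_space \<Rightarrow> complex) set" for \<epsilon> :: real where
  wave: "(\<lambda>x. c * (cis (2 * pi * (x \<bullet> \<theta>)) * of_real (exp (- \<epsilon> * (norm x)\<^sup>2)))) \<in> gauss_fun \<epsilon>"
| add: "f \<in> gauss_fun \<epsilon> \<Longrightarrow> g \<in> gauss_fun \<epsilon> \<Longrightarrow> (\<lambda>x. f x + g x) \<in> gauss_fun \<epsilon>"
| scale: "f \<in> gauss_fun \<epsilon> \<Longrightarrow> (\<lambda>x. c * f x) \<in> gauss_fun \<epsilon>"
| coord: "f \<in> gauss_fun \<epsilon> \<Longrightarrow> (\<lambda>x. of_real (x \<bullet> v) * f x) \<in> gauss_fun \<epsilon>"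

lemma gauss_fun_sum:
  "finite A \<Longrightarrow> (\<And>i. i \<in> A \<Longrightarrow> f i \<in> gauss_fun \<epsilon>) \<Longrightarrow> (\<lambda>x. \<Sum>i\<in>A. f i x) \<in> gauss_fun \<epsilon>"
proof (induction A rule: finite_induct)
  case empty
  show ?case using gauss_fun.wave[of 0 0 \<epsilon>] by simp
next
  case (insert i A)
  then show ?case using gauss_fun.add[of "f i" \<epsilon> "\<lambda>x. \<Sum>i\<in>A. f i x"] by simp
qed

lemma gauss_fun_derivative:
  assumes "f \<in> gauss_fun \<epsilon>"
  shows "\<exists>D. (\<forall>v. D v \<in> gauss_fun \<epsilon>) \<and> (\<forall>x. (f has_derivative (\<lambda>v. D v x)) (at x))"
  using assms
proof (induction rule: gauss_fun.induct)
  case (wave c \<theta>)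
  let ?f = "\<lambda>c x. c * (cis (2 * pi * (x \<bullet> \<theta>)) * of_real (exp (- \<epsilon> * (norm x)\<^sup>2)))"
  define D where "D = (\<lambda>v x. ?f (c * (2 * pi * \<i> * (v \<bullet> \<theta>))) x + of_real (x \<bullet> v) * ?f (c * (- 2 * \<epsilon>)) x)"
  have "D v \<in> gauss_fun \<epsilon>" for v unfolding D_def
    by (intro gauss_fun.add gauss_fun.coord gauss_fun.wave)
  moreover have "(?f c has_derivative (\<lambda>v. D v x)) (at x)" for x
  proof -
    have "((\<lambda>x. exp (- \<epsilon> * (x \<bullet> x))) has_derivative (\<lambda>v. exp (- \<epsilon> * (x \<bullet> x)) * (- 2 * \<epsilon> * (x \<bullet> v)))) (at x)"
      by (auto intro!: derivative_eq_intros simp: inner_commute algebra_simps)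
    then have 1: "((\<lambda>x. complex_of_real (exp (- \<epsilon> * (norm x)\<^sup>2))) has_derivative
        (\<lambda>v. of_real (exp (- \<epsilon> * (norm x)\<^sup>2) * (- 2 * \<epsilon> * (x \<bullet> v))))) (at x)"
      unfolding power2_norm_eq_inner by (rule has_derivative_of_real)
    have "((\<lambda>x. 2 * pi * (x \<bullet> \<theta>)) has_derivative (\<lambda>v. 2 * pi * (v \<bullet> \<theta>))) (at x)"
      by (auto intro!: derivative_eq_intros)
    then have 2: "((\<lambda>x. cis (2 * pi * (x \<bullet> \<theta>))) has_derivative (\<lambda>v. (2 * pi * (v \<bullet> \<theta>)) *\<^sub>R (\<i> * cis (2 * pi * (x \<bullet> \<theta>))))) (at x)"
      by (rule has_derivative_cis)
    show ?thesis
      by (rule has_derivative_eq_rhs[OF has_derivative_mult_right[OF has_derivative_mult[OF 2 1]]])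
         (rule ext, simp add: D_def scaleR_conv_of_real algebra_simps)
  qed
  ultimately show ?case by blast
next
  case (add f g)
  then obtain Df Dg where "\<forall>v. Df v \<in> gauss_fun \<epsilon>" "\<forall>x. (f has_derivative (\<lambda>v. Df v x)) (at x)"
    "\<forall>v. Dg v \<in> gauss_fun \<epsilon>" "\<forall>x. (g has_derivative (\<lambda>v. Dg v x)) (at x)" by blast
  then show ?case
    by (intro exI[of _ "\<lambda>v x. Df v x + Dg v x"]) (auto intro: gauss_fun.add has_derivative_add)
next
  case (scale f c)
  then obtain D where "\<forall>v. D v \<in> gauss_fun \<epsilon>" "\<forall>x. (f has_derivative (\<lambda>v. D v x)) (at x)" by blast
  then show ?case
    by (intro exI[of _ "\<lambda>v x. c * D v x"]) (auto intro: gauss_fun.scale has_derivative_mult_right)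
next
  case (coord f w)
  then obtain D where D: "\<forall>v. D v \<in> gauss_fun \<epsilon>" "\<forall>x. (f has_derivative (\<lambda>v. D v x)) (at x)" by blast
  have "((\<lambda>x. of_real (x \<bullet> w) * f x) has_derivative (\<lambda>v. of_real (x \<bullet> w) * D v x + of_real (v \<bullet> w) * f x)) (at x)" for x
  proof -
    have "((\<lambda>x. x \<bullet> w) has_derivative (\<lambda>v. v \<bullet> w)) (at x)" by (auto intro!: derivative_eq_intros)
    then have "((\<lambda>x. complex_of_real (x \<bullet> w)) has_derivative (\<lambda>v. of_real (v \<bullet> w))) (at x)"
      by (rule has_derivative_of_real)
    from has_derivative_mult[OF this D(2)[rule_format, of x]] show ?thesis .
  qed
  moreover have "(\<lambda>x. of_real (x \<bullet> w) * D v x + of_real (v \<bullet> w) * f x) \<in> gauss_fun \<epsilon>" for v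
    using D(1) coord.hyps by (intro gauss_fun.add gauss_fun.coord gauss_fun.scale) auto
  ultimately show ?case
    by (intro exI[of _ "\<lambda>v x. of_real (x \<bullet> w) * D v x + of_real (v \<bullet> w) * f x"]) auto
qed

lemma gauss_fun_decay:
  assumes "f \<in> gauss_fun \<epsilon>" and \<epsilon>: "\<epsilon> > 0"
  shows "\<exists>B. \<forall>x. (1 + norm x) ^ N * norm (f x) \<le> B"
  using assms(1)
proof (induction arbitrary: N rule: gauss_fun.induct)
  case (wave c \<theta>)
  have "(1 + norm x) ^ N * norm (c * (cis (2 * pi * (x \<bullet> \<theta>)) * of_real (exp (- \<epsilon> * (norm x)\<^sup>2)))) \<le> norm c * (2 ^ N * (1 / \<epsilon>) ^ N * fact N * exp \<epsilon>)" for x :: 'a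
  proof -
    define y where "y = \<epsilon> * (1 + (norm x)\<^sup>2)"
    have y: "y \<ge> 0" using \<epsilon> by (simp add: y_def)
    have "2 * norm x \<le> 1 + (norm x)\<^sup>2"
      using zero_le_power2[of "norm x - 1"] by (simp add: power2_diff)
    then have "norm x \<le> 1 + (norm x)\<^sup>2" using norm_ge_zero[of x] by linarith
    moreover have "1 + u \<le> 2 * (1 + v)" if "u \<le> 1 + v" "0 \<le> v" for u v :: real using that by simp
    ultimately have "1 + norm x \<le> 2 * (1 + (norm x)\<^sup>2)" using zero_le_power2[of "norm x"] by blast
    then have "(1 + norm x) ^ N \<le> (2 * (1 + (norm x)\<^sup>2)) ^ N" by (intro power_mono) auto
    also have "\<dots> = 2 ^ N * (1 / \<epsilon>) ^ N * y ^ N"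
      using \<epsilon> by (simp add: y_def flip: power_mult_distrib)
    also have "y ^ N \<le> fact N * exp y"
    proof -
      have "(\<Sum>n\<in>{N}. y ^ n /\<^sub>R fact n) \<le> (\<Sum>n. y ^ n /\<^sub>R fact n)"
        using y by (intro sum_le_suminf summable_exp_generic) auto
      then show ?thesis by (simp add: exp_def field_simps)
    qed
    finally have 1: "(1 + norm x) ^ N \<le> 2 ^ N * (1 / \<epsilon>) ^ N * (fact N * exp y)"
      using \<epsilon> by (simp add: mult_left_mono)
    have "(1 + norm x) ^ N * exp (- \<epsilon> * (norm x)\<^sup>2) \<le> 2 ^ N * (1 / \<epsilon>) ^ N * (fact N * exp y) * exp (- \<epsilon> * (norm x)\<^sup>2)"
      using 1 by (rule mult_right_mono) simp
    also have "\<dots> = 2 ^ N * (1 / \<epsilon>) ^ N * fact N * (exp y * exp (- \<epsilon> * (norm x)\<^sup>2))" by simp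
    also have "exp y * exp (- \<epsilon> * (norm x)\<^sup>2) = exp \<epsilon>"
      by (simp add: y_def algebra_simps flip: exp_add)
    finally have "(1 + norm x) ^ N * exp (- \<epsilon> * (norm x)\<^sup>2) \<le> 2 ^ N * (1 / \<epsilon>) ^ N * fact N * exp \<epsilon>" .
    then have "norm c * ((1 + norm x) ^ N * exp (- \<epsilon> * (norm x)\<^sup>2)) \<le> norm c * (2 ^ N * (1 / \<epsilon>) ^ N * fact N * exp \<epsilon>)"
      by (rule mult_left_mono) simp
    then show ?thesis by (simp add: norm_mult mult_ac)
  qed
  then show ?case by blast
next
  case (add f g)
  then obtain B B' where B: "\<And>x. (1 + norm x) ^ N * norm (f x) \<le> B" "\<And>x. (1 + norm x) ^ N * norm (g x) \<le> B'" by metis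
  have "(1 + norm x) ^ N * norm (f x + g x) \<le> B + B'" for x
  proof -
    have "(1 + norm x) ^ N * norm (f x + g x) \<le> (1 + norm x) ^ N * (norm (f x) + norm (g x))"
      by (intro mult_left_mono norm_triangle_ineq) auto
    then show ?thesis using B[of x] by (simp add: distrib_left)
  qed
  then show ?case by blast
next
  case (scale f c)
  then obtain B where B: "\<And>x. (1 + norm x) ^ N * norm (f x) \<le> B" by metis
  have "(1 + norm x) ^ N * norm (c * f x) \<le> norm c * B" for x
    using mult_left_mono[OF B[of x] norm_ge_zero[of c]] by (simp add: norm_mult mult_ac)
  then show ?case by blast
next
  case (coord f v)
  \<comment> \<open>Multiplication by a coordinate costs one power, so the induction hypothesis is
    taken at \<open>Suc N\<close>.\<close>
  then obtain B where B: "\<And>x. (1 + norm x) ^ Suc N * norm (f x) \<le> B" by metis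
  have "(1 + norm x) ^ N * norm (of_real (x \<bullet> v) * f x) \<le> norm v * B" for x
  proof -
    have "\<bar>x \<bullet> v\<bar> \<le> norm x * norm v" by (rule Cauchy_Schwarz_ineq2)
    also have "\<dots> \<le> (1 + norm x) * norm v" by (intro mult_right_mono) auto
    finally have "(1 + norm x) ^ N * norm (f x) * \<bar>x \<bullet> v\<bar> \<le> (1 + norm x) ^ N * norm (f x) * ((1 + norm x) * norm v)"
      by (rule mult_left_mono) simp
    also have "\<dots> = norm v * ((1 + norm x) ^ Suc N * norm (f x))" by simp
    also have "\<dots> \<le> norm v * B" by (intro mult_left_mono B) simp
    finally show ?thesis by (simp add: norm_mult mult_ac)
  qed
  then show ?case by blast
qed

lemma gauss_fun_iter_dderiv: "f \<in> gauss_fun \<epsilon> \<Longrightarrow> iter_dderiv vs f \<in> gauss_fun \<epsilon>"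
proof (induction vs)
  case (Cons v vs)
  then have "iter_dderiv vs f \<in> gauss_fun \<epsilon>" by simp
  then obtain D where D: "\<forall>v. D v \<in> gauss_fun \<epsilon>" "\<And>x. (iter_dderiv vs f has_derivative (\<lambda>v. D v x)) (at x)"
    using gauss_fun_derivative by blast
  have "frechet_derivative (iter_dderiv vs f) (at x) v = D v x" for x
    using frechet_derivative_at[OF D(2)[of x]] by metis
  then have "iter_dderiv (v # vs) f = D v" by auto
  then show ?case using D by simp
qed simp

lemma gauss_fun_schwartz:
  assumes "f \<in> gauss_fun \<epsilon>" "\<epsilon> > 0"
  shows "schwartz f"
  unfolding schwartz_def
proof (intro allI impI conjI)
  fix vs :: "'a list" and x :: 'a and N :: nat
  have "iter_dderiv vs f \<in> gauss_fun \<epsilon>" by (rule gauss_fun_iter_dderiv[OF assms(1)])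
  then show "iter_dderiv vs f differentiable (at x)" "\<exists>B. \<forall>x. (1 + norm x) ^ N * norm (iter_dderiv vs f x) \<le> B"
    using gauss_fun_derivative[of "iter_dderiv vs f" \<epsilon>] gauss_fun_decay[OF _ assms(2)]
    by (auto simp: differentiable_def)
qed

definition gwave :: "real \<Rightarrow> 'a::euclidean_space \<Rightarrow> 'a \<Rightarrow> complex" where
  "gwave \<epsilon> \<theta> x = cis (2 * pi * (x \<bullet> \<theta>)) * of_real (exp (- (pi * \<epsilon>\<^sup>2) * (norm x)\<^sup>2))"

text \<open>The transform of \<open>gwave \<epsilon> 0\<close>: a Gaussian of width \<epsilon> and
  mass one, an approximate identity as \<epsilon> tends to 0.\<close>

definition gkernel :: "real \<Rightarrow> 'a::euclidean_space \<Rightarrow> real" where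
  "gkernel \<epsilon> \<xi> = \<epsilon> powr - real DIM('a) * exp (- pi * (norm \<xi>)\<^sup>2 / \<epsilon>\<^sup>2)"

lemma gwave_gauss_fun: "gwave \<epsilon> \<theta> \<in> gauss_fun (pi * \<epsilon>\<^sup>2)"
  using gauss_fun.wave[of 1 \<theta> "pi * \<epsilon>\<^sup>2"] by (simp add: gwave_def[abs_def])

lemma gaussian_exponents:
  assumes "\<epsilon> > 0"
  shows "(pi / (pi * \<epsilon>\<^sup>2)) powr (real n / 2) = \<epsilon> powr - real n"
proof -
  have "pi / (pi * \<epsilon>\<^sup>2) = \<epsilon> powr - 2" using assms by (simp add: powr_minus_divide)
  then show ?thesis by (simp only: powr_powr) simp
qed

lemma fourier_gwave:
  fixes \<theta> \<xi> :: "'a::euclidean_space"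
  assumes "\<epsilon> > 0"
  shows "fourier (gwave \<epsilon> \<theta>) \<xi> = of_real (gkernel \<epsilon> (\<xi> - \<theta>))"
    and "integrable lborel (\<lambda>x. gwave \<epsilon> \<theta> x * cis (- 2 * pi * (x \<bullet> \<xi>)))"
proof -
  have u: "pi * \<epsilon>\<^sup>2 > 0" using assms by simp
  have eq: "gwave \<epsilon> \<theta> x * cis (- 2 * pi * (x \<bullet> \<xi>)) = exp (- (pi * \<epsilon>\<^sup>2) * (norm x)\<^sup>2) * cis (2 * pi * ((\<theta> - \<xi>) \<bullet> x))" for x
  proof -
    have "2 * pi * (x \<bullet> \<theta>) + - 2 * pi * (x \<bullet> \<xi>) = 2 * pi * ((\<theta> - \<xi>) \<bullet> x)"
      by (simp add: inner_diff_left inner_commute algebra_simps)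
    then have c: "cis (2 * pi * (x \<bullet> \<theta>)) * cis (- 2 * pi * (x \<bullet> \<xi>)) = cis (2 * pi * ((\<theta> - \<xi>) \<bullet> x))"
      by (simp only: cis_mult)
    have ac: "A * E * B = E * (A * B)" for A B E :: complex by simp
    show ?thesis unfolding gwave_def ac c ..
  qed
  show "integrable lborel (\<lambda>x. gwave \<epsilon> \<theta> x * cis (- 2 * pi * (x \<bullet> \<xi>)))"
    unfolding eq by (rule gaussian_fourier(1)[OF u])
  have "- pi\<^sup>2 * r / (pi * \<epsilon>\<^sup>2) = - pi * r / \<epsilon>\<^sup>2" for r
    using assms by (simp add: power2_eq_square)
  then show "fourier (gwave \<epsilon> \<theta>) \<xi> = of_real (gkernel \<epsilon> (\<xi> - \<theta>))"
    unfolding fourier_def eq gaussian_fourier(2)[OF u] gaussian_exponents[OF assms] gkernel_def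
    by (simp only: norm_minus_commute)
qed

lemma gkernel_fourier:
  fixes X a :: "'a::euclidean_space"
  assumes "\<epsilon> > 0"
  shows "integrable lborel (\<lambda>\<xi>. of_real (gkernel \<epsilon> (\<xi> - a)) * cis (2 * pi * (X \<bullet> \<xi>)))"
    and "(\<integral>\<xi>. of_real (gkernel \<epsilon> (\<xi> - a)) * cis (2 * pi * (X \<bullet> \<xi>)) \<partial>lborel) = gwave \<epsilon> a X"
proof -
  define F where "F = (\<lambda>\<xi>::'a. of_real (gkernel \<epsilon> \<xi>) * cis (2 * pi * (X \<bullet> \<xi>)))"
  have u: "pi / \<epsilon>\<^sup>2 > 0" using assms by simp
  have F: "F \<xi> = of_real (\<epsilon> powr - real DIM('a)) * (exp (- (pi / \<epsilon>\<^sup>2) * (norm \<xi>)\<^sup>2) * cis (2 * pi * (X \<bullet> \<xi>)))" for \<xi>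
    by (simp add: F_def gkernel_def)
  have Fi: "integrable lborel F"
    unfolding F[abs_def] by (intro integrable_mult_right gaussian_fourier(1)[OF u])
  have [measurable]: "F \<in> borel_measurable borel" using Fi by auto
  have e: "of_real (gkernel \<epsilon> (\<xi> - a)) * cis (2 * pi * (X \<bullet> \<xi>)) = cis (2 * pi * (X \<bullet> a)) * F (- a + \<xi>)" for \<xi>
    by (simp add: F_def cis_mult inner_diff_right algebra_simps)
  have "(\<integral>\<^sup>+\<xi>. ennreal (norm (F (- a + \<xi>))) \<partial>lborel) = (\<integral>\<^sup>+\<xi>. ennreal (norm (F \<xi>)) \<partial>lborel)"
    by (rule nn_integral_lborel_translation) measurable
  then have "integrable lborel (\<lambda>\<xi>. F (- a + \<xi>))"
    using Fi unfolding integrable_iff_bounded by simp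
  then show "integrable lborel (\<lambda>\<xi>. of_real (gkernel \<epsilon> (\<xi> - a)) * cis (2 * pi * (X \<bullet> \<xi>)))"
    unfolding e by (rule integrable_mult_right)
  have 1: "pi / (pi / \<epsilon>\<^sup>2) = \<epsilon>\<^sup>2" by simp
  have 2: "(\<epsilon>\<^sup>2) powr (DIM('a) / 2) = \<epsilon> powr DIM('a)"
  proof -
    have "(\<epsilon>\<^sup>2) powr (DIM('a) / 2) = (\<epsilon> powr 2) powr (DIM('a) / 2)" using assms by simp
    then show ?thesis by (simp only: powr_powr) simp
  qed
  have 3: "- pi\<^sup>2 * r / (pi / \<epsilon>\<^sup>2) = - (pi * \<epsilon>\<^sup>2) * r" for r by (simp add: power2_eq_square)
  have 4: "complex_of_real (\<epsilon> powr - real DIM('a)) * of_real (\<epsilon> powr DIM('a) * y) = of_real y" for y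
  proof -
    have "\<epsilon> powr - real DIM('a) * (\<epsilon> powr DIM('a) * y) = y"
      using assms by (simp add: powr_minus)
    then show ?thesis by (simp only: of_real_mult[symmetric])
  qed
  have "(\<integral>\<xi>. F \<xi> \<partial>lborel) = of_real (exp (- (pi * \<epsilon>\<^sup>2) * (norm X)\<^sup>2))"
    unfolding F by (subst integral_mult_right_zero) (simp only: gaussian_fourier(2)[OF u] 1 2 3 4)
  then show "(\<integral>\<xi>. of_real (gkernel \<epsilon> (\<xi> - a)) * cis (2 * pi * (X \<bullet> \<xi>)) \<partial>lborel) = gwave \<epsilon> a X"
    unfolding e using lborel_integral_translation[of F "- a"]
    by (subst integral_mult_right_zero) (simp add: gwave_def)
qed

text \<open>The kernel has mass one and the character modulus one, so the error is at most the
  average of |\<sigma>(a + \<epsilon> \<zeta>) - \<sigma>(a)| against a fixed Gaussian. This bound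
  does not involve X, and it tends to 0 by dominated convergence from continuity at the single point
  a.\<close>

lemma gkernel_approximation:
  fixes \<sigma> :: "'a::euclidean_space \<Rightarrow> complex"
  assumes [measurable]: "\<sigma> \<in> borel_measurable borel" and \<sigma>: "\<And>x. norm (\<sigma> x) \<le> 1" and cont: "isCont \<sigma> a" and \<eta>: "\<eta> > 0"
  shows "\<forall>\<^sub>F n in sequentially. \<forall>X. norm ((\<integral>\<xi>. \<sigma> \<xi> * (of_real (gkernel (1 / real (Suc n)) (\<xi> - a)) * cis (2 * pi * (X \<bullet> \<xi>))) \<partial>lborel)
      - \<sigma> a * gwave (1 / real (Suc n)) a X) \<le> \<eta>"
proof -
  define E where "E = (\<lambda>\<epsilon>. \<integral>\<zeta>. norm (\<sigma> (a + \<epsilon> *\<^sub>R \<zeta>) - \<sigma> a) * exp (- pi * (norm \<zeta>)\<^sup>2) \<partial>lborel)"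
  have gi: "integrable lborel (\<lambda>\<zeta>::'a. exp (- pi * (norm \<zeta>)\<^sup>2))"
    by (rule integrable_gaussian(1)) simp
  have d2: "norm (\<sigma> x - \<sigma> y) \<le> 2" for x y
    using norm_triangle_ineq4[of "\<sigma> x" "\<sigma> y"] \<sigma>[of x] \<sigma>[of y] by linarith
  have lim: "(\<lambda>n. 1 / real (Suc n)) \<longlonglongrightarrow> 0"
    by (rule LIMSEQ_Suc) (rule lim_1_over_n)
  have "(\<lambda>n. E (1 / real (Suc n))) \<longlonglongrightarrow> (\<integral>\<zeta>. norm (\<sigma> a - \<sigma> a) * exp (- pi * (norm (\<zeta>::'a))\<^sup>2) \<partial>lborel)"
    unfolding E_def
  proof (rule integral_dominated_convergence)
    show "integrable lborel (\<lambda>\<zeta>::'a. 2 * exp (- pi * (norm \<zeta>)\<^sup>2))" using gi by simp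
    show "AE \<zeta> in lborel. norm (norm (\<sigma> (a + (1 / real (Suc n)) *\<^sub>R \<zeta>) - \<sigma> a) * exp (- pi * (norm \<zeta>)\<^sup>2)) \<le> 2 * exp (- pi * (norm \<zeta>)\<^sup>2)" for n
      by (intro AE_I2) (simp add: d2 mult_right_mono)
    show "AE \<zeta> in lborel. (\<lambda>n. norm (\<sigma> (a + (1 / real (Suc n)) *\<^sub>R \<zeta>) - \<sigma> a) * exp (- pi * (norm \<zeta>)\<^sup>2))
       \<longlonglongrightarrow> norm (\<sigma> a - \<sigma> a) * exp (- pi * (norm \<zeta>)\<^sup>2)"
    proof (rule AE_I2)
      fix \<zeta> :: 'a
      have "(\<lambda>n. a + (1 / real (Suc n)) *\<^sub>R \<zeta>) \<longlonglongrightarrow> a + 0 *\<^sub>R \<zeta>"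
        by (intro tendsto_intros lim)
      then have "(\<lambda>n. \<sigma> (a + (1 / real (Suc n)) *\<^sub>R \<zeta>)) \<longlonglongrightarrow> \<sigma> a"
        using isCont_tendsto_compose[OF cont, of "\<lambda>n. a + (1 / real (Suc n)) *\<^sub>R \<zeta>"] by simp
      then show "(\<lambda>n. norm (\<sigma> (a + (1 / real (Suc n)) *\<^sub>R \<zeta>) - \<sigma> a) * exp (- pi * (norm \<zeta>)\<^sup>2))
       \<longlonglongrightarrow> norm (\<sigma> a - \<sigma> a) * exp (- pi * (norm \<zeta>)\<^sup>2)"
        by (intro tendsto_intros)
    qed
  qed measurable
  then have "(\<lambda>n. E (1 / real (Suc n))) \<longlonglongrightarrow> 0" by simp
  then have "\<forall>\<^sub>F n in sequentially. E (1 / real (Suc n)) < \<eta>" using \<eta> by (rule order_tendstoD)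
  then show ?thesis
  proof eventually_elim
    case (elim n)
    define \<epsilon> where "\<epsilon> = 1 / real (Suc n)"
    have \<epsilon>: "\<epsilon> > 0" "E \<epsilon> < \<eta>" using elim by (simp_all add: \<epsilon>_def)
    show ?case unfolding \<epsilon>_def[symmetric]
    proof
      fix X :: 'a
      let ?k = "\<lambda>\<xi>. of_real (gkernel \<epsilon> (\<xi> - a)) * cis (2 * pi * (X \<bullet> \<xi>))"
      note ki = gkernel_fourier(1)[OF \<epsilon>(1), of a X]
      have g0: "gkernel \<epsilon> \<xi> \<ge> 0" for \<xi> :: 'a by (simp add: gkernel_def)
      have [measurable]: "gkernel \<epsilon> \<in> borel_measurable (borel :: 'a measure)"
        unfolding gkernel_def by measurable
      have si: "integrable lborel (\<lambda>\<xi>. \<sigma> \<xi> * ?k \<xi>)"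
        by (rule Bochner_Integration.integrable_bound[OF ki])
           (use \<sigma> in \<open>auto simp: norm_mult intro!: AE_I2 mult_left_le_one_le\<close>)
      have diff: "(\<integral>\<xi>. \<sigma> \<xi> * ?k \<xi> \<partial>lborel) - \<sigma> a * gwave \<epsilon> a X = (\<integral>\<xi>. (\<sigma> \<xi> - \<sigma> a) * ?k \<xi> \<partial>lborel)"
        unfolding gkernel_fourier(2)[OF \<epsilon>(1), symmetric] left_diff_distrib
        by (subst Bochner_Integration.integral_diff[OF si integrable_mult_right[OF ki]]) simp
      have di: "integrable lborel (\<lambda>\<xi>. (\<sigma> \<xi> - \<sigma> a) * ?k \<xi>)"
        unfolding left_diff_distrib by (intro Bochner_Integration.integrable_diff si integrable_mult_right ki)
      have "ennreal (norm (\<integral>\<xi>. (\<sigma> \<xi> - \<sigma> a) * ?k \<xi> \<partial>lborel)) \<le> (\<integral>\<^sup>+\<xi>. ennreal (norm ((\<sigma> \<xi> - \<sigma> a) * ?k \<xi>)) \<partial>lborel)"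
        by (rule integral_norm_bound_ennreal[OF di])
      also have "\<dots> = (\<integral>\<^sup>+\<xi>. ennreal (norm (\<sigma> \<xi> - \<sigma> a) * gkernel \<epsilon> (\<xi> - a)) \<partial>lborel)"
        using g0 by (simp add: norm_mult)
      also have "\<dots> = ennreal (\<epsilon> powr DIM('a)) * (\<integral>\<^sup>+\<zeta>. ennreal (norm (\<sigma> (a + \<epsilon> *\<^sub>R \<zeta>) - \<sigma> a) * gkernel \<epsilon> ((a + \<epsilon> *\<^sub>R \<zeta>) - a)) \<partial>lborel)"
      proof -
        have "ennreal (\<epsilon> powr DIM('a)) * ennreal (\<epsilon> powr - real DIM('a)) = 1"
          using \<epsilon> by (simp add: ennreal_mult'[symmetric] powr_minus)
        then show ?thesis
          using \<epsilon> by (subst nn_integral_lborel_scale[of "\<lambda>\<xi>. ennreal (norm (\<sigma> \<xi> - \<sigma> a) * gkernel \<epsilon> (\<xi> - a))" \<epsilon> a])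
            (simp_all flip: mult.assoc)
      qed
      also have "\<dots> = (\<integral>\<^sup>+\<zeta>. ennreal (\<epsilon> powr DIM('a)) * ennreal (norm (\<sigma> (a + \<epsilon> *\<^sub>R \<zeta>) - \<sigma> a) * gkernel \<epsilon> ((a + \<epsilon> *\<^sub>R \<zeta>) - a)) \<partial>lborel)"
        by (rule nn_integral_cmult[symmetric]) measurable
      also have "\<dots> = (\<integral>\<^sup>+\<zeta>. ennreal (norm (\<sigma> (a + \<epsilon> *\<^sub>R \<zeta>) - \<sigma> a) * exp (- pi * (norm \<zeta>)\<^sup>2)) \<partial>lborel)"
      proof (rule nn_integral_cong)
        fix \<zeta> :: 'a
        have "\<epsilon> powr DIM('a) * gkernel \<epsilon> (\<epsilon> *\<^sub>R \<zeta>) = exp (- pi * (norm \<zeta>)\<^sup>2)"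
          using \<epsilon> by (simp add: gkernel_def powr_minus power_mult_distrib)
        then have "\<epsilon> powr DIM('a) * (norm (\<sigma> (a + \<epsilon> *\<^sub>R \<zeta>) - \<sigma> a) * gkernel \<epsilon> ((a + \<epsilon> *\<^sub>R \<zeta>) - a))
          = norm (\<sigma> (a + \<epsilon> *\<^sub>R \<zeta>) - \<sigma> a) * exp (- pi * (norm \<zeta>)\<^sup>2)"
          by (simp only: add_diff_cancel_left' mult.left_commute[of "\<epsilon> powr _"])
        then show "ennreal (\<epsilon> powr DIM('a)) * ennreal (norm (\<sigma> (a + \<epsilon> *\<^sub>R \<zeta>) - \<sigma> a) * gkernel \<epsilon> ((a + \<epsilon> *\<^sub>R \<zeta>) - a))
           = ennreal (norm (\<sigma> (a + \<epsilon> *\<^sub>R \<zeta>) - \<sigma> a) * exp (- pi * (norm \<zeta>)\<^sup>2))"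
          by (subst ennreal_mult'[symmetric]) (simp_all only: powr_ge_zero)
      qed
      also have "\<dots> = ennreal (E \<epsilon>)"
        unfolding E_def
      proof (rule nn_integral_eq_integral)
        show "integrable lborel (\<lambda>\<zeta>. norm (\<sigma> (a + \<epsilon> *\<^sub>R \<zeta>) - \<sigma> a) * exp (- pi * (norm \<zeta>)\<^sup>2))"
          by (rule Bochner_Integration.integrable_bound[OF integrable_mult_right[OF gi, of 2]])
             (use d2 in \<open>auto intro!: AE_I2 mult_right_mono\<close>)
      qed simp
      finally have "norm (\<integral>\<xi>. (\<sigma> \<xi> - \<sigma> a) * ?k \<xi> \<partial>lborel) \<le> E \<epsilon>"
        by (subst (asm) ennreal_le_iff) (auto simp: E_def)
      then show "norm ((\<integral>\<xi>. \<sigma> \<xi> * ?k \<xi> \<partial>lborel) - \<sigma> a * gwave \<epsilon> a X) \<le> \<eta>"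
        unfolding diff using \<epsilon>(2) by linarith
    qed
  qed
qed

section \<open>Test functions with frequencies in two blocks\<close>

definition two_block :: "'m \<Rightarrow> 'm \<Rightarrow> real^'n \<Rightarrow> real \<Rightarrow> real \<Rightarrow> (real^'n)^'m::finite" where
  "two_block m1 m2 e \<alpha> \<beta> = (\<chi> j. if j = m1 then \<alpha> *\<^sub>R e else if j = m2 then \<beta> *\<^sub>R e else 0)"

lemma two_block_nth:
  "two_block m1 m2 e \<alpha> \<beta> $ j = (if j = m1 then \<alpha> *\<^sub>R e else if j = m2 then \<beta> *\<^sub>R e else 0)"
  by (simp add: two_block_def)

lemma two_block_norm:
  assumes "m1 \<noteq> m2" "norm e = 1"
  shows "\<bar>\<alpha>\<bar> \<le> norm (two_block m1 m2 e \<alpha> \<beta>)" "norm (two_block m1 m2 e \<alpha> \<beta>) \<le> \<bar>\<alpha>\<bar> + \<bar>\<beta>\<bar>"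
proof -
  show "\<bar>\<alpha>\<bar> \<le> norm (two_block m1 m2 e \<alpha> \<beta>)"
    using Finite_Cartesian_Product.norm_nth_le[of "two_block m1 m2 e \<alpha> \<beta>" m1] assms by (simp add: two_block_nth)
  have "norm (two_block m1 m2 e \<alpha> \<beta>) \<le> (\<Sum>j\<in>UNIV. norm (two_block m1 m2 e \<alpha> \<beta> $ j))"
    unfolding norm_vec_def by (rule L2_set_le_sum) simp
  also have "\<dots> = (\<Sum>j\<in>{m1, m2}. norm (two_block m1 m2 e \<alpha> \<beta> $ j))"
    by (rule sum.mono_neutral_right) (auto simp: two_block_nth)
  also have "\<dots> = \<bar>\<alpha>\<bar> + \<bar>\<beta>\<bar>" using assms by (simp add: two_block_nth)
  finally show "norm (two_block m1 m2 e \<alpha> \<beta>) \<le> \<bar>\<alpha>\<bar> + \<bar>\<beta>\<bar>" .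
qed

lemma two_block_diff_norm:
  assumes "m1 \<noteq> m2" "norm e = 1"
  shows "\<bar>\<alpha> - \<alpha>'\<bar> \<le> norm (two_block m1 m2 e \<alpha> \<beta> - two_block m1 m2 e \<alpha>' \<beta>')"
    and "\<bar>\<beta> - \<beta>'\<bar> \<le> norm (two_block m1 m2 e \<alpha> \<beta> - two_block m1 m2 e \<alpha>' \<beta>')"
  using Finite_Cartesian_Product.norm_nth_le[of "two_block m1 m2 e \<alpha> \<beta> - two_block m1 m2 e \<alpha>' \<beta>'" m1]
    Finite_Cartesian_Product.norm_nth_le[of "two_block m1 m2 e \<alpha> \<beta> - two_block m1 m2 e \<alpha>' \<beta>'" m2] assms
  by (simp_all add: two_block_nth flip: scaleR_diff_left)

text \<open>The exponential in \<open>mult_op\<close> is thereby a character of the product space,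
  evaluated at the diagonal point (x, ..., x).\<close>

lemma inner_const_vec: "((\<chi> j. x) :: (real^'n)^'m::finite) \<bullet> \<xi> = x \<bullet> (\<Sum>j\<in>UNIV. \<xi> $ j)"
  by (simp add: inner_vec_def[of "\<chi> j. x"] inner_sum_right)

lemma inner_const_two_block:
  assumes "m1 \<noteq> m2"
  shows "((\<chi> j. x) :: (real^'n)^'m::finite) \<bullet> two_block m1 m2 e \<alpha> \<beta> = (\<alpha> + \<beta>) * (x \<bullet> e)"
proof -
  have "(\<Sum>j\<in>UNIV. two_block m1 m2 e \<alpha> \<beta> $ j) = (\<Sum>j\<in>{m1, m2}. two_block m1 m2 e \<alpha> \<beta> $ j)"
    by (rule sum.mono_neutral_right) (auto simp: two_block_nth)
  also have "\<dots> = (\<alpha> + \<beta>) *\<^sub>R e" using assms by (simp add: two_block_nth scaleR_left_distrib)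
  finally show ?thesis unfolding inner_const_vec by simp
qed

lemma norm_vec_sq: "(norm (\<xi> :: 'b::real_inner^'m::finite))\<^sup>2 = (\<Sum>j\<in>UNIV. (norm (\<xi> $ j))\<^sup>2)"
  by (simp add: power2_norm_eq_inner inner_vec_def)

lemma norm_const_vec: "(norm ((\<chi> j. x) :: (real^'n)^'m::finite))\<^sup>2 = CARD('m) * (norm x)\<^sup>2"
  by (simp add: norm_vec_sq)

text \<open>Makes the product of the transforms of the Gaussian waves in all slots an approximate
  identity on the product space.\<close>

lemma gkernel_prod:
  assumes "\<epsilon> > 0"
  shows "(\<Prod>j\<in>UNIV. gkernel \<epsilon> (\<xi> $ j)) = gkernel \<epsilon> (\<xi> :: (real^'n)^'m::finite)"
proof -
  have "(\<Prod>j\<in>UNIV. gkernel \<epsilon> (\<xi> $ j)) = (\<epsilon> powr - real DIM(real^'n)) ^ CARD('m) * exp (\<Sum>j\<in>UNIV. - pi * (norm (\<xi> $ j))\<^sup>2 / \<epsilon>\<^sup>2)"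
    unfolding gkernel_def prod.distrib by (simp add: exp_sum)
  also have "(\<epsilon> powr - real DIM(real^'n)) ^ CARD('m) = \<epsilon> powr - real DIM((real^'n)^'m)"
    using assms by (simp add: powr_realpow[symmetric] powr_powr mult.commute)
  also have "(\<Sum>j\<in>UNIV. - pi * (norm (\<xi> $ j))\<^sup>2 / \<epsilon>\<^sup>2) = - pi * (norm \<xi>)\<^sup>2 / \<epsilon>\<^sup>2"
    unfolding norm_vec_sq sum_distrib_left sum_divide_distrib ..
  finally show ?thesis by (simp add: gkernel_def)
qed

definition wave_sum :: "real \<Rightarrow> real^'n \<Rightarrow> nat \<Rightarrow> (nat \<Rightarrow> real) \<Rightarrow> (nat \<Rightarrow> real) \<Rightarrow> real^'n \<Rightarrow> complex" where
  "wave_sum \<epsilon> e A r \<alpha> x = (\<Sum>i<A. of_real (r i) * gwave \<epsilon> (\<alpha> i *\<^sub>R e) x)"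

definition test_tuple :: "real \<Rightarrow> 'm \<Rightarrow> 'm \<Rightarrow> real^'n \<Rightarrow> nat \<Rightarrow> (nat \<Rightarrow> real) \<Rightarrow> (nat \<Rightarrow> real) \<Rightarrow> nat \<Rightarrow> (nat \<Rightarrow> real) \<Rightarrow> (nat \<Rightarrow> real)
    \<Rightarrow> 'm \<Rightarrow> real^'n \<Rightarrow> complex" where
  "test_tuple \<epsilon> m1 m2 e A r \<alpha> B r' \<beta> j =
    (if j = m1 then wave_sum \<epsilon> e A r \<alpha> else if j = m2 then wave_sum \<epsilon> e B r' \<beta> else gwave \<epsilon> 0)"

lemma wave_sum_schwartz: "\<epsilon> > 0 \<Longrightarrow> schwartz (wave_sum \<epsilon> e A r \<alpha>)"
  unfolding wave_sum_def[abs_def]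
  by (rule gauss_fun_schwartz[of _ "pi * \<epsilon>\<^sup>2"]) (auto intro!: gauss_fun_sum gauss_fun.scale gwave_gauss_fun)

lemma test_tuple_schwartz: "\<epsilon> > 0 \<Longrightarrow> schwartz (test_tuple \<epsilon> m1 m2 e A r \<alpha> B r' \<beta> j)"
  unfolding test_tuple_def
  by (auto intro: wave_sum_schwartz gauss_fun_schwartz[OF gwave_gauss_fun])

lemma fourier_wave_sum:
  assumes "\<epsilon> > 0"
  shows "fourier (wave_sum \<epsilon> e A r \<alpha>) \<xi> = (\<Sum>i<A. of_real (r i * gkernel \<epsilon> (\<xi> - \<alpha> i *\<^sub>R e)))"
proof -
  have "fourier (wave_sum \<epsilon> e A r \<alpha>) \<xi> = (\<integral>x. (\<Sum>i<A. of_real (r i) * (gwave \<epsilon> (\<alpha> i *\<^sub>R e) x * cis (- 2 * pi * (x \<bullet> \<xi>)))) \<partial>lborel)"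
    unfolding fourier_def wave_sum_def by (simp only: sum_distrib_right mult.assoc)
  also have "\<dots> = (\<Sum>i<A. of_real (r i) * fourier (gwave \<epsilon> (\<alpha> i *\<^sub>R e)) \<xi>)"
    unfolding fourier_def
    by (subst Bochner_Integration.integral_sum) (intro integrable_mult_right fourier_gwave(2)[OF assms] integral_mult_right_zero sum.cong refl)+
  finally show ?thesis by (simp add: fourier_gwave(1)[OF assms])
qed

text \<open>The two sums are multiplied out and the Gaussians tensorise; the remaining slots hold an
  unmodulated Gaussian, which matches the zero blocks of \<open>two_block\<close>.\<close>

lemma fourier_test_tuple_prod:
  fixes \<xi> :: "(real^'n)^'m::finite"
  assumes \<epsilon>: "\<epsilon> > 0" and m: "m1 \<noteq> m2"
  shows "(\<Prod>j\<in>UNIV. fourier (test_tuple \<epsilon> m1 m2 e A r \<alpha> B r' \<beta> j) (\<xi> $ j))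
    = (\<Sum>i<A. \<Sum>l<B. of_real (r i * r' l) * of_real (gkernel \<epsilon> (\<xi> - two_block m1 m2 e (\<alpha> i) (\<beta> l))))"
proof -
  define R where "R = UNIV - {m1, m2}"
  have U: "UNIV = insert m1 (insert m2 R)" by (auto simp: R_def)
  have split: "(\<Prod>j\<in>UNIV. F j) = F m1 * (F m2 * (\<Prod>j\<in>R. F j))" for F :: "'m \<Rightarrow> 'c::comm_monoid_mult"
    unfolding U using m by (simp add: R_def)
  have rest: "fourier (test_tuple \<epsilon> m1 m2 e A r \<alpha> B r' \<beta> j) (\<xi> $ j) = of_real (gkernel \<epsilon> (\<xi> $ j))" if "j \<in> R" for j
    using that fourier_gwave(1)[OF \<epsilon>, of 0 "\<xi> $ j"] by (auto simp: R_def test_tuple_def)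
  have k: "gkernel \<epsilon> (\<xi> - two_block m1 m2 e a b) = gkernel \<epsilon> (\<xi> $ m1 - a *\<^sub>R e) * (gkernel \<epsilon> (\<xi> $ m2 - b *\<^sub>R e) * (\<Prod>j\<in>R. gkernel \<epsilon> (\<xi> $ j)))" for a b
  proof -
    have "(\<Prod>j\<in>R. gkernel \<epsilon> ((\<xi> - two_block m1 m2 e a b) $ j)) = (\<Prod>j\<in>R. gkernel \<epsilon> (\<xi> $ j))"
      by (rule prod.cong) (auto simp: R_def two_block_nth)
    then show ?thesis
      unfolding gkernel_prod[OF \<epsilon>, symmetric] split using m by (simp add: two_block_nth)
  qed
  have "(\<Prod>j\<in>UNIV. fourier (test_tuple \<epsilon> m1 m2 e A r \<alpha> B r' \<beta> j) (\<xi> $ j))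
    = (\<Sum>i<A. of_real (r i * gkernel \<epsilon> (\<xi> $ m1 - \<alpha> i *\<^sub>R e))) * ((\<Sum>l<B. of_real (r' l * gkernel \<epsilon> (\<xi> $ m2 - \<beta> l *\<^sub>R e))) * of_real (\<Prod>j\<in>R. gkernel \<epsilon> (\<xi> $ j)))"
    unfolding split of_real_prod using m rest by (simp add: test_tuple_def fourier_wave_sum[OF \<epsilon>])
  also have "\<dots> = (\<Sum>i<A. \<Sum>l<B. of_real (r i * r' l) * of_real (gkernel \<epsilon> (\<xi> - two_block m1 m2 e (\<alpha> i) (\<beta> l))))"
    unfolding k sum_distrib_right[where r="of_real (\<Prod>j\<in>R. gkernel \<epsilon> (\<xi> $ j))"] sum_product
    by (intro sum.cong refl) simp
  finally show ?thesis .
qed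

lemma mult_op_test_tuple:
  fixes \<sigma> :: "(real^'n)^'m::finite \<Rightarrow> complex"
  assumes \<epsilon>: "\<epsilon> > 0" and m: "m1 \<noteq> m2" and [measurable]: "\<sigma> \<in> borel_measurable borel" and \<sigma>: "\<And>x. norm (\<sigma> x) \<le> 1"
  shows "mult_op \<sigma> (test_tuple \<epsilon> m1 m2 e A r \<alpha> B r' \<beta>) x
    = (\<Sum>i<A. \<Sum>l<B. of_real (r i * r' l) *
        (\<integral>\<xi>. \<sigma> \<xi> * (of_real (gkernel \<epsilon> (\<xi> - two_block m1 m2 e (\<alpha> i) (\<beta> l))) * cis (2 * pi * ((\<chi> j. x) \<bullet> \<xi>))) \<partial>lborel))"
proof -
  let ?k = "\<lambda>i l \<xi>. \<sigma> \<xi> * (of_real (gkernel \<epsilon> (\<xi> - two_block m1 m2 e (\<alpha> i) (\<beta> l))) * cis (2 * pi * ((\<chi> j. x) \<bullet> \<xi>)))"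
  have int: "integrable lborel (?k i l)" for i l
    by (rule Bochner_Integration.integrable_bound[OF gkernel_fourier(1)[OF \<epsilon>, of "two_block m1 m2 e (\<alpha> i) (\<beta> l)" "\<chi> j. x"]])
       (use \<sigma> gkernel_fourier(1)[OF \<epsilon>, of "two_block m1 m2 e (\<alpha> i) (\<beta> l)" "\<chi> j. x"] in \<open>auto simp: norm_mult intro!: AE_I2 mult_left_le_one_le borel_measurable_times dest: borel_measurable_integrable\<close>)
  have "mult_op \<sigma> (test_tuple \<epsilon> m1 m2 e A r \<alpha> B r' \<beta>) x = (\<integral>\<xi>. (\<Sum>i<A. \<Sum>l<B. of_real (r i * r' l) * ?k i l \<xi>) \<partial>lborel)"
    unfolding mult_op_def fourier_test_tuple_prod[OF \<epsilon> m] inner_const_vec[symmetric]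
    by (simp add: sum_distrib_left sum_distrib_right mult_ac)
  also have "\<dots> = (\<Sum>i<A. \<Sum>l<B. of_real (r i * r' l) * (\<integral>\<xi>. ?k i l \<xi> \<partial>lborel))"
    by (simp add: Bochner_Integration.integral_sum int)
  finally show ?thesis .
qed

text \<open>\<open>gkernel_approximation\<close> at each of the finitely many frequency points,
  uniformly in x; summing costs a factor A B because the coefficients have modulus at most
  1.\<close>

lemma mult_op_test_tuple_approx:
  fixes \<sigma> :: "(real^'n)^'m::finite \<Rightarrow> complex"
  assumes m: "m1 \<noteq> m2" and \<sigma>m: "\<sigma> \<in> borel_measurable borel" and \<sigma>: "\<And>x. norm (\<sigma> x) \<le> 1"
    and cont: "\<forall>i<A. \<forall>l<B. isCont \<sigma> (two_block m1 m2 e (\<alpha> i) (\<beta> l))"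
    and r: "\<And>i. \<bar>r i\<bar> \<le> 1" "\<And>l. \<bar>r' l\<bar> \<le> 1" and \<eta>: "\<eta> > 0"
  shows "\<forall>\<^sub>F n in sequentially. \<forall>x. norm (mult_op \<sigma> (test_tuple (1 / real (Suc n)) m1 m2 e A r \<alpha> B r' \<beta>) x
     - (\<Sum>i<A. \<Sum>l<B. of_real (r i * r' l) * (\<sigma> (two_block m1 m2 e (\<alpha> i) (\<beta> l)) *
          gwave (1 / real (Suc n)) (two_block m1 m2 e (\<alpha> i) (\<beta> l)) (\<chi> j. x)))) \<le> \<eta>"
proof -
  \<comment> \<open>The summand 1 avoids a division by zero when A or B is 0.\<close>
  define \<eta>' where "\<eta>' = \<eta> / (real A * real B + 1)"
  have AB: "real A * real B + 1 > 0" by (intro add_nonneg_pos mult_nonneg_nonneg) auto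
  have \<eta>': "\<eta>' > 0" using \<eta> AB by (simp add: \<eta>'_def)
  let ?I = "\<lambda>n x i l. \<integral>\<xi>. \<sigma> \<xi> * (of_real (gkernel (1 / real (Suc n)) (\<xi> - two_block m1 m2 e (\<alpha> i) (\<beta> l))) * cis (2 * pi * (((\<chi> j. x) :: (real^'n)^'m) \<bullet> \<xi>))) \<partial>lborel"
  let ?M = "\<lambda>n x i l. \<sigma> (two_block m1 m2 e (\<alpha> i) (\<beta> l)) * gwave (1 / real (Suc n)) (two_block m1 m2 e (\<alpha> i) (\<beta> l)) (\<chi> j. x)"
  have "\<forall>\<^sub>F n in sequentially. \<forall>il\<in>{..<A} \<times> {..<B}. \<forall>x. norm (?I n x (fst il) (snd il) - ?M n x (fst il) (snd il)) \<le> \<eta>'"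
  proof (rule eventually_ball_finite, simp, rule ballI)
    fix il :: "nat \<times> nat" assume il: "il \<in> {..<A} \<times> {..<B}"
    have "isCont \<sigma> (two_block m1 m2 e (\<alpha> (fst il)) (\<beta> (snd il)))" using il cont by auto
    from gkernel_approximation[OF \<sigma>m \<sigma> this \<eta>']
    show "\<forall>\<^sub>F n in sequentially. \<forall>x. norm (?I n x (fst il) (snd il) - ?M n x (fst il) (snd il)) \<le> \<eta>'"
      by eventually_elim blast
  qed
  then show ?thesis
  proof eventually_elim
    case (elim n)
    show ?case
    proof
      fix x
      have \<epsilon>: "1 / real (Suc n) > 0" by simp
      have "norm (mult_op \<sigma> (test_tuple (1 / real (Suc n)) m1 m2 e A r \<alpha> B r' \<beta>) x
         - (\<Sum>i<A. \<Sum>l<B. of_real (r i * r' l) * ?M n x i l))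
         = norm (\<Sum>i<A. \<Sum>l<B. of_real (r i * r' l) * (?I n x i l - ?M n x i l))"
        unfolding mult_op_test_tuple[OF \<epsilon> m \<sigma>m \<sigma>] sum_subtractf[symmetric] right_diff_distrib[symmetric] ..
      also have "\<dots> \<le> (\<Sum>i<A. \<Sum>l<B. \<eta>')"
      proof (intro sum_norm_le)
        fix i l assume il: "i \<in> {..<A}" "l \<in> {..<B}"
        have "norm (of_real (r i * r' l) * (?I n x i l - ?M n x i l)) = \<bar>r i\<bar> * \<bar>r' l\<bar> * norm (?I n x i l - ?M n x i l)"
          by (simp only: norm_mult norm_of_real abs_mult)
        also have "\<dots> \<le> 1 * \<eta>'"
          using elim il r \<eta>' by (intro mult_mono mult_le_one) auto
        finally show "norm (of_real (r i * r' l) * (?I n x i l - ?M n x i l)) \<le> \<eta>'" by simp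
      qed
      also have "\<dots> = real A * real B * \<eta>'" by simp
      also have "\<dots> \<le> \<eta>"
        using \<eta> AB by (simp add: \<eta>'_def field_simps)
      finally show "norm (mult_op \<sigma> (test_tuple (1 / real (Suc n)) m1 m2 e A r \<alpha> B r' \<beta>) x
         - (\<Sum>i<A. \<Sum>l<B. of_real (r i * r' l) * ?M n x i l)) \<le> \<eta>" .
    qed
  qed
qed

text \<open>With the prescribed values the double sum is evaluated by
  \<open>rudin_shapiro_convolution\<close>. The offset b in the first block contributes only a
  unimodular factor, so the same pattern may be placed at different locations of the symbol.\<close>

lemma mult_op_test_tuple_lower:
  fixes \<sigma> :: "(real^'n)^'m::finite \<Rightarrow> complex" and K :: nat
  assumes m: "m1 \<noteq> m2" and \<sigma>m: "\<sigma> \<in> borel_measurable borel" and \<sigma>: "\<And>x. norm (\<sigma> x) \<le> 1"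
    and cont: "\<forall>i<2 * K. \<forall>l<K. isCont \<sigma> (two_block m1 m2 e (b + real i * \<nu>) (real l * \<nu>))"
    and val: "\<And>i l. i < 2 * K \<Longrightarrow> l < K \<Longrightarrow> \<sigma> (two_block m1 m2 e (b + real i * \<nu>) (real l * \<nu>))
       = of_real (if K \<le> i + l \<and> i + l < 2 * K then r i * r' l * \<tau> (i + l - K) else 0)"
    and r: "\<And>i. \<bar>r i\<bar> \<le> 1" "\<And>l. \<bar>r' l\<bar> \<le> 1" "\<And>i. i < 2 * K \<Longrightarrow> r i * r i = 1" "\<And>l. l < K \<Longrightarrow> r' l * r' l = 1" and \<eta>: "\<eta> > 0"
  shows "\<forall>\<^sub>F n in sequentially. \<forall>x. exp (- (pi * (1 / real (Suc n))\<^sup>2) * (CARD('m) * (norm x)\<^sup>2)) *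
       (real K * norm (\<Sum>u<K. of_real (\<tau> u) * cis (real u * (2 * pi * \<nu> * (x \<bullet> e))))) - \<eta>
     \<le> norm (mult_op \<sigma> (test_tuple (1 / real (Suc n)) m1 m2 e (2 * K) r (\<lambda>i. b + real i * \<nu>) K r' (\<lambda>l. real l * \<nu>)) x)"
  using mult_op_test_tuple_approx[where A="2 * K" and B=K and \<alpha>="\<lambda>i. b + real i * \<nu>" and \<beta>="\<lambda>l. real l * \<nu>" and r=r and r'=r',
      OF m \<sigma>m \<sigma> cont r(1,2) \<eta>]
proof eventually_elim
  case (elim n)
  show ?case
  proof
    fix x :: "real^'n"
    define \<epsilon> where "\<epsilon> = 1 / real (Suc n)"
    \<comment> \<open>At the diagonal point the squared norm is CARD('m) times |x|^2, the source of
      this factor.\<close>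
    define E where "E = exp (- (pi * \<epsilon>\<^sup>2) * (CARD('m) * (norm x)\<^sup>2))"
    define \<theta> where "\<theta> = 2 * pi * \<nu> * (x \<bullet> e)"
    define S where "S = (\<Sum>i<2 * K. \<Sum>l<K. of_real (r i * r' l) * (\<sigma> (two_block m1 m2 e (b + real i * \<nu>) (real l * \<nu>)) *
          gwave \<epsilon> (two_block m1 m2 e (b + real i * \<nu>) (real l * \<nu>)) (\<chi> j. x)))"
    have gw: "gwave \<epsilon> (two_block m1 m2 e (b + real i * \<nu>) (real l * \<nu>)) (\<chi> j. x)
      = of_real E * cis (2 * pi * b * (x \<bullet> e)) * cis (real (i + l) * \<theta>)" for i l
    proof -
      have "2 * pi * ((b + real i * \<nu> + real l * \<nu>) * (x \<bullet> e)) = 2 * pi * b * (x \<bullet> e) + real (i + l) * \<theta>"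
        by (simp add: \<theta>_def algebra_simps)
      then show ?thesis
        unfolding gwave_def inner_const_two_block[OF m] norm_const_vec E_def
        by (simp add: cis_mult[symmetric] mult_ac)
    qed
    have "S = of_real E * cis (2 * pi * b * (x \<bullet> e)) *
       (\<Sum>i<2 * K. \<Sum>l<K. of_real (r i * r' l * (if K \<le> i + l \<and> i + l < 2 * K then r i * r' l * \<tau> (i + l - K) else 0)) * cis (real (i + l) * \<theta>))"
      unfolding S_def gw sum_distrib_left
    proof (intro sum.cong refl)
      fix i l assume "i \<in> {..<2 * K}" "l \<in> {..<K}"
      then have "\<sigma> (two_block m1 m2 e (b + real i * \<nu>) (real l * \<nu>))
       = of_real (if K \<le> i + l \<and> i + l < 2 * K then r i * r' l * \<tau> (i + l - K) else 0)" using val by simp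
      then show "of_real (r i * r' l) * (\<sigma> (two_block m1 m2 e (b + real i * \<nu>) (real l * \<nu>)) * (of_real E * cis (2 * pi * b * (x \<bullet> e)) * cis (real (i + l) * \<theta>)))
        = of_real E * cis (2 * pi * b * (x \<bullet> e)) * (of_real (r i * r' l * (if K \<le> i + l \<and> i + l < 2 * K then r i * r' l * \<tau> (i + l - K) else 0)) * cis (real (i + l) * \<theta>))"
        by (simp only: of_real_mult mult_ac)
    qed
    also have "\<dots> = of_real E * cis (2 * pi * b * (x \<bullet> e)) * (of_nat K * cis (real K * \<theta>) * (\<Sum>u<K. of_real (\<tau> u) * cis (real u * \<theta>)))"
      by (subst rudin_shapiro_convolution[OF r(3,4)]) auto
    finally have "norm S = E * (real K * norm (\<Sum>u<K. of_real (\<tau> u) * cis (real u * \<theta>)))"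
      by (simp add: norm_mult E_def)
    moreover have "norm (mult_op \<sigma> (test_tuple \<epsilon> m1 m2 e (2 * K) r (\<lambda>i. b + real i * \<nu>) K r' (\<lambda>l. real l * \<nu>)) x - S) \<le> \<eta>"
      using elim unfolding S_def \<epsilon>_def by blast
    moreover have "norm S - norm (S - y) \<le> norm y" for y using norm_triangle_ineq2[of S "S - y"] by simp
    ultimately show "exp (- (pi * (1 / real (Suc n))\<^sup>2) * (CARD('m) * (norm x)\<^sup>2)) *
       (real K * norm (\<Sum>u<K. of_real (\<tau> u) * cis (real u * (2 * pi * \<nu> * (x \<bullet> e))))) - \<eta>
     \<le> norm (mult_op \<sigma> (test_tuple (1 / real (Suc n)) m1 m2 e (2 * K) r (\<lambda>i. b + real i * \<nu>) K r' (\<lambda>l. real l * \<nu>)) x)"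
      unfolding \<epsilon>_def[symmetric] E_def[symmetric] \<theta>_def[symmetric]
      by (smt (verit) norm_minus_commute)
  qed
qed

section \<open>L^p norms of the test functions\<close>

text \<open>The norm of a Gaussian of width 1 / \<epsilon> scales like \<epsilon>^(-d/q). Writing 1
  / q as \<open>enn2real (inverse q)\<close> gives exponent 0 for q = infinity, so one formula
  serves all exponents.\<close>

lemma lp_norm_gaussian_bound:
  assumes q: "q > 0"
  obtains D where "D \<ge> 0"
    "\<And>\<epsilon> S (f :: 'a::euclidean_space \<Rightarrow> complex). \<epsilon> > 0 \<Longrightarrow> S \<ge> 0 \<Longrightarrow> (\<And>x. norm (f x) \<le> S * exp (- (pi * \<epsilon>\<^sup>2) * (norm x)\<^sup>2)) \<Longrightarrow>
       lp_norm q f \<le> ennreal (S * D * \<epsilon> powr - (real DIM('a) * enn2real (inverse q)))"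
proof (cases "q = top")
  case True
  show ?thesis
  proof (rule that[of 1])
    fix \<epsilon> S :: real and f :: "'a \<Rightarrow> complex"
    assume \<epsilon>: "\<epsilon> > 0" "S \<ge> 0" and f: "\<And>x. norm (f x) \<le> S * exp (- (pi * \<epsilon>\<^sup>2) * (norm x)\<^sup>2)"
    have "norm (f x) \<le> S" for x
    proof -
      have "S * exp (- (pi * \<epsilon>\<^sup>2) * (norm x)\<^sup>2) \<le> S * 1" using \<epsilon> by (intro mult_left_mono) auto
      with f[of x] show ?thesis by linarith
    qed
    then have "lp_norm q f \<le> ennreal S"
      unfolding lp_norm_def using True by (auto intro!: Inf_lower AE_I2 ennreal_leI)
    then show "lp_norm q f \<le> ennreal (S * 1 * \<epsilon> powr - (real DIM('a) * enn2real (inverse q)))"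
      using True \<epsilon> by simp
  qed simp
next
  case False
  define p where "p = enn2real q"
  have p: "p > 0" "q = ennreal p"
    using q False by (auto simp: p_def enn2real_positive_iff top.not_eq_extremum)
  have w: "enn2real (inverse q) = 1 / p" using p by (simp add: inverse_ennreal inverse_eq_divide)
  show ?thesis
  proof (rule that[of "p powr - (DIM('a) / 2 / p)"])
    fix \<epsilon> S :: real and f :: "'a \<Rightarrow> complex"
    assume \<epsilon>: "\<epsilon> > 0" "S \<ge> 0" and f: "\<And>x. norm (f x) \<le> S * exp (- (pi * \<epsilon>\<^sup>2) * (norm x)\<^sup>2)"
    have pe: "pi * (p * \<epsilon>\<^sup>2) > 0" using p \<epsilon> by simp
    have "(\<integral>\<^sup>+x. ennreal (norm (f x) powr p) \<partial>lborel) \<le> (\<integral>\<^sup>+x. ennreal (S powr p * exp (- (pi * (p * \<epsilon>\<^sup>2)) * (norm (x::'a))\<^sup>2)) \<partial>lborel)"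
    proof (intro nn_integral_mono ennreal_leI)
      fix x :: 'a
      have "norm (f x) powr p \<le> (S * exp (- (pi * \<epsilon>\<^sup>2) * (norm x)\<^sup>2)) powr p"
        using f p by (intro powr_mono2) auto
      also have "\<dots> = S powr p * exp (- (pi * (p * \<epsilon>\<^sup>2)) * (norm x)\<^sup>2)"
        using \<epsilon> by (simp add: powr_mult exp_powr_real algebra_simps)
      finally show "norm (f x) powr p \<le> S powr p * exp (- (pi * (p * \<epsilon>\<^sup>2)) * (norm x)\<^sup>2)" .
    qed
    also have "\<dots> = ennreal (\<integral>x. S powr p * exp (- (pi * (p * \<epsilon>\<^sup>2)) * (norm (x::'a))\<^sup>2) \<partial>lborel)"
      by (intro nn_integral_eq_integral integrable_mult_right integrable_gaussian(1)[OF pe]) auto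
    also have "\<dots> = ennreal (S powr p * (1 / (p * \<epsilon>\<^sup>2)) powr (DIM('a) / 2))"
      using integrable_gaussian(2)[OF pe, where 'a='a] by simp
    finally have "lp_norm q f \<le> epowr (ennreal (S powr p * (1 / (p * \<epsilon>\<^sup>2)) powr (DIM('a) / 2))) (1 / p)"
      unfolding lp_norm_def using False p(1) by (auto simp: p_def[symmetric] intro!: epowr_mono)
    also have "\<dots> = ennreal ((S powr p * (1 / (p * \<epsilon>\<^sup>2)) powr (DIM('a) / 2)) powr (1 / p))"
      by (rule epowr_ennreal) simp
    also have "(S powr p * (1 / (p * \<epsilon>\<^sup>2)) powr (DIM('a) / 2)) powr (1 / p)
       = S * p powr - (DIM('a) / 2 / p) * \<epsilon> powr - (real DIM('a) * (1 / p))"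
    proof -
      have "(\<epsilon>\<^sup>2) powr (DIM('a) / 2) = (\<epsilon> powr 2) powr (DIM('a) / 2)" using \<epsilon> by simp
      also have "\<dots> = \<epsilon> powr DIM('a)" by (subst powr_powr) simp
      finally have 1: "(1 / (p * \<epsilon>\<^sup>2)) powr (DIM('a) / 2) = p powr - (DIM('a) / 2) * \<epsilon> powr - real DIM('a)"
        using p \<epsilon> by (simp add: powr_divide powr_mult powr_minus_divide)
      have 2: "(S powr p) powr (1 / p) = S" using p \<epsilon> by (simp add: powr_powr)
      have 3: "(p powr - (DIM('a) / 2)) powr (1 / p) = p powr - (DIM('a) / 2 / p)"
        "(\<epsilon> powr - real DIM('a)) powr (1 / p) = \<epsilon> powr - (real DIM('a) * (1 / p))"
        by (simp_all only: powr_powr) simp_all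
      show ?thesis
        unfolding 1 powr_mult 2 3 by (simp only: mult.assoc)
    qed
    finally show "lp_norm q f \<le> ennreal (S * p powr - (DIM('a) / 2 / p) * \<epsilon> powr - (real DIM('a) * enn2real (inverse q)))"
      unfolding w .
  qed simp
qed

lemma wave_sum_bound:
  assumes "\<And>\<theta>. norm (\<Sum>i<A. of_real (r i) * cis (real i * \<theta>)) \<le> S"
  shows "norm (wave_sum \<epsilon> e A r (\<lambda>i. b + real i * \<nu>) x) \<le> S * exp (- (pi * \<epsilon>\<^sup>2) * (norm x)\<^sup>2)"
proof -
  have "wave_sum \<epsilon> e A r (\<lambda>i. b + real i * \<nu>) x
     = cis (2 * pi * b * (x \<bullet> e)) * of_real (exp (- (pi * \<epsilon>\<^sup>2) * (norm x)\<^sup>2)) * (\<Sum>i<A. of_real (r i) * cis (real i * (2 * pi * \<nu> * (x \<bullet> e))))"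
    unfolding wave_sum_def sum_distrib_left
  proof (rule sum.cong[OF refl])
    fix i
    have "2 * pi * (x \<bullet> ((b + real i * \<nu>) *\<^sub>R e)) = 2 * pi * b * (x \<bullet> e) + real i * (2 * pi * \<nu> * (x \<bullet> e))"
      by (simp add: algebra_simps)
    then show "of_real (r i) * gwave \<epsilon> ((b + real i * \<nu>) *\<^sub>R e) x
      = cis (2 * pi * b * (x \<bullet> e)) * of_real (exp (- (pi * \<epsilon>\<^sup>2) * (norm x)\<^sup>2)) * (of_real (r i) * cis (real i * (2 * pi * \<nu> * (x \<bullet> e))))"
      unfolding gwave_def by (simp only: cis_mult[symmetric] mult_ac)
  qed
  then have "norm (wave_sum \<epsilon> e A r (\<lambda>i. b + real i * \<nu>) x)
     = exp (- (pi * \<epsilon>\<^sup>2) * (norm x)\<^sup>2) * norm (\<Sum>i<A. of_real (r i) * cis (real i * (2 * pi * \<nu> * (x \<bullet> e))))"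
    by (simp add: norm_mult)
  also have "\<dots> \<le> exp (- (pi * \<epsilon>\<^sup>2) * (norm x)\<^sup>2) * S"
    by (intro mult_left_mono assms) simp
  finally show ?thesis by (simp add: mult.commute)
qed

lemma borel_measurable_mult_op:
  fixes \<sigma> :: "(real^'n)^'m::finite \<Rightarrow> complex"
  assumes [measurable]: "\<sigma> \<in> borel_measurable borel" "\<And>j. f j \<in> borel_measurable borel"
  shows "mult_op \<sigma> f \<in> borel_measurable borel"
proof -
  have [measurable]: "(\<lambda>\<xi>::(real^'n)^'m. \<xi> $ j) \<in> borel_measurable borel" for j
    by (intro borel_measurable_continuous_onI continuous_intros)
  show ?thesis unfolding mult_op_def[abs_def] by measurable
qed

section \<open>Unboundedness of the multiplier operator\<close>

text \<open>For each k the assumed bound is tested on Rudin-Shapiro sums at one small \<epsilon>.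
  The powers of \<epsilon> on the two sides agree by \<open>hoelder\<close> and cancel; what remains
  bounds sqrt (2^k) by a constant independent of k.\<close>

lemma not_mult_bounded_of_rudin_shapiro_values:
  fixes \<sigma> :: "(real^'n)^'m::finite \<Rightarrow> complex" and ps :: "'m \<Rightarrow> ennreal" and p :: real
    and r r' :: "nat \<Rightarrow> nat \<Rightarrow> real" and b :: "nat \<Rightarrow> bool \<Rightarrow> real" and \<nu> :: "nat \<Rightarrow> real"
  defines "\<tau> \<equiv> \<lambda>k c. if c then r k else r' k"
  assumes m: "m1 \<noteq> m2" and e: "norm e = 1" and p: "p > 0" and ps: "\<And>j. ps j > 0"
    and hoelder: "ennreal (1 / p) = (\<Sum>j\<in>UNIV. inverse (ps j))"
    and \<sigma>m: "\<sigma> \<in> borel_measurable borel" and \<sigma>: "\<And>x. norm (\<sigma> x) \<le> 1"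
    and r1: "\<And>k l. \<bar>r k l\<bar> \<le> 1" and rr: "\<And>k l. l < 2 ^ k \<Longrightarrow> r k l * r k l = 1"
    and RS: "\<And>k \<theta>. (norm (\<Sum>l<2 ^ k. of_real (r k l) * cis (real l * \<theta>)))\<^sup>2
        + (norm (\<Sum>l<2 ^ k. of_real (r' k l) * cis (real l * \<theta>)))\<^sup>2 = 2 * 2 ^ k"
    and cont: "\<And>k c i l. i < 2 * 2 ^ k \<Longrightarrow> l < 2 ^ k \<Longrightarrow> isCont \<sigma> (two_block m1 m2 e (b k c + real i * \<nu> k) (real l * \<nu> k))"
    and val: "\<And>k c i l. i < 2 * 2 ^ k \<Longrightarrow> l < 2 ^ k \<Longrightarrow> \<sigma> (two_block m1 m2 e (b k c + real i * \<nu> k) (real l * \<nu> k))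
       = of_real (if 2 ^ k \<le> i + l \<and> i + l < 2 * 2 ^ k then r (Suc k) i * r k l * \<tau> k c (i + l - 2 ^ k) else 0)"
  shows "\<not> mult_bounded \<sigma> ps (ennreal p)"
proof
  assume "mult_bounded \<sigma> ps (ennreal p)"
  then obtain C where C: "C \<ge> 0" "\<And>f. (\<And>j. schwartz (f j)) \<Longrightarrow>
           lp_norm (ennreal p) (mult_op \<sigma> f) \<le> ennreal C * (\<Prod>j\<in>UNIV. lp_norm (ps j) (f j))"
    unfolding mult_bounded_def by blast
  define d where "d = real DIM(real^'n)"
  define w where "w = (\<lambda>j. enn2real (inverse (ps j)))"
  \<comment> \<open>With the real numbers w_j = 1 / p_j, where 1 / infinity is 0, the Hoelder
    relation becomes an identity between exponents.\<close>
  have wsum: "(\<Sum>j\<in>UNIV. w j) = 1 / p"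
  proof -
    have "inverse (ps j) < top" for j
      using ps[of j] by (simp add: top.not_eq_extremum[symmetric] ennreal_inverse_eq_top_iff)
    then have "inverse (ps j) = ennreal (w j)" for j by (simp add: w_def)
    then have "(\<Sum>j\<in>UNIV. inverse (ps j)) = (\<Sum>j\<in>UNIV. ennreal (w j))"
      by (intro sum.cong refl)
    also have "\<dots> = ennreal (\<Sum>j\<in>UNIV. w j)"
      by (rule sum_ennreal) (simp add: w_def)
    finally have "ennreal (1 / p) = ennreal (\<Sum>j\<in>UNIV. w j)"
      unfolding hoelder .
    then show ?thesis using p by (subst (asm) ennreal_inj) (auto simp: w_def intro!: sum_nonneg)
  qed
  have "\<exists>D. D \<ge> 0 \<and> (\<forall>\<epsilon> S (f :: real^'n \<Rightarrow> complex). \<epsilon> > 0 \<longrightarrow> S \<ge> 0 \<longrightarrow> (\<forall>x. norm (f x) \<le> S * exp (- (pi * \<epsilon>\<^sup>2) * (norm x)\<^sup>2)) \<longrightarrow>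
       lp_norm (ps j) f \<le> ennreal (S * D * \<epsilon> powr - (d * w j)))" for j
    unfolding d_def w_def using lp_norm_gaussian_bound[OF ps[of j], where 'a="real^'n"] by metis
  then obtain D where D: "\<And>j. D j \<ge> 0" "\<And>j \<epsilon> S (f :: real^'n \<Rightarrow> complex). \<epsilon> > 0 \<Longrightarrow> S \<ge> 0 \<Longrightarrow> (\<And>x. norm (f x) \<le> S * exp (- (pi * \<epsilon>\<^sup>2) * (norm x)\<^sup>2)) \<Longrightarrow>
       lp_norm (ps j) f \<le> ennreal (S * D j * \<epsilon> powr - (d * w j))"
    by metis
  define A where "A = exp (- (pi * CARD('m)))"
  have A: "A > 0" by (simp add: A_def)
  define v where "v = unit_ball_vol d"
  have v: "v > 0" by (simp add: v_def d_def)
  have RSle: "norm (\<Sum>l<2 ^ k. of_real (r k l) * cis (real l * \<theta>)) \<le> sqrt (2 * 2 ^ k)" for k \<theta>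
    using RS[of k \<theta>] by (intro real_le_rsqrt) (smt (verit) zero_le_power2)
  have main: "A * (2 ^ k * sqrt (2 ^ k)) / 2 * (v / 2) powr (1 / p) \<le> C * (2 * sqrt 2 * 2 ^ k * (\<Prod>j\<in>UNIV. D j))" for k
  proof -
    define K where "K = (2 ^ k :: nat)"
    have K: "K > 0" "real K = 2 ^ k" by (simp_all add: K_def)
    \<comment> \<open>Half of the guaranteed main term, so that the approximation error leaves the
      other half.\<close>
    define \<eta> where "\<eta> = A * (real K * sqrt K) / 2"
    have \<eta>: "\<eta> > 0" using A K by (simp add: \<eta>_def)
    let ?f = "\<lambda>c n. test_tuple (1 / real (Suc n)) m1 m2 e (2 * K) (r (Suc k)) (\<lambda>i. b k c + real i * \<nu> k) K (r k) (\<lambda>l. real l * \<nu> k)"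
    have low: "\<forall>\<^sub>F n in sequentially. \<forall>x. exp (- (pi * (1 / real (Suc n))\<^sup>2) * (CARD('m) * (norm x)\<^sup>2)) *
       (real K * norm (\<Sum>u<K. of_real (\<tau> k c u) * cis (real u * (2 * pi * \<nu> k * (x \<bullet> e))))) - \<eta> \<le> norm (mult_op \<sigma> (?f c n) x)" for c
    proof (rule mult_op_test_tuple_lower[OF m \<sigma>m \<sigma> _ _ r1 r1 _ _ \<eta>])
      show "\<forall>i<2 * K. \<forall>l<K. isCont \<sigma> (two_block m1 m2 e (b k c + real i * \<nu> k) (real l * \<nu> k))"
        using cont by (auto simp: K_def)
      show "\<sigma> (two_block m1 m2 e (b k c + real i * \<nu> k) (real l * \<nu> k))
       = of_real (if K \<le> i + l \<and> i + l < 2 * K then r (Suc k) i * r k l * \<tau> k c (i + l - K) else 0)"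
        if "i < 2 * K" "l < K" for i l using val[of i k l c] that unfolding K_def by blast
      show "r (Suc k) i * r (Suc k) i = 1" if "i < 2 * K" for i using rr[of i "Suc k"] that by (simp add: K_def)
      show "r k l * r k l = 1" if "l < K" for l using rr[of l k] that by (simp add: K_def)
    qed
    \<comment> \<open>One n must serve both choices of c, because c is selected only afterwards, by
      the sizes of the sets \<open>E c\<close>.\<close>
    obtain n where n: "\<And>c x. exp (- (pi * (1 / real (Suc n))\<^sup>2) * (CARD('m) * (norm x)\<^sup>2)) *
       (real K * norm (\<Sum>u<K. of_real (\<tau> k c u) * cis (real u * (2 * pi * \<nu> k * (x \<bullet> e))))) - \<eta> \<le> norm (mult_op \<sigma> (?f c n) x)"
    proof -
      define Q where "Q = (\<lambda>c n. \<forall>x. exp (- (pi * (1 / real (Suc n))\<^sup>2) * (CARD('m) * (norm x)\<^sup>2)) *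
       (real K * norm (\<Sum>u<K. of_real (\<tau> k c u) * cis (real u * (2 * pi * \<nu> k * (x \<bullet> e))))) - \<eta> \<le> norm (mult_op \<sigma> (?f c n) x))"
      have "\<forall>\<^sub>F n in sequentially. Q True n \<and> Q False n"
        unfolding Q_def by (intro eventually_conj low)
      then obtain n where "Q True n \<and> Q False n"
        using eventually_happens'[OF sequentially_bot] by blast
      then have "Q c n" for c by (cases c) auto
      then show ?thesis using that unfolding Q_def by blast
    qed
    define \<epsilon> where "\<epsilon> = 1 / real (Suc n)"
    have \<epsilon>: "\<epsilon> > 0" by (simp add: \<epsilon>_def)
    define T where "T = (\<lambda>c. mult_op \<sigma> (?f c n))"
    have sch: "schwartz (?f c n j)" for c j by (rule test_tuple_schwartz) simp
    have Tm[measurable]: "T c \<in> borel_measurable borel" for c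
      unfolding T_def by (intro borel_measurable_mult_op \<sigma>m schwartz_measurable sch)
    \<comment> \<open>On this ball the factor exp (- pi \<epsilon>^2 CARD('m) |x|^2) is at least A,
      and its volume supplies the power \<epsilon>^(-d).\<close>
    define G where "G = ball (0::real^'n) (1 / \<epsilon>)"
    define E where "E = (\<lambda>c. {x \<in> G. \<eta> \<le> norm (T c x)})"
    have Em[measurable]: "E c \<in> sets borel" for c unfolding E_def G_def by measurable
    have cover: "G \<subseteq> E True \<union> E False"
    proof
      fix x assume x: "x \<in> G"
      define \<theta> where "\<theta> = 2 * pi * \<nu> k * (x \<bullet> e)"
      define P where "P = (\<lambda>c. norm (\<Sum>u<K. of_real (\<tau> k c u) * cis (real u * \<theta>)))"
      have "\<epsilon> * norm x \<le> 1" using x \<epsilon> by (simp add: G_def field_simps)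
      then have "(\<epsilon> * norm x)\<^sup>2 \<le> 1" using \<epsilon> by (intro power_le_one) auto
      then have "pi * \<epsilon>\<^sup>2 * (CARD('m) * (norm x)\<^sup>2) \<le> pi * CARD('m) * 1"
        using mult_left_mono[of "(\<epsilon> * norm x)\<^sup>2" 1 "pi * CARD('m)"] by (simp add: power_mult_distrib mult_ac)
      then have Ale: "A \<le> exp (- (pi * \<epsilon>\<^sup>2) * (CARD('m) * (norm x)\<^sup>2))" by (simp add: A_def)
      have "(P True)\<^sup>2 + (P False)\<^sup>2 = 2 * K"
        using RS[of k \<theta>] by (simp add: P_def \<tau>_def K_def)
      then have "(P True)\<^sup>2 \<ge> K \<or> (P False)\<^sup>2 \<ge> K" by linarith
      then obtain c where "(P c)\<^sup>2 \<ge> K" by blast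
      then have Pc: "sqrt K \<le> P c" by (intro real_le_lsqrt) (auto simp: P_def)
      have "2 * \<eta> = A * (real K * sqrt K)" by (simp add: \<eta>_def)
      also have "\<dots> \<le> exp (- (pi * \<epsilon>\<^sup>2) * (CARD('m) * (norm x)\<^sup>2)) * (real K * P c)"
        using Ale Pc A by (intro mult_mono) auto
      also have "\<dots> \<le> \<eta> + norm (T c x)"
        using n[of x c] unfolding P_def \<theta>_def T_def \<epsilon>_def by linarith
      finally have "x \<in> E c" using x by (simp add: E_def)
      then show "x \<in> E True \<union> E False" by (cases c) auto
    qed
    have volG: "emeasure lborel G = ennreal (v * \<epsilon> powr - d)"
      using \<epsilon> by (simp add: G_def emeasure_ball v_def d_def powr_minus powr_realpow power_one_over divide_inverse power_inverse)
    \<comment> \<open>Pigeonhole: the two sets cover the ball, so one has at least half of its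
      measure. Arguing with measures works for every p > 0.\<close>
    obtain c where c: "ennreal (v * \<epsilon> powr - d / 2) \<le> emeasure lborel (E c)"
    proof (rule ccontr)
      assume "\<not> thesis"
      with that have lt: "emeasure lborel (E c) < ennreal (v * \<epsilon> powr - d / 2)" for c by (meson not_le)
      have "emeasure lborel G \<le> emeasure lborel (E True \<union> E False)"
        using cover by (intro emeasure_mono) auto
      also have "\<dots> \<le> emeasure lborel (E True) + emeasure lborel (E False)"
        by (rule emeasure_subadditive) auto
      also have "\<dots> < ennreal (v * \<epsilon> powr - d / 2) + ennreal (v * \<epsilon> powr - d / 2)"
        using lt[of True] lt[of False] by (rule add_strict_mono)
      also have "\<dots> = ennreal (v * \<epsilon> powr - d)"
        using v by (simp add: ennreal_plus[symmetric] del: ennreal_plus)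
      finally show False unfolding volG by simp
    qed
    have "ennreal (\<eta> powr p * (v * \<epsilon> powr - d / 2)) \<le> (\<integral>\<^sup>+x. ennreal (norm (T c x) powr p) \<partial>lborel)"
    proof -
      have "ennreal (\<eta> powr p * (v * \<epsilon> powr - d / 2)) \<le> ennreal (\<eta> powr p) * emeasure lborel (E c)"
        using c by (subst ennreal_mult') (auto intro: mult_left_mono)
      also have "\<dots> = (\<integral>\<^sup>+x. ennreal (\<eta> powr p) * indicator (E c) x \<partial>lborel)"
        by (simp add: nn_integral_cmult_indicator)
      also have "\<dots> \<le> (\<integral>\<^sup>+x. ennreal (norm (T c x) powr p) \<partial>lborel)"
        using p \<eta> by (intro nn_integral_mono) (auto simp: indicator_def E_def intro!: ennreal_leI powr_mono2)
      finally show ?thesis .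
    qed
    then have "epowr (ennreal (\<eta> powr p * (v * \<epsilon> powr - d / 2))) (1 / p) \<le> lp_norm (ennreal p) (T c)"
      unfolding lp_norm_def using p by (auto intro!: epowr_mono)
    also have "epowr (ennreal (\<eta> powr p * (v * \<epsilon> powr - d / 2))) (1 / p) = ennreal (\<eta> * (v / 2) powr (1 / p) * \<epsilon> powr - (d * (1 / p)))"
    proof -
      have "(\<eta> powr p * (v * \<epsilon> powr - d / 2)) powr (1 / p) = (\<eta> powr p) powr (1 / p) * ((v / 2) powr (1 / p) * (\<epsilon> powr - d) powr (1 / p))"
        unfolding powr_mult[symmetric] by simp
      also have "(\<eta> powr p) powr (1 / p) = \<eta>" using p \<eta> by (simp add: powr_powr)
      also have "(\<epsilon> powr - d) powr (1 / p) = \<epsilon> powr - (d * (1 / p))" by (simp only: powr_powr) simp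
      finally show ?thesis using v by (subst epowr_ennreal) (simp_all add: mult.assoc)
    qed
    also have "lp_norm (ennreal p) (T c) \<le> ennreal C * (\<Prod>j\<in>UNIV. lp_norm (ps j) (?f c n j))"
      unfolding T_def by (rule C(2)[OF sch])
    also have "\<dots> \<le> ennreal C * (\<Prod>j\<in>UNIV. ennreal ((if j = m1 then sqrt (2 * (2 * K)) else if j = m2 then sqrt (2 * K) else 1) * D j * \<epsilon> powr - (d * w j)))"
    proof (intro mult_left_mono prod_mono_ennreal)
      fix j
      have b1: "norm (wave_sum \<epsilon> e (2 * K) (r (Suc k)) (\<lambda>i. b k c + real i * \<nu> k) x) \<le> sqrt (2 * (2 * K)) * exp (- (pi * \<epsilon>\<^sup>2) * (norm x)\<^sup>2)" for x
        using RSle[of "Suc k"] by (intro wave_sum_bound) (simp add: K_def)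
      have b2: "norm (wave_sum \<epsilon> e K (r k) (\<lambda>l. real l * \<nu> k) x) \<le> sqrt (2 * K) * exp (- (pi * \<epsilon>\<^sup>2) * (norm x)\<^sup>2)" for x
        using wave_sum_bound[where b=0 and A=K and r="r k", of "sqrt (2 * K)" \<epsilon> e "\<nu> k" x] RSle[of k] by (simp add: K_def)
      show "lp_norm (ps j) (?f c n j) \<le> ennreal ((if j = m1 then sqrt (2 * (2 * K)) else if j = m2 then sqrt (2 * K) else 1) * D j * \<epsilon> powr - (d * w j))"
        unfolding \<epsilon>_def[symmetric]
        by (rule D(2)[OF \<epsilon>]) (use b1 b2 m in \<open>auto simp: test_tuple_def gwave_def norm_mult\<close>)
    qed simp
    also have "\<dots> = ennreal (C * (2 * sqrt 2 * K * (\<Prod>j\<in>UNIV. D j)) * \<epsilon> powr - (d * (1 / p)))"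
    proof -
      let ?s = "\<lambda>j. if j = m1 then sqrt (2 * (2 * K)) else if j = m2 then sqrt (2 * K) else 1"
      have "(\<Prod>j\<in>UNIV. ennreal (?s j * D j * \<epsilon> powr - (d * w j))) = ennreal (\<Prod>j\<in>UNIV. ?s j * D j * \<epsilon> powr - (d * w j))"
        using D(1) by (intro prod_ennreal) auto
      also have "(\<Prod>j\<in>UNIV. ?s j * D j * \<epsilon> powr - (d * w j)) = (\<Prod>j\<in>UNIV. ?s j) * (\<Prod>j\<in>UNIV. D j) * (\<Prod>j\<in>UNIV. \<epsilon> powr - (d * w j))"
        by (simp only: prod.distrib)
      also have "(\<Prod>j\<in>UNIV. ?s j) = (\<Prod>j\<in>{m1, m2}. ?s j)"
        by (rule prod.mono_neutral_right) auto
      \<comment> \<open>Thanks to flatness the two nontrivial inputs cost only order K together,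
        against order K^(3/2) in \<open>\<eta>\<close>.\<close>
      also have "\<dots> = 2 * sqrt 2 * K"
        using m by (simp add: real_sqrt_mult)
      also have "(\<Prod>j\<in>UNIV. \<epsilon> powr - (d * w j)) = \<epsilon> powr - (d * (1 / p))"
        using \<epsilon> by (simp add: wsum[symmetric] sum_distrib_left sum_negf[symmetric] powr_sum)
      finally show ?thesis using C(1) by (simp add: ennreal_mult'[symmetric] mult_ac)
    qed
    finally have "\<eta> * (v / 2) powr (1 / p) * \<epsilon> powr - (d * (1 / p)) \<le> C * (2 * sqrt 2 * K * (\<Prod>j\<in>UNIV. D j)) * \<epsilon> powr - (d * (1 / p))"
      using C(1) D(1) by (subst (asm) ennreal_le_iff) (auto intro!: mult_nonneg_nonneg prod_nonneg)
    then have "\<eta> * (v / 2) powr (1 / p) \<le> C * (2 * sqrt 2 * K * (\<Prod>j\<in>UNIV. D j))"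
      using \<epsilon> by simp
    then show ?thesis by (simp add: \<eta>_def K_def)
  qed
  define B where "B = C * (2 * sqrt 2 * (\<Prod>j\<in>UNIV. D j)) / (A / 2 * (v / 2) powr (1 / p))"
  have den: "A / 2 * (v / 2) powr (1 / p) > 0" using A v by simp
  have le: "sqrt (2 ^ k) \<le> B" for k
  proof -
    have "2 ^ k * (sqrt (2 ^ k) * (A / 2 * (v / 2) powr (1 / p))) \<le> 2 ^ k * (C * (2 * sqrt 2 * (\<Prod>j\<in>UNIV. D j)))"
      using main[of k] by (simp add: mult_ac)
    then have "sqrt (2 ^ k) * (A / 2 * (v / 2) powr (1 / p)) \<le> C * (2 * sqrt 2 * (\<Prod>j\<in>UNIV. D j))"
      by (subst (asm) mult_le_cancel_left_pos) auto
    then show ?thesis unfolding B_def by (subst pos_le_divide_eq[OF den])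
  qed
  obtain k where k: "B\<^sup>2 < 2 ^ k" using real_arch_pow[of 2 "B\<^sup>2"] by auto
  have "B < sqrt (2 ^ k)" using k by (intro real_less_rsqrt)
  with le[of k] show False by simp
qed

text \<open>Both parts of the theorem are instances of this. What remains here is to lay out the
  frequency points for all k and both choices of c in one annulus, with explicit
  separations.\<close>

lemma counterexample_multiplier:
  fixes \<Psi> :: "(real^'n)^'m::finite \<Rightarrow> complex"
    and p :: real and ps :: "'m \<Rightarrow> ennreal" and s r :: real and q :: ennreal
  assumes m2: "CARD('m) \<ge> 2"
    and p_pos: "p > 0"
    and ps_pos: "\<forall>j. ps j > 0"
    and hoelder: "ennreal (1 / p) = (\<Sum>j\<in>UNIV. inverse (ps j))"
    and s: "0 < s" "s < real (CARD('m) * CARD('n))"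
    and Psi_schwartz: "schwartz \<Psi>"
    and Psi_supp: "\<forall>\<xi>. fourier \<Psi> \<xi> \<noteq> 0 \<longrightarrow> 1/2 \<le> norm \<xi> \<and> norm \<xi> \<le> 2"
    and r: "0 < r" and q: "0 < q"
    and rq: "r < real (CARD('m) * CARD('n)) / s \<or> r = real (CARD('m) * CARD('n)) / s \<and> 1 < q"
  shows "\<exists>\<sigma> :: (real^'n)^'m \<Rightarrow> complex.
          \<sigma> \<in> borel_measurable lborel \<and> bounded (range \<sigma>) \<and>
          (SUP k::int. sobolev_lorentz_norm s r q
               (\<lambda>\<xi>. \<sigma> (2 powr real_of_int k *\<^sub>R \<xi>) * fourier \<Psi> \<xi>)) < top \<and>
          \<not> mult_bounded \<sigma> ps (ennreal p)"
proof -
  have dim: "DIM((real^'n)^'m) = CARD('m) * CARD('n)" by simp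
  obtain m1 m2 :: 'm where m: "m1 \<noteq> m2"
    using m2 card_le_Suc0_iff_eq[of "UNIV :: 'm set"] by auto
  define e :: "real^'n" where "e = axis undefined 1"
  have e: "norm e = 1" by (simp add: e_def)
  define RS where "RS = (\<lambda>k (\<rho> :: nat \<Rightarrow> real) (\<rho>' :: nat \<Rightarrow> real). (\<forall>l. \<bar>\<rho> l\<bar> \<le> 1) \<and> (\<forall>l. \<bar>\<rho>' l\<bar> \<le> 1) \<and> (\<forall>l<2 ^ k. \<rho> l * \<rho> l = 1) \<and>
    (\<forall>\<theta>. (norm (\<Sum>l<2 ^ k. of_real (\<rho> l) * cis (real l * \<theta>)))\<^sup>2
        + (norm (\<Sum>l<2 ^ k. of_real (\<rho>' l) * cis (real l * \<theta>)))\<^sup>2 = 2 * 2 ^ k))"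
  have "\<exists>\<rho> \<rho>'. RS k \<rho> \<rho>'" for k
    unfolding RS_def by (rule rudin_shapiro[of k]) blast
  then obtain \<rho> \<rho>' where RS: "\<And>k. RS k (\<rho> k) (\<rho>' k)" by metis
  have \<rho>: "\<And>k l. \<bar>\<rho> k l\<bar> \<le> 1" "\<And>k l. \<bar>\<rho>' k l\<bar> \<le> 1" "\<And>k l. l < 2 ^ k \<Longrightarrow> \<rho> k l * \<rho> k l = 1"
     "\<And>k \<theta>. (norm (\<Sum>l<2 ^ k. of_real (\<rho> k l) * cis (real l * \<theta>)))\<^sup>2
        + (norm (\<Sum>l<2 ^ k. of_real (\<rho>' k l) * cis (real l * \<theta>)))\<^sup>2 = 2 * 2 ^ k"
    using RS unfolding RS_def by blast+
  define \<tau> where "\<tau> = (\<lambda>k c. if c then \<rho> k else \<rho>' k)"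
  have \<tau>: "\<bar>\<tau> k c l\<bar> \<le> 1" for k c l using \<rho>(1,2) by (simp add: \<tau>_def)
  \<comment> \<open>Offsets of the clusters, one for each index t. The ratio 1/4 leaves room: in the
    first block cluster t stays within [1 + u_t, 1 + 2 u_t), while the preceding one starts at 1 + 4
    u_t. The factor 1/64 keeps all norms between 7/8 and 9/8.\<close>
  define u where "u = (\<lambda>t::nat. (1 / 4) ^ t / 64 :: real)"
  \<comment> \<open>The spacing for which 2 * 2^k steps cover exactly u_(2k+1), the smaller of the
    two offsets belonging to k.\<close>
  define \<nu> where "\<nu> = (\<lambda>k. u (2 * k + 1) / (2 * 2 ^ k))"
  \<comment> \<open>Even indices for \<open>c = True\<close> and odd ones for
    \<open>c = False\<close>, so different pairs (k, c) get different clusters.\<close>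
  define t where "t = (\<lambda>k c. if c then 2 * k else 2 * k + 1 :: nat)"
  have u: "u i > 0" "u (Suc i) = u i / 4" "u i \<le> 1 / 64" for i
    by (auto simp: u_def power_le_one)
  have u_mono: "i < j \<Longrightarrow> u j \<le> u i / 4" for i j
  proof -
    assume "i < j"
    then have "u j \<le> u (Suc i)" unfolding u_def by (intro divide_right_mono power_decreasing) auto
    then show ?thesis by (simp add: u(2))
  qed
  have \<nu>: "\<nu> k > 0" for k using u(1) by (simp add: \<nu>_def)
  have \<nu>_le: "2 * 2 ^ k * \<nu> k = u (2 * k + 1)" for k by (simp add: \<nu>_def)
  have u_t: "u (2 * k + 1) \<le> u (t k c)" for k c
    using u_mono[of "2 * k" "2 * k + 1"] u(1)[of "2 * k"] by (auto simp: t_def)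
  have i\<nu>: "real i * \<nu> k < u (t k c)" if "i < 2 * 2 ^ k" for i k c
  proof -
    have "real i < 2 * 2 ^ k" using that of_nat_less_iff[of i "2 * 2 ^ k", where 'a=real] by simp
    then have "real i * \<nu> k < 2 * 2 ^ k * \<nu> k" using \<nu>[of k] by (rule mult_strict_right_mono)
    then show ?thesis using \<nu>_le[of k] u_t[of k c] by linarith
  qed
  have \<nu>_u: "\<nu> k \<le> u (t k c) / 2" for k c
  proof -
    have "2 * \<nu> k \<le> 2 * 2 ^ k * \<nu> k" using \<nu>[of k] by simp
    then show ?thesis using \<nu>_le[of k] u_t[of k c] by linarith
  qed
  define I :: "(nat \<times> bool \<times> nat \<times> nat) set" where "I = {(k, c, i, l). i < 2 * 2 ^ k \<and> l < (2::nat) ^ k}"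
  define P :: "nat \<times> bool \<times> nat \<times> nat \<Rightarrow> (real^'n)^'m"
    where "P = (\<lambda>(k, c, i, l). two_block m1 m2 e (1 + u (t k c) + real i * \<nu> k) (real l * \<nu> k))"
  define V :: "nat \<times> bool \<times> nat \<times> nat \<Rightarrow> complex"
    where "V = (\<lambda>(k, c, i, l). of_real (if 2 ^ k \<le> i + l \<and> i + l < 2 * 2 ^ k then \<rho> (Suc k) i * \<rho> k l * \<tau> k c (i + l - 2 ^ k) else 0))"
  have V1: "norm (V x) \<le> 1" for x
  proof -
    obtain k c i l where x: "x = (k, c, i, l)" by (cases x) auto
    show ?thesis unfolding x V_def using \<rho>(1) \<tau>
      by (auto simp: norm_mult abs_mult intro!: mult_le_one)
  qed
  have P1: "7 / 8 \<le> norm (P x)" "norm (P x) \<le> 9 / 8" if "x \<in> I" for x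
  proof -
    obtain k c i l where x: "x = (k, c, i, l)" by (cases x) auto
    have il: "i < 2 * 2 ^ k" "l < 2 * 2 ^ k" using that by (auto simp: I_def x)
    have "0 \<le> real i * \<nu> k" "0 \<le> real l * \<nu> k" using \<nu>[of k] by auto
    then show "7 / 8 \<le> norm (P x)" "norm (P x) \<le> 9 / 8"
      using two_block_norm[OF m e, of "1 + u (t k c) + real i * \<nu> k" "real l * \<nu> k"] i\<nu>[OF il(1), of c] i\<nu>[OF il(2), of c] u(1,3)[of "t k c"]
      unfolding x P_def by auto
  qed
  \<comment> \<open>Within a cluster distinct points differ by at least \<open>\<nu> k\<close> in
    one of the two blocks; different clusters are already separated in the first block.\<close>
  have sep: "\<nu> (fst x) \<le> norm (P x - P y)" if xy: "x \<in> I" "y \<in> I" "x \<noteq> y" for x y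
  proof -
    obtain k c i l where x: "x = (k, c, i, l)" by (cases x) auto
    obtain k' c' i' l' where y: "y = (k', c', i', l')" by (cases y) auto
    have il: "i < 2 * 2 ^ k" "i' < 2 * 2 ^ k'" using xy by (auto simp: I_def x y)
    let ?a = "1 + u (t k c) + real i * \<nu> k" and ?a' = "1 + u (t k' c') + real i' * \<nu> k'"
    have P: "\<bar>?a - ?a'\<bar> \<le> norm (P x - P y)" "\<bar>real l * \<nu> k - real l' * \<nu> k'\<bar> \<le> norm (P x - P y)"
      unfolding x y P_def prod.case by (rule two_block_diff_norm[OF m e])+
    have 0: "0 \<le> real i * \<nu> k" "0 \<le> real i' * \<nu> k'" using \<nu>[of k] \<nu>[of k'] by auto
    show ?thesis
    proof (cases "t k c = t k' c'")
      case True
      then have kc: "k = k'" "c = c'" unfolding t_def by (auto split: if_splits; presburger)+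
      have gap: "\<nu> k \<le> \<bar>real n * \<nu> k - real n' * \<nu> k\<bar>" if "n \<noteq> n'" for n n' :: nat
      proof -
        have "1 \<le> \<bar>real n - real n'\<bar>" using that by linarith
        then have "1 * \<nu> k \<le> \<bar>real n - real n'\<bar> * \<nu> k" using \<nu>[of k] by (intro mult_right_mono) auto
        also have "\<dots> = \<bar>real n * \<nu> k - real n' * \<nu> k\<bar>"
          using \<nu>[of k] by (simp add: abs_mult flip: left_diff_distrib)
        finally show ?thesis by simp
      qed
      have "i \<noteq> i' \<or> l \<noteq> l'" using xy(3) kc by (auto simp: x y)
      then show ?thesis
      proof
        assume "i \<noteq> i'"
        from gap[OF this] show ?thesis using P(1) kc by (simp add: x)
      next
        assume "l \<noteq> l'"
        from gap[OF this] show ?thesis using P(2) kc by (simp add: x)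
      qed
    next
      case False
      then consider "t k c < t k' c'" | "t k' c' < t k c" by linarith
      then have "\<nu> k \<le> \<bar>?a - ?a'\<bar>"
      proof cases
        case 1
        then show ?thesis using u_mono[OF 1] i\<nu>[OF il(2), of c'] \<nu>_u[of k c] 0 by linarith
      next
        case 2
        then show ?thesis using u_mono[OF 2] i\<nu>[OF il(1), of c] \<nu>_u[of k c] 0 u(1)[of "t k c"] by linarith
      qed
      then show ?thesis using P(1) by (simp add: x)
    qed
  qed
  \<comment> \<open>The construction takes a sequence over all natural numbers, so \<open>I\<close>
    is enumerated bijectively; injectivity is what the separation hypothesis needs.\<close>
  have "infinite I"
  proof
    assume "finite I"
    moreover have "(\<lambda>k. (k, True, 0, 0)) ` UNIV \<subseteq> I" by (auto simp: I_def)
    ultimately have "finite ((\<lambda>k::nat. (k, True, 0::nat, 0::nat)) ` UNIV)" by (rule finite_subset[rotated])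
    then have "finite (UNIV :: nat set)" by (rule finite_imageD) (auto simp: inj_on_def)
    then show False by simp
  qed
  then obtain \<phi> :: "nat \<Rightarrow> nat \<times> bool \<times> nat \<times> nat" where \<phi>: "bij_betw \<phi> UNIV I"
    using bij_betw_from_nat_into[of I] by auto
  have \<phi>I: "\<phi> n \<in> I" for n using \<phi> by (auto simp: bij_betw_def)
  have \<phi>inj: "\<phi> i \<noteq> \<phi> j" if "i \<noteq> j" for i j using \<phi> that by (auto simp: bij_betw_def inj_def)
  obtain \<sigma> :: "(real^'n)^'m \<Rightarrow> complex" where \<sigma>: "\<sigma> \<in> borel_measurable borel" "\<And>x. norm (\<sigma> x) \<le> 1"
    "\<And>i. \<sigma> (P (\<phi> i)) = V (\<phi> i)" "\<And>i. isCont \<sigma> (P (\<phi> i))"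
    "(SUP k::int. sobolev_lorentz_norm s r q (\<lambda>\<xi>. \<sigma> (2 powr real_of_int k *\<^sub>R \<xi>) * fourier \<Psi> \<xi>)) < top"
  proof (rule multiplier_construction[of \<Psi> s r q "\<lambda>i. V (\<phi> i)" "\<lambda>i. P (\<phi> i)" "\<lambda>i. \<nu> (fst (\<phi> i))"])
    show "schwartz \<Psi>" by (rule Psi_schwartz)
    show "\<And>\<xi>. fourier \<Psi> \<xi> \<noteq> 0 \<Longrightarrow> 1 / 2 \<le> norm \<xi> \<and> norm \<xi> \<le> 2" using Psi_supp by blast
    show "0 < s" "0 < r" "0 < q" by fact+
    show "s < real DIM((real^'n)^'m)" using s(2) unfolding dim .
    show "r < real DIM((real^'n)^'m) / s \<or> r = real DIM((real^'n)^'m) / s \<and> 1 < q" using rq unfolding dim .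
  qed (use V1 P1 \<phi>I \<nu> sep \<phi>inj in auto)
  have all: "\<sigma> (P x) = V x" "isCont \<sigma> (P x)" if "x \<in> I" for x
    using \<sigma>(3,4) \<phi> that unfolding bij_betw_def by (metis imageE)+
  have "\<not> mult_bounded \<sigma> ps (ennreal p)"
  proof (rule not_mult_bounded_of_rudin_shapiro_values[where r=\<rho> and r'=\<rho>' and b="\<lambda>k c. 1 + u (t k c)" and \<nu>=\<nu>, OF m e p_pos _ hoelder \<sigma>(1,2) \<rho>(1) \<rho>(3) \<rho>(4)])
    fix k i l :: nat and c assume il: "i < 2 * 2 ^ k" "l < (2::nat) ^ k"
    then have x: "(k, c, i, l) \<in> I" by (simp add: I_def)
    show "isCont \<sigma> (two_block m1 m2 e (1 + u (t k c) + real i * \<nu> k) (real l * \<nu> k))"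
      using all(2)[OF x] by (simp add: P_def)
    show "\<sigma> (two_block m1 m2 e (1 + u (t k c) + real i * \<nu> k) (real l * \<nu> k)) =
       complex_of_real (if 2 ^ k \<le> i + l \<and> i + l < 2 * 2 ^ k then \<rho> (Suc k) i * \<rho> k l * (if c then \<rho> k else \<rho>' k) (i + l - 2 ^ k) else 0)"
      using all(1)[OF x] unfolding P_def V_def \<tau>_def by simp
  qed (use ps_pos in auto)
  moreover have "bounded (range \<sigma>)" using \<sigma>(2) by (auto simp: bounded_iff)
  ultimately show ?thesis using \<sigma>(1,5) by auto
qed

theorem theorem1p2:
  fixes \<Psi> :: "(real^'n)^'m::finite \<Rightarrow> complex"
    and p :: real and ps :: "'m \<Rightarrow> ennreal" and s :: real
  assumes m2: "CARD('m) \<ge> 2"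
    and p_pos: "p > 0"
    and ps_pos: "\<forall>j. ps j > 0"
    and hoelder: "ennreal (1 / p) = (\<Sum>j\<in>UNIV. inverse (ps j))"
    and s_pos: "0 < s" and s_lt: "s < real (CARD('m) * CARD('n))"
    and Psi_schwartz: "schwartz \<Psi>"
    and Psi_supp: "\<forall>\<xi>. fourier \<Psi> \<xi> \<noteq> 0 \<longrightarrow> 1/2 \<le> norm \<xi> \<and> norm \<xi> \<le> 2"
    and Psi_part: "\<forall>\<xi>. \<xi> \<noteq> 0 \<longrightarrow>
         ((\<lambda>k::int. fourier \<Psi> (inverse (2 powr real_of_int k) *\<^sub>R \<xi>)) has_sum 1) UNIV"
  shows
   "(\<forall>r q. 0 < r \<and> r < real (CARD('m) * CARD('n)) / s \<and> 0 < q \<longrightarrow>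
       (\<exists>\<sigma> :: (real^'n)^'m \<Rightarrow> complex.
          \<sigma> \<in> borel_measurable lborel \<and> bounded (range \<sigma>) \<and>
          (SUP k::int. sobolev_lorentz_norm s r q
               (\<lambda>\<xi>. \<sigma> (2 powr real_of_int k *\<^sub>R \<xi>) * fourier \<Psi> \<xi>)) < top \<and>
          \<not> mult_bounded \<sigma> ps (ennreal p)))
    \<and>
    (\<forall>q. 1 < q \<longrightarrow>
       (\<exists>\<sigma> :: (real^'n)^'m \<Rightarrow> complex.
          \<sigma> \<in> borel_measurable lborel \<and> bounded (range \<sigma>) \<and>
          (SUP k::int. sobolev_lorentz_norm s (real (CARD('m) * CARD('n)) / s) q
               (\<lambda>\<xi>. \<sigma> (2 powr real_of_int k *\<^sub>R \<xi>) * fourier \<Psi> \<xi>)) < top \<and>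
          \<not> mult_bounded \<sigma> ps (ennreal p)))"
proof -
  note counterexample = counterexample_multiplier[OF m2 p_pos ps_pos hoelder s_pos s_lt Psi_schwartz Psi_supp]
  have "0 < real (CARD('m) * CARD('n)) / s"
    using s_pos by simp
  moreover have "0 < q" if "1 < q" for q :: ennreal
    using that by (rule less_trans[rotated]) simp
  ultimately show ?thesis
    using counterexample by blast
qed

end
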